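(* Let $\mathcal{H}$ be a separable infinite-dimensional real Hilbert space, let $K,K'\subset\mathcal{H}$ be GB convex bodies and let $X$ be an isonormal Gaussian process on $\mathcal{H}$. Then $$V_2(K)=\pi\,\mathbb{E}\left[|h_K(X)|^2-\|Dh_K(X)\|_{\mathcal{H}}^2\right]$$ and $$V_2(K,K')=\pi\,\mathbb{E}\left[h_K(X)h_{K'}(X)-\big(Dh_K(X),Dh_{K'}(X)\big)_{\mathcal{H}}\right],$$ where $h_K,h_{K'}$ are the support functions of $K$ and $K'$ and $D$ is the Malliavin derivative.
   Context: An isonormal Gaussian process on $\mathcal{H}$ is a family $X=(X_v)_{v\in\mathcal{H}}$ of centred jointly Gaussian random variables on a probability space $(\Omega,\mathcal{F},\mathbb{P})$ with $\mathbb{E}[X_vX_u]=(v,u)_{\mathcal{H}}$ and $X_{av+bu}=aX_v+bX_u$. A convex body in $\mathcal{H}$ is a non-empty compact convex subset; it is Gaussian bounded (GB) if for every countable $C\subset K$, $\sup_{v\in C}X_v<\infty$ almost surely. The support function of a GB convex body as a random variable is $h_K(X)=\sup_{v\in K}X_v$, meaning the supremum over any countable dense subset of $K$ (a.s. independent of the choice). Intrinsic volumes: for a convex body $K$ contained in a $d$-dimensional subspace identified with $\mathbb{R}^d$, $V_k(K)$ is defined by $\mathrm{vol}_d(K+rB^d)=\sum_{k=0}^d r^{d-k}\kappa_{d-k}V_k(K)$ for $r>0$, where $B^d$ is the unit ball and $\kappa_j$ the volume of the unit $j$-ball (independent of the ambient $d$). For infinite-dimensional $K$, $V_k(K)=\sup\{V_k(C):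 C\subset K\text{ a finite-dimensional convex body}\}$. With Minkowski sums, $V_2(K,K')=\frac12\big(V_2(K+K')-V_2(K)-V_2(K')\big)$. Malliavin derivative: for a smooth random variable $\varphi=f(X_{v_1},\dots,X_{v_n})$, with $f$ smooth and all its partial derivatives of at most polynomial growth, $D\varphi=\sum_j\partial_jf(X_{v_1},\dots,X_{v_n})v_j$. This operator is closable from $L^2(\Omega)$ to $L^2(\Omega;\mathcal{H})$; $D$ also denotes its closure, with domain the Sobolev space $\mathbb{D}^{1,2}$ normed by $\|\varphi\|_{1,2}^2=\mathbb{E}[|\varphi|^2]+\mathbb{E}[\|D\varphi\|_{\mathcal{H}}^2]$. For every GB convex body $K$, $h_K(X)\in\mathbb{D}^{1,2}$. *)

theory Defs
  imports "HOL-Analysis.Analysis" "HOL-Probability.Probability" "HOL-Library.Set_Algebras"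
begin

definition finite_dimensional :: "'a::real_vector set \<Rightarrow> bool" where
  "finite_dimensional S \<longleftrightarrow> (\<exists>B. finite B \<and> S \<subseteq> span B)"


subsection \<open>Isonormal Gaussian processes\<close>

text \<open>The point mass at 0 (variance 0) counts as Gaussian; \<open>s\<close> is the standard deviation.\<close>

definition centred_gaussian_law :: "real \<Rightarrow> real measure" where
  "centred_gaussian_law s =
     (if s = 0 then return borel 0 else density lborel (\<lambda>x. ennreal (normal_density 0 s x)))"

definition centred_jointly_gaussian :: "'w measure \<Rightarrow> ('i \<Rightarrow> 'w \<Rightarrow> real) \<Rightarrow> bool" where
  "centred_jointly_gaussian M X \<longleftrightarrow>
     (\<forall>v. X v \<in> borel_measurable M) \<and>
     (\<forall>S c. finite S \<longrightarrow>
        (\<exists>s\<ge>0. distr M borel (\<lambda>\<omega>. \<Sum>v\<in>S. c v * X v \<omega>) = centred_gaussian_law s))"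

definition isonormal_process :: "'w measure \<Rightarrow> ('a::real_inner \<Rightarrow> 'w \<Rightarrow> real) \<Rightarrow> bool" where
  "isonormal_process M X \<longleftrightarrow>
     prob_space M \<and>
     centred_jointly_gaussian M X \<and>
     (\<forall>u v. (LINT \<omega>|M. X v \<omega> * X u \<omega>) = v \<bullet> u) \<and>
     (\<forall>a b u v. AE \<omega> in M. X (a *\<^sub>R v + b *\<^sub>R u) \<omega> = a * X v \<omega> + b * X u \<omega>)"


subsection \<open>Convex bodies and support functions\<close>

definition convex_body :: "'a::real_normed_vector set \<Rightarrow> bool" where
  "convex_body K \<longleftrightarrow> K \<noteq> {} \<and> compact K \<and> convex K"

definition GB_convex_body ::
    "'w measure \<Rightarrow> ('a::real_inner \<Rightarrow> 'w \<Rightarrow> real) \<Rightarrow> 'a set \<Rightarrow> bool" where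
  "GB_convex_body M X K \<longleftrightarrow>
     convex_body K \<and>
     (\<forall>C\<subseteq>K. countable C \<longrightarrow> (AE \<omega> in M. bdd_above ((\<lambda>v. X v \<omega>) ` C)))"

text \<open>
  \<open>is_support_rv M X K h\<close>: the random variable \<open>h\<close> is a version of the supremum of \<open>X\<close> over
  some countable dense subset of \<open>K\<close>. For GB convex bodies all such \<open>h\<close> agree almost surely.
\<close>

definition is_support_rv ::
    "'w measure \<Rightarrow> ('a::real_inner \<Rightarrow> 'w \<Rightarrow> real) \<Rightarrow> 'a set \<Rightarrow> ('w \<Rightarrow> real) \<Rightarrow> bool" where
  "is_support_rv M X K h \<longleftrightarrow>
     h \<in> borel_measurable M \<and>
     (\<exists>C. countable C \<and> C \<subseteq> K \<and> K \<subseteq> closure C \<and> (AE \<omega> in M. h \<omega> = (SUP v\<in>C. X v \<omega>)))"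


subsection \<open>Intrinsic volumes\<close>

definition orthonormal_system :: "nat \<Rightarrow> (nat \<Rightarrow> 'a::real_inner) \<Rightarrow> bool" where
  "orthonormal_system d e \<longleftrightarrow> (\<forall>i<d. \<forall>j<d. e i \<bullet> e j = (if i = j then 1 else 0))"

text \<open>
  The \<open>d\<close>-dimensional Lebesgue measure on the span of an orthonormal system \<open>e 0, \<dots>, e (d - 1)\<close>,
  with coordinate vectors taken as extensional functions on \<open>{..<d}\<close>.
\<close>

definition subspace_vol :: "nat \<Rightarrow> (nat \<Rightarrow> 'a::real_inner) \<Rightarrow> 'a set \<Rightarrow> real" where
  "subspace_vol d e A =
     measure (Pi\<^sub>M {..<d} (\<lambda>_. lborel)) {x \<in> extensional {..<d}. (\<Sum>i<d. x i *\<^sub>R e i) \<in> A}"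

text \<open>
  \<open>W\<close> is the sequence of coefficients of the Steiner polynomial of \<open>K\<close> in the span of \<open>e\<close>,
  extended by 0 beyond the ambient dimension \<open>d\<close>.
\<close>

definition steiner_coeffs ::
    "nat \<Rightarrow> (nat \<Rightarrow> 'a::real_inner) \<Rightarrow> 'a set \<Rightarrow> (nat \<Rightarrow> real) \<Rightarrow> bool" where
  "steiner_coeffs d e K W \<longleftrightarrow>
     (\<forall>r>0. subspace_vol d e (K + (\<lambda>x. r *\<^sub>R x) ` (cball 0 1 \<inter> span (e ` {..<d}))) =
        (\<Sum>k\<le>d. r ^ (d - k) * unit_ball_vol (real (d - k)) * W k)) \<and>
     (\<forall>k>d. W k = 0)"

definition fin_dim_intrinsic_volume :: "nat \<Rightarrow> 'a::real_inner set \<Rightarrow> real" where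
  "fin_dim_intrinsic_volume k K =
     (THE x. \<exists>d e W. orthonormal_system d e \<and> K \<subseteq> span (e ` {..<d}) \<and>
        steiner_coeffs d e K W \<and> x = W k)"

text \<open>Extended real values, since the supremum may be infinite for a general convex body.\<close>

definition intrinsic_volume :: "nat \<Rightarrow> 'a::real_inner set \<Rightarrow> ereal" where
  "intrinsic_volume k K =
     (if finite_dimensional K then ereal (fin_dim_intrinsic_volume k K)
      else (SUP C\<in>{C. convex_body C \<and> finite_dimensional C \<and> C \<subseteq> K}.
              ereal (fin_dim_intrinsic_volume k C)))"

definition mixed_V2 :: "'a::real_inner set \<Rightarrow> 'a set \<Rightarrow> ereal" where
  "mixed_V2 K K' =
     (intrinsic_volume 2 (K + K') - intrinsic_volume 2 K - intrinsic_volume 2 K') / 2"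


subsection \<open>The Malliavin derivative\<close>

text \<open>
  Functions on \<open>\<real>\<^sup>n\<close>, with \<open>n\<close> varying, are represented as functions of \<open>x :: nat \<Rightarrow> real\<close>
  depending only on \<open>x 0, \<dots>, x (n - 1)\<close>; for these, continuity in the product topology is
  continuity on \<open>\<real>\<^sup>n\<close>.
\<close>

definition partial_deriv :: "nat \<Rightarrow> ((nat \<Rightarrow> real) \<Rightarrow> real) \<Rightarrow> (nat \<Rightarrow> real) \<Rightarrow> real" where
  "partial_deriv i f x = deriv (\<lambda>t. f (x(i := t))) (x i)"

definition iterated_partial_deriv ::
    "nat list \<Rightarrow> ((nat \<Rightarrow> real) \<Rightarrow> real) \<Rightarrow> (nat \<Rightarrow> real) \<Rightarrow> real" where
  "iterated_partial_deriv js f = foldr partial_deriv js f"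

text \<open>Smooth means that all iterated partial derivatives exist and are continuous.\<close>

definition smooth_poly_growth :: "nat \<Rightarrow> ((nat \<Rightarrow> real) \<Rightarrow> real) \<Rightarrow> bool" where
  "smooth_poly_growth n f \<longleftrightarrow>
     (\<forall>x y. (\<forall>i<n. x i = y i) \<longrightarrow> f x = f y) \<and>
     (\<forall>js. set js \<subseteq> {..<n} \<longrightarrow>
        (let g = iterated_partial_deriv js f in
          continuous_on UNIV g \<and>
          (\<forall>i<n. \<forall>x. (\<lambda>t. g (x(i := t))) differentiable (at (x i))) \<and>
          (\<exists>c p. \<forall>x. \<bar>g x\<bar> \<le> c * (1 + (\<Sum>i<n. \<bar>x i\<bar>)) ^ p)))"

text \<open>\<open>\<phi>\<close> is a smooth random variable, and \<open>Z\<close> is its derivative.\<close>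

definition smooth_rv_deriv ::
    "('a::real_inner \<Rightarrow> 'w \<Rightarrow> real) \<Rightarrow> ('w \<Rightarrow> real) \<Rightarrow> ('w \<Rightarrow> 'a) \<Rightarrow> bool" where
  "smooth_rv_deriv X \<phi> Z \<longleftrightarrow>
     (\<exists>n f v. smooth_poly_growth n f \<and>
        \<phi> = (\<lambda>\<omega>. f (\<lambda>i. X (v i) \<omega>)) \<and>
        Z = (\<lambda>\<omega>. \<Sum>j<n. partial_deriv j f (\<lambda>i. X (v i) \<omega>) *\<^sub>R v j))"

definition square_integrable :: "'w measure \<Rightarrow> ('w \<Rightarrow> 'b::real_normed_vector) \<Rightarrow> bool" where
  "square_integrable M \<phi> \<longleftrightarrow> \<phi> \<in> borel_measurable M \<and> integrable M (\<lambda>\<omega>. (norm (\<phi> \<omega>))\<^sup>2)"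

text \<open>The graph of the closure of the operator \<open>D\<close>, from \<open>L\<^sup>2(\<Omega>)\<close> to \<open>L\<^sup>2(\<Omega>; \<H>)\<close>.\<close>

definition malliavin_graph ::
    "'w measure \<Rightarrow> ('a::real_inner \<Rightarrow> 'w \<Rightarrow> real) \<Rightarrow> ('w \<Rightarrow> real) \<Rightarrow> ('w \<Rightarrow> 'a) \<Rightarrow> bool" where
  "malliavin_graph M X \<phi> Z \<longleftrightarrow>
     square_integrable M \<phi> \<and> square_integrable M Z \<and>
     (\<exists>\<phi>s Zs. (\<forall>k. smooth_rv_deriv X (\<phi>s k) (Zs k)) \<and>
        (\<lambda>k. \<integral>\<^sup>+\<omega>. ennreal ((\<phi>s k \<omega> - \<phi> \<omega>)\<^sup>2) \<partial>M) \<longlonglongrightarrow> 0 \<and>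
        (\<lambda>k. \<integral>\<^sup>+\<omega>. ennreal ((norm (Zs k \<omega> - Z \<omega>))\<^sup>2) \<partial>M) \<longlonglongrightarrow> 0)"

text \<open>
  By closability the derivative is determined up to almost sure equality on the domain
  of the closure; this picks a version. It is meaningful only on that domain, in which \<open>h\<^sub>K(X)\<close> lies
  for every GB convex body \<open>K\<close>.
\<close>

definition malliavin_deriv ::
    "'w measure \<Rightarrow> ('a::real_inner \<Rightarrow> 'w \<Rightarrow> real) \<Rightarrow> ('w \<Rightarrow> real) \<Rightarrow> 'w \<Rightarrow> 'a" where
  "malliavin_deriv M X \<phi> = (SOME Z. malliavin_graph M X \<phi> Z)"

end

theory Submission
  imports Defs
begin

text \<open>
  Write \<open>\<langle>(\<phi>, Z), (\<psi>, W)\<rangle> = E[\<phi> \<psi>] - E[Z \<bullet> W]\<close>. If \<open>(\<psi>, W)\<close> is the soft maximum of finitely many \<open>X v\<close> together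
  with its derivative, Gaussian integration by parts rewrites this form as \<open>E[\<phi> \<delta>]\<close> with \<open>\<delta> \<ge> 0\<close>; so the form is
  monotone in \<open>\<phi>\<close>. With Fernique's moment bound, monotonicity makes the soft maxima over a dense sequence
  of \<open>K\<close> converge to \<open>h\<^sub>K\<close> together with their derivatives, and it reduces the theorem to bodies of finite dimension.

  For a body \<open>K\<close> in the span of an orthonormal system, let \<open>\<xi>\<close> be the standard Gaussian vector there. Integrating
  the Steiner polynomial against Gaussian weights gives
  \<open>E exp (\<bar>\<xi>\<bar>\<^sup>2 / 2 - t\<^sup>2 dist(\<xi> / t, K)\<^sup>2 / 2) = \<Sum>k. t ^ k * V\<^sub>k(K) / sqrt (2 \<pi>) ^ k\<close>.
  The exponent is \<open>t h\<^sub>t(\<xi>)\<close>, where \<open>h\<^sub>t\<close> is a smoothing of the support function whose gradient at \<open>\<xi>\<close> is the point of \<open>K\<close>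
  nearest to \<open>\<xi> / t\<close>. Since \<open>E[h\<^sub>K - h\<^sub>t] = t E[\<bar>D h\<^sub>K\<bar>\<^sup>2] / 2 + O(t\<^sup>2)\<close>, comparing coefficients of \<open>t\<^sup>2\<close> yields the formula
  for \<open>V\<^sub>2(K)\<close>. The mixed formula follows by polarisation from \<open>h\<^sub>K\<^sub>+\<^sub>K\<^sub>' = h\<^sub>K + h\<^sub>K\<^sub>'\<close>.
\<close>

text \<open>The probability space is arbitrary, and \<open>X\<close> is linear only almost surely,
  with null sets that depend on the vectors. Paths are therefore never treated as linear
  functionals: facts about \<open>X\<close> are transferred through equality of laws on the product
  space of all real functions on the Hilbert space, and these laws depend only on the inner products
  of the index vectors. The \<sigma>-algebra of \<open>M\<close> may be larger than the one
  generated by \<open>X\<close>, so integration by parts alone does not determine a derivative;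
  \<open>path_generated\<close> supplies the rest and makes the choice in
  \<open>malliavin_deriv\<close> harmless. The form is indefinite, so convergence of derivatives
  cannot be read off from a norm; the sign of \<delta>, entropy plus variance of Gibbs weights,
  takes its place. \<open>fin_dim_intrinsic_volume\<close> is a definite description, so Steiner
  coefficients have to be shown to exist: the parallel body of a polytope is cut according to the
  nearest face, each piece scales like a power of the radius, and general bodies follow by
  approximation. Uniqueness across all ambient spaces is free, since every admissible
  \<open>W 2\<close> equals the same expectation.\<close>

lemma (in finite_measure) integrable_bounded:
  fixes f :: "'a \<Rightarrow> real"
  assumes "f \<in> borel_measurable M" and "\<And>x. \<bar>f x\<bar> \<le> B"
  shows "integrable M f"
  by (rule integrable_const_bound[of _ B]) (use assms in auto)

section \<open>Laws determined by cosine integrals; Gaussian fields\<close>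

lemma distr_eqI_cos:
  fixes X :: "'m \<Rightarrow> real" and Y :: "'n \<Rightarrow> real"
  assumes fin: "finite_measure M" "finite_measure N"
    and X[measurable]: "X \<in> borel_measurable M" and Y[measurable]: "Y \<in> borel_measurable N"
    and eq: "\<And>t c. (LINT w|M. cos (t * X w + c)) = (LINT w|N. cos (t * Y w + c))"
  shows "distr M borel X = distr N borel Y"
proof -
  interpret M: finite_measure M by fact
  interpret N: finite_measure N by fact
  define m where "m = measure M (space M)"
  have mN: "measure N (space N) = m"
    using eq[of 0 0] by (simp add: m_def)
  have eM: "emeasure M (space M) = ennreal m" and eN: "emeasure N (space N) = ennreal m"
    using mN by (simp_all add: m_def M.emeasure_eq_measure N.emeasure_eq_measure)
  \<comment> \<open>Levy uniqueness speaks of probability measures, so both sides are divided by the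
    common mass \<open>m\<close>; null measures are treated separately.\<close>
  show ?thesis
  proof (cases "m = 0")
    case True
    show ?thesis
    proof (rule measure_eqI)
      fix A assume "A \<in> sets (distr M borel X)"
      then have A[measurable]: "A \<in> sets borel" by simp
      have "emeasure M (X -` A \<inter> space M) \<le> 0"
        using emeasure_space[of M "X -` A \<inter> space M"] eM True by simp
      moreover have "emeasure N (Y -` A \<inter> space N) \<le> 0"
        using emeasure_space[of N "Y -` A \<inter> space N"] eN True by simp
      ultimately show "emeasure (distr M borel X) A = emeasure (distr N borel Y) A"
        by (simp add: emeasure_distr)
    qed simp
  next
    case False
    then have m: "m > 0" using measure_nonneg[of M "space M"] unfolding m_def by linarith
    define DX where "DX = distr (density M (\<lambda>_. ennreal (1 / m))) borel X"
    define DY where "DY = distr (density N (\<lambda>_. ennreal (1 / m))) borel Y"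
    have one: "ennreal (1 / m) * ennreal m = 1"
      using m by (simp flip: ennreal_mult)
    have "prob_space DX"
      by (rule prob_spaceI)
        (simp add: DX_def emeasure_distr emeasure_density_const eM one)
    then have DX: "real_distribution DX"
      by (simp add: real_distribution_def real_distribution_axioms_def DX_def)
    have "prob_space DY"
      by (rule prob_spaceI)
        (simp add: DY_def emeasure_distr emeasure_density_const eN one)
    then have DY: "real_distribution DY"
      by (simp add: real_distribution_def real_distribution_axioms_def DY_def)
    \<comment> \<open>The phase \<open>c\<close> carries both parts of the characteristic function:
      0 gives the real part and \<open>- pi / 2\<close> turns the cosine into a sine.\<close>
    have chX: "(CLINT w|M. iexp (t * X w)) = (CLINT w|N. iexp (t * Y w))" for t
    proof (rule complex_eqI)
      have iM: "complex_integrable M (\<lambda>w. iexp (t * X w))"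
        by (rule M.integrable_const_bound[of _ 1]) auto
      have iN: "complex_integrable N (\<lambda>w. iexp (t * Y w))"
        by (rule N.integrable_const_bound[of _ 1]) auto
      have re: "Re (iexp (t * x)) = cos (t * x + 0)" "Im (iexp (t * x)) = cos (t * x + (- pi / 2))" for x
        by (simp_all add: Re_exp Im_exp cos_diff flip: minus_divide_left diff_conv_add_uminus)
      show "Re (CLINT w|M. iexp (t * X w)) = Re (CLINT w|N. iexp (t * Y w))"
        unfolding integral_Re[OF iM, symmetric] integral_Re[OF iN, symmetric] re by (rule eq)
      show "Im (CLINT w|M. iexp (t * X w)) = Im (CLINT w|N. iexp (t * Y w))"
        unfolding integral_Im[OF iM, symmetric] integral_Im[OF iN, symmetric] re by (rule eq)
    qed
    have "char DX = char DY"
    proof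
      fix t
      have "char DX t = (1 / m) *\<^sub>R (CLINT w|M. iexp (t * X w))"
        unfolding char_def DX_def using m
        by (subst integral_distr) (simp_all add: integral_density)
      also have "\<dots> = (1 / m) *\<^sub>R (CLINT w|N. iexp (t * Y w))" by (simp only: chX)
      also have "\<dots> = char DY t"
        unfolding char_def DY_def using m
        by (subst integral_distr) (simp_all add: integral_density)
      finally show "char DX t = char DY t" .
    qed
    then have eq2: "DX = DY" by (rule Levy_uniqueness[OF DX DY])
    show ?thesis
    proof (rule measure_eqI)
      fix A assume A: "A \<in> sets (distr M borel X)"
      have "ennreal (1 / m) * emeasure (distr M borel X) A = ennreal (1 / m) * emeasure (distr N borel Y) A"
        using arg_cong[OF eq2, of "\<lambda>D. emeasure D A"] A
        by (simp add: DX_def DY_def emeasure_distr emeasure_density_const)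
      then show "emeasure (distr M borel X) A = emeasure (distr N borel Y) A"
        using m by (simp add: ennreal_mult_cancel_left)
    qed simp
  qed
qed

text \<open>Sine and cosine are treated together: the class \<open>S\<close> is closed under phase shifts.\<close>

lemma weighted_box_integral_eq:
  fixes X :: "'i \<Rightarrow> 'm \<Rightarrow> real" and Y :: "'i \<Rightarrow> 'n \<Rightarrow> real"
  assumes fin: "finite_measure M" "finite_measure N"
    and X[measurable]: "\<And>i. X i \<in> borel_measurable M" and Y[measurable]: "\<And>i. Y i \<in> borel_measurable N"
    and S0: "((\<lambda>_. 0), (\<lambda>_. 0)) \<in> S"
    and S1: "\<And>F G t i c. (F, G) \<in> S \<Longrightarrow> i \<in> I \<Longrightarrow>
       ((\<lambda>w. F w + (t * X i w + c)), (\<lambda>w. G w + (t * Y i w + c))) \<in> S"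
    and Sm: "\<And>F G. (F, G) \<in> S \<Longrightarrow> F \<in> borel_measurable M" "\<And>F G. (F, G) \<in> S \<Longrightarrow> G \<in> borel_measurable N"
    and eq: "\<And>F G. (F, G) \<in> S \<Longrightarrow> (LINT w|M. cos (F w)) = (LINT w|N. cos (G w))"
  shows "finite J \<Longrightarrow> J \<subseteq> I \<Longrightarrow> (\<And>i. i \<in> J \<Longrightarrow> A i \<in> sets borel) \<Longrightarrow> (F, G) \<in> S \<Longrightarrow>
    (LINT w|M. (\<Prod>i\<in>J. indicator (A i) (X i w)) * cos (F w)) =
    (LINT w|N. (\<Prod>i\<in>J. indicator (A i) (Y i w)) * cos (G w))"
proof (induction J arbitrary: F G rule: finite_induct)
  case empty
  then show ?case by (simp add: eq)
next
  case (insert j J)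
  interpret M: finite_measure M by fact
  interpret N: finite_measure N by fact
  note [measurable] = insert.prems(2) Sm
  define p where "p w = (\<Prod>i\<in>J. indicator (A i) (X i w) :: real)" for w
  define q where "q w = (\<Prod>i\<in>J. indicator (A i) (Y i w) :: real)" for w
  have A[measurable]: "i \<in> J \<Longrightarrow> A i \<in> sets borel" for i using insert.prems(2) by simp
  have Aj[measurable]: "A j \<in> sets borel" using insert.prems(2) by simp
  have [measurable]: "p \<in> borel_measurable M" unfolding p_def by measurable
  have [measurable]: "q \<in> borel_measurable N" unfolding q_def by measurable
  have p01: "0 \<le> p w" "p w \<le> 1" for w
    unfolding p_def by (auto intro!: prod_nonneg prod_le_1 simp: indicator_def)
  have q01: "0 \<le> q w" "q w \<le> 1" for w
    unfolding q_def by (auto intro!: prod_nonneg prod_le_1 simp: indicator_def)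
  have IH: "(LINT w|M. p w * cos (F w)) = (LINT w|N. q w * cos (G w))" if "(F, G) \<in> S" for F G
    unfolding p_def q_def using insert.IH[of F G] insert.prems that by auto
  have j: "j \<in> I" using insert.prems by auto
  have ip: "integrable M (\<lambda>w. p w * cos (F w))" if "F \<in> borel_measurable M" for F
    by (rule M.integrable_bounded[of _ 1])
      (use that p01 in \<open>auto simp: abs_mult intro!: mult_le_one\<close>)
  have iq: "integrable N (\<lambda>w. q w * cos (F w))" if "F \<in> borel_measurable N" for F
    by (rule N.integrable_bounded[of _ 1])
      (use that q01 in \<open>auto simp: abs_mult intro!: mult_le_one\<close>)
  \<comment> \<open>\<open>cos (F w)\<close> changes sign and is no density, but
    \<open>p w * (1 + cos (F w))\<close> is nonnegative, so the uniqueness of one-dimensional laws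
    applies to \<open>X j\<close> under this weighted measure.\<close>
  have key: "(LINT w|M. p w * (1 + cos (F w)) * indicator (A j) (X j w)) =
      (LINT w|N. q w * (1 + cos (G w)) * indicator (A j) (Y j w))" if FG: "(F, G) \<in> S" for F G
  proof -
    have [measurable]: "F \<in> borel_measurable M" "G \<in> borel_measurable N"
      using Sm FG by blast+
    define a where "a w = p w * (1 + cos (F w))" for w
    define b where "b w = q w * (1 + cos (G w))" for w
    have [measurable]: "a \<in> borel_measurable M" unfolding a_def by measurable
    have [measurable]: "b \<in> borel_measurable N" unfolding b_def by measurable
    have c1: "0 \<le> 1 + cos y" "1 + cos y \<le> 2" for y :: real
      using cos_ge_minus_one[of y] cos_le_one[of y] by linarith+
    have a0: "0 \<le> a w" "\<bar>a w\<bar> \<le> 1 * 2" for w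
      using p01[of w] c1[of "F w"] mult_mono[of "p w" 1 "1 + cos (F w)" 2] by (simp_all add: a_def)
    have b0: "0 \<le> b w" "\<bar>b w\<bar> \<le> 1 * 2" for w
      using q01[of w] c1[of "G w"] mult_mono[of "q w" 1 "1 + cos (G w)" 2] by (simp_all add: b_def)
    have ia: "integrable M a" by (rule M.integrable_bounded[of _ 2]) (use a0 in auto)
    have ib: "integrable N b" by (rule N.integrable_bounded[of _ 2]) (use b0 in auto)
    have "distr (density M a) borel (X j) = distr (density N b) borel (Y j)"
    proof (rule distr_eqI_cos)
      show "finite_measure (density M a)"
        by (rule finite_measureI)
          (use ia a0 in \<open>auto simp: emeasure_density nn_integral_eq_integral
             nn_integral_set_ennreal[symmetric] cong: nn_integral_cong_simp\<close>)
      show "finite_measure (density N b)"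
        by (rule finite_measureI)
          (use ib b0 in \<open>auto simp: emeasure_density nn_integral_eq_integral
             nn_integral_set_ennreal[symmetric] cong: nn_integral_cong_simp\<close>)
      fix t c
      \<comment> \<open>A product of two cosines is a mean of cosines of the sum and the difference
        of the phases; both phases belong to \<open>S\<close> again, so the induction hypothesis
        covers each term.\<close>
      have prod: "p * (1 + cos f) * cos e = p * cos e + (p * cos (f + e) / 2 + p * cos (f - e) / 2)"
        for p f e :: real by (simp add: cos_add cos_diff field_simps)
      have "(LINT w|density M a. cos (t * X j w + c)) = (LINT w|M. a w * cos (t * X j w + c))"
        by (subst integral_density) (use a0 in auto)
      also have "\<dots> = (LINT w|M. p w * cos (t * X j w + c)) +
         ((LINT w|M. p w * cos (F w + (t * X j w + c))) / 2 + (LINT w|M. p w * cos (F w - (t * X j w + c))) / 2)"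
        unfolding a_def prod
        by (subst Bochner_Integration.integral_add, auto intro!: ip Bochner_Integration.integrable_add integrable_divide)
          (subst Bochner_Integration.integral_add, auto intro!: ip integrable_divide)
      also have "\<dots> = (LINT w|N. q w * cos (t * Y j w + c)) +
         ((LINT w|N. q w * cos (G w + (t * Y j w + c))) / 2 + (LINT w|N. q w * cos (G w - (t * Y j w + c))) / 2)"
        using IH[OF S1[OF S0 j, of t c]] IH[OF S1[OF FG j, of t c]] IH[OF S1[OF FG j, of "-t" "-c"]]
        by (simp add: algebra_simps)
      also have "\<dots> = (LINT w|N. b w * cos (t * Y j w + c))"
        unfolding b_def prod
        by (subst Bochner_Integration.integral_add, auto intro!: iq Bochner_Integration.integrable_add integrable_divide)
          (subst Bochner_Integration.integral_add, auto intro!: iq integrable_divide)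
      also have "\<dots> = (LINT w|density N b. cos (t * Y j w + c))"
        by (subst integral_density) (use b0 in auto)
      finally show "(LINT w|density M a. cos (t * X j w + c)) = (LINT w|density N b. cos (t * Y j w + c))" .
    qed auto
    then have "(LINT x|distr (density M a) borel (X j). indicator (A j) x :: real)
       = (LINT x|distr (density N b) borel (Y j). indicator (A j) x)" by (rule arg_cong)
    moreover have "(LINT x|distr (density M a) borel (X j). indicator (A j) x) =
        (LINT w|M. a w * indicator (A j) (X j w))"
      by (subst integral_distr, simp, simp, subst integral_density) (use a0 in auto)
    moreover have "(LINT x|distr (density N b) borel (Y j). indicator (A j) x) =
        (LINT w|N. b w * indicator (A j) (Y j w))"
      by (subst integral_distr, simp, simp, subst integral_density) (use b0 in auto)
    ultimately show ?thesis by (simp add: a_def b_def)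
  qed
  have iA: "integrable M (\<lambda>w. p w * cos (F w) * indicator (A j) (X j w))" if "F \<in> borel_measurable M" for F
    by (rule M.integrable_bounded[of _ 1])
      (use that p01 in \<open>auto simp: abs_mult indicator_def intro!: mult_le_one\<close>)
  have iB: "integrable N (\<lambda>w. q w * cos (F w) * indicator (A j) (Y j w))" if "F \<in> borel_measurable N" for F
    by (rule N.integrable_bounded[of _ 1])
      (use that q01 in \<open>auto simp: abs_mult indicator_def intro!: mult_le_one\<close>)
  have FG: "(F, G) \<in> S" by fact
  have m: "F \<in> borel_measurable M" "G \<in> borel_measurable N" using Sm FG by blast+
  have sp: "p w * (1 + c) * i = p w * cos 0 * i + p w * c * i" 
    "q w' * (1 + c) * i = q w' * cos 0 * i + q w' * c * i" for w w' c i
    by (simp_all add: algebra_simps)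
  \<comment> \<open>For \<open>F = 0\<close> the weight is \<open>2 * p\<close>. Subtracting this
    part from \<open>key\<close> leaves the integral with the signed cosine.\<close>
  have 1: "(LINT w|M. p w * cos 0 * indicator (A j) (X j w)) = (LINT w|N. q w * cos 0 * indicator (A j) (Y j w))"
  proof -
    have e: "x * (1 + cos (0::real)) * i = 2 * (x * cos 0 * i)" for x i :: real by simp
    show ?thesis using key[OF S0] unfolding e by (simp del: cos_zero)
  qed
  have "(LINT w|M. p w * cos (F w) * indicator (A j) (X j w)) = (LINT w|N. q w * cos (G w) * indicator (A j) (Y j w))"
    using key[OF FG] 1 unfolding sp
      Bochner_Integration.integral_add[OF iA[OF borel_measurable_const] iA[OF m(1)]]
      Bochner_Integration.integral_add[OF iB[OF borel_measurable_const] iB[OF m(2)]]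
    by linarith
  then show ?case
    using insert.hyps by (simp add: p_def q_def mult.commute mult.left_commute)
qed

text \<open>The Cramer-Wold device. Indicators of a finite box are inserted one coordinate at a
  time, with a cosine of the remaining linear combination kept as a weight; finite boxes determine a
  law on an arbitrary product.\<close>

lemma distr_PiM_eqI_cos:
  fixes X :: "'i \<Rightarrow> 'm \<Rightarrow> real" and Y :: "'i \<Rightarrow> 'n \<Rightarrow> real"
  assumes fin: "finite_measure M" "finite_measure N"
    and X[measurable]: "\<And>i. X i \<in> borel_measurable M" and Y[measurable]: "\<And>i. Y i \<in> borel_measurable N"
    and eq: "\<And>J a c. finite J \<Longrightarrow> J \<subseteq> I \<Longrightarrow>
       (LINT w|M. cos ((\<Sum>i\<in>J. a i * X i w) + c)) = (LINT w|N. cos ((\<Sum>i\<in>J. a i * Y i w) + c))"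
  shows "distr M (PiM I (\<lambda>_. borel)) (\<lambda>w. \<lambda>i\<in>I. X i w) = distr N (PiM I (\<lambda>_. borel)) (\<lambda>w. \<lambda>i\<in>I. Y i w)"
proof (rule measure_eqI_PiM_infinite)
  interpret M: finite_measure M by fact
  interpret N: finite_measure N by fact
  define S where "S = {((\<lambda>w. (\<Sum>i\<in>J. a i * X i w) + c), (\<lambda>w. (\<Sum>i\<in>J. a i * Y i w) + c)) | J a c.
     finite J \<and> J \<subseteq> I}"
  have S0: "((\<lambda>_. 0), (\<lambda>_. 0)) \<in> S"
    unfolding S_def by (simp, intro exI[of _ "{}"] exI[of _ 0]) auto
  have S1: "((\<lambda>w. F w + (t * X i w + c)), (\<lambda>w. G w + (t * Y i w + c))) \<in> S"
    if FG: "(F, G) \<in> S" and i: "i \<in> I" for F G t i c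
  proof -
    from FG obtain J a d where F: "F = (\<lambda>w. (\<Sum>i\<in>J. a i * X i w) + d)" "G = (\<lambda>w. (\<Sum>i\<in>J. a i * Y i w) + d)"
      and J: "finite J" "J \<subseteq> I" unfolding S_def by auto
    \<comment> \<open>The index \<open>i\<close> may already lie in \<open>J\<close>; then the old
      and new coefficients add up.\<close>
    define b where "b k = (if k \<in> J then a k else 0) + (if k = i then t else 0)" for k
    have *: "(\<Sum>k\<in>insert i J. b k * f k) = (\<Sum>k\<in>J. a k * f k) + t * f i" for f
    proof -
      have "(\<Sum>k\<in>insert i J. b k * f k) = (\<Sum>k\<in>insert i J. (if k \<in> J then a k else 0) * f k)
          + (\<Sum>k\<in>insert i J. (if k = i then t else 0) * f k)"
        by (simp add: b_def distrib_right sum.distrib)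
      also have "(\<Sum>k\<in>insert i J. (if k \<in> J then a k else 0) * f k) = (\<Sum>k\<in>J. (if k \<in> J then a k else 0) * f k)"
        by (rule sum.mono_neutral_right) (use J in auto)
      also have "\<dots> = (\<Sum>k\<in>J. a k * f k)" by (rule sum.cong) auto
      also have "(\<Sum>k\<in>insert i J. (if k = i then t else 0) * f k) = (\<Sum>k\<in>insert i J. if k = i then t * f k else 0)"
        by (rule sum.cong) auto
      also have "\<dots> = t * f i" using J by (subst sum.delta) auto
      finally show ?thesis .
    qed
    show ?thesis
      unfolding S_def F
      by (rule CollectI, intro exI[of _ "insert i J"] exI[of _ b] exI[of _ "d + c"])
        (use J i in \<open>auto simp: * algebra_simps\<close>)
  qed
  have Sm: "F \<in> borel_measurable M" "G \<in> borel_measurable N"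
    and Seq: "(LINT w|M. cos (F w)) = (LINT w|N. cos (G w))" if "(F, G) \<in> S" for F G
    using that eq unfolding S_def by auto
  show "finite_measure (distr M (PiM I (\<lambda>_. borel)) (\<lambda>w. \<lambda>i\<in>I. X i w))"
    by (rule M.finite_measure_distr) measurable
  fix A J assume J: "finite J" "J \<subseteq> I" and A: "\<And>i. i \<in> J \<Longrightarrow> A i \<in> sets (borel :: real measure)"
  let ?E = "prod_emb I (\<lambda>_. borel :: real measure) J (Pi\<^sub>E J A)"
  have E[measurable]: "?E \<in> sets (PiM I (\<lambda>_. borel))"
    using J A by (intro sets_PiM_I) auto
  have vM: "(\<lambda>w. \<lambda>i\<in>I. Z i w) -` ?E \<inter> space L = {w \<in> space L. \<forall>i\<in>J. Z i w \<in> A i}"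
    for Z :: "'i \<Rightarrow> 'z \<Rightarrow> real" and L
    using J by (auto simp: prod_emb_def PiE_iff subset_eq)
  have ind: "indicator {w \<in> space L. \<forall>i\<in>J. Z i w \<in> A i} w = (\<Prod>i\<in>J. indicator (A i) (Z i w) :: real)"
    if "w \<in> space L" for Z :: "'i \<Rightarrow> 'z \<Rightarrow> real" and L w
    using that J by (auto simp: indicator_def)
  have meas: "measure L {w \<in> space L. \<forall>i\<in>J. Z i w \<in> A i} = (LINT w|L. (\<Prod>i\<in>J. indicator (A i) (Z i w)))"
    for Z :: "'i \<Rightarrow> 'z \<Rightarrow> real" and L
  proof -
    have "(LINT w|L. (\<Prod>i\<in>J. indicator (A i) (Z i w) :: real)) =
        (LINT w|L. indicator {w \<in> space L. \<forall>i\<in>J. Z i w \<in> A i} w)"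
      by (rule Bochner_Integration.integral_cong) (simp_all only: ind)
    also have "\<dots> = measure L ({w \<in> space L. \<forall>i\<in>J. Z i w \<in> A i} \<inter> space L)" by simp
    finally show ?thesis by (simp add: Int_def conj_ac)
  qed
  have "measure M {w \<in> space M. \<forall>i\<in>J. X i w \<in> A i} = (LINT w|M. (\<Prod>i\<in>J. indicator (A i) (X i w)))"
    by (rule meas)
  also have "\<dots> = (LINT w|N. (\<Prod>i\<in>J. indicator (A i) (Y i w)))"
    using weighted_box_integral_eq[where S=S and X=X and Y=Y and I=I, OF fin X Y S0 S1 Sm Seq J A S0]
    by simp
  also have "\<dots> = measure N {w \<in> space N. \<forall>i\<in>J. Y i w \<in> A i}"
    by (rule meas[symmetric])
  finally show "emeasure (distr M (PiM I (\<lambda>_. borel)) (\<lambda>w. \<lambda>i\<in>I. X i w)) ?E =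
      emeasure (distr N (PiM I (\<lambda>_. borel)) (\<lambda>w. \<lambda>i\<in>I. Y i w)) ?E"
    by (simp add: emeasure_distr vM M.emeasure_eq_measure N.emeasure_eq_measure)
qed simp_all

text \<open>Gaussianity is encoded by the characteristic function with a free phase, in the form
  that \<open>distr_PiM_eqI_cos\<close> consumes. The index space is arbitrary, so that the real
  line, an isonormal process and independent pairs of fields are all instances.\<close>

definition gaussian_field :: "'w measure \<Rightarrow> ('e::real_inner \<Rightarrow> 'w \<Rightarrow> real) \<Rightarrow> bool" where
  "gaussian_field N Y \<longleftrightarrow> prob_space N \<and> (\<forall>v. Y v \<in> borel_measurable N) \<and>
     (\<forall>a b u v. AE \<omega> in N. Y (a *\<^sub>R v + b *\<^sub>R u) \<omega> = a * Y v \<omega> + b * Y u \<omega>) \<and>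
     (\<forall>v c. (LINT \<omega>|N. cos (Y v \<omega> + c)) = exp (- (norm v)\<^sup>2 / 2) * cos c)"

lemma gaussian_fieldD:
  assumes "gaussian_field N Y"
  shows "prob_space N" "Y v \<in> borel_measurable N"
    "AE \<omega> in N. Y (a *\<^sub>R v + b *\<^sub>R u) \<omega> = a * Y v \<omega> + b * Y u \<omega>"
    "(LINT \<omega>|N. cos (Y v \<omega> + c)) = exp (- (norm v)\<^sup>2 / 2) * cos c"
  using assms unfolding gaussian_field_def by auto

lemma gaussian_field_zero:
  assumes Y: "gaussian_field N Y"
  shows "AE \<omega> in N. Y 0 \<omega> = 0"
  using gaussian_fieldD(3)[OF Y, of 0 0 0 0] by simp

lemma gaussian_field_sum:
  assumes Y: "gaussian_field N Y" and "finite J"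
  shows "AE \<omega> in N. Y (\<Sum>i\<in>J. c i *\<^sub>R \<alpha> i) \<omega> = (\<Sum>i\<in>J. c i * Y (\<alpha> i) \<omega>)"
  using assms(2)
proof (induction J rule: finite_induct)
  case empty
  then show ?case using gaussian_field_zero[OF Y] by simp
next
  case (insert j J)
  from gaussian_fieldD(3)[OF Y, of "c j" "\<alpha> j" 1 "\<Sum>i\<in>J. c i *\<^sub>R \<alpha> i"] insert.IH
  show ?case by eventually_elim (use insert.hyps in simp)
qed

lemma norm_sum_scaleR_power2:
  fixes \<alpha> :: "'i \<Rightarrow> 'e::real_inner"
  shows "(norm (\<Sum>i\<in>J. c i *\<^sub>R \<alpha> i))\<^sup>2 = (\<Sum>i\<in>J. \<Sum>j\<in>J. c i * c j * (\<alpha> i \<bullet> \<alpha> j))"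
  by (simp add: power2_norm_eq_inner inner_sum_left inner_sum_right sum_distrib_left mult.assoc
      inner_commute[of "\<alpha> _" "\<alpha> _"])

text \<open>A linear combination of values of the field is almost surely its value at one vector,
  and the norm of that vector is a function of the Gram matrix. This is the source of every symmetry
  used later: reflection, rotation of two copies, splitting off a direction.\<close>

lemma gaussian_field_law_eq:
  assumes Y: "gaussian_field N Y" and Y': "gaussian_field N' Y'"
    and gram: "\<And>i j. i \<in> I \<Longrightarrow> j \<in> I \<Longrightarrow> \<alpha> i \<bullet> \<alpha> j = \<alpha>' i \<bullet> \<alpha>' j"
  shows "distr N (PiM I (\<lambda>_. borel)) (\<lambda>w. \<lambda>i\<in>I. Y (\<alpha> i) w) = distr N' (PiM I (\<lambda>_. borel)) (\<lambda>w. \<lambda>i\<in>I. Y' (\<alpha>' i) w)"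
proof (rule distr_PiM_eqI_cos)
  interpret N: prob_space N by (rule gaussian_fieldD[OF Y])
  interpret N': prob_space N' by (rule gaussian_fieldD[OF Y'])
  show "finite_measure N" "finite_measure N'" by unfold_locales
  show [measurable]: "Y (\<alpha> i) \<in> borel_measurable N" "Y' (\<alpha>' i) \<in> borel_measurable N'" for i
    using gaussian_fieldD[OF Y] gaussian_fieldD[OF Y'] by auto
  have [measurable]: "Y v \<in> borel_measurable N" "Y' v' \<in> borel_measurable N'" for v v'
    using gaussian_fieldD[OF Y] gaussian_fieldD[OF Y'] by auto
  fix J a c assume J: "finite J" "J \<subseteq> I"
  have "(LINT w|N. cos ((\<Sum>i\<in>J. a i * Y (\<alpha> i) w) + c)) = (LINT w|N. cos (Y (\<Sum>i\<in>J. a i *\<^sub>R \<alpha> i) w + c))"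
    by (rule integral_cong_AE) (use gaussian_field_sum[OF Y J(1), of a \<alpha>] in \<open>auto elim!: eventually_mono\<close>)
  also have "\<dots> = (LINT w|N'. cos (Y' (\<Sum>i\<in>J. a i *\<^sub>R \<alpha>' i) w + c))"
  proof -
    have "(norm (\<Sum>i\<in>J. a i *\<^sub>R \<alpha> i))\<^sup>2 = (norm (\<Sum>i\<in>J. a i *\<^sub>R \<alpha>' i))\<^sup>2"
      unfolding norm_sum_scaleR_power2 using J gram by (intro sum.cong) auto
    then show ?thesis by (simp only: gaussian_fieldD(4)[OF Y] gaussian_fieldD(4)[OF Y'])
  qed
  also have "\<dots> = (LINT w|N'. cos ((\<Sum>i\<in>J. a i * Y' (\<alpha>' i) w) + c))"
    by (rule integral_cong_AE) (use gaussian_field_sum[OF Y' J(1), of a \<alpha>'] in \<open>auto elim!: eventually_mono\<close>)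
  finally show "(LINT w|N. cos ((\<Sum>i\<in>J. a i * Y (\<alpha> i) w) + c)) = (LINT w|N'. cos ((\<Sum>i\<in>J. a i * Y' (\<alpha>' i) w) + c))" .
qed

abbreviation std_normal :: "real measure" where
  "std_normal \<equiv> density lborel (\<lambda>x. ennreal (std_normal_density x))"

lemma prob_space_std_normal: "prob_space std_normal"
  by (rule prob_space_normal_density) simp

lemma integral_std_normal_cos:
  "(LINT x|std_normal. cos (t * x + c)) = exp (- t\<^sup>2 / 2) * cos c"
proof -
  interpret prob_space std_normal by (rule prob_space_std_normal)
  have i: "complex_integrable std_normal (\<lambda>x. iexp (t * x))"
    by (rule integrable_const_bound[of _ 1]) auto
  have ch: "(CLINT x|std_normal. iexp (t * x)) = complex_of_real (exp (- t\<^sup>2 / 2))"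
    using char_std_normal_distribution unfolding char_def by (simp add: fun_eq_iff)
  have c: "(LINT x|std_normal. cos (t * x)) = exp (- t\<^sup>2 / 2)"
    using integral_Re[OF i] unfolding ch by (simp add: Re_exp)
  have s: "(LINT x|std_normal. sin (t * x)) = 0"
    using integral_Im[OF i] unfolding ch by (simp add: Im_exp)
  have ic: "integrable std_normal (\<lambda>x. cos (t * x) * cos c)"
    "integrable std_normal (\<lambda>x. sin (t * x) * sin c)"
    by (rule integrable_bounded[of _ "1 * 1"]; auto simp: abs_mult intro!: mult_le_one)+
  have "(LINT x|std_normal. cos (t * x + c)) = (LINT x|std_normal. cos (t * x)) * cos c - (LINT x|std_normal. sin (t * x)) * sin c"
    unfolding cos_add by (subst Bochner_Integration.integral_diff[OF ic]) simp
  then show ?thesis unfolding c s by simp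
qed

lemma gaussian_field_std_normal: "gaussian_field std_normal (\<lambda>c x. c * x)"
  unfolding gaussian_field_def
  by (auto simp: prob_space_std_normal integral_std_normal_cos distrib_right)

lemma centred_gaussian_law_eq:
  assumes "s \<ge> 0"
  shows "centred_gaussian_law s = distr std_normal borel (\<lambda>x. s * x)"
proof (cases "s = 0")
  case True
  interpret prob_space std_normal by (rule prob_space_std_normal)
  show ?thesis using True
    by (auto simp: centred_gaussian_law_def intro!: measure_eqI simp: emeasure_distr emeasure_space_1 indicator_def vimage_def)
next
  case False
  interpret prob_space std_normal by (rule prob_space_std_normal)
  have "distributed std_normal lborel (\<lambda>x. x) (\<lambda>x. ennreal (std_normal_density x))"
    unfolding distributed_def by (auto simp: distr_id2)
  then have "distributed std_normal lborel (\<lambda>x. 0 + s * x) (\<lambda>x. ennreal (normal_density (0 + s * 0) (\<bar>s\<bar> * 1) x))"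
    by (rule normal_density_affine) (use False in auto)
  then have "distr std_normal lborel (\<lambda>x. s * x) = density lborel (\<lambda>x. ennreal (normal_density 0 s x))"
    using assms by (simp add: distributed_def)
  moreover have "distr std_normal lborel (\<lambda>x. s * x) = distr std_normal borel (\<lambda>x. s * x)"
    by (rule distr_cong) auto
  ultimately show ?thesis using False by (simp add: centred_gaussian_law_def)
qed

text \<open>Completing the square turns the tilted density into a multiple of the normal density
  with mean \<open>b\<close>.\<close>

lemma integrable_std_normal_exp: "integrable std_normal (\<lambda>x. exp (b * x))"
proof -
  have "std_normal_density x * exp (b * x) = exp (b\<^sup>2 / 2) * normal_density b 1 x" for x
    by (simp add: normal_density_def field_simps flip: exp_add) (simp add: power2_eq_square algebra_simps)
  then have "integrable lborel (\<lambda>x. std_normal_density x *\<^sub>R exp (b * x))"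
    by simp
  then show ?thesis by (subst integrable_density) auto
qed

lemma AE_pair_fst:
  assumes "prob_space N'" "AE x in N. P x"
  shows "AE \<omega> in N \<Otimes>\<^sub>M N'. P (fst \<omega>)"
proof -
  have "AE x in distr (N \<Otimes>\<^sub>M N') N fst. P x"
    unfolding prob_space.distr_pair_fst[OF assms(1)] by (rule assms(2))
  then show ?thesis by (rule AE_distrD[rotated]) simp
qed

lemma AE_pair_snd:
  assumes "prob_space N" "prob_space N'" "AE x in N'. P x"
  shows "AE \<omega> in N \<Otimes>\<^sub>M N'. P (snd \<omega>)"
proof -
  interpret N: prob_space N by fact
  interpret N': prob_space N' by fact
  have "distr (N \<Otimes>\<^sub>M N') N' snd = N'"
  proof (rule measure_eqI)
    fix A assume A: "A \<in> sets (distr (N \<Otimes>\<^sub>M N') N' snd)"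
    then have "snd -` A \<inter> space (N \<Otimes>\<^sub>M N') = space N \<times> A"
      using sets.sets_into_space by (fastforce simp: space_pair_measure)
    then show "emeasure (distr (N \<Otimes>\<^sub>M N') N' snd) A = emeasure N' A"
      using A by (simp add: emeasure_distr N'.emeasure_pair_measure_Times N.emeasure_space_1)
  qed simp
  then have "AE x in distr (N \<Otimes>\<^sub>M N') N' snd. P x" using assms(3) by (simp only:)
  then show ?thesis by (rule AE_distrD[rotated]) simp
qed

text \<open>Independent fields correspond to the orthogonal sum of the index spaces: characteristic
  functions multiply while squared norms add.\<close>

lemma gaussian_field_pair:
  fixes Y :: "'e::real_inner \<Rightarrow> 'm \<Rightarrow> real" and Y' :: "'f::real_inner \<Rightarrow> 'n \<Rightarrow> real"
  assumes Y: "gaussian_field N Y" and Y': "gaussian_field N' Y'"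
  shows "gaussian_field (N \<Otimes>\<^sub>M N') (\<lambda>p \<omega>. Y (fst p) (fst \<omega>) + Y' (snd p) (snd \<omega>))"
proof -
  interpret N: prob_space N by (rule gaussian_fieldD[OF Y])
  interpret N': prob_space N' by (rule gaussian_fieldD[OF Y'])
  interpret P: pair_prob_space N N' by unfold_locales
  have [measurable]: "Y v \<in> borel_measurable N" "Y' v' \<in> borel_measurable N'" for v v'
    using gaussian_fieldD[OF Y] gaussian_fieldD[OF Y'] by auto
  show ?thesis
    unfolding gaussian_field_def
  proof (intro conjI allI)
    show "prob_space (N \<Otimes>\<^sub>M N')" by unfold_locales
    show "(\<lambda>\<omega>. Y (fst p) (fst \<omega>) + Y' (snd p) (snd \<omega>)) \<in> borel_measurable (N \<Otimes>\<^sub>M N')" for p by measurable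
    fix a b and u v :: "'e \<times> 'f"
    from AE_pair_fst[OF N'.prob_space_axioms gaussian_fieldD(3)[OF Y, of a "fst v" b "fst u"]]
      AE_pair_snd[OF N.prob_space_axioms N'.prob_space_axioms gaussian_fieldD(3)[OF Y', of a "snd v" b "snd u"]]
    show "AE \<omega> in N \<Otimes>\<^sub>M N'. Y (fst (a *\<^sub>R v + b *\<^sub>R u)) (fst \<omega>) + Y' (snd (a *\<^sub>R v + b *\<^sub>R u)) (snd \<omega>) =
       a * (Y (fst v) (fst \<omega>) + Y' (snd v) (snd \<omega>)) + b * (Y (fst u) (fst \<omega>) + Y' (snd u) (snd \<omega>))"
      by eventually_elim (simp add: distrib_left)
  next
    fix v :: "'e \<times> 'f" and c
    have "(LINT \<omega>|(N \<Otimes>\<^sub>M N'). cos (Y (fst v) (fst \<omega>) + Y' (snd v) (snd \<omega>) + c)) =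
       (LINT y|N'. LINT x|N. cos (Y (fst v) x + Y' (snd v) y + c))"
    proof -
      have "integrable (N \<Otimes>\<^sub>M N') (case_prod (\<lambda>x y. cos (Y (fst v) x + Y' (snd v) y + c)))"
        by (rule P.P.integrable_bounded[of _ 1]) (auto simp: split_def)
      then show ?thesis using P.integral_snd[of "\<lambda>x y. cos (Y (fst v) x + Y' (snd v) y + c)"]
        by (simp add: split_def)
    qed
    also have "\<dots> = (LINT y|N'. exp (- (norm (fst v))\<^sup>2 / 2) * cos (Y' (snd v) y + c))"
      by (simp add: add.assoc gaussian_fieldD(4)[OF Y])
    also have "\<dots> = exp (- (norm (fst v))\<^sup>2 / 2) * (exp (- (norm (snd v))\<^sup>2 / 2) * cos c)"
      by (simp add: gaussian_fieldD(4)[OF Y'])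
    also have "\<dots> = exp (- (norm v)\<^sup>2 / 2) * cos c"
    proof -
      have "- (norm v)\<^sup>2 / 2 = - (norm (fst v))\<^sup>2 / 2 + - (norm (snd v))\<^sup>2 / 2"
        by (simp add: norm_prod_def add_divide_distrib)
      then show ?thesis by (simp only: exp_add mult.assoc)
    qed
    finally show "(LINT \<omega>|(N \<Otimes>\<^sub>M N'). cos (Y (fst v) (fst \<omega>) + Y' (snd v) (snd \<omega>) + c)) = exp (- (norm v)\<^sup>2 / 2) * cos c" .
  qed
qed

text \<open>The sort of \<open>'a\<close> expresses a separable Hilbert space: second countability
  gives measurability of vector-valued variables, completeness gives limits of derivatives.\<close>

locale isonormal =
  fixes M :: "'w measure"
    and X :: "'a::{real_inner, complete_space, second_countable_topology} \<Rightarrow> 'w \<Rightarrow> real"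
  assumes isonormal: "isonormal_process M X"
begin

sublocale prob_space M
  using isonormal by (simp add: isonormal_process_def)

lemma X_measurable[measurable]: "X v \<in> borel_measurable M"
  using isonormal by (simp add: isonormal_process_def centred_jointly_gaussian_def)

lemma X_cov: "(LINT \<omega>|M. X v \<omega> * X u \<omega>) = v \<bullet> u"
  using isonormal by (simp add: isonormal_process_def)

lemma X_linear: "AE \<omega> in M. X (a *\<^sub>R v + b *\<^sub>R u) \<omega> = a * X v \<omega> + b * X u \<omega>"
  using isonormal by (simp add: isonormal_process_def)

text \<open>Joint Gaussianity only yields some standard deviation; comparing second moments with the
  covariance identifies it with \<open>norm v\<close>.\<close>

lemma X_law: "distr M borel (X v) = distr std_normal borel (\<lambda>x. norm v * x)"
proof -
  have "\<exists>s\<ge>0. distr M borel (\<lambda>\<omega>. \<Sum>w\<in>{v}. 1 * X w \<omega>) = centred_gaussian_law s"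
    using isonormal unfolding isonormal_process_def centred_jointly_gaussian_def
    by (elim conjE allE[of _ "{v}"] allE[of _ "\<lambda>_. 1"] impE) auto
  then obtain s where s: "s \<ge> 0" "distr M borel (X v) = centred_gaussian_law s" by auto
  have "(norm v)\<^sup>2 = (LINT \<omega>|M. (X v \<omega>)\<^sup>2)"
    using X_cov[of v v] by (simp add: power2_norm_eq_inner) (simp add: power2_eq_square)
  also have "\<dots> = (LINT x|distr M borel (X v). x\<^sup>2)" by (simp add: integral_distr)
  also have "\<dots> = (LINT x|std_normal. (s * x)\<^sup>2)"
    unfolding s(2) centred_gaussian_law_eq[OF s(1)] by (simp add: integral_distr)
  also have "\<dots> = s\<^sup>2 * (LINT x|lborel. std_normal_density x * x\<^sup>2)"
    by (subst integral_density) (simp_all add: power_mult_distrib mult.left_commute[of _ "s\<^sup>2"])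
  also have "(LINT x|lborel. std_normal_density x * x\<^sup>2) = 1"
    using std_normal_moment_even[of 1] by (simp add: has_bochner_integral_iff)
  finally have "norm v = s" using s(1) by simp
  then show ?thesis using s centred_gaussian_law_eq[of s] by simp
qed

lemma gaussian_field: "gaussian_field M X"
  unfolding gaussian_field_def
proof (intro conjI allI)
  show "prob_space M" by unfold_locales
  fix v c
  have "(LINT \<omega>|M. cos (X v \<omega> + c)) = (LINT x|distr M borel (X v). cos (x + c))" by (simp add: integral_distr)
  also have "\<dots> = (LINT x|std_normal. cos (norm v * x + c))" unfolding X_law by (simp add: integral_distr)
  finally show "(LINT \<omega>|M. cos (X v \<omega> + c)) = exp (- (norm v)\<^sup>2 / 2) * cos c" by (simp add: integral_std_normal_cos)
qed (use X_linear in auto)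

lemma integrable_exp_X: "integrable M (\<lambda>\<omega>. exp (a * X v \<omega>))"
proof -
  have "integrable (distr M borel (X v)) (\<lambda>x. exp (a * x))"
    unfolding X_law by (subst integrable_distr_eq) (simp_all add: integrable_std_normal_exp[of "a * norm v", unfolded mult.assoc])
  then show ?thesis by (subst (asm) integrable_distr_eq) auto
qed

lemma integrable_exp_sum_abs_X:
  assumes V: "finite V"
  shows "integrable M (\<lambda>\<omega>. exp (a * (\<Sum>v\<in>V. \<bar>X v \<omega>\<bar>)))"
proof (rule Bochner_Integration.integrable_bound)
  \<comment> \<open>The sum is at most \<open>card V\<close> times its largest term, and the
    exponential of that term is below the sum over \<open>V\<close> of exponentials of both signs.
    The summand 1 in the bound serves the empty \<open>V\<close>.\<close>
  define b where "b = \<bar>a\<bar> * real (card V)"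
  show "integrable M (\<lambda>\<omega>. 1 + (\<Sum>v\<in>V. exp (b * X v \<omega>) + exp ((- b) * X v \<omega>)))"
    by (intro Bochner_Integration.integrable_add Bochner_Integration.integrable_sum integrable_exp_X) simp
  show "AE \<omega> in M. norm (exp (a * (\<Sum>v\<in>V. \<bar>X v \<omega>\<bar>))) \<le> norm (1 + (\<Sum>v\<in>V. exp (b * X v \<omega>) + exp ((- b) * X v \<omega>)))"
  proof (rule AE_I2)
    fix \<omega>
    let ?S = "\<Sum>v\<in>V. exp (b * X v \<omega>) + exp ((- b) * X v \<omega>)"
    have S0: "?S \<ge> 0" by (intro sum_nonneg add_nonneg_nonneg) auto
    have "exp (a * (\<Sum>v\<in>V. \<bar>X v \<omega>\<bar>)) \<le> 1 + ?S"
    proof (cases "V = {}")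
      case False
      define m where "m = Max ((\<lambda>v. \<bar>X v \<omega>\<bar>) ` V)"
      have "m \<in> (\<lambda>v. \<bar>X v \<omega>\<bar>) ` V" unfolding m_def using V False by (intro Max_in) auto
      then obtain w where w: "w \<in> V" "m = \<bar>X w \<omega>\<bar>" by auto
      have "(\<Sum>v\<in>V. \<bar>X v \<omega>\<bar>) \<le> (\<Sum>v\<in>V. m)" unfolding m_def using V by (intro sum_mono Max_ge) auto
      then have "\<bar>a\<bar> * (\<Sum>v\<in>V. \<bar>X v \<omega>\<bar>) \<le> \<bar>a\<bar> * (card V * m)"
        by (intro mult_left_mono) auto
      moreover have "a * (\<Sum>v\<in>V. \<bar>X v \<omega>\<bar>) \<le> \<bar>a\<bar> * (\<Sum>v\<in>V. \<bar>X v \<omega>\<bar>)"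
        by (intro mult_right_mono) (auto intro: sum_nonneg)
      ultimately have "a * (\<Sum>v\<in>V. \<bar>X v \<omega>\<bar>) \<le> \<bar>a\<bar> * (card V * m)" by linarith
      then have "exp (a * (\<Sum>v\<in>V. \<bar>X v \<omega>\<bar>)) \<le> exp (b * \<bar>X w \<omega>\<bar>)" by (simp add: b_def w mult.assoc)
      also have "\<dots> \<le> exp (b * X w \<omega>) + exp ((- b) * X w \<omega>)"
        using exp_ge_zero[of "b * X w \<omega>"] exp_ge_zero[of "- b * X w \<omega>"]
        by (cases "X w \<omega> \<ge> 0") (simp_all add: abs_if)
      also have "\<dots> \<le> ?S"
        by (rule member_le_sum[OF w(1) _ V]) (simp add: add_nonneg_nonneg)
      finally show ?thesis by simp
    qed auto
    then show "norm (exp (a * (\<Sum>v\<in>V. \<bar>X v \<omega>\<bar>))) \<le> norm (1 + ?S)" using S0 by simp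
  qed
qed measurable

end

section \<open>Gaussian integration by parts\<close>

text \<open>A class of functionals of the whole path, closed under sums and products and contained
  in every \<open>L^p\<close>, because Gaussian variables have exponential moments. It contains
  coordinates, cosines and smooth functions of polynomial growth in finitely many
  coordinates.\<close>

definition exp_growth :: "(('a \<Rightarrow> real) \<Rightarrow> real) \<Rightarrow> bool" where
  "exp_growth \<Phi> \<longleftrightarrow> \<Phi> \<in> borel_measurable (PiM UNIV (\<lambda>_. borel)) \<and>
     (\<exists>C a V. finite V \<and> 0 \<le> a \<and> 0 \<le> C \<and> (\<forall>x. \<bar>\<Phi> x\<bar> \<le> C * exp (a * (\<Sum>v\<in>V. \<bar>x v\<bar>))))"

lemma exp_growth_measurable: "exp_growth \<Phi> \<Longrightarrow> \<Phi> \<in> borel_measurable (PiM UNIV (\<lambda>_. borel))"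
  by (simp add: exp_growth_def)

lemma exp_growthI:
  assumes "\<Phi> \<in> borel_measurable (PiM UNIV (\<lambda>_. borel))" "finite V" "0 \<le> a" "0 \<le> C"
    "\<And>x. \<bar>\<Phi> x\<bar> \<le> C * exp (a * (\<Sum>v\<in>V. \<bar>x v\<bar>))"
  shows "exp_growth \<Phi>"
  unfolding exp_growth_def using assms by blast

lemma exp_growth_bounded:
  assumes "\<Phi> \<in> borel_measurable (PiM UNIV (\<lambda>_. borel))" "\<And>x. \<bar>\<Phi> x\<bar> \<le> C"
  shows "exp_growth \<Phi>"
  by (rule exp_growthI[of _ "{}" 0 C]) (use assms assms(2)[THEN order_trans[OF abs_ge_zero]] in auto)

lemma exp_growth_const: "exp_growth (\<lambda>_. c)"
  by (rule exp_growth_bounded[of _ "\<bar>c\<bar>"]) auto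

lemma exp_growth_coordinate: "exp_growth (\<lambda>x. x v)"
proof (rule exp_growthI[of _ "{v}" 1 1])
  show "\<bar>x v\<bar> \<le> 1 * exp (1 * (\<Sum>w\<in>{v}. \<bar>x w\<bar>))" for x :: "'a \<Rightarrow> real"
  proof -
    have "\<bar>x v\<bar> \<le> exp \<bar>x v\<bar>" using exp_ge_add_one_self[of "\<bar>x v\<bar>"] by linarith
    then show ?thesis by simp
  qed
qed simp_all

lemma exp_growth_combine:
  assumes "exp_growth \<Phi>" "exp_growth \<Psi>"
  obtains C D a V where "finite V" "0 \<le> a" "0 \<le> C" "0 \<le> D"
    "\<And>x. \<bar>\<Phi> x\<bar> \<le> C * exp (a * (\<Sum>v\<in>V. \<bar>x v\<bar>))" "\<And>x. \<bar>\<Psi> x\<bar> \<le> D * exp (a * (\<Sum>v\<in>V. \<bar>x v\<bar>))"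
proof -
  from assms obtain C a V D b W where V: "finite V" "0 \<le> a" "0 \<le> C" "finite W" "0 \<le> b" "0 \<le> D"
    and 1: "\<And>x. \<bar>\<Phi> x\<bar> \<le> C * exp (a * (\<Sum>v\<in>V. \<bar>x v\<bar>))"
    and 2: "\<And>x. \<bar>\<Psi> x\<bar> \<le> D * exp (b * (\<Sum>v\<in>W. \<bar>x v\<bar>))"
    unfolding exp_growth_def by blast
  show thesis
  proof (rule that[of "V \<union> W" "a + b" C D])
    fix x
    have mono: "c * exp (d * (\<Sum>v\<in>U. \<bar>x v\<bar>)) \<le> c * exp ((a + b) * (\<Sum>v\<in>V \<union> W. \<bar>x v\<bar>))"
      if "0 \<le> c" "0 \<le> d" "d \<le> a + b" "U \<subseteq> V \<union> W" for c d U
    proof -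
      have "(\<Sum>v\<in>U. \<bar>x v\<bar>) \<le> (\<Sum>v\<in>V \<union> W. \<bar>x v\<bar>)"
        by (rule sum_mono2) (use V that in auto)
      then have "d * (\<Sum>v\<in>U. \<bar>x v\<bar>) \<le> (a + b) * (\<Sum>v\<in>V \<union> W. \<bar>x v\<bar>)"
        by (rule mult_mono[rotated]) (use that V in \<open>auto intro: sum_nonneg\<close>)
      then show ?thesis using that by (intro mult_left_mono) auto
    qed
    show "\<bar>\<Phi> x\<bar> \<le> C * exp ((a + b) * (\<Sum>v\<in>V \<union> W. \<bar>x v\<bar>))"
      by (rule order_trans[OF 1 mono]) (use V in auto)
    show "\<bar>\<Psi> x\<bar> \<le> D * exp ((a + b) * (\<Sum>v\<in>V \<union> W. \<bar>x v\<bar>))"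
      by (rule order_trans[OF 2 mono]) (use V in auto)
  qed (use V in auto)
qed

lemma exp_growth_add:
  assumes "exp_growth \<Phi>" "exp_growth \<Psi>"
  shows "exp_growth (\<lambda>x. \<Phi> x + \<Psi> x)"
proof -
  obtain V a C D where *: "finite V" "0 \<le> a" "0 \<le> C" "0 \<le> D"
    "\<And>x. \<bar>\<Phi> x\<bar> \<le> C * exp (a * (\<Sum>v\<in>V. \<bar>x v\<bar>))" "\<And>x. \<bar>\<Psi> x\<bar> \<le> D * exp (a * (\<Sum>v\<in>V. \<bar>x v\<bar>))"
    by (rule exp_growth_combine[OF assms]) (rule that)
  show ?thesis
  proof (rule exp_growthI[of _ V a "C + D"])
    show "\<bar>\<Phi> x + \<Psi> x\<bar> \<le> (C + D) * exp (a * (\<Sum>v\<in>V. \<bar>x v\<bar>))" for x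
      using *(5)[of x] *(6)[of x] by (simp add: distrib_right)
  qed (use * assms[THEN exp_growth_measurable] in auto)
qed

lemma exp_growth_mult:
  assumes "exp_growth \<Phi>" "exp_growth \<Psi>"
  shows "exp_growth (\<lambda>x. \<Phi> x * \<Psi> x)"
proof -
  obtain V a C D where *: "finite V" "0 \<le> a" "0 \<le> C" "0 \<le> D"
    "\<And>x. \<bar>\<Phi> x\<bar> \<le> C * exp (a * (\<Sum>v\<in>V. \<bar>x v\<bar>))" "\<And>x. \<bar>\<Psi> x\<bar> \<le> D * exp (a * (\<Sum>v\<in>V. \<bar>x v\<bar>))"
    by (rule exp_growth_combine[OF assms]) (rule that)
  show ?thesis
  proof (rule exp_growthI[of _ V "a + a" "C * D"])
    fix x
    have "\<bar>\<Phi> x * \<Psi> x\<bar> \<le> (C * exp (a * (\<Sum>v\<in>V. \<bar>x v\<bar>))) * (D * exp (a * (\<Sum>v\<in>V. \<bar>x v\<bar>)))"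
      unfolding abs_mult by (intro mult_mono *) (use * in auto)
    also have "\<dots> = (C * D) * exp ((a + a) * (\<Sum>v\<in>V. \<bar>x v\<bar>))"
      unfolding distrib_right exp_add by (simp only: mult_ac)
    finally show "\<bar>\<Phi> x * \<Psi> x\<bar> \<le> (C * D) * exp ((a + a) * (\<Sum>v\<in>V. \<bar>x v\<bar>))" .
  qed (use * assms[THEN exp_growth_measurable] in auto)
qed

lemma exp_growth_cmult: "exp_growth \<Phi> \<Longrightarrow> exp_growth (\<lambda>x. c * \<Phi> x)"
  by (rule exp_growth_mult[OF exp_growth_const])

lemma exp_growth_diff: "exp_growth \<Phi> \<Longrightarrow> exp_growth \<Psi> \<Longrightarrow> exp_growth (\<lambda>x. \<Phi> x - \<Psi> x)"
  using exp_growth_add[OF _ exp_growth_cmult[of _ "-1"]] by fastforce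

lemma exp_growth_sum: "(\<And>i. i \<in> I \<Longrightarrow> exp_growth (\<Phi> i)) \<Longrightarrow> exp_growth (\<lambda>x. \<Sum>i\<in>I. \<Phi> i x)"
  by (induction I rule: infinite_finite_induct) (auto intro: exp_growth_const exp_growth_add)

text \<open>The derivative along a Cameron-Martin direction: the path is shifted by multiples of the
  function \<open>\<lambda>v. v \<bullet> u\<close>. Differentiability is asked at
  \<open>t = 0\<close> only, but for every path, hence it holds at every \<open>t\<close>
  (\<open>path_deriv_at\<close>).\<close>

definition path_deriv :: "'a::real_inner \<Rightarrow> (('a \<Rightarrow> real) \<Rightarrow> real) \<Rightarrow> (('a \<Rightarrow> real) \<Rightarrow> real) \<Rightarrow> bool" where
  "path_deriv u \<Phi> \<Phi>' \<longleftrightarrow> exp_growth \<Phi> \<and> exp_growth \<Phi>' \<and>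
     (\<forall>x. ((\<lambda>t. \<Phi> (\<lambda>v. x v + t * (v \<bullet> u))) has_real_derivative \<Phi>' x) (at 0)) \<and>
     (\<forall>x. continuous_on UNIV (\<lambda>t. \<Phi>' (\<lambda>v. x v + t * (v \<bullet> u))))"

lemma path_deriv_at:
  assumes "path_deriv u \<Phi> \<Phi>'"
  shows "((\<lambda>t. \<Phi> (\<lambda>v. x v + t * (v \<bullet> u))) has_real_derivative \<Phi>' (\<lambda>v. x v + t * (v \<bullet> u))) (at t)"
proof -
  have "((\<lambda>s. \<Phi> (\<lambda>v. (x v + t * (v \<bullet> u)) + s * (v \<bullet> u))) has_real_derivative \<Phi>' (\<lambda>v. x v + t * (v \<bullet> u))) (at 0)"
    using assms[unfolded path_deriv_def, THEN conjunct2, THEN conjunct2, THEN conjunct1, THEN spec,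
        of "\<lambda>v. x v + t * (v \<bullet> u)"] by simp
  then have "((\<lambda>s. \<Phi> (\<lambda>v. x v + (s + t) * (v \<bullet> u))) has_real_derivative \<Phi>' (\<lambda>v. x v + t * (v \<bullet> u))) (at 0)"
    by (simp add: algebra_simps)
  then show ?thesis
    using DERIV_shift[of "\<lambda>s. \<Phi> (\<lambda>v. x v + s * (v \<bullet> u))" _ 0 t] by simp
qed

lemma path_deriv_continuous:
  assumes "path_deriv u \<Phi> \<Phi>'"
  shows "continuous_on UNIV (\<lambda>t. \<Phi> (\<lambda>v. x v + t * (v \<bullet> u)))"
  by (rule DERIV_continuous_on) (rule has_field_derivative_at_within[OF path_deriv_at[OF assms]])

lemma path_deriv_mult:
  assumes "path_deriv u \<Phi> \<Phi>'" "path_deriv u \<Psi> \<Psi>'"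
  shows "path_deriv u (\<lambda>x. \<Phi> x * \<Psi> x) (\<lambda>x. \<Phi>' x * \<Psi> x + \<Phi> x * \<Psi>' x)"
proof -
  have c: "continuous_on UNIV (\<lambda>t. \<Phi> (\<lambda>v. x v + t * (v \<bullet> u)))" "continuous_on UNIV (\<lambda>t. \<Psi> (\<lambda>v. x v + t * (v \<bullet> u)))" for x
    by (rule path_deriv_continuous[OF assms(1)], rule path_deriv_continuous[OF assms(2)])
  show ?thesis
    unfolding path_deriv_def
  proof (intro conjI allI)
    fix x
    show "((\<lambda>t. \<Phi> (\<lambda>v. x v + t * (v \<bullet> u)) * \<Psi> (\<lambda>v. x v + t * (v \<bullet> u))) has_real_derivative \<Phi>' x * \<Psi> x + \<Phi> x * \<Psi>' x) (at 0)"
      using DERIV_mult[OF path_deriv_at[OF assms(1), of x 0] path_deriv_at[OF assms(2), of x 0]]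
      by (simp add: add.commute mult.commute)
    show "continuous_on UNIV (\<lambda>t. \<Phi>' (\<lambda>v. x v + t * (v \<bullet> u)) * \<Psi> (\<lambda>v. x v + t * (v \<bullet> u)) +
        \<Phi> (\<lambda>v. x v + t * (v \<bullet> u)) * \<Psi>' (\<lambda>v. x v + t * (v \<bullet> u)))"
      using c assms unfolding path_deriv_def by (intro continuous_intros) auto
  qed (use assms in \<open>auto simp: path_deriv_def intro!: exp_growth_add exp_growth_mult\<close>)
qed

lemma measurable_path_coordinate[measurable]: "(\<lambda>x. x v) \<in> PiM UNIV (\<lambda>_. borel) \<rightarrow>\<^sub>M borel"
  by (rule measurable_component_singleton) simp

lemma path_deriv_cos: "path_deriv u (\<lambda>x. cos (x w + c)) (\<lambda>x. - sin (x w + c) * (w \<bullet> u))"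
  unfolding path_deriv_def
proof (intro conjI allI)
  show "exp_growth (\<lambda>x. cos (x w + c))" by (rule exp_growth_bounded[of _ 1]) auto
  show "exp_growth (\<lambda>x. - sin (x w + c) * (w \<bullet> u))"
    by (intro exp_growth_mult exp_growth_const) (rule exp_growth_bounded[of _ 1], auto)
qed (auto intro!: derivative_eq_intros continuous_intros)

text \<open>Completing the square around \<open>a + 1\<close> rather than \<open>a\<close> leaves
  the factor \<open>exp (- \<bar>s\<bar>)\<close>, which provides decay.\<close>

lemma exp_shift_le:
  fixes a s :: real
  shows "exp (a * \<bar>s\<bar> - s\<^sup>2 / 2) \<le> exp ((a + 1)\<^sup>2 / 2) * exp (- \<bar>s\<bar>)"
proof -
  have "0 \<le> (\<bar>s\<bar> - (a + 1))\<^sup>2" by simp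
  then have "a * \<bar>s\<bar> - s\<^sup>2 / 2 \<le> (a + 1)\<^sup>2 / 2 + - \<bar>s\<bar>"
    by (simp add: power2_eq_square algebra_simps abs_if split: if_splits)
  then show ?thesis by (simp flip: exp_add)
qed

lemma integrable_std_normal_exp_abs: "integrable std_normal (\<lambda>s. exp (a * \<bar>s\<bar>))"
proof (rule Bochner_Integration.integrable_bound[OF Bochner_Integration.integrable_add[OF
        integrable_std_normal_exp[of a] integrable_std_normal_exp[of "- a"]]])
  have "exp (a * \<bar>s\<bar>) \<le> exp (a * s) + exp (- a * s)" for s
    using exp_ge_zero[of "a * s"] exp_ge_zero[of "- a * s"] by (cases "s \<ge> 0") (simp_all add: abs_if)
  then show "AE s in std_normal. norm (exp (a * \<bar>s\<bar>)) \<le> norm (exp (a * s) + exp (- a * s))"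
    by (intro AE_I2) (simp add: abs_of_nonneg add_nonneg_nonneg)
qed auto

lemma integrable_std_normal_exp_bound:
  assumes "F \<in> borel_measurable borel" "\<And>s. \<bar>F s\<bar> \<le> C * exp (a * \<bar>s\<bar>)"
  shows "integrable std_normal (F :: real \<Rightarrow> real)"
  by (rule Bochner_Integration.integrable_bound[OF integrable_mult_right[OF integrable_std_normal_exp_abs[of a], of C]])
    (use assms assms(2)[THEN order_trans[OF _ abs_ge_self]] in auto)

text \<open>Stein's identity. Since the density satisfies \<open>d' = - s * d\<close>, both
  integrands differ by the derivative of density times \<open>F\<close>, whose boundary terms
  vanish.\<close>

lemma std_normal_integration_by_parts:
  fixes F :: "real \<Rightarrow> real"
  assumes F: "\<And>s. (F has_real_derivative F' s) (at s)" and cont: "continuous_on UNIV F'"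
    and bF: "\<And>s. \<bar>F s\<bar> \<le> C * exp (a * \<bar>s\<bar>)" and bF': "\<And>s. \<bar>F' s\<bar> \<le> C' * exp (a' * \<bar>s\<bar>)"
  shows "(LINT s|std_normal. F' s) = (LINT s|std_normal. s * F s)"
proof -
  have cF: "continuous_on UNIV F" by (rule DERIV_continuous_on) (rule has_field_derivative_at_within[OF F])
  have [measurable]: "F \<in> borel_measurable borel" "F' \<in> borel_measurable borel"
    using cF cont by (auto intro: borel_measurable_continuous_onI)
  have i1: "integrable std_normal F'" by (rule integrable_std_normal_exp_bound[OF _ bF']) auto
  have i2: "integrable std_normal (\<lambda>s. s * F s)"
  proof (rule integrable_std_normal_exp_bound)
    show "\<bar>s * F s\<bar> \<le> C * exp ((a + 1) * \<bar>s\<bar>)" for s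
    proof -
      have "\<bar>s\<bar> \<le> exp \<bar>s\<bar>" using exp_ge_add_one_self[of "\<bar>s\<bar>"] by linarith
      then have "\<bar>s\<bar> * \<bar>F s\<bar> \<le> exp \<bar>s\<bar> * (C * exp (a * \<bar>s\<bar>))" by (intro mult_mono bF) auto
      then show ?thesis unfolding abs_mult distrib_right exp_add mult_1 by (simp only: mult_ac)
    qed
  qed auto
  let ?d = std_normal_density
  have j1: "integrable lborel (\<lambda>s. ?d s * F' s)" using i1 by (subst (asm) integrable_density) auto
  have j2: "integrable lborel (\<lambda>s. ?d s * (s * F s))" using i2 by (subst (asm) integrable_density) auto
  have dd: "(?d has_real_derivative - s * ?d s) (at s)" for s
    unfolding std_normal_density_def by (auto intro!: derivative_eq_intros simp: field_simps)
  have dG: "((\<lambda>s. ?d s * F s) has_real_derivative ?d s * F' s - ?d s * (s * F s)) (at s)" for s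
    using DERIV_mult[OF dd F, of s] by (simp add: algebra_simps)
  have bG: "norm (?d s * F s) \<le> C * exp ((a + 1)\<^sup>2 / 2) * exp (- \<bar>s\<bar>)" for s
  proof -
    have C0: "C \<ge> 0" using bF[of 0] by (auto intro: order_trans[OF abs_ge_zero])
    have "1 \<le> sqrt (2 * pi)" using pi_gt3 by simp
    then have "?d s \<le> exp (- s\<^sup>2 / 2)" unfolding std_normal_density_def
      by (simp add: divide_le_eq_1 mult_le_cancel_right1 field_simps)
    then have "?d s * \<bar>F s\<bar> \<le> exp (- s\<^sup>2 / 2) * (C * exp (a * \<bar>s\<bar>))" by (intro mult_mono bF) auto
    also have "\<dots> = C * exp (a * \<bar>s\<bar> - s\<^sup>2 / 2)" by (simp add: mult.left_commute flip: exp_add)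
    also have "\<dots> \<le> C * (exp ((a + 1)\<^sup>2 / 2) * exp (- \<bar>s\<bar>))" by (rule mult_left_mono[OF exp_shift_le C0])
    finally show ?thesis by (simp add: abs_mult mult.assoc)
  qed
  have "((\<lambda>s::real. exp (- \<bar>s\<bar>)) \<longlongrightarrow> 0) at_top"
    by (rule filterlim_compose[OF exp_at_bot])
      (rule filterlim_uminus_at_top[THEN iffD1], rule filterlim_abs_real)
  then have top: "((\<lambda>s::real. C * exp ((a + 1)\<^sup>2 / 2) * exp (- \<bar>s\<bar>)) \<longlongrightarrow> 0) at_top"
    by (rule tendsto_mult_right_zero)
  then have bot: "((\<lambda>s::real. C * exp ((a + 1)\<^sup>2 / 2) * exp (- \<bar>s\<bar>)) \<longlongrightarrow> 0) at_bot"
    by (simp add: filterlim_at_bot_mirror)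
  have "(LBINT s=-\<infinity>..\<infinity>. ?d s * F' s - ?d s * (s * F s)) = 0 - 0"
  proof (rule interval_integral_FTC_integrable)
    show "((\<lambda>s. ?d s * F s) has_vector_derivative ?d s * F' s - ?d s * (s * F s)) (at s)" for s
      using dG has_real_derivative_iff_has_vector_derivative by blast
    have "continuous_on UNIV (\<lambda>s. ?d s * F' s - ?d s * (s * F s))"
      unfolding std_normal_density_def by (intro continuous_intros cF cont) auto
    then show "isCont (\<lambda>s. ?d s * F' s - ?d s * (s * F s)) s" for s
      by (simp add: continuous_on_eq_continuous_at)
    show "set_integrable lborel (einterval (- \<infinity>) \<infinity>) (\<lambda>s. ?d s * F' s - ?d s * (s * F s))"
      using j1 j2 by (auto simp: set_integrable_def einterval_def)
    show "(((\<lambda>s. ?d s * F s) \<circ> real_of_ereal) \<longlongrightarrow> 0) (at_right (- \<infinity>))"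
      unfolding ereal_tendsto_simps by (rule Lim_null_comparison[OF always_eventually bot]) (rule allI, rule bG)
    show "(((\<lambda>s. ?d s * F s) \<circ> real_of_ereal) \<longlongrightarrow> 0) (at_left \<infinity>)"
      unfolding ereal_tendsto_simps by (rule Lim_null_comparison[OF always_eventually top]) (rule allI, rule bG)
  qed simp
  then have "(LINT s|lborel. ?d s * F' s - ?d s * (s * F s)) = 0"
    by (simp add: interval_lebesgue_integral_def set_lebesgue_integral_def einterval_def)
  then have "(LINT s|lborel. ?d s * F' s) = (LINT s|lborel. ?d s * (s * F s))"
    using Bochner_Integration.integral_diff[OF j1 j2] by simp
  moreover have "(LINT s|std_normal. F' s) = (LINT s|lborel. ?d s * F' s)"
    by (subst integral_density) auto
  moreover have "(LINT s|std_normal. s * F s) = (LINT s|lborel. ?d s * (s * F s))"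
    by (subst integral_density) auto
  ultimately show ?thesis by simp
qed

context isonormal
begin

lemma path_measurable[measurable]: "(\<lambda>\<omega>. \<lambda>v. X v \<omega>) \<in> M \<rightarrow>\<^sub>M PiM UNIV (\<lambda>_. borel)"
  by (rule measurable_PiM_single') auto

lemma exp_growth_random_variable:
  "exp_growth \<Phi> \<Longrightarrow> (\<lambda>\<omega>. \<Phi> (\<lambda>v. X v \<omega>)) \<in> borel_measurable M"
  using measurable_compose[OF path_measurable exp_growth_measurable] .

lemma integrable_exp_growth:
  assumes "exp_growth \<Phi>"
  shows "integrable M (\<lambda>\<omega>. \<Phi> (\<lambda>v. X v \<omega>))"
proof -
  from assms obtain C a V where *: "finite V" "\<And>x. \<bar>\<Phi> x\<bar> \<le> C * exp (a * (\<Sum>v\<in>V. \<bar>x v\<bar>))"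
    unfolding exp_growth_def by blast
  show ?thesis
    by (rule Bochner_Integration.integrable_bound[OF integrable_mult_right[OF integrable_exp_sum_abs_X[OF *(1), of a], of C]])
      (use *(2)[THEN order_trans[OF _ abs_ge_self]] exp_growth_random_variable[OF assms] in auto)
qed

text \<open>Each index vector is split into its component along \<open>u\<close> and the orthogonal
  rest. The map \<alpha> preserves inner products, so \<open>X\<close> has the law of an independent
  standard normal in direction \<open>u\<close> plus \<open>X\<close> at the rests; the independence
  lives on the product space and is not constructed inside \<open>M\<close>.\<close>

lemma expectation_exp_growth_decomposition:
  assumes \<Phi>: "exp_growth \<Phi>" and u: "norm u = 1"
  shows "expectation (\<lambda>\<omega>. \<Phi> (\<lambda>v. X v \<omega>)) =
    expectation (\<lambda>\<omega>. LINT s|std_normal. \<Phi> (\<lambda>v. X (v - (v \<bullet> u) *\<^sub>R u) \<omega> + s * (v \<bullet> u)))"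
proof -
  interpret N: prob_space std_normal by (rule prob_space_std_normal)
  interpret P: pair_prob_space std_normal M by unfold_locales
  have [measurable]: "\<Phi> \<in> borel_measurable (PiM UNIV (\<lambda>_. borel))" by (rule exp_growth_measurable[OF \<Phi>])
  define \<alpha> where "\<alpha> v = (v \<bullet> u, v - (v \<bullet> u) *\<^sub>R u)" for v
  define T where "T p = (\<lambda>v. fst (\<alpha> v) * fst p + X (snd (\<alpha> v)) (snd p))" for p
  have [measurable]: "T \<in> std_normal \<Otimes>\<^sub>M M \<rightarrow>\<^sub>M PiM UNIV (\<lambda>_. borel)"
    unfolding T_def by (rule measurable_PiM_single') auto
  have "distr M (PiM UNIV (\<lambda>_. borel)) (\<lambda>\<omega>. \<lambda>v\<in>UNIV. X v \<omega>) =
     distr (std_normal \<Otimes>\<^sub>M M) (PiM UNIV (\<lambda>_. borel)) (\<lambda>\<omega>. \<lambda>v\<in>UNIV. fst (\<alpha> v) * fst \<omega> + X (snd (\<alpha> v)) (snd \<omega>))"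
  proof (rule gaussian_field_law_eq[OF gaussian_field gaussian_field_pair[OF gaussian_field_std_normal gaussian_field], where \<alpha>="\<lambda>v. v"])
    fix v w
    show "v \<bullet> w = \<alpha> v \<bullet> \<alpha> w"
      using u by (simp add: \<alpha>_def inner_diff_left inner_diff_right inner_commute norm_eq_1)
  qed
  then have eq: "distr M (PiM UNIV (\<lambda>_. borel)) (\<lambda>\<omega>. \<lambda>v. X v \<omega>) = distr (std_normal \<Otimes>\<^sub>M M) (PiM UNIV (\<lambda>_. borel)) T"
    by (simp add: T_def[abs_def] restrict_UNIV)
  have "integrable (distr M (PiM UNIV (\<lambda>_. borel)) (\<lambda>\<omega>. \<lambda>v. X v \<omega>)) \<Phi>"
    using integrable_exp_growth[OF \<Phi>] by (subst integrable_distr_eq) auto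
  then have int: "integrable (std_normal \<Otimes>\<^sub>M M) (\<lambda>p. \<Phi> (T p))"
    unfolding eq by (subst (asm) integrable_distr_eq) auto
  have "expectation (\<lambda>\<omega>. \<Phi> (\<lambda>v. X v \<omega>)) = (LINT x|distr M (PiM UNIV (\<lambda>_. borel)) (\<lambda>\<omega>. \<lambda>v. X v \<omega>). \<Phi> x)"
    by (subst integral_distr) auto
  also have "\<dots> = (LINT p|(std_normal \<Otimes>\<^sub>M M). \<Phi> (T p))"
    unfolding eq by (subst integral_distr) auto
  also have "\<dots> = expectation (\<lambda>\<omega>. LINT s|std_normal. \<Phi> (T (s, \<omega>)))"
    using P.integral_snd[of "\<lambda>s \<omega>. \<Phi> (T (s, \<omega>))"] int by (simp add: split_def)
  finally show ?thesis by (simp add: T_def \<alpha>_def add.commute mult.commute)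
qed

text \<open>With the path of the orthogonal rests frozen, a shift along \<open>u\<close> is a shift
  of one standard normal variable, so Stein's identity applies under the outer expectation.\<close>

lemma integration_by_parts_unit:
  assumes D: "path_deriv u \<Phi> \<Phi>'" and u: "norm u = 1"
  shows "expectation (\<lambda>\<omega>. \<Phi>' (\<lambda>v. X v \<omega>)) = expectation (\<lambda>\<omega>. X u \<omega> * \<Phi> (\<lambda>v. X v \<omega>))"
proof -
  have g: "exp_growth \<Phi>" "exp_growth \<Phi>'" and cont: "\<And>x. continuous_on UNIV (\<lambda>t. \<Phi>' (\<lambda>v. x v + t * (v \<bullet> u)))"
    using D by (auto simp: path_deriv_def)
  define Y where "Y \<omega> v = X (v - (v \<bullet> u) *\<^sub>R u) \<omega>" for \<omega> v
  have growth: "\<exists>C a. \<forall>s. \<bar>\<Psi> (\<lambda>v. y v + s * (v \<bullet> u))\<bar> \<le> C * exp (a * \<bar>s\<bar>)" if "exp_growth \<Psi>" for \<Psi> y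
  proof -
    from that obtain C a V where *: "finite V" "0 \<le> a" "0 \<le> C" "\<And>x. \<bar>\<Psi> x\<bar> \<le> C * exp (a * (\<Sum>v\<in>V. \<bar>x v\<bar>))"
      unfolding exp_growth_def by blast
    define A where "A = a * (\<Sum>v\<in>V. \<bar>y v\<bar>)"
    define B where "B = a * (\<Sum>v\<in>V. \<bar>v \<bullet> u\<bar>)"
    have "\<bar>\<Psi> (\<lambda>v. y v + s * (v \<bullet> u))\<bar> \<le> C * exp A * exp (B * \<bar>s\<bar>)" for s
    proof -
      have "(\<Sum>v\<in>V. \<bar>y v + s * (v \<bullet> u)\<bar>) \<le> (\<Sum>v\<in>V. \<bar>y v\<bar> + \<bar>v \<bullet> u\<bar> * \<bar>s\<bar>)"
        by (intro sum_mono order_trans[OF abs_triangle_ineq]) (simp add: abs_mult)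
      then have "a * (\<Sum>v\<in>V. \<bar>y v + s * (v \<bullet> u)\<bar>) \<le> a * (\<Sum>v\<in>V. \<bar>y v\<bar> + \<bar>v \<bullet> u\<bar> * \<bar>s\<bar>)"
        using * by (intro mult_left_mono)
      also have "\<dots> = A + B * \<bar>s\<bar>"
        by (simp add: A_def B_def sum.distrib distrib_left sum_distrib_right)
      finally have "C * exp (a * (\<Sum>v\<in>V. \<bar>y v + s * (v \<bullet> u)\<bar>)) \<le> C * exp (A + B * \<bar>s\<bar>)"
        using * by (intro mult_left_mono) auto
      with *(4)[of "\<lambda>v. y v + s * (v \<bullet> u)"] show ?thesis by (simp add: exp_add mult.assoc)
    qed
    then show ?thesis by blast
  qed
  have 1: "(LINT s|std_normal. \<Phi>' (\<lambda>v. Y \<omega> v + s * (v \<bullet> u))) = (LINT s|std_normal. s * \<Phi> (\<lambda>v. Y \<omega> v + s * (v \<bullet> u)))" for \<omega>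
  proof -
    obtain C a where "\<forall>s. \<bar>\<Phi> (\<lambda>v. Y \<omega> v + s * (v \<bullet> u))\<bar> \<le> C * exp (a * \<bar>s\<bar>)"
      using growth[OF g(1), of "Y \<omega>"] by blast
    moreover obtain C' a' where "\<forall>s. \<bar>\<Phi>' (\<lambda>v. Y \<omega> v + s * (v \<bullet> u))\<bar> \<le> C' * exp (a' * \<bar>s\<bar>)"
      using growth[OF g(2), of "Y \<omega>"] by blast
    ultimately show ?thesis
      by (intro std_normal_integration_by_parts[where C=C and a=a and C'=C' and a'=a'] path_deriv_at[OF D] cont) auto
  qed
  have gu: "exp_growth (\<lambda>x. x u * \<Phi> x)" by (intro exp_growth_mult exp_growth_coordinate g)
  have meas: "(\<lambda>\<omega>. LINT s|std_normal. \<Psi> (\<lambda>v. Y \<omega> v + s * (v \<bullet> u))) \<in> borel_measurable M" if "exp_growth \<Psi>" for \<Psi>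
  proof -
    interpret N: prob_space std_normal by (rule prob_space_std_normal)
    have [measurable]: "\<Psi> \<in> borel_measurable (PiM UNIV (\<lambda>_. borel))" by (rule exp_growth_measurable[OF that])
    have [measurable]: "(\<lambda>p. \<lambda>v. Y (fst p) v + snd p * (v \<bullet> u)) \<in> M \<Otimes>\<^sub>M std_normal \<rightarrow>\<^sub>M PiM UNIV (\<lambda>_. borel)"
      unfolding Y_def by (rule measurable_PiM_single') auto
    have "(\<lambda>(\<omega>, s). \<Psi> (\<lambda>v. Y \<omega> v + s * (v \<bullet> u))) \<in> borel_measurable (M \<Otimes>\<^sub>M std_normal)"
      unfolding split_def by measurable
    then show ?thesis by (rule N.borel_measurable_lebesgue_integral)
  qed
  have "expectation (\<lambda>\<omega>. X u \<omega> * \<Phi> (\<lambda>v. X v \<omega>)) =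
      expectation (\<lambda>\<omega>. LINT s|std_normal. (Y \<omega> u + s * (u \<bullet> u)) * \<Phi> (\<lambda>v. Y \<omega> v + s * (v \<bullet> u)))"
    unfolding Y_def by (rule expectation_exp_growth_decomposition[OF gu u])
  \<comment> \<open>For a unit vector the rest of \<open>u\<close> is 0, so
    \<open>Y \<omega> u\<close> is \<open>X 0 \<omega>\<close>, which vanishes only almost
    surely.\<close>
  also have "\<dots> = expectation (\<lambda>\<omega>. LINT s|std_normal. s * \<Phi> (\<lambda>v. Y \<omega> v + s * (v \<bullet> u)))"
  proof (rule integral_cong_AE)
    show "(\<lambda>\<omega>. LINT s|std_normal. (Y \<omega> u + s * (u \<bullet> u)) * \<Phi> (\<lambda>v. Y \<omega> v + s * (v \<bullet> u))) \<in> borel_measurable M"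
      using meas[OF gu] by simp
    show "(\<lambda>\<omega>. LINT s|std_normal. s * \<Phi> (\<lambda>v. Y \<omega> v + s * (v \<bullet> u))) \<in> borel_measurable M"
      using meas[OF g(2)] by (simp only: 1)
    show "AE \<omega> in M. (LINT s|std_normal. (Y \<omega> u + s * (u \<bullet> u)) * \<Phi> (\<lambda>v. Y \<omega> v + s * (v \<bullet> u))) =
       (LINT s|std_normal. s * \<Phi> (\<lambda>v. Y \<omega> v + s * (v \<bullet> u)))"
      using gaussian_field_zero[OF gaussian_field] by eventually_elim (use u in \<open>simp add: Y_def norm_eq_1\<close>)
  qed
  also have "\<dots> = expectation (\<lambda>\<omega>. LINT s|std_normal. \<Phi>' (\<lambda>v. Y \<omega> v + s * (v \<bullet> u)))" by (simp only: 1)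
  also have "\<dots> = expectation (\<lambda>\<omega>. \<Phi>' (\<lambda>v. X v \<omega>))"
    unfolding Y_def by (rule expectation_exp_growth_decomposition[OF g(2) u, symmetric])
  finally show ?thesis by simp
qed

lemma integration_by_parts:
  assumes D: "path_deriv u \<Phi> \<Phi>'"
  shows "expectation (\<lambda>\<omega>. \<Phi>' (\<lambda>v. X v \<omega>)) = expectation (\<lambda>\<omega>. X u \<omega> * \<Phi> (\<lambda>v. X v \<omega>))"
proof (cases "u = 0")
  case True
  have "\<Phi>' x = 0" for x
    using D DERIV_unique[of "\<lambda>_. \<Phi> x" "\<Phi>' x" 0 0] unfolding path_deriv_def True by simp
  moreover have "expectation (\<lambda>\<omega>. X u \<omega> * \<Phi> (\<lambda>v. X v \<omega>)) = expectation (\<lambda>_. 0)"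
    by (rule integral_cong_AE)
      (use D True gaussian_field_zero[OF gaussian_field] exp_growth_random_variable in \<open>auto simp: path_deriv_def elim!: eventually_mono\<close>)
  ultimately show ?thesis by simp
next
  case False
  define r where "r = norm u"
  define w where "w = (1 / r) *\<^sub>R u"
  have r: "r > 0" using False by (simp add: r_def)
  have w: "norm w = 1" using r by (simp add: w_def r_def)
  have u: "u = r *\<^sub>R w" using r by (simp add: w_def)
  have sh: "(\<lambda>t. \<Psi> (\<lambda>v. x v + t * (v \<bullet> w))) = (\<lambda>t. \<Psi> (\<lambda>v. x v + (1 / r * t) * (v \<bullet> u)))" for \<Psi> :: "('a \<Rightarrow> real) \<Rightarrow> real" and x
    using r by (simp add: u)
  have "path_deriv w \<Phi> (\<lambda>x. 1 / r * \<Phi>' x)"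
    unfolding path_deriv_def
  proof (intro conjI allI)
    show "exp_growth \<Phi>" using D by (simp add: path_deriv_def)
    show "exp_growth (\<lambda>x. 1 / r * \<Phi>' x)" by (rule exp_growth_cmult) (use D in \<open>simp add: path_deriv_def\<close>)
    fix x
    have "((\<lambda>t. \<Phi> (\<lambda>v. x v + t * (v \<bullet> u))) has_real_derivative \<Phi>' x) (at (1 / r * 0))"
      using D by (simp add: path_deriv_def)
    moreover have "((\<lambda>t. 1 / r * t) has_real_derivative 1 / r) (at 0)"
      using r by (auto intro!: derivative_eq_intros)
    ultimately show "((\<lambda>t. \<Phi> (\<lambda>v. x v + t * (v \<bullet> w))) has_real_derivative 1 / r * \<Phi>' x) (at 0)"
      unfolding sh mult.commute[of "1 / r" "\<Phi>' x"]
      by (rule DERIV_chain2[where f="\<lambda>t. \<Phi> (\<lambda>v. x v + t * (v \<bullet> u))" and g="\<lambda>t. 1 / r * t"])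
    have c: "continuous_on UNIV (\<lambda>t. \<Phi>' (\<lambda>v. x v + t * (v \<bullet> u)))"
      using D by (simp add: path_deriv_def)
    have "continuous_on UNIV (\<lambda>t. 1 / r * t)" by (intro continuous_on_mult_left continuous_on_id)
    from continuous_on_compose2[OF c this subset_UNIV]
    have "continuous_on UNIV (\<lambda>t. \<Phi>' (\<lambda>v. x v + t * (v \<bullet> w)))"
      unfolding sh[of \<Phi>'] .
    then show "continuous_on UNIV (\<lambda>t. 1 / r * \<Phi>' (\<lambda>v. x v + t * (v \<bullet> w)))"
      by (rule continuous_on_mult_left)
  qed
  from integration_by_parts_unit[OF this w]
  have "1 / r * expectation (\<lambda>\<omega>. \<Phi>' (\<lambda>v. X v \<omega>)) = expectation (\<lambda>\<omega>. X w \<omega> * \<Phi> (\<lambda>v. X v \<omega>))" by simp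
  moreover have "expectation (\<lambda>\<omega>. X u \<omega> * \<Phi> (\<lambda>v. X v \<omega>)) = expectation (\<lambda>\<omega>. r * (X w \<omega> * \<Phi> (\<lambda>v. X v \<omega>)))"
  proof (rule integral_cong_AE)
    have [measurable]: "(\<lambda>\<omega>. \<Phi> (\<lambda>v. X v \<omega>)) \<in> borel_measurable M"
      using D by (auto simp: path_deriv_def intro: exp_growth_random_variable)
    show "(\<lambda>\<omega>. X u \<omega> * \<Phi> (\<lambda>v. X v \<omega>)) \<in> borel_measurable M" "(\<lambda>\<omega>. r * (X w \<omega> * \<Phi> (\<lambda>v. X v \<omega>))) \<in> borel_measurable M" by auto
    show "AE \<omega> in M. X u \<omega> * \<Phi> (\<lambda>v. X v \<omega>) = r * (X w \<omega> * \<Phi> (\<lambda>v. X v \<omega>))"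
      using X_linear[of r w 0 w] by eventually_elim (simp add: u)
  qed
  ultimately show ?thesis using r by (simp add: field_simps)
qed

end

text \<open>Coordinates are moved one at a time, and each increment is handled by the mean value
  theorem. Continuity of the partial derivatives is in the product topology, so no norm on sequences
  enters.\<close>

lemma partial_chain_rule:
  fixes f :: "(nat \<Rightarrow> real) \<Rightarrow> real"
  assumes dep: "\<And>x y. (\<And>i. i < n \<Longrightarrow> x i = y i) \<Longrightarrow> f x = f y"
    and g: "\<And>i x. i < n \<Longrightarrow> ((\<lambda>t. f (x(i := t))) has_real_derivative g i x) (at (x i))"
    and cont: "\<And>i. i < n \<Longrightarrow> continuous_on UNIV (g i)"
  shows "((\<lambda>t. f (\<lambda>i. x i + t * b i)) has_real_derivative (\<Sum>i<n. g i x * b i)) (at 0)"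
proof -
  \<comment> \<open>The point whose first \<open>k\<close> coordinates have already been moved; the
    increments from \<open>z k\<close> to \<open>z (Suc k)\<close> telescope.\<close>
  define z where "z k t = (\<lambda>i. if i < k then x i + t * b i else x i)" for k :: nat and t :: real
  have z0: "z k 0 = x" for k by (simp add: z_def fun_eq_iff)
  have step: "((\<lambda>t. f (z (Suc k) t) - f (z k t)) has_real_derivative g k x * b k) (at 0)" if k: "k < n" for k
  proof -
    have "\<exists>\<theta>. 0 \<le> \<theta> \<and> \<theta> \<le> 1 \<and> f (z (Suc k) t) - f (z k t) = t * b k * g k ((z k t)(k := x k + \<theta> * (t * b k)))" for t
    proof -
      let ?p = "\<lambda>s. (z k t)(k := x k + s * (t * b k))"
      have "\<exists>\<theta>>0. \<theta> < 1 \<and> f (?p 1) - f (?p 0) = (1 - 0) * (g k (?p \<theta>) * (t * b k))"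
      proof (rule MVT2)
        fix s :: real
        have "((\<lambda>r. f ((?p s)(k := r))) has_real_derivative g k (?p s)) (at (?p s k))" by (rule g[OF k])
        then have "((\<lambda>r. f ((z k t)(k := r))) has_real_derivative g k (?p s)) (at (x k + s * (t * b k)))" by simp
        moreover have "((\<lambda>s. x k + s * (t * b k)) has_real_derivative t * b k) (at s)"
          by (auto intro!: derivative_eq_intros)
        ultimately show "((\<lambda>s. f (?p s)) has_real_derivative g k (?p s) * (t * b k)) (at s)"
          by (rule DERIV_chain2)
      qed simp
      moreover have "?p 1 = z (Suc k) t" "?p 0 = z k t" by (auto simp: z_def fun_eq_iff less_Suc_eq)
      ultimately show ?thesis by (auto intro: less_imp_le)
    qed
    then obtain \<theta> where \<theta>: "\<And>t. 0 \<le> \<theta> t \<and> \<theta> t \<le> 1 \<and>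
        f (z (Suc k) t) - f (z k t) = t * b k * g k ((z k t)(k := x k + \<theta> t * (t * b k)))" by metis
    \<comment> \<open>Treats the time \<open>t\<close> and the offset of the intermediate point as
      independent variables; joint continuity then lets the intermediate point tend to
      \<open>x\<close> although \<theta> may be wild.\<close>
    define W where "W p = (z k (fst p))(k := x k + snd p)" for p :: "real \<times> real"
    have "continuous_on UNIV W"
    proof (rule continuous_on_coordinatewise_then_product)
      fix i
      show "continuous_on UNIV (\<lambda>p. W p i)"
        by (cases "i = k"; cases "i < k") (auto simp: W_def z_def intro!: continuous_intros)
    qed
    then have "continuous_on UNIV (\<lambda>p. g k (W p))"
      by (rule continuous_on_compose2[OF cont[OF k] _ subset_UNIV])
    then have iso: "isCont (\<lambda>p. g k (W p)) (0, 0)" by (simp add: continuous_on_eq_continuous_at)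
    have "((\<lambda>t. \<theta> t * (t * b k)) \<longlongrightarrow> 0) (at 0)"
    proof (rule Lim_null_comparison)
      show "\<forall>\<^sub>F t in at 0. norm (\<theta> t * (t * b k)) \<le> \<bar>t * b k\<bar>"
        using \<theta> by (intro always_eventually allI) (simp add: abs_mult mult_left_le_one_le)
      show "((\<lambda>t. \<bar>t * b k\<bar>) \<longlongrightarrow> 0) (at 0)" by (auto intro!: tendsto_eq_intros)
    qed
    then have "((\<lambda>t. (t, \<theta> t * (t * b k))) \<longlongrightarrow> (0, 0)) (at 0)"
      by (intro tendsto_Pair tendsto_ident_at)
    from isCont_tendsto_compose[OF iso this]
    have "((\<lambda>t. g k (W (t, \<theta> t * (t * b k))) * b k) \<longlongrightarrow> g k x * b k) (at 0)"
      by (intro tendsto_mult_right) (simp add: W_def z0)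
    moreover have "\<forall>\<^sub>F t in at 0. g k (W (t, \<theta> t * (t * b k))) * b k =
        ((f (z (Suc k) (0 + t)) - f (z k (0 + t))) - (f (z (Suc k) 0) - f (z k 0))) / t"
    proof -
      have "\<forall>\<^sub>F t in at 0. t \<noteq> (0::real)" by (simp add: eventually_at_filter)
      then show ?thesis
        by eventually_elim (use \<theta> in \<open>simp add: z0 W_def\<close>)
    qed
    ultimately show ?thesis unfolding DERIV_def by (rule Lim_transform_eventually)
  qed
  have "((\<lambda>t. f (z k t)) has_real_derivative (\<Sum>i<k. g i x * b i)) (at 0)" if "k \<le> n" for k
    using that
  proof (induction k)
    case 0
    then show ?case by (simp add: z_def)
  next
    case (Suc k)
    then have "((\<lambda>t. f (z k t) + (f (z (Suc k) t) - f (z k t))) has_real_derivative (\<Sum>i<k. g i x * b i) + g k x * b k) (at 0)"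
      by (intro DERIV_add step) auto
    then show ?case by simp
  qed
  from this[of n] have "((\<lambda>t. f (z n t)) has_real_derivative (\<Sum>i<n. g i x * b i)) (at 0)" by simp
  moreover have "f (z n t) = f (\<lambda>i. x i + t * b i)" for t by (rule dep) (simp add: z_def)
  ultimately show ?thesis by simp
qed

lemma exp_growth_pullback:
  fixes f :: "(nat \<Rightarrow> real) \<Rightarrow> real" and v :: "nat \<Rightarrow> 'a"
  assumes f: "continuous_on UNIV f" and "0 \<le> a" "0 \<le> C" and b: "\<And>x. \<bar>f x\<bar> \<le> C * exp (a * (\<Sum>i<n. \<bar>x i\<bar>))"
  shows "exp_growth (\<lambda>x. f (\<lambda>i. x (v i)))"
\<comment> \<open>The vectors \<open>v i\<close> may coincide, so a coordinate of the path can be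
  counted up to \<open>n\<close> times; this is the factor \<open>n\<close> in the exponent.\<close>
proof (rule exp_growthI[of _ "v ` {..<n}" "a * n" C])
  have [measurable]: "f \<in> borel_measurable borel" by (rule borel_measurable_continuous_onI[OF f])
  have "(\<lambda>x i. x (v i)) \<in> PiM UNIV (\<lambda>_. borel :: real measure) \<rightarrow>\<^sub>M PiM UNIV (\<lambda>_. borel)"
    by (rule measurable_PiM_single') (auto intro: measurable_component_singleton)
  then have [measurable]: "(\<lambda>x i. x (v i)) \<in> PiM UNIV (\<lambda>_. borel :: real measure) \<rightarrow>\<^sub>M (borel :: (nat \<Rightarrow> real) measure)"
    by (simp only: measurable_cong_sets[OF refl sets_PiM_equal_borel])
  show "(\<lambda>x. f (\<lambda>i. x (v i))) \<in> borel_measurable (PiM UNIV (\<lambda>_. borel))" by measurable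
  fix x :: "'a \<Rightarrow> real"
  have "(\<Sum>i<n. \<bar>x (v i)\<bar>) \<le> (\<Sum>i<n. \<Sum>w\<in>v ` {..<n}. \<bar>x w\<bar>)"
    by (rule sum_mono, rule member_le_sum[where f="\<lambda>w. \<bar>x w\<bar>"]) auto
  then have "a * (\<Sum>i<n. \<bar>x (v i)\<bar>) \<le> a * (n * (\<Sum>w\<in>v ` {..<n}. \<bar>x w\<bar>))"
    using assms(2) by (intro mult_left_mono) auto
  then have "C * exp (a * (\<Sum>i<n. \<bar>x (v i)\<bar>)) \<le> C * exp (a * n * (\<Sum>w\<in>v ` {..<n}. \<bar>x w\<bar>))"
    using assms(3) by (intro mult_left_mono) (auto simp: mult.assoc)
  then show "\<bar>f (\<lambda>i. x (v i))\<bar> \<le> C * exp (a * n * (\<Sum>w\<in>v ` {..<n}. \<bar>x w\<bar>))"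
    using b[of "\<lambda>i. x (v i)"] by linarith
qed (use assms in auto)

definition exp_bound :: "nat \<Rightarrow> ((nat \<Rightarrow> real) \<Rightarrow> real) \<Rightarrow> bool" where
  "exp_bound n f \<longleftrightarrow> (\<exists>C a. 0 \<le> a \<and> 0 \<le> C \<and> (\<forall>x. \<bar>f x\<bar> \<le> C * exp (a * (\<Sum>i<n. \<bar>x i\<bar>))))"

lemma exp_boundI_bounded: "(\<And>x. \<bar>f x\<bar> \<le> B) \<Longrightarrow> exp_bound n f"
  unfolding exp_bound_def
  by (intro exI[of _ B] exI[of _ 0]) (auto intro: order_trans[OF abs_ge_zero])

lemma exp_boundI_poly:
  assumes "\<And>x. \<bar>f x\<bar> \<le> c * (1 + (\<Sum>i<n. \<bar>x i\<bar>)) ^ p"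
  shows "exp_bound n f"
  unfolding exp_bound_def
proof (rule exI[of _ "\<bar>c\<bar>"], rule exI[of _ "real p"], intro conjI allI)
  fix x :: "nat \<Rightarrow> real"
  have "(1 + (\<Sum>i<n. \<bar>x i\<bar>)) ^ p \<le> exp (\<Sum>i<n. \<bar>x i\<bar>) ^ p"
    by (intro power_mono exp_ge_add_one_self add_nonneg_nonneg sum_nonneg) auto
  also have "\<dots> = exp (p * (\<Sum>i<n. \<bar>x i\<bar>))" by (simp add: exp_of_nat_mult)
  finally have "\<bar>c\<bar> * (1 + (\<Sum>i<n. \<bar>x i\<bar>)) ^ p \<le> \<bar>c\<bar> * exp (p * (\<Sum>i<n. \<bar>x i\<bar>))"
    by (intro mult_left_mono) auto
  moreover have "c * (1 + (\<Sum>i<n. \<bar>x i\<bar>)) ^ p \<le> \<bar>c\<bar> * (1 + (\<Sum>i<n. \<bar>x i\<bar>)) ^ p"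
    by (intro mult_right_mono zero_le_power add_nonneg_nonneg sum_nonneg) auto
  ultimately show "\<bar>f x\<bar> \<le> \<bar>c\<bar> * exp (p * (\<Sum>i<n. \<bar>x i\<bar>))" using assms[of x] by linarith
qed auto

lemma exp_growth_pullback': "continuous_on UNIV f \<Longrightarrow> exp_bound n f \<Longrightarrow> exp_growth (\<lambda>x. f (\<lambda>i. x (v i)))"
  unfolding exp_bound_def using exp_growth_pullback by metis

lemma path_deriv_pullback:
  fixes f :: "(nat \<Rightarrow> real) \<Rightarrow> real" and v :: "nat \<Rightarrow> 'a::real_inner"
  assumes dep: "\<And>x y. (\<And>i. i < n \<Longrightarrow> x i = y i) \<Longrightarrow> f x = f y"
    and g: "\<And>i x. i < n \<Longrightarrow> ((\<lambda>t. f (x(i := t))) has_real_derivative g i x) (at (x i))"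
    and cont: "continuous_on UNIV f" "\<And>i. i < n \<Longrightarrow> continuous_on UNIV (g i)"
    and bound: "exp_bound n f" "\<And>i. i < n \<Longrightarrow> exp_bound n (g i)"
  shows "path_deriv u (\<lambda>x. f (\<lambda>i. x (v i))) (\<lambda>x. \<Sum>j<n. g j (\<lambda>i. x (v i)) * (v j \<bullet> u))"
  unfolding path_deriv_def
proof (intro conjI allI)
  show "exp_growth (\<lambda>x. f (\<lambda>i. x (v i)))" by (rule exp_growth_pullback'[OF cont(1) bound(1)])
  show "exp_growth (\<lambda>x. \<Sum>j<n. g j (\<lambda>i. x (v i)) * (v j \<bullet> u))"
    by (intro exp_growth_sum exp_growth_mult exp_growth_const exp_growth_pullback'[OF cont(2) bound(2)]) auto
  fix x :: "'a \<Rightarrow> real"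
  show "((\<lambda>t. f (\<lambda>i. x (v i) + t * (v i \<bullet> u))) has_real_derivative (\<Sum>j<n. g j (\<lambda>i. x (v i)) * (v j \<bullet> u))) (at 0)"
    by (rule partial_chain_rule[OF dep g cont(2)])
  have "continuous_on UNIV (\<lambda>t. g j (\<lambda>i. x (v i) + t * (v i \<bullet> u)))" if "j < n" for j
    by (rule continuous_on_compose2[OF cont(2)[OF that] _ subset_UNIV])
      (intro continuous_on_coordinatewise_then_product continuous_intros)
  then show "continuous_on UNIV (\<lambda>t. \<Sum>j<n. g j (\<lambda>i. x (v i) + t * (v i \<bullet> u)) * (v j \<bullet> u))"
    by (intro continuous_intros) auto
qed

lemma smooth_poly_growthD:
  assumes "smooth_poly_growth n f"
  shows "(\<And>i. i < n \<Longrightarrow> x i = y i) \<Longrightarrow> f x = f y"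
    and "i < n \<Longrightarrow> ((\<lambda>t. f (x(i := t))) has_real_derivative partial_deriv i f x) (at (x i))"
    and "continuous_on UNIV f" "i < n \<Longrightarrow> continuous_on UNIV (partial_deriv i f)"
    and "exp_bound n f" "i < n \<Longrightarrow> exp_bound n (partial_deriv i f)"
proof -
  have *: "set js \<subseteq> {..<n} \<Longrightarrow> continuous_on UNIV (iterated_partial_deriv js f) \<and>
     (\<forall>i<n. \<forall>x. (\<lambda>t. iterated_partial_deriv js f (x(i := t))) differentiable (at (x i))) \<and>
     (\<exists>c p. \<forall>x. \<bar>iterated_partial_deriv js f x\<bar> \<le> c * (1 + (\<Sum>i<n. \<bar>x i\<bar>)) ^ p)" for js
    using assms unfolding smooth_poly_growth_def Let_def by blast
  show "(\<And>i. i < n \<Longrightarrow> x i = y i) \<Longrightarrow> f x = f y" using assms unfolding smooth_poly_growth_def by blast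
  show "continuous_on UNIV f" "exp_bound n f"
    using *[of "[]"] exp_boundI_poly unfolding iterated_partial_deriv_def by (simp, simp, metis)
  assume i: "i < n"
  have "(\<lambda>t. f (x(i := t))) differentiable (at (x i))"
    using *[of "[]"] i unfolding iterated_partial_deriv_def by simp
  then show "((\<lambda>t. f (x(i := t))) has_real_derivative partial_deriv i f x) (at (x i))"
    unfolding partial_deriv_def by (simp add: DERIV_deriv_iff_real_differentiable)
  show "continuous_on UNIV (partial_deriv i f)" "exp_bound n (partial_deriv i f)"
    using *[of "[i]"] i exp_boundI_poly unfolding iterated_partial_deriv_def by (simp, simp, metis)
qed

lemma path_deriv_smooth:
  assumes "smooth_poly_growth n f"
  shows "path_deriv u (\<lambda>x. f (\<lambda>i. x (v i))) (\<lambda>x. \<Sum>j<n. partial_deriv j f (\<lambda>i. x (v i)) * (v j \<bullet> u))"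
  by (rule path_deriv_pullback) (use smooth_poly_growthD[OF assms] in blast)+

section \<open>Soft maxima\<close>

text \<open>Log-sum-exp at inverse temperature \<open>b\<close>, a free energy. Its gradient
  consists of the Gibbs weights \<open>soft_wt\<close>.\<close>

definition soft_max :: "nat \<Rightarrow> real \<Rightarrow> (nat \<Rightarrow> real) \<Rightarrow> real" where
  "soft_max n b x = ln (\<Sum>i<n. exp (b * x i)) / b"

definition soft_wt :: "nat \<Rightarrow> real \<Rightarrow> nat \<Rightarrow> (nat \<Rightarrow> real) \<Rightarrow> real" where
  "soft_wt n b i x = exp (b * x i) / (\<Sum>j<n. exp (b * x j))"

context
  fixes n :: nat and b :: real
  assumes n: "0 < n" and b: "0 < b"
begin

lemma soft_denominator_pos: "0 < (\<Sum>i<n. exp (b * x i))"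
  using n by (intro sum_pos) auto

lemma soft_wt_pos: "0 < soft_wt n b i x"
  using soft_denominator_pos by (simp add: soft_wt_def)

lemma sum_soft_wt: "(\<Sum>i<n. soft_wt n b i x) = 1"
  using soft_denominator_pos[of x] by (simp add: soft_wt_def flip: sum_divide_distrib)

lemma soft_wt_le_1: "i < n \<Longrightarrow> soft_wt n b i x \<le> 1"
  using member_le_sum[of i "{..<n}" "\<lambda>i. soft_wt n b i x"] sum_soft_wt[of x] soft_wt_pos[of _ x]
  by (simp add: less_imp_le)

text \<open>The gap to a coordinate is the negative logarithm of its Gibbs weight over
  \<open>b\<close>; estimates of the soft maximum thereby become estimates of weights.\<close>

lemma soft_max_diff: "soft_max n b x - x i = - ln (soft_wt n b i x) / b"
  using soft_denominator_pos[of x] b by (simp add: soft_max_def soft_wt_def ln_div field_simps)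

lemma soft_max_ge: "i < n \<Longrightarrow> x i \<le> soft_max n b x"
  using soft_max_diff[of x i] soft_wt_le_1[of i x] soft_wt_pos[of i x] b
  by (smt (verit) divide_nonneg_pos ln_le_zero_iff)

lemma soft_max_le:
  assumes "\<And>i. i < n \<Longrightarrow> x i \<le> m"
  shows "soft_max n b x \<le> m + ln n / b"
proof -
  have "(\<Sum>i<n. exp (b * x i)) \<le> (\<Sum>i<n. exp (b * m))"
    using assms b by (intro sum_mono) auto
  then have "ln (\<Sum>i<n. exp (b * x i)) \<le> ln (n * exp (b * m))"
    using soft_denominator_pos[of x] by (intro ln_mono) auto
  also have "\<dots> = ln n + b * m" using n by (simp add: ln_mult)
  finally show ?thesis using b by (simp add: soft_max_def field_simps)
qed

text \<open>By \<open>soft_max_diff\<close> the difference is the Shannon entropy of the weights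
  divided by \<open>b\<close>, which lies between 0 and that of the uniform distribution.\<close>

lemma soft_max_entropy:
  "0 \<le> soft_max n b x - (\<Sum>i<n. soft_wt n b i x * x i)"
  "soft_max n b x - (\<Sum>i<n. soft_wt n b i x * x i) \<le> ln n / b"
proof -
  have eq: "soft_max n b x - (\<Sum>i<n. soft_wt n b i x * x i) = (\<Sum>i<n. soft_wt n b i x * (soft_max n b x - x i))"
    by (simp add: right_diff_distrib sum_subtractf sum_soft_wt flip: sum_distrib_right)
  show "0 \<le> soft_max n b x - (\<Sum>i<n. soft_wt n b i x * x i)"
    unfolding eq using soft_max_ge soft_wt_pos by (intro sum_nonneg mult_nonneg_nonneg) (auto simp: less_imp_le)
  \<comment> \<open>The bound \<open>ln y \<le> y - 1\<close> at \<open>y = 1 / (n * w)\<close>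
    gives a termwise estimate; its linear parts cancel in the sum because both \<open>1 / n\<close>
    and the weights sum to 1.\<close>
  have "soft_wt n b i x * (soft_max n b x - x i) \<le> (1 / n - soft_wt n b i x) / b + soft_wt n b i x * (ln n / b)" for i
  proof -
    let ?w = "soft_wt n b i x"
    have "ln (1 / (n * ?w)) \<le> 1 / (n * ?w) - 1"
      using n soft_wt_pos[of i x] by (intro ln_le_minus_one) auto
    then have "- ln ?w \<le> 1 / (n * ?w) - 1 + ln n"
      using n soft_wt_pos[of i x] by (simp add: ln_div ln_mult)
    then have "?w * - ln ?w \<le> ?w * (1 / (n * ?w) - 1 + ln n)"
      using soft_wt_pos[of i x] by (intro mult_left_mono) auto
    also have "\<dots> = 1 / n - ?w + ?w * ln n" using soft_wt_pos[of i x] n by (simp add: field_simps)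
    finally have "?w * - ln ?w / b \<le> (1 / n - ?w + ?w * ln n) / b" using b by (intro divide_right_mono) auto
    then show ?thesis unfolding soft_max_diff by (simp add: add_divide_distrib)
  qed
  then have "(\<Sum>i<n. soft_wt n b i x * (soft_max n b x - x i)) \<le> (\<Sum>i<n. (1 / n - soft_wt n b i x) / b + soft_wt n b i x * (ln n / b))"
    by (intro sum_mono)
  also have "\<dots> = ln n / b"
    using n by (simp add: sum.distrib sum_subtractf sum_soft_wt flip: sum_divide_distrib sum_distrib_right)
  finally show "soft_max n b x - (\<Sum>i<n. soft_wt n b i x * x i) \<le> ln n / b" unfolding eq .
qed

text \<open>The sum is the variance of a random vector taking the value \<open>v i\<close> with
  probability \<open>soft_wt n b i x\<close>.\<close>

lemma soft_variance_nonneg: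
  fixes v :: "nat \<Rightarrow> 'a::real_inner"
  shows "0 \<le> (\<Sum>i<n. soft_wt n b i x * (v i \<bullet> v i - (\<Sum>j<n. soft_wt n b j x * (v j \<bullet> v i))))"
proof -
  define w where "w i = soft_wt n b i x" for i
  define m where "m = (\<Sum>j<n. w j *\<^sub>R v j)"
  have m: "(\<Sum>j<n. w j * (v j \<bullet> y)) = m \<bullet> y" for y by (simp add: m_def inner_sum_left)
  have s: "(\<Sum>i<n. w i) = 1" by (simp add: w_def sum_soft_wt)
  have "0 \<le> (\<Sum>i<n. w i * ((v i - m) \<bullet> (v i - m)))"
    using soft_wt_pos by (intro sum_nonneg mult_nonneg_nonneg) (auto simp: w_def less_imp_le)
  also have "\<dots> = (\<Sum>i<n. w i * (v i \<bullet> v i - m \<bullet> v i)) - (\<Sum>i<n. w i * (v i \<bullet> m)) + (\<Sum>i<n. w i) * (m \<bullet> m)"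
    by (simp add: sum_distrib_right inner_diff_left inner_diff_right inner_commute flip: sum_subtractf sum.distrib)
      (auto intro!: sum.cong simp: algebra_simps)
  finally show ?thesis unfolding s m by (simp add: m w_def[symmetric])
qed

lemma soft_sum_deriv:
  assumes "j < n"
  shows "((\<lambda>t. \<Sum>i<n. exp (b * (x(j := t)) i)) has_real_derivative b * exp (b * x j)) (at (x j))"
proof -
  have "((\<lambda>t. \<Sum>i<n. exp (b * (x(j := t)) i)) has_real_derivative (\<Sum>i<n. if i = j then b * exp (b * x j) else 0)) (at (x j))"
    by (rule DERIV_sum) (auto intro!: derivative_eq_intros)
  then show ?thesis using assms by simp
qed

lemma soft_max_partial:
  assumes j: "j < n"
  shows "((\<lambda>t. soft_max n b (x(j := t))) has_real_derivative soft_wt n b j x) (at (x j))"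
proof -
  have "((\<lambda>t. ln (\<Sum>i<n. exp (b * (x(j := t)) i)) / b) has_real_derivative
     (1 / (\<Sum>i<n. exp (b * (x(j := x j)) i)) * (b * exp (b * x j))) / b) (at (x j))"
    by (intro DERIV_cdivide DERIV_chain2[of ln] soft_sum_deriv[OF j])
      (use soft_denominator_pos in \<open>auto intro!: derivative_eq_intros simp: divide_inverse\<close>)
  then show ?thesis using b by (simp add: soft_max_def soft_wt_def)
qed

lemma soft_wt_partial:
  assumes j: "j < n"
  shows "((\<lambda>t. soft_wt n b i (x(j := t))) has_real_derivative
    b * soft_wt n b i x * ((if i = j then 1 else 0) - soft_wt n b j x)) (at (x j))"
proof -
  have "((\<lambda>t. exp (b * (x(j := t)) i)) has_real_derivative (if i = j then b * exp (b * x j) else 0)) (at (x j))"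
    by (auto intro!: derivative_eq_intros)
  from DERIV_divide[OF this soft_sum_deriv[OF j, of x]]
  have "((\<lambda>t. soft_wt n b i (x(j := t))) has_real_derivative
     ((if i = j then b * exp (b * x j) else 0) * (\<Sum>i<n. exp (b * x i)) - exp (b * x i) * (b * exp (b * x j))) /
     ((\<Sum>i<n. exp (b * x i)) * (\<Sum>i<n. exp (b * x i)))) (at (x j))"
    using soft_denominator_pos[of x] by (simp add: soft_wt_def)
  moreover have "((if i = j then b * exp (b * x j) else 0) * (\<Sum>i<n. exp (b * x i)) - exp (b * x i) * (b * exp (b * x j))) /
     ((\<Sum>i<n. exp (b * x i)) * (\<Sum>i<n. exp (b * x i))) = b * soft_wt n b i x * ((if i = j then 1 else 0) - soft_wt n b j x)"
    using soft_denominator_pos[of x] by (simp add: soft_wt_def field_simps)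
  ultimately show ?thesis by simp
qed

lemma continuous_soft_wt: "continuous_on UNIV (soft_wt n b i)"
  unfolding soft_wt_def[abs_def] using soft_denominator_pos
  by (intro continuous_intros) (auto simp: less_imp_neq[symmetric] intro: order.strict_implies_not_eq)

lemma continuous_soft_max: "continuous_on UNIV (soft_max n b)"
  unfolding soft_max_def[abs_def] using soft_denominator_pos b
  by (intro continuous_intros) (auto simp: less_imp_neq[symmetric] intro: order.strict_implies_not_eq)

text \<open>The algebra generated by the weights is closed under partial derivatives and consists of
  bounded continuous functions. All iterated partial derivatives of \<open>soft_max\<close> of
  positive order lie in it, which settles smoothness and growth at once.\<close>

inductive soft_poly :: "((nat \<Rightarrow> real) \<Rightarrow> real) \<Rightarrow> bool" where
  const: "soft_poly (\<lambda>_. c)"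
| wt: "i < n \<Longrightarrow> soft_poly (soft_wt n b i)"
| add: "soft_poly f \<Longrightarrow> soft_poly g \<Longrightarrow> soft_poly (\<lambda>x. f x + g x)"
| mult: "soft_poly f \<Longrightarrow> soft_poly g \<Longrightarrow> soft_poly (\<lambda>x. f x * g x)"

lemma soft_poly_continuous: "soft_poly f \<Longrightarrow> continuous_on UNIV f"
  by (induction rule: soft_poly.induct) (auto intro!: continuous_intros continuous_soft_wt)

lemma soft_poly_bounded: "soft_poly f \<Longrightarrow> \<exists>B. \<forall>x. \<bar>f x\<bar> \<le> B"
proof (induction rule: soft_poly.induct)
  case (wt i)
  then show ?case using soft_wt_le_1 soft_wt_pos by (intro exI[of _ 1]) (simp add: less_imp_le)
next
  case (add f g)
  then obtain B C where "\<forall>x. \<bar>f x\<bar> \<le> B" "\<forall>x. \<bar>g x\<bar> \<le> C" by blast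
  then show ?case by (intro exI[of _ "B + C"]) (auto intro: order_trans[OF abs_triangle_ineq] add_mono)
next
  case (mult f g)
  then obtain B C where "\<forall>x. \<bar>f x\<bar> \<le> B" "\<forall>x. \<bar>g x\<bar> \<le> C" by blast
  then show ?case by (intro exI[of _ "B * C"]) (auto simp: abs_mult intro!: mult_mono intro: order_trans[OF abs_ge_zero])
qed auto

lemma soft_poly_partial:
  "soft_poly f \<Longrightarrow> j < n \<Longrightarrow> \<exists>f'. soft_poly f' \<and> (\<forall>x. ((\<lambda>t. f (x(j := t))) has_real_derivative f' x) (at (x j)))"
proof (induction rule: soft_poly.induct)
  case (const c)
  then show ?case by (intro exI[of _ "\<lambda>_. 0"]) (auto intro: soft_poly.const)
next
  case (wt i)
  have "soft_poly (\<lambda>x. b * soft_wt n b i x * ((if i = j then 1 else 0) + (- 1) * soft_wt n b j x))"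
    using wt by (intro soft_poly.intros)
  then have "soft_poly (\<lambda>x. b * soft_wt n b i x * ((if i = j then 1 else 0) - soft_wt n b j x))"
    by (simp only: mult_minus1 add_uminus_conv_diff)
  then show ?case using soft_wt_partial[OF wt(2), of i] by blast
next
  case (add f g)
  then obtain f' g' where *: "soft_poly f'" "soft_poly g'"
    "\<forall>x. ((\<lambda>t. f (x(j := t))) has_real_derivative f' x) (at (x j))" "\<forall>x. ((\<lambda>t. g (x(j := t))) has_real_derivative g' x) (at (x j))"
    by blast
  have "((\<lambda>t. f (x(j := t)) + g (x(j := t))) has_real_derivative f' x + g' x) (at (x j))" for x
    by (rule DERIV_add[OF *(3)[THEN spec, of x] *(4)[THEN spec, of x]])
  then show ?case using soft_poly.add[OF *(1,2)] by blast
next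
  case (mult f g)
  then obtain f' g' where *: "soft_poly f'" "soft_poly g'"
    "\<forall>x. ((\<lambda>t. f (x(j := t))) has_real_derivative f' x) (at (x j))" "\<forall>x. ((\<lambda>t. g (x(j := t))) has_real_derivative g' x) (at (x j))"
    by blast
  have "((\<lambda>t. f (x(j := t)) * g (x(j := t))) has_real_derivative f' x * g x + g' x * f x) (at (x j))" for x
    using DERIV_mult[OF *(3)[THEN spec, of x] *(4)[THEN spec, of x]] by simp
  moreover have "soft_poly (\<lambda>x. f' x * g x + g' x * f x)"
    by (intro soft_poly.add soft_poly.mult *(1,2) mult.hyps)
  ultimately show ?case by blast
qed

lemma partial_deriv_eqI:
  assumes "\<And>x. ((\<lambda>t. f (x(j := t))) has_real_derivative f' x) (at (x j))"
  shows "partial_deriv j f = f'"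
  unfolding partial_deriv_def using assms by (auto intro: DERIV_imp_deriv)

lemma iterated_partial_deriv_soft_max:
  "set js \<subseteq> {..<n} \<Longrightarrow> js = [] \<or> soft_poly (iterated_partial_deriv js (soft_max n b))"
proof (induction js)
  case (Cons j js)
  show ?case
  proof (cases "js = []")
    case True
    then show ?thesis
      using Cons partial_deriv_eqI[OF soft_max_partial, of j] by (auto simp: iterated_partial_deriv_def intro: soft_poly.wt)
  next
    case False
    with Cons have "soft_poly (iterated_partial_deriv js (soft_max n b))" by auto
    from soft_poly_partial[OF this, of j] Cons obtain f' where "soft_poly f'"
      "\<forall>x. ((\<lambda>t. iterated_partial_deriv js (soft_max n b) (x(j := t))) has_real_derivative f' x) (at (x j))" by auto
    then show ?thesis using partial_deriv_eqI[of "iterated_partial_deriv js (soft_max n b)" j f']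
      by (simp add: iterated_partial_deriv_def)
  qed
qed simp

lemma soft_max_bound: "\<bar>soft_max n b x\<bar> \<le> (1 + ln n / b) * (1 + (\<Sum>i<n. \<bar>x i\<bar>)) ^ 1"
proof -
  let ?S = "\<Sum>i<n. \<bar>x i\<bar>"
  have S: "\<bar>x i\<bar> \<le> ?S" if "i < n" for i by (rule member_le_sum) (use that in auto)
  have l: "0 \<le> ln n / b" using n b by (intro divide_nonneg_pos) auto
  have "soft_max n b x \<le> ?S + ln n / b"
    using S by (intro soft_max_le) (auto intro: order_trans[OF abs_ge_self])
  moreover have "- ?S \<le> soft_max n b x"
    using soft_max_ge[of 0 x] S[of 0] n by linarith
  moreover have S0: "0 \<le> ?S" by (rule sum_nonneg) auto
  moreover have "0 \<le> ln n / b * ?S" by (rule mult_nonneg_nonneg[OF l S0])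
  ultimately show ?thesis using l by (simp add: algebra_simps abs_le_iff)
qed

lemma smooth_soft_max: "smooth_poly_growth n (soft_max n b)"
  unfolding smooth_poly_growth_def Let_def
proof (intro conjI allI impI)
  show "soft_max n b x = soft_max n b y" if "\<forall>i<n. x i = y i" for x y
    using that by (simp add: soft_max_def)
next
  fix js assume js: "set js \<subseteq> {..<n}"
  let ?g = "iterated_partial_deriv js (soft_max n b)"
  have c: "js = [] \<or> soft_poly ?g" by (rule iterated_partial_deriv_soft_max[OF js])
  have e: "js = [] \<Longrightarrow> ?g = soft_max n b" by (simp add: iterated_partial_deriv_def)
  show "continuous_on UNIV ?g" using c e soft_poly_continuous continuous_soft_max by auto
  show "(\<lambda>t. ?g (x(i := t))) differentiable (at (x i))" if "i < n" for i x
    using c e soft_poly_partial[OF _ that] soft_max_partial[OF that] real_differentiable_def by metis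
  show "\<exists>c p. \<forall>x. \<bar>?g x\<bar> \<le> c * (1 + (\<Sum>i<n. \<bar>x i\<bar>)) ^ p"
  proof (cases "js = []")
    case True
    then show ?thesis using soft_max_bound unfolding e[OF True] by blast
  next
    case False
    then obtain B where "\<forall>x. \<bar>?g x\<bar> \<le> B" using c soft_poly_bounded by blast
    then show ?thesis by (intro exI[of _ B] exI[of _ 0]) auto
  qed
qed

lemma partial_deriv_soft_max: "j < n \<Longrightarrow> partial_deriv j (soft_max n b) = soft_wt n b j"
  by (rule partial_deriv_eqI[OF soft_max_partial])

lemma path_deriv_soft_wt:
  fixes v :: "nat \<Rightarrow> 'a::real_inner"
  assumes i: "i < n"
  shows "path_deriv u (\<lambda>x. soft_wt n b i (\<lambda>k. x (v k)))
    (\<lambda>x. b * soft_wt n b i (\<lambda>k. x (v k)) * (v i \<bullet> u - (\<Sum>j<n. soft_wt n b j (\<lambda>k. x (v k)) * (v j \<bullet> u))))"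
proof -
  let ?g = "\<lambda>j x. b * soft_wt n b i x * ((if i = j then 1 else 0) - soft_wt n b j x)"
  have "path_deriv u (\<lambda>x. soft_wt n b i (\<lambda>k. x (v k))) (\<lambda>x. \<Sum>j<n. ?g j (\<lambda>k. x (v k)) * (v j \<bullet> u))"
  proof (rule path_deriv_pullback)
    show "soft_wt n b i x = soft_wt n b i y" if "\<And>i. i < n \<Longrightarrow> x i = y i" for x y
      using that i by (simp add: soft_wt_def)
    show "exp_bound n (soft_wt n b i)"
      by (rule exp_boundI_bounded[of _ 1]) (use soft_wt_le_1[OF i] soft_wt_pos in \<open>simp add: less_imp_le\<close>)
    fix j assume j: "j < n"
    show "continuous_on UNIV (?g j)" by (intro continuous_intros continuous_soft_wt)
    have "soft_poly (\<lambda>x. b * soft_wt n b i x * ((if i = j then 1 else 0) + (- 1) * soft_wt n b j x))"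
      using i j by (intro soft_poly.intros)
    then obtain B where "\<And>x. \<bar>?g j x\<bar> \<le> B" using soft_poly_bounded by fastforce
    then show "exp_bound n (?g j)" by (rule exp_boundI_bounded)
  qed (rule soft_wt_partial continuous_soft_wt, assumption?)+
  moreover have "(\<Sum>j<n. ?g j y * (v j \<bullet> u)) = b * soft_wt n b i y * (v i \<bullet> u - (\<Sum>j<n. soft_wt n b j y * (v j \<bullet> u)))" for y
  proof -
    have "(\<Sum>j<n. ?g j y * (v j \<bullet> u)) = (\<Sum>j<n. (if i = j then b * soft_wt n b i y * (v j \<bullet> u) else 0) - b * soft_wt n b i y * (soft_wt n b j y * (v j \<bullet> u)))"
      by (intro sum.cong) (auto simp: algebra_simps)
    then show ?thesis using i by (simp add: sum_subtractf right_diff_distrib flip: sum_distrib_left)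
  qed
  ultimately show ?thesis by simp
qed

end

section \<open>Uniqueness of the Malliavin derivative\<close>

text \<open>The convergence occurring in \<open>malliavin_graph\<close>, stated once for real and
  for vector values.\<close>

definition l2_lim :: "'w measure \<Rightarrow> (nat \<Rightarrow> 'w \<Rightarrow> 'b::real_normed_vector) \<Rightarrow> ('w \<Rightarrow> 'b) \<Rightarrow> bool" where
  "l2_lim M \<phi>s \<phi> \<longleftrightarrow> (\<lambda>k. \<integral>\<^sup>+\<omega>. ennreal ((norm (\<phi>s k \<omega> - \<phi> \<omega>))\<^sup>2) \<partial>M) \<longlonglongrightarrow> 0"

lemma square_integrableD:
  assumes "square_integrable M \<phi>"
  shows "\<phi> \<in> borel_measurable M" "integrable M (\<lambda>\<omega>. (norm (\<phi> \<omega>))\<^sup>2)"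
  using assms by (auto simp: square_integrable_def)

lemma integrable_inner_square_integrable:
  fixes \<phi> \<psi> :: "'w \<Rightarrow> 'b::{real_inner, second_countable_topology}"
  assumes "square_integrable M \<phi>" "square_integrable M \<psi>"
  shows "integrable M (\<lambda>\<omega>. \<phi> \<omega> \<bullet> \<psi> \<omega>)"
proof (rule Bochner_Integration.integrable_bound[OF Bochner_Integration.integrable_add[OF
      assms[THEN square_integrableD(2)]]])
  note [measurable] = assms[THEN square_integrableD(1)]
  show "(\<lambda>\<omega>. \<phi> \<omega> \<bullet> \<psi> \<omega>) \<in> borel_measurable M" by measurable
  have "\<bar>x \<bullet> y\<bar> \<le> (norm x)\<^sup>2 + (norm y)\<^sup>2" for x y :: 'b
  proof -
    have "2 * \<bar>x \<bullet> y\<bar> \<le> 2 * (norm x * norm y)" using Cauchy_Schwarz_ineq2[of x y] by simp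
    also have "\<dots> \<le> (norm x)\<^sup>2 + (norm y)\<^sup>2" using sum_squares_bound[of "norm x" "norm y"] by simp
    finally show ?thesis using zero_le_power2[of "norm x"] zero_le_power2[of "norm y"] by linarith
  qed
  then show "AE \<omega> in M. norm (\<phi> \<omega> \<bullet> \<psi> \<omega>) \<le> norm ((norm (\<phi> \<omega>))\<^sup>2 + (norm (\<psi> \<omega>))\<^sup>2)"
    by (intro AE_I2) simp
qed

lemma square_integrable_scaleR_const:
  fixes v :: "'b::{real_inner, second_countable_topology}"
  assumes "square_integrable M g"
  shows "square_integrable M (\<lambda>\<omega>. (g \<omega> :: real) *\<^sub>R v)"
  using assms unfolding square_integrable_def
  by (auto simp: power_mult_distrib intro!: integrable_mult_left)

lemma square_integrable_cmult:
  fixes \<phi> :: "'w \<Rightarrow> 'b::{real_inner, second_countable_topology}"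
  assumes "square_integrable M \<phi>"
  shows "square_integrable M (\<lambda>\<omega>. (c::real) *\<^sub>R \<phi> \<omega>)"
  using assms unfolding square_integrable_def
  by (auto simp: power_mult_distrib intro!: integrable_mult_right)

lemma square_integrable_bound:
  fixes \<phi> :: "'w \<Rightarrow> 'b::{real_inner, second_countable_topology}" and \<psi> :: "'w \<Rightarrow> 'c::real_normed_vector"
  assumes "square_integrable M \<psi>" "\<phi> \<in> borel_measurable M" "\<And>\<omega>. norm (\<phi> \<omega>) \<le> norm (\<psi> \<omega>)"
  shows "square_integrable M \<phi>"
  unfolding square_integrable_def
proof (intro conjI assms(2) Bochner_Integration.integrable_bound[OF square_integrableD(2)[OF assms(1)]] AE_I2)
  note [measurable] = assms(2)
  show "(\<lambda>\<omega>. (norm (\<phi> \<omega>))\<^sup>2) \<in> borel_measurable M" by measurable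
  show "norm ((norm (\<phi> \<omega>))\<^sup>2) \<le> norm ((norm (\<psi> \<omega>))\<^sup>2)" for \<omega>
    using power_mono[OF assms(3)[of \<omega>], of 2] by simp
qed

lemma square_integrable_add:
  fixes \<phi> \<psi> :: "'w \<Rightarrow> 'b::{real_inner, second_countable_topology}"
  assumes "square_integrable M \<phi>" "square_integrable M \<psi>"
  shows "square_integrable M (\<lambda>\<omega>. \<phi> \<omega> + \<psi> \<omega>)"
proof -
  have "(norm (x + y))\<^sup>2 = (norm x)\<^sup>2 + 2 * (x \<bullet> y) + (norm y)\<^sup>2" for x y :: 'b
    by (simp add: power2_norm_eq_inner inner_add_left inner_add_right inner_commute)
  then show ?thesis
    using assms integrable_inner_square_integrable[OF assms] unfolding square_integrable_def by auto
qed

lemma square_integrable_diff: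
  fixes \<phi> \<psi> :: "'w \<Rightarrow> 'b::{real_inner, second_countable_topology}"
  assumes "square_integrable M \<phi>" "square_integrable M \<psi>"
  shows "square_integrable M (\<lambda>\<omega>. \<phi> \<omega> - \<psi> \<omega>)"
  using square_integrable_add[OF assms(1) square_integrable_cmult[OF assms(2), of "-1"]] by simp

lemma square_integrable_sum:
  fixes \<phi> :: "'i \<Rightarrow> 'w \<Rightarrow> 'b::{real_inner, second_countable_topology}"
  assumes "\<And>i. i \<in> I \<Longrightarrow> square_integrable M (\<phi> i)"
  shows "square_integrable M (\<lambda>\<omega>. \<Sum>i\<in>I. \<phi> i \<omega>)"
  using assms
proof (induction I rule: infinite_finite_induct)
  case (insert i I)
  then show ?case using square_integrable_add[of M "\<phi> i" "\<lambda>\<omega>. \<Sum>i\<in>I. \<phi> i \<omega>"] by simp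
qed (simp_all add: square_integrable_def)

lemma square_integrable_inner_const:
  fixes \<phi> :: "'w \<Rightarrow> 'b::{real_inner, second_countable_topology}"
  assumes "square_integrable M \<phi>"
  shows "square_integrable M (\<lambda>\<omega>. \<phi> \<omega> \<bullet> u)"
  unfolding square_integrable_def
proof (intro conjI)
  note [measurable] = square_integrableD(1)[OF assms]
  show "(\<lambda>\<omega>. \<phi> \<omega> \<bullet> u) \<in> borel_measurable M" by measurable
  have "(norm (\<phi> \<omega> \<bullet> u))\<^sup>2 \<le> (norm (\<phi> \<omega>))\<^sup>2 * (norm u)\<^sup>2" for \<omega>
    using power_mono[OF Cauchy_Schwarz_ineq2[of "\<phi> \<omega>" u], of 2] by (simp add: power_mult_distrib)
  then show "integrable M (\<lambda>\<omega>. (norm (\<phi> \<omega> \<bullet> u))\<^sup>2)"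
    by (intro Bochner_Integration.integrable_bound[OF integrable_mult_left[OF square_integrableD(2)[OF assms], of "(norm u)\<^sup>2"]]) auto
qed

lemma Cauchy_Schwarz_expectation:
  fixes \<phi> \<psi> :: "'w \<Rightarrow> 'b::{real_inner, second_countable_topology}"
  assumes "square_integrable M \<phi>" "square_integrable M \<psi>"
  shows "\<bar>LINT \<omega>|M. \<phi> \<omega> \<bullet> \<psi> \<omega>\<bar> \<le> sqrt (LINT \<omega>|M. (norm (\<phi> \<omega>))\<^sup>2) * sqrt (LINT \<omega>|M. (norm (\<psi> \<omega>))\<^sup>2)"
proof -
  define a where "a = (LINT \<omega>|M. (norm (\<phi> \<omega>))\<^sup>2)"
  define b where "b = (LINT \<omega>|M. (norm (\<psi> \<omega>))\<^sup>2)"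
  define c where "c = (LINT \<omega>|M. \<phi> \<omega> \<bullet> \<psi> \<omega>)"
  note i = assms[THEN square_integrableD(2)] integrable_inner_square_integrable[OF assms]
  have q: "0 \<le> a * s\<^sup>2 + 2 * (s * t) * c + b * t\<^sup>2" for s t
  proof -
    have e: "(norm (s *\<^sub>R \<phi> \<omega> + t *\<^sub>R \<psi> \<omega>))\<^sup>2 = s\<^sup>2 * (norm (\<phi> \<omega>))\<^sup>2 + 2 * (s * t) * (\<phi> \<omega> \<bullet> \<psi> \<omega>) + t\<^sup>2 * (norm (\<psi> \<omega>))\<^sup>2" for \<omega>
      unfolding power2_norm_eq_inner by (simp add: inner_add_left inner_add_right inner_commute algebra_simps power2_eq_square)
    have "0 \<le> (LINT \<omega>|M. (norm (s *\<^sub>R \<phi> \<omega> + t *\<^sub>R \<psi> \<omega>))\<^sup>2)" by simp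
    also have "\<dots> = s\<^sup>2 * a + 2 * (s * t) * c + t\<^sup>2 * b"
      unfolding e using i by (simp add: a_def b_def c_def)
    finally show ?thesis by (simp add: mult.commute)
  qed
  have ab: "0 \<le> a" "0 \<le> b" by (simp_all add: a_def b_def)
  have "c\<^sup>2 \<le> a * b"
  proof (cases "b = 0")
    case True
    have "c = 0"
    proof (rule ccontr)
      assume "c \<noteq> 0"
      \<comment> \<open>This choice of the second variable makes the quadratic form equal to
        -1.\<close>
      have "0 \<le> a * 1\<^sup>2 + 2 * (1 * (- (a + 1) / (2 * c))) * c" using q[of 1 "- (a + 1) / (2 * c)"] True by simp
      with \<open>c \<noteq> 0\<close> show False by (simp add: field_simps)
    qed
    then show ?thesis using True by simp
  next
    case False
    have "0 \<le> a * b\<^sup>2 + 2 * (b * - c) * c + b * (- c)\<^sup>2" by (rule q)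
    also have "\<dots> = b * (a * b - c\<^sup>2)" by (simp add: power2_eq_square algebra_simps)
    finally show ?thesis using ab False by (simp add: zero_le_mult_iff)
  qed
  then have "sqrt (c\<^sup>2) \<le> sqrt (a * b)" by (rule real_sqrt_le_mono)
  then show ?thesis by (simp add: real_sqrt_mult a_def b_def c_def)
qed

lemma l2_lim_iff_integral:
  fixes \<phi> :: "'w \<Rightarrow> 'b::{real_inner, second_countable_topology}"
  assumes "\<And>k. square_integrable M (\<phi>s k)" "square_integrable M \<phi>"
  shows "l2_lim M \<phi>s \<phi> \<longleftrightarrow> (\<lambda>k. LINT \<omega>|M. (norm (\<phi>s k \<omega> - \<phi> \<omega>))\<^sup>2) \<longlonglongrightarrow> 0"
proof -
  have "(\<integral>\<^sup>+\<omega>. ennreal ((norm (\<phi>s k \<omega> - \<phi> \<omega>))\<^sup>2) \<partial>M) = ennreal (LINT \<omega>|M. (norm (\<phi>s k \<omega> - \<phi> \<omega>))\<^sup>2)" for k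
    by (rule nn_integral_eq_integral[OF square_integrableD(2)[OF square_integrable_diff[OF assms]]]) simp
  then show ?thesis
    unfolding l2_lim_def using tendsto_ennreal_iff[of "\<lambda>k. LINT \<omega>|M. (norm (\<phi>s k \<omega> - \<phi> \<omega>))\<^sup>2" sequentially 0]
    by simp
qed

lemma l2_lim_inner:
  fixes \<phi> \<psi> :: "'w \<Rightarrow> 'b::{real_inner, second_countable_topology}"
  assumes \<phi>: "\<And>k. square_integrable M (\<phi>s k)" "square_integrable M \<phi>" "l2_lim M \<phi>s \<phi>"
    and \<psi>: "\<And>k. square_integrable M (\<psi>s k)" "square_integrable M \<psi>" "l2_lim M \<psi>s \<psi>"
  shows "(\<lambda>k. LINT \<omega>|M. \<phi>s k \<omega> \<bullet> \<psi>s k \<omega>) \<longlonglongrightarrow> (LINT \<omega>|M. \<phi> \<omega> \<bullet> \<psi> \<omega>)"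
proof -
  define d where "d k = sqrt (LINT \<omega>|M. (norm (\<phi>s k \<omega> - \<phi> \<omega>))\<^sup>2)" for k
  define e where "e k = sqrt (LINT \<omega>|M. (norm (\<psi>s k \<omega> - \<psi> \<omega>))\<^sup>2)" for k
  define p where "p = sqrt (LINT \<omega>|M. (norm (\<phi> \<omega>))\<^sup>2)"
  define q where "q = sqrt (LINT \<omega>|M. (norm (\<psi> \<omega>))\<^sup>2)"
  have d: "d \<longlonglongrightarrow> 0" using \<phi>(3) tendsto_real_sqrt unfolding d_def l2_lim_iff_integral[OF \<phi>(1,2)] by fastforce
  have e: "e \<longlonglongrightarrow> 0" using \<psi>(3) tendsto_real_sqrt unfolding e_def l2_lim_iff_integral[OF \<psi>(1,2)] by fastforce
  note D = square_integrable_diff[OF \<phi>(1,2)] and E = square_integrable_diff[OF \<psi>(1,2)]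
  have bound: "norm ((LINT \<omega>|M. \<phi>s k \<omega> \<bullet> \<psi>s k \<omega>) - (LINT \<omega>|M. \<phi> \<omega> \<bullet> \<psi> \<omega>)) \<le> d k * e k + d k * q + p * e k" for k
  proof -
    have "\<phi>s k \<omega> \<bullet> \<psi>s k \<omega> = (\<phi>s k \<omega> - \<phi> \<omega>) \<bullet> (\<psi>s k \<omega> - \<psi> \<omega>) + (\<phi>s k \<omega> - \<phi> \<omega>) \<bullet> \<psi> \<omega> + \<phi> \<omega> \<bullet> (\<psi>s k \<omega> - \<psi> \<omega>) + \<phi> \<omega> \<bullet> \<psi> \<omega>" for \<omega>
      by (simp add: inner_diff_left inner_diff_right)
    then have "(LINT \<omega>|M. \<phi>s k \<omega> \<bullet> \<psi>s k \<omega>) = (LINT \<omega>|M. (\<phi>s k \<omega> - \<phi> \<omega>) \<bullet> (\<psi>s k \<omega> - \<psi> \<omega>)) +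
        (LINT \<omega>|M. (\<phi>s k \<omega> - \<phi> \<omega>) \<bullet> \<psi> \<omega>) + (LINT \<omega>|M. \<phi> \<omega> \<bullet> (\<psi>s k \<omega> - \<psi> \<omega>)) + (LINT \<omega>|M. \<phi> \<omega> \<bullet> \<psi> \<omega>)"
      using integrable_inner_square_integrable[OF D[of k] E[of k]] integrable_inner_square_integrable[OF D[of k] \<psi>(2)]
        integrable_inner_square_integrable[OF \<phi>(2) E[of k]] integrable_inner_square_integrable[OF \<phi>(2) \<psi>(2)]
      by simp
    then show ?thesis
      using Cauchy_Schwarz_expectation[OF D[of k] E[of k]] Cauchy_Schwarz_expectation[OF D[of k] \<psi>(2)]
        Cauchy_Schwarz_expectation[OF \<phi>(2) E[of k]]
      by (simp add: d_def e_def p_def q_def)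
  qed
  have "(\<lambda>k. d k * e k + d k * q + p * e k) \<longlonglongrightarrow> 0"
    using d e by (auto intro!: tendsto_eq_intros)
  then have "(\<lambda>k. (LINT \<omega>|M. \<phi>s k \<omega> \<bullet> \<psi>s k \<omega>) - (LINT \<omega>|M. \<phi> \<omega> \<bullet> \<psi> \<omega>)) \<longlonglongrightarrow> 0"
    by (rule Lim_null_comparison[OF always_eventually, rotated]) (rule allI, rule bound)
  then show ?thesis by (simp add: LIM_zero_iff)
qed

lemma l2_lim_const: "l2_lim M (\<lambda>_. \<phi>) \<phi>" by (simp add: l2_lim_def)

lemma l2_lim_inner_const:
  fixes \<phi> :: "'w \<Rightarrow> 'b::{real_inner, second_countable_topology}"
  assumes "\<And>k. square_integrable M (\<phi>s k)" "square_integrable M \<phi>" "l2_lim M \<phi>s \<phi>"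
  shows "l2_lim M (\<lambda>k \<omega>. \<phi>s k \<omega> \<bullet> u) (\<lambda>\<omega>. \<phi> \<omega> \<bullet> u)"
proof -
  note D = square_integrable_diff[OF assms(1,2)]
  have "(\<lambda>k. LINT \<omega>|M. (norm (\<phi>s k \<omega> \<bullet> u - \<phi> \<omega> \<bullet> u))\<^sup>2) \<longlonglongrightarrow> 0"
  proof (rule Lim_null_comparison)
    show "\<forall>\<^sub>F k in sequentially. norm (LINT \<omega>|M. (norm (\<phi>s k \<omega> \<bullet> u - \<phi> \<omega> \<bullet> u))\<^sup>2) \<le> (LINT \<omega>|M. (norm (\<phi>s k \<omega> - \<phi> \<omega>))\<^sup>2) * (norm u)\<^sup>2"
    proof (intro always_eventually allI)
      fix k
      have "(norm (\<phi>s k \<omega> \<bullet> u - \<phi> \<omega> \<bullet> u))\<^sup>2 \<le> (norm (\<phi>s k \<omega> - \<phi> \<omega>))\<^sup>2 * (norm u)\<^sup>2" for \<omega>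
        using power_mono[OF Cauchy_Schwarz_ineq2[of "\<phi>s k \<omega> - \<phi> \<omega>" u], of 2]
        by (simp add: power_mult_distrib inner_diff_left)
      then have "(LINT \<omega>|M. (norm (\<phi>s k \<omega> \<bullet> u - \<phi> \<omega> \<bullet> u))\<^sup>2) \<le> (LINT \<omega>|M. (norm (\<phi>s k \<omega> - \<phi> \<omega>))\<^sup>2 * (norm u)\<^sup>2)"
        using square_integrableD(2)[OF D] square_integrableD(2)[OF square_integrable_inner_const[OF D[of k], of u]]
        by (intro integral_mono) (auto simp: inner_diff_left)
      then show "norm (LINT \<omega>|M. (norm (\<phi>s k \<omega> \<bullet> u - \<phi> \<omega> \<bullet> u))\<^sup>2) \<le> (LINT \<omega>|M. (norm (\<phi>s k \<omega> - \<phi> \<omega>))\<^sup>2) * (norm u)\<^sup>2"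
        by simp
    qed
    show "(\<lambda>k. (LINT \<omega>|M. (norm (\<phi>s k \<omega> - \<phi> \<omega>))\<^sup>2) * (norm u)\<^sup>2) \<longlonglongrightarrow> 0"
      using assms(3) unfolding l2_lim_iff_integral[OF assms(1,2)] by (rule tendsto_mult_left_zero)
  qed
  then show ?thesis
    by (subst l2_lim_iff_integral) (auto intro: square_integrable_inner_const assms)
qed

context isonormal
begin

lemma square_integrable_exp_growth:
  assumes "exp_growth \<Phi>"
  shows "square_integrable M (\<lambda>\<omega>. \<Phi> (\<lambda>v. X v \<omega>))"
  using exp_growth_random_variable[OF assms] integrable_exp_growth[OF exp_growth_mult[OF assms assms]]
  by (simp add: square_integrable_def power2_eq_square)

text \<open>A weak derivative: \<open>Z\<close> is tested through the adjoint of the derivative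
  against smooth functionals of the path. The condition is linear and survives
  \<open>L\<^sup>2\<close> limits of both components, hence passes to the closure of the
  operator.\<close>

definition ibp_pair :: "('w \<Rightarrow> real) \<Rightarrow> ('w \<Rightarrow> 'a) \<Rightarrow> bool" where
  "ibp_pair \<phi> Z \<longleftrightarrow> square_integrable M \<phi> \<and> square_integrable M Z \<and>
     (\<forall>u \<Psi> \<Psi>'. path_deriv u \<Psi> \<Psi>' \<longrightarrow>
        expectation (\<lambda>\<omega>. (Z \<omega> \<bullet> u) * \<Psi> (\<lambda>v. X v \<omega>)) =
        expectation (\<lambda>\<omega>. \<phi> \<omega> * (X u \<omega> * \<Psi> (\<lambda>v. X v \<omega>) - \<Psi>' (\<lambda>v. X v \<omega>))))"

lemma ibp_pairD:
  assumes "ibp_pair \<phi> Z"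
  shows "square_integrable M \<phi>" "square_integrable M Z"
    "path_deriv u \<Psi> \<Psi>' \<Longrightarrow> expectation (\<lambda>\<omega>. (Z \<omega> \<bullet> u) * \<Psi> (\<lambda>v. X v \<omega>)) =
        expectation (\<lambda>\<omega>. \<phi> \<omega> * (X u \<omega> * \<Psi> (\<lambda>v. X v \<omega>) - \<Psi>' (\<lambda>v. X v \<omega>)))"
  using assms unfolding ibp_pair_def by simp_all

text \<open>Integration by parts sees \<open>Z\<close> only through functionals of \<open>X\<close>,
  while \<open>M\<close> may carry further randomness. Lying in the closed span of the cosine
  functionals, componentwise, excludes this; it is expressed by orthogonality and so avoids
  conditional expectations.\<close>

definition path_generated :: "('w \<Rightarrow> 'a) \<Rightarrow> bool" where
  "path_generated Z \<longleftrightarrow> (\<forall>Y u. square_integrable M Y \<longrightarrow> (\<forall>w c. expectation (\<lambda>\<omega>. Y \<omega> * cos (X w \<omega> + c)) = 0) \<longrightarrow>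
     expectation (\<lambda>\<omega>. Y \<omega> * (Z \<omega> \<bullet> u)) = 0)"

lemma path_generatedD:
  assumes "path_generated Z" "square_integrable M Y" "\<forall>w c. expectation (\<lambda>\<omega>. Y \<omega> * cos (X w \<omega> + c)) = 0"
  shows "expectation (\<lambda>\<omega>. Y \<omega> * (Z \<omega> \<bullet> u)) = 0"
  using assms unfolding path_generated_def by simp

text \<open>Write \<open>Y = p - q\<close> with nonnegative parts. Orthogonality to all cosines says
  that the path of \<open>X\<close> has the same cosine integrals under the densities
  \<open>p\<close> and \<open>q\<close>, hence the same law, so every functional of the path has
  equal integrals.\<close>

lemma orthogonal_exp_growth:
  assumes Y: "square_integrable M Y" and orth: "\<And>w c. expectation (\<lambda>\<omega>. Y \<omega> * cos (X w \<omega> + c)) = 0"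
    and \<Phi>: "exp_growth \<Phi>"
  shows "expectation (\<lambda>\<omega>. Y \<omega> * \<Phi> (\<lambda>v. X v \<omega>)) = 0"
proof -
  have [measurable]: "Y \<in> borel_measurable M" "\<Phi> \<in> borel_measurable (PiM UNIV (\<lambda>_. borel))"
    using square_integrableD(1)[OF Y] exp_growth_measurable[OF \<Phi>] by auto
  have intY: "integrable M (\<lambda>\<omega>. Y \<omega> * G \<omega>)" if "square_integrable M G" for G
    using integrable_inner_square_integrable[OF Y that] by simp
  define p where "p \<omega> = max 0 (Y \<omega>)" for \<omega>
  define q where "q \<omega> = max 0 (- Y \<omega>)" for \<omega>
  have [measurable]: "p \<in> borel_measurable M" unfolding p_def by measurable
  have [measurable]: "q \<in> borel_measurable M" unfolding q_def by measurable
  have pq: "Y \<omega> = p \<omega> - q \<omega>" "0 \<le> p \<omega>" "0 \<le> q \<omega>" "\<bar>p \<omega>\<bar> \<le> \<bar>Y \<omega>\<bar>" "\<bar>q \<omega>\<bar> \<le> \<bar>Y \<omega>\<bar>" for \<omega>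
    by (auto simp: p_def q_def)
  have sp: "square_integrable M p" "square_integrable M q"
    by (rule square_integrable_bound[OF Y], simp, simp only: real_norm_def pq(4,5))+
  have ip: "integrable M (\<lambda>\<omega>. p \<omega> * G \<omega>)" "integrable M (\<lambda>\<omega>. q \<omega> * G \<omega>)" if "square_integrable M G" for G
    using integrable_inner_square_integrable[OF sp(1) that] integrable_inner_square_integrable[OF sp(2) that] by auto
  have s1: "square_integrable M (\<lambda>_. 1 :: real)" by (simp add: square_integrable_def)
  have fin: "finite_measure (density M (\<lambda>\<omega>. ennreal (r \<omega>)))" if "\<And>\<omega>. 0 \<le> r \<omega>" "integrable M r" for r
  proof (rule finite_measureI)
    have [measurable]: "r \<in> borel_measurable M" using that by auto
    have "emeasure (density M (\<lambda>\<omega>. ennreal (r \<omega>))) (space (density M (\<lambda>\<omega>. ennreal (r \<omega>)))) = (\<integral>\<^sup>+\<omega>. ennreal (r \<omega>) \<partial>M)"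
      by (subst emeasure_density) (auto intro!: nn_integral_cong)
    also have "\<dots> = ennreal (expectation r)" using that by (intro nn_integral_eq_integral) auto
    finally show "emeasure (density M (\<lambda>\<omega>. ennreal (r \<omega>))) (space (density M (\<lambda>\<omega>. ennreal (r \<omega>)))) \<noteq> \<infinity>" by simp
  qed
  have "distr (density M (\<lambda>\<omega>. ennreal (p \<omega>))) (PiM UNIV (\<lambda>_. borel)) (\<lambda>\<omega>. \<lambda>v\<in>UNIV. X v \<omega>) =
        distr (density M (\<lambda>\<omega>. ennreal (q \<omega>))) (PiM UNIV (\<lambda>_. borel)) (\<lambda>\<omega>. \<lambda>v\<in>UNIV. X v \<omega>)"
  proof (rule distr_PiM_eqI_cos)
    show "finite_measure (density M (\<lambda>\<omega>. ennreal (p \<omega>)))" "finite_measure (density M (\<lambda>\<omega>. ennreal (q \<omega>)))"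
      using fin[of p] fin[of q] pq ip[OF s1] by auto
    fix J :: "'a set" and a c assume J: "finite J"
    let ?g = "\<lambda>\<omega>. cos ((\<Sum>i\<in>J. a i * X i \<omega>) + c)"
    have sg: "square_integrable M ?g"
      unfolding square_integrable_def by (auto intro!: integrable_bounded[of _ 1] simp: abs_square_le_1)
    have "expectation (\<lambda>\<omega>. Y \<omega> * ?g \<omega>) = expectation (\<lambda>\<omega>. Y \<omega> * cos (X (\<Sum>i\<in>J. a i *\<^sub>R i) \<omega> + c))"
      by (rule integral_cong_AE) (use gaussian_field_sum[OF gaussian_field J, of a "\<lambda>i. i"] in \<open>auto elim!: eventually_mono\<close>)
    then have "expectation (\<lambda>\<omega>. p \<omega> * ?g \<omega> - q \<omega> * ?g \<omega>) = 0"
      unfolding orth by (simp add: pq(1) left_diff_distrib)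
    then have "expectation (\<lambda>\<omega>. p \<omega> * ?g \<omega>) = expectation (\<lambda>\<omega>. q \<omega> * ?g \<omega>)"
      using ip[OF sg] by simp
    then show "(LINT \<omega>|density M (\<lambda>\<omega>. ennreal (p \<omega>)). ?g \<omega>) = (LINT \<omega>|density M (\<lambda>\<omega>. ennreal (q \<omega>)). ?g \<omega>)"
      using pq by (simp add: integral_density)
  qed auto
  then have eq: "distr (density M (\<lambda>\<omega>. ennreal (p \<omega>))) (PiM UNIV (\<lambda>_. borel)) (\<lambda>\<omega> v. X v \<omega>) =
        distr (density M (\<lambda>\<omega>. ennreal (q \<omega>))) (PiM UNIV (\<lambda>_. borel)) (\<lambda>\<omega> v. X v \<omega>)"
    by (simp add: restrict_UNIV)
  have i: "(LINT x|distr (density M (\<lambda>\<omega>. ennreal (r \<omega>))) (PiM UNIV (\<lambda>_. borel)) (\<lambda>\<omega> v. X v \<omega>). \<Phi> x) =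
      expectation (\<lambda>\<omega>. r \<omega> * \<Phi> (\<lambda>v. X v \<omega>))" if "\<And>\<omega>. 0 \<le> r \<omega>" "r \<in> borel_measurable M" for r
    using that exp_growth_random_variable[OF \<Phi>] by (subst integral_distr) (auto simp: integral_density)
  have "expectation (\<lambda>\<omega>. p \<omega> * \<Phi> (\<lambda>v. X v \<omega>)) = expectation (\<lambda>\<omega>. q \<omega> * \<Phi> (\<lambda>v. X v \<omega>))"
    using i[of p] i[of q] pq eq by simp
  then show ?thesis
    using ip[OF square_integrable_exp_growth[OF \<Phi>]] by (simp add: pq(1) left_diff_distrib)
qed

text \<open>Apply \<open>integration_by_parts\<close> to the product \<open>\<Phi> * \<Psi>\<close>
  and expand by the product rule.\<close>

lemma ibp_pair_path:
  assumes D: "\<And>u. path_deriv u \<Phi> (\<lambda>x. F x \<bullet> u)" and Z: "square_integrable M (\<lambda>\<omega>. F (\<lambda>v. X v \<omega>))"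
  shows "ibp_pair (\<lambda>\<omega>. \<Phi> (\<lambda>v. X v \<omega>)) (\<lambda>\<omega>. F (\<lambda>v. X v \<omega>))"
  unfolding ibp_pair_def
proof (intro conjI allI impI Z)
  have g: "exp_growth \<Phi>" "exp_growth (\<lambda>x. F x \<bullet> u)" for u using D by (auto simp: path_deriv_def)
  show "square_integrable M (\<lambda>\<omega>. \<Phi> (\<lambda>v. X v \<omega>))" by (rule square_integrable_exp_growth[OF g(1)])
  fix u and \<Psi> \<Psi>' :: "('a \<Rightarrow> real) \<Rightarrow> real" assume \<Psi>: "path_deriv u \<Psi> \<Psi>'"
  then have gp: "exp_growth \<Psi>" "exp_growth \<Psi>'" by (auto simp: path_deriv_def)
  let ?P = "\<lambda>\<omega>. (\<lambda>v. X v \<omega>)"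
  have "expectation (\<lambda>\<omega>. (F (?P \<omega>) \<bullet> u) * \<Psi> (?P \<omega>) + \<Phi> (?P \<omega>) * \<Psi>' (?P \<omega>)) = expectation (\<lambda>\<omega>. X u \<omega> * (\<Phi> (?P \<omega>) * \<Psi> (?P \<omega>)))"
    by (rule integration_by_parts[OF path_deriv_mult[OF D \<Psi>]])
  moreover have "integrable M (\<lambda>\<omega>. (F (?P \<omega>) \<bullet> u) * \<Psi> (?P \<omega>))" "integrable M (\<lambda>\<omega>. \<Phi> (?P \<omega>) * \<Psi>' (?P \<omega>))"
    by (rule integrable_exp_growth[OF exp_growth_mult[OF g(2) gp(1)]]) (rule integrable_exp_growth[OF exp_growth_mult[OF g(1) gp(2)]])
  moreover have "integrable M (\<lambda>\<omega>. X u \<omega> * (\<Phi> (?P \<omega>) * \<Psi> (?P \<omega>)))"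
    by (rule integrable_exp_growth[OF exp_growth_mult[OF exp_growth_coordinate exp_growth_mult[OF g(1) gp(1)]]])
  ultimately show "expectation (\<lambda>\<omega>. (F (?P \<omega>) \<bullet> u) * \<Psi> (?P \<omega>)) = expectation (\<lambda>\<omega>. \<Phi> (?P \<omega>) * (X u \<omega> * \<Psi> (?P \<omega>) - \<Psi>' (?P \<omega>)))"
    by (simp add: right_diff_distrib mult.left_commute)
qed

lemma smooth_rv_deriv_props:
  assumes "smooth_rv_deriv X \<phi> Z"
  shows "ibp_pair \<phi> Z" "path_generated Z" "square_integrable M \<phi>" "square_integrable M Z"
proof -
  from assms obtain n f v where f: "smooth_poly_growth n f" and \<phi>: "\<phi> = (\<lambda>\<omega>. f (\<lambda>i. X (v i) \<omega>))"
    and Z: "Z = (\<lambda>\<omega>. \<Sum>j<n. partial_deriv j f (\<lambda>i. X (v i) \<omega>) *\<^sub>R v j)"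
    unfolding smooth_rv_deriv_def by blast
  define \<Phi> where "\<Phi> x = f (\<lambda>i. x (v i))" for x :: "'a \<Rightarrow> real"
  define \<Phi>' where "\<Phi>' u x = (\<Sum>j<n. partial_deriv j f (\<lambda>i. x (v i)) * (v j \<bullet> u))" for u :: 'a and x :: "'a \<Rightarrow> real"
  have D: "path_deriv u \<Phi> (\<Phi>' u)" for u :: 'a
    unfolding \<Phi>_def[abs_def] \<Phi>'_def[abs_def] by (rule path_deriv_smooth[OF f])
  then have g: "exp_growth \<Phi>" "exp_growth (\<Phi>' u)" for u by (auto simp: path_deriv_def)
  have \<phi>': "\<phi> = (\<lambda>\<omega>. \<Phi> (\<lambda>v. X v \<omega>))" by (simp add: \<phi> \<Phi>_def)
  have Z': "Z \<omega> \<bullet> u = \<Phi>' u (\<lambda>v. X v \<omega>)" for \<omega> u by (simp add: Z \<Phi>'_def inner_sum_left)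
  show s1: "square_integrable M \<phi>" unfolding \<phi>' by (rule square_integrable_exp_growth[OF g(1)])
  have "exp_growth (\<lambda>x. partial_deriv j f (\<lambda>i. x (v i)))" if "j < n" for j
    by (rule exp_growth_pullback') (use smooth_poly_growthD(4,6)[OF f that] in auto)
  then show s2: "square_integrable M Z" unfolding Z
    by (intro square_integrable_sum square_integrable_scaleR_const) (use square_integrable_exp_growth in fastforce)
  show "path_generated Z"
    unfolding path_generated_def Z' by (intro allI impI orthogonal_exp_growth[OF _ _ g(2)]) simp_all
  define F where "F x = (\<Sum>j<n. partial_deriv j f (\<lambda>i. x (v i)) *\<^sub>R v j)" for x :: "'a \<Rightarrow> real"
  have F: "F x \<bullet> u = \<Phi>' u x" for x u by (simp add: F_def \<Phi>'_def inner_sum_left)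
  have Z'': "Z = (\<lambda>\<omega>. F (\<lambda>v. X v \<omega>))" by (simp add: Z F_def)
  show "ibp_pair \<phi> Z"
    unfolding \<phi>' Z'' by (rule ibp_pair_path) (use D s2 in \<open>simp_all add: F flip: Z''\<close>)
qed

lemma ibp_pair_add:
  assumes "ibp_pair \<phi> Z" "ibp_pair \<psi> W"
  shows "ibp_pair (\<lambda>\<omega>. \<phi> \<omega> + \<psi> \<omega>) (\<lambda>\<omega>. Z \<omega> + W \<omega>)"
  unfolding ibp_pair_def
proof (intro conjI allI impI)
  have s: "square_integrable M \<phi>" "square_integrable M \<psi>" "square_integrable M Z" "square_integrable M W"
    using assms by (auto simp: ibp_pair_def)
  then show "square_integrable M (\<lambda>\<omega>. \<phi> \<omega> + \<psi> \<omega>)" "square_integrable M (\<lambda>\<omega>. Z \<omega> + W \<omega>)"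
    by (auto intro: square_integrable_add)
  fix u and \<Psi> \<Psi>' :: "('a \<Rightarrow> real) \<Rightarrow> real" assume \<Psi>: "path_deriv u \<Psi> \<Psi>'"
  then have gp: "exp_growth \<Psi>" "exp_growth \<Psi>'" by (auto simp: path_deriv_def)
  let ?P = "\<lambda>\<omega>. (\<lambda>v. X v \<omega>)"
  let ?t = "\<lambda>\<omega>. X u \<omega> * \<Psi> (?P \<omega>) - \<Psi>' (?P \<omega>)"
  have t: "square_integrable M ?t"
    by (rule square_integrable_exp_growth[OF exp_growth_diff[OF exp_growth_mult[OF exp_growth_coordinate gp(1)] gp(2)]])
  note P = square_integrable_exp_growth[OF gp(1)]
  have "integrable M (\<lambda>\<omega>. \<phi> \<omega> * ?t \<omega>)" "integrable M (\<lambda>\<omega>. \<psi> \<omega> * ?t \<omega>)"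
    using integrable_inner_square_integrable[OF s(1) t] integrable_inner_square_integrable[OF s(2) t] by auto
  moreover have "integrable M (\<lambda>\<omega>. (Z \<omega> \<bullet> u) * \<Psi> (?P \<omega>))" "integrable M (\<lambda>\<omega>. (W \<omega> \<bullet> u) * \<Psi> (?P \<omega>))"
    using integrable_inner_square_integrable[OF square_integrable_inner_const[OF s(3)] P]
      integrable_inner_square_integrable[OF square_integrable_inner_const[OF s(4)] P] by auto
  moreover have "expectation (\<lambda>\<omega>. (Z \<omega> \<bullet> u) * \<Psi> (?P \<omega>)) = expectation (\<lambda>\<omega>. \<phi> \<omega> * ?t \<omega>)"
    "expectation (\<lambda>\<omega>. (W \<omega> \<bullet> u) * \<Psi> (?P \<omega>)) = expectation (\<lambda>\<omega>. \<psi> \<omega> * ?t \<omega>)"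
    by (rule ibp_pairD(3)[OF assms(1) \<Psi>], rule ibp_pairD(3)[OF assms(2) \<Psi>])
  ultimately show "expectation (\<lambda>\<omega>. ((Z \<omega> + W \<omega>) \<bullet> u) * \<Psi> (?P \<omega>)) = expectation (\<lambda>\<omega>. (\<phi> \<omega> + \<psi> \<omega>) * ?t \<omega>)"
    by (simp add: inner_add_left distrib_right)
qed

lemma ibp_pair_const: "ibp_pair (\<lambda>_. c) (\<lambda>_. 0)"
  unfolding ibp_pair_def
proof (intro conjI allI impI)
  fix u and \<Psi> \<Psi>' :: "('a \<Rightarrow> real) \<Rightarrow> real" assume \<Psi>: "path_deriv u \<Psi> \<Psi>'"
  then have gp: "exp_growth \<Psi>" "exp_growth \<Psi>'" by (auto simp: path_deriv_def)
  show "expectation (\<lambda>\<omega>. (0 \<bullet> u) * \<Psi> (\<lambda>v. X v \<omega>)) = expectation (\<lambda>\<omega>. c * (X u \<omega> * \<Psi> (\<lambda>v. X v \<omega>) - \<Psi>' (\<lambda>v. X v \<omega>)))"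
    using integration_by_parts[OF \<Psi>] integrable_exp_growth[OF gp(2)]
      integrable_exp_growth[OF exp_growth_mult[OF exp_growth_coordinate gp(1)]] by simp
qed (auto simp: square_integrable_def)

lemma malliavin_graph_alt:
  "malliavin_graph M X \<phi> Z \<longleftrightarrow> square_integrable M \<phi> \<and> square_integrable M Z \<and>
    (\<exists>\<phi>s Zs. (\<forall>k. smooth_rv_deriv X (\<phi>s k) (Zs k)) \<and> l2_lim M \<phi>s \<phi> \<and> l2_lim M Zs Z)"
  by (simp add: malliavin_graph_def l2_lim_def)

lemma ibp_pair_lim:
  assumes p: "\<And>k. ibp_pair (\<phi>s k) (Zs k)" and s: "square_integrable M \<phi>" "square_integrable M Z"
    and l: "l2_lim M \<phi>s \<phi>" "l2_lim M Zs Z"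
  shows "ibp_pair \<phi> Z"
  unfolding ibp_pair_def
proof (intro conjI allI impI s)
  fix u and \<Psi> \<Psi>' :: "('a \<Rightarrow> real) \<Rightarrow> real" assume \<Psi>: "path_deriv u \<Psi> \<Psi>'"
  then have gp: "exp_growth \<Psi>" "exp_growth \<Psi>'" by (auto simp: path_deriv_def)
  let ?P = "\<lambda>\<omega>. (\<lambda>v. X v \<omega>)"
  let ?t = "\<lambda>\<omega>. X u \<omega> * \<Psi> (?P \<omega>) - \<Psi>' (?P \<omega>)"
  have t: "square_integrable M ?t"
    by (rule square_integrable_exp_growth[OF exp_growth_diff[OF exp_growth_mult[OF exp_growth_coordinate gp(1)] gp(2)]])
  note P = square_integrable_exp_growth[OF gp(1)]
  have sk: "square_integrable M (\<phi>s k)" "square_integrable M (Zs k)" for k using p by (auto simp: ibp_pair_def)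
  have 1: "(\<lambda>k. expectation (\<lambda>\<omega>. (Zs k \<omega> \<bullet> u) * \<Psi> (?P \<omega>))) \<longlonglongrightarrow> expectation (\<lambda>\<omega>. (Z \<omega> \<bullet> u) * \<Psi> (?P \<omega>))"
    using l2_lim_inner[OF square_integrable_inner_const[OF sk(2)] square_integrable_inner_const[OF s(2)]
        l2_lim_inner_const[OF sk(2) s(2) l(2)] P P l2_lim_const, of u] by simp
  have 2: "(\<lambda>k. expectation (\<lambda>\<omega>. \<phi>s k \<omega> * ?t \<omega>)) \<longlonglongrightarrow> expectation (\<lambda>\<omega>. \<phi> \<omega> * ?t \<omega>)"
    using l2_lim_inner[OF sk(1) s(1) l(1) t t l2_lim_const] by simp
  have "expectation (\<lambda>\<omega>. (Zs k \<omega> \<bullet> u) * \<Psi> (?P \<omega>)) = expectation (\<lambda>\<omega>. \<phi>s k \<omega> * ?t \<omega>)" for k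
    by (rule ibp_pairD(3)[OF p \<Psi>])
  with 1 2 show "expectation (\<lambda>\<omega>. (Z \<omega> \<bullet> u) * \<Psi> (?P \<omega>)) = expectation (\<lambda>\<omega>. \<phi> \<omega> * ?t \<omega>)"
    by (simp only:) (rule LIMSEQ_unique)
qed

lemma path_generated_lim:
  assumes p: "\<And>k. path_generated (Zs k)" and s: "\<And>k. square_integrable M (Zs k)" "square_integrable M Z"
    and l: "l2_lim M Zs Z"
  shows "path_generated Z"
  unfolding path_generated_def
proof (intro allI impI)
  fix Y u assume Y: "square_integrable M Y" "\<forall>w c. expectation (\<lambda>\<omega>. Y \<omega> * cos (X w \<omega> + c)) = 0"
  have "(\<lambda>k. expectation (\<lambda>\<omega>. Y \<omega> * (Zs k \<omega> \<bullet> u))) \<longlonglongrightarrow> expectation (\<lambda>\<omega>. Y \<omega> * (Z \<omega> \<bullet> u))"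
    using l2_lim_inner[OF Y(1) Y(1) l2_lim_const square_integrable_inner_const[OF s(1)] square_integrable_inner_const[OF s(2)]
        l2_lim_inner_const[OF s l], of u] by simp
  moreover have "expectation (\<lambda>\<omega>. Y \<omega> * (Zs k \<omega> \<bullet> u)) = 0" for k
    by (rule path_generatedD[OF p Y])
  ultimately show "expectation (\<lambda>\<omega>. Y \<omega> * (Z \<omega> \<bullet> u)) = 0" by (simp add: LIMSEQ_const_iff)
qed

lemma malliavin_graphD:
  assumes "malliavin_graph M X \<phi> Z"
  shows "ibp_pair \<phi> Z" "path_generated Z" "square_integrable M \<phi>" "square_integrable M Z"
proof -
  from assms obtain \<phi>s Zs where *: "square_integrable M \<phi>" "square_integrable M Z"
    "\<And>k. smooth_rv_deriv X (\<phi>s k) (Zs k)" "l2_lim M \<phi>s \<phi>" "l2_lim M Zs Z"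
    unfolding malliavin_graph_alt by blast
  show "ibp_pair \<phi> Z"
    by (rule ibp_pair_lim[OF smooth_rv_deriv_props(1)[OF *(3)] *(1,2,4,5)])
  show "path_generated Z"
    by (rule path_generated_lim[OF smooth_rv_deriv_props(2,4)[OF *(3)] *(2,5)])
qed (use assms in \<open>auto simp: malliavin_graph_def\<close>)

lemma path_generated_add:
  assumes "path_generated Z" "path_generated W" "square_integrable M Z" "square_integrable M W"
  shows "path_generated (\<lambda>\<omega>. Z \<omega> + W \<omega>)"
  unfolding path_generated_def
proof (intro allI impI)
  fix Y u assume Y: "square_integrable M Y" "\<forall>w c. expectation (\<lambda>\<omega>. Y \<omega> * cos (X w \<omega> + c)) = 0"
  have "expectation (\<lambda>\<omega>. Y \<omega> * (Z \<omega> \<bullet> u)) = 0" "expectation (\<lambda>\<omega>. Y \<omega> * (W \<omega> \<bullet> u)) = 0"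
    by (rule path_generatedD[OF assms(1) Y], rule path_generatedD[OF assms(2) Y])
  moreover have "integrable M (\<lambda>\<omega>. Y \<omega> * (Z \<omega> \<bullet> u))" "integrable M (\<lambda>\<omega>. Y \<omega> * (W \<omega> \<bullet> u))"
    using integrable_inner_square_integrable[OF Y(1) square_integrable_inner_const[OF assms(3)]]
      integrable_inner_square_integrable[OF Y(1) square_integrable_inner_const[OF assms(4)]] by auto
  ultimately show "expectation (\<lambda>\<omega>. Y \<omega> * ((Z \<omega> + W \<omega>) \<bullet> u)) = 0"
    by (simp add: inner_add_left distrib_left)
qed

text \<open>Cosine test functionals show that \<open>Y = (Z - W) \<bullet> u\<close> is orthogonal
  to all cosines. As \<open>Z\<close> and \<open>W\<close> are path generated, \<open>Y\<close> is
  then orthogonal to its own two summands, so its second moment is 0. Countably many dense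
  directions \<open>u\<close> suffice.\<close>

lemma ibp_pair_unique:
  assumes Z: "ibp_pair \<phi> Z" "path_generated Z" and W: "ibp_pair \<phi> W" "path_generated W"
  shows "AE \<omega> in M. Z \<omega> = W \<omega>"
proof -
  have s: "square_integrable M Z" "square_integrable M W" using Z W by (auto simp: ibp_pair_def)
  have u: "AE \<omega> in M. (Z \<omega> - W \<omega>) \<bullet> u = 0" for u
  proof -
    define Y where "Y \<omega> = (Z \<omega> - W \<omega>) \<bullet> u" for \<omega>
    have Y: "square_integrable M Y" unfolding Y_def[abs_def]
      by (intro square_integrable_inner_const square_integrable_diff s)
    have i: "integrable M (\<lambda>\<omega>. G \<omega> * (Z \<omega> \<bullet> u))" "integrable M (\<lambda>\<omega>. G \<omega> * (W \<omega> \<bullet> u))" if "square_integrable M G" for G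
      using integrable_inner_square_integrable[OF that square_integrable_inner_const[OF s(1)]]
        integrable_inner_square_integrable[OF that square_integrable_inner_const[OF s(2)]] by auto
    have orth: "\<forall>w c. expectation (\<lambda>\<omega>. Y \<omega> * cos (X w \<omega> + c)) = 0"
    proof (intro allI)
      fix w c
      have sg: "square_integrable M (\<lambda>\<omega>. cos (X w \<omega> + c))"
        unfolding square_integrable_def by (auto intro!: integrable_bounded[of _ 1] simp: abs_square_le_1)
      have "expectation (\<lambda>\<omega>. (Z \<omega> \<bullet> u) * cos (X w \<omega> + c)) = expectation (\<lambda>\<omega>. (W \<omega> \<bullet> u) * cos (X w \<omega> + c))"
        unfolding ibp_pairD(3)[OF Z(1) path_deriv_cos] ibp_pairD(3)[OF W(1) path_deriv_cos] ..
      then show "expectation (\<lambda>\<omega>. Y \<omega> * cos (X w \<omega> + c)) = 0"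
        using i[OF sg] by (simp add: Y_def inner_diff_left right_diff_distrib mult.commute)
    qed
    have "expectation (\<lambda>\<omega>. Y \<omega> * (Z \<omega> \<bullet> u)) = 0" "expectation (\<lambda>\<omega>. Y \<omega> * (W \<omega> \<bullet> u)) = 0"
      by (rule path_generatedD[OF Z(2) Y orth], rule path_generatedD[OF W(2) Y orth])
    then have "expectation (\<lambda>\<omega>. Y \<omega> * (Z \<omega> \<bullet> u) - Y \<omega> * (W \<omega> \<bullet> u)) = 0" using i[OF Y] by simp
    then have "expectation (\<lambda>\<omega>. (norm (Y \<omega>))\<^sup>2) = 0"
      by (simp add: Y_def inner_diff_left power2_eq_square right_diff_distrib)
    then have "AE \<omega> in M. (norm (Y \<omega>))\<^sup>2 = 0"
      using integral_nonneg_eq_0_iff_AE[OF square_integrableD(2)[OF Y]] by simp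
    then show ?thesis by (simp add: Y_def)
  qed
  obtain D :: "'a set" where D: "countable D" "\<And>U. open U \<Longrightarrow> U \<noteq> {} \<Longrightarrow> \<exists>d\<in>D. d \<in> U"
    using countable_dense_exists by auto
  have "AE \<omega> in M. \<forall>u\<in>D. (Z \<omega> - W \<omega>) \<bullet> u = 0" using u D(1) by (simp add: AE_ball_countable)
  then show ?thesis
  proof eventually_elim
    fix \<omega> assume *: "\<forall>u\<in>D. (Z \<omega> - W \<omega>) \<bullet> u = 0"
    let ?y = "Z \<omega> - W \<omega>"
    show "Z \<omega> = W \<omega>"
    proof (rule ccontr)
      assume "Z \<omega> \<noteq> W \<omega>"
      then have "ball ?y (norm ?y) \<noteq> {}" by simp
      then obtain d where d: "d \<in> D" "d \<in> ball ?y (norm ?y)" using D(2)[of "ball ?y (norm ?y)"] by auto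
      \<comment> \<open>The point \<open>d\<close> is closer to \<open>?y\<close> than 0 is, yet
        orthogonal to \<open>?y\<close>; Pythagoras contradicts this.\<close>
      have "(norm (?y - d))\<^sup>2 = (norm ?y)\<^sup>2 + (norm d)\<^sup>2"
        using * d(1) by (simp add: power2_norm_eq_inner inner_diff_left inner_diff_right inner_commute)
      moreover have "norm (?y - d) < norm ?y" using d(2) by (simp add: dist_norm)
      then have "(norm (?y - d))\<^sup>2 < (norm ?y)\<^sup>2" by (intro power_strict_mono) auto
      ultimately show False using zero_le_power2[of "norm d"] by linarith
    qed
  qed
qed

lemma malliavin_deriv_eq:
  assumes "malliavin_graph M X \<phi> Z"
  shows "AE \<omega> in M. malliavin_deriv M X \<phi> \<omega> = Z \<omega>" "malliavin_graph M X \<phi> (malliavin_deriv M X \<phi>)"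
proof -
  show g: "malliavin_graph M X \<phi> (malliavin_deriv M X \<phi>)"
    unfolding malliavin_deriv_def by (rule someI[of "malliavin_graph M X \<phi>", OF assms])
  show "AE \<omega> in M. malliavin_deriv M X \<phi> \<omega> = Z \<omega>"
    by (rule ibp_pair_unique[OF malliavin_graphD(1,2)[OF g] malliavin_graphD(1,2)[OF assms]])
qed

end

section \<open>Monotonicity of the Malliavin form against soft maxima\<close>

context isonormal
begin

definition soft_sup :: "nat \<Rightarrow> real \<Rightarrow> (nat \<Rightarrow> 'a) \<Rightarrow> 'w \<Rightarrow> real" where
  "soft_sup n b v \<omega> = soft_max n b (\<lambda>i. X (v i) \<omega>)"

definition soft_argmax :: "nat \<Rightarrow> real \<Rightarrow> (nat \<Rightarrow> 'a) \<Rightarrow> 'w \<Rightarrow> 'a" where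
  "soft_argmax n b v \<omega> = (\<Sum>i<n. soft_wt n b i (\<lambda>k. X (v k) \<omega>) *\<^sub>R v i)"

text \<open>The soft maximum minus the divergence of its derivative, that is, the identity plus the
  Ornstein-Uhlenbeck generator applied to it. The first line is an entropy divided by
  \<open>b\<close>, the second is \<open>b\<close> times a variance.\<close>

definition soft_defect :: "nat \<Rightarrow> real \<Rightarrow> (nat \<Rightarrow> 'a) \<Rightarrow> ('a \<Rightarrow> real) \<Rightarrow> real" where
  "soft_defect n b v x = soft_max n b (\<lambda>i. x (v i)) - (\<Sum>i<n. soft_wt n b i (\<lambda>k. x (v k)) * x (v i)) +
     b * (\<Sum>i<n. soft_wt n b i (\<lambda>k. x (v k)) * (v i \<bullet> v i - (\<Sum>j<n. soft_wt n b j (\<lambda>k. x (v k)) * (v j \<bullet> v i))))"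

text \<open>For functionals of \<open>X\<close> the form is \<open>1 - n\<close> times the inner
  product on the n-th Wiener chaos, hence indefinite. Derivatives are explicit arguments, since they
  are unique only almost surely.\<close>

definition malliavin_form :: "('w \<Rightarrow> real) \<Rightarrow> ('w \<Rightarrow> 'a) \<Rightarrow> ('w \<Rightarrow> real) \<Rightarrow> ('w \<Rightarrow> 'a) \<Rightarrow> real" where
  "malliavin_form \<phi> Z \<psi> W = expectation (\<lambda>\<omega>. \<phi> \<omega> * \<psi> \<omega>) - expectation (\<lambda>\<omega>. Z \<omega> \<bullet> W \<omega>)"

lemma malliavin_form_commute: "malliavin_form \<phi> Z \<psi> W = malliavin_form \<psi> W \<phi> Z"
  by (simp add: malliavin_form_def mult.commute inner_commute)

context
  fixes n :: nat and b :: real and v :: "nat \<Rightarrow> 'a"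
  assumes n: "0 < n" and b: "0 < b"
begin

lemma smooth_rv_deriv_soft: "smooth_rv_deriv X (soft_sup n b v) (soft_argmax n b v)"
  unfolding smooth_rv_deriv_def
proof (rule exI[of _ n], rule exI[of _ "soft_max n b"], rule exI[of _ v], intro conjI ext)
  show "smooth_poly_growth n (soft_max n b)" by (rule smooth_soft_max[OF n b])
  show "soft_argmax n b v \<omega> = (\<Sum>j<n. partial_deriv j (soft_max n b) (\<lambda>i. X (v i) \<omega>) *\<^sub>R v j)" for \<omega>
    unfolding soft_argmax_def by (intro sum.cong) (simp_all add: partial_deriv_soft_max[OF n b])
qed (simp add: soft_sup_def)

lemmas soft_props = smooth_rv_deriv_props[OF smooth_rv_deriv_soft]

lemma exp_growth_soft_wt: "i < n \<Longrightarrow> exp_growth (\<lambda>x. soft_wt n b i (\<lambda>k. x (v k)))"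
  using path_deriv_soft_wt[OF n b, of i 0 v] by (simp add: path_deriv_def)

lemma exp_growth_soft_max: "exp_growth (\<lambda>x. soft_max n b (\<lambda>i. x (v i)))"
  using path_deriv_smooth[OF smooth_soft_max[OF n b], of 0 v] by (simp add: path_deriv_def)

lemma exp_growth_soft_defect: "exp_growth (soft_defect n b v)"
  unfolding soft_defect_def[abs_def]
  by (intro exp_growth_add exp_growth_diff exp_growth_sum exp_growth_mult exp_growth_const exp_growth_coordinate
      exp_growth_soft_max exp_growth_soft_wt) auto

lemma soft_defect_nonneg: "0 \<le> soft_defect n b v x"
  unfolding soft_defect_def using soft_max_entropy(1)[OF n b] soft_variance_nonneg[OF n b] b
  by (intro add_nonneg_nonneg mult_nonneg_nonneg) (auto simp: less_imp_le)

lemma norm_soft_argmax_le: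
  assumes "\<And>i. i < n \<Longrightarrow> norm (v i) \<le> R"
  shows "norm (soft_argmax n b v \<omega>) \<le> R"
proof -
  have "norm (soft_argmax n b v \<omega>) \<le> (\<Sum>i<n. norm (soft_wt n b i (\<lambda>k. X (v k) \<omega>) *\<^sub>R v i))"
    unfolding soft_argmax_def by (rule norm_sum)
  also have "\<dots> \<le> (\<Sum>i<n. soft_wt n b i (\<lambda>k. X (v k) \<omega>) * R)"
    using soft_wt_pos[OF n b] assms by (intro sum_mono) (auto simp: abs_of_pos intro!: mult_left_mono less_imp_le)
  also have "\<dots> = R" by (simp add: sum_soft_wt[OF n b] flip: sum_distrib_right)
  finally show ?thesis .
qed

text \<open>Integration by parts moves the derivative onto \<open>soft_argmax\<close>; the result is a nonnegative
  random variable because the entropy and the variance of the weights are nonnegative.\<close>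

lemma malliavin_form_soft:
  assumes \<phi>: "ibp_pair \<phi> Z"
  shows "malliavin_form \<phi> Z (soft_sup n b v) (soft_argmax n b v) = expectation (\<lambda>\<omega>. \<phi> \<omega> * soft_defect n b v (\<lambda>v. X v \<omega>))"
proof -
  let ?P = "\<lambda>\<omega>. (\<lambda>v. X v \<omega>)"
  let ?w = "\<lambda>i x. soft_wt n b i (\<lambda>k. x (v k))"
  let ?d = "\<lambda>i x. b * ?w i x * (v i \<bullet> v i - (\<Sum>j<n. ?w j x * (v j \<bullet> v i)))"
  let ?t = "\<lambda>i x. x (v i) * ?w i x - ?d i x"
  note s = ibp_pairD(1,2)[OF \<phi>]
  have gt: "exp_growth (?t i)" if "i < n" for i
    by (intro exp_growth_diff exp_growth_mult exp_growth_const exp_growth_sum exp_growth_coordinate exp_growth_soft_wt that) auto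
  have it: "integrable M (\<lambda>\<omega>. \<phi> \<omega> * ?t i (?P \<omega>))" if "i < n" for i
    using integrable_inner_square_integrable[OF s(1) square_integrable_exp_growth[OF gt[OF that]]] by simp
  have im: "integrable M (\<lambda>\<omega>. \<phi> \<omega> * soft_max n b (\<lambda>i. X (v i) \<omega>))"
    using integrable_inner_square_integrable[OF s(1) square_integrable_exp_growth[OF exp_growth_soft_max]] by simp
  have iw: "integrable M (\<lambda>\<omega>. (Z \<omega> \<bullet> v i) * ?w i (?P \<omega>))" if "i < n" for i
    using integrable_inner_square_integrable[OF square_integrable_inner_const[OF s(2)]
      square_integrable_exp_growth[OF exp_growth_soft_wt[OF that]]] by simp
  have "expectation (\<lambda>\<omega>. Z \<omega> \<bullet> soft_argmax n b v \<omega>) = expectation (\<lambda>\<omega>. \<Sum>i<n. (Z \<omega> \<bullet> v i) * ?w i (?P \<omega>))"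
    by (simp add: soft_argmax_def inner_sum_right mult.commute)
  also have "\<dots> = (\<Sum>i<n. expectation (\<lambda>\<omega>. (Z \<omega> \<bullet> v i) * ?w i (?P \<omega>)))"
    using iw by (intro Bochner_Integration.integral_sum) auto
  also have "\<dots> = (\<Sum>i<n. expectation (\<lambda>\<omega>. \<phi> \<omega> * ?t i (?P \<omega>)))"
    using ibp_pairD(3)[OF \<phi> path_deriv_soft_wt[OF n b]] by (intro sum.cong) auto
  also have "\<dots> = expectation (\<lambda>\<omega>. \<Sum>i<n. \<phi> \<omega> * ?t i (?P \<omega>))"
    using it by (intro Bochner_Integration.integral_sum[symmetric]) auto
  finally have "malliavin_form \<phi> Z (soft_sup n b v) (soft_argmax n b v) =
     expectation (\<lambda>\<omega>. \<phi> \<omega> * soft_max n b (\<lambda>i. X (v i) \<omega>) - (\<Sum>i<n. \<phi> \<omega> * ?t i (?P \<omega>)))"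
    unfolding malliavin_form_def soft_sup_def using im it
    by (subst Bochner_Integration.integral_diff) (auto intro!: Bochner_Integration.integrable_sum)
  also have "\<dots> = expectation (\<lambda>\<omega>. \<phi> \<omega> * soft_defect n b v (?P \<omega>))"
  proof (rule Bochner_Integration.integral_cong[OF refl])
    fix \<omega>
    have "(\<Sum>i<n. ?t i (?P \<omega>)) = (\<Sum>i<n. ?w i (?P \<omega>) * X (v i) \<omega>) -
        b * (\<Sum>i<n. ?w i (?P \<omega>) * (v i \<bullet> v i - (\<Sum>j<n. ?w j (?P \<omega>) * (v j \<bullet> v i))))"
      by (simp add: sum_subtractf sum_distrib_left mult.assoc mult.commute[of "X _ \<omega>"])
    then show "\<phi> \<omega> * soft_max n b (\<lambda>i. X (v i) \<omega>) - (\<Sum>i<n. \<phi> \<omega> * ?t i (?P \<omega>)) = \<phi> \<omega> * soft_defect n b v (?P \<omega>)"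
      unfolding soft_defect_def sum_distrib_left[symmetric] by (simp add: right_diff_distrib distrib_left)
  qed
  finally show ?thesis .
qed

lemma malliavin_form_soft_mono:
  assumes \<phi>: "ibp_pair \<phi> Z" and \<psi>: "ibp_pair \<psi> W" and le: "AE \<omega> in M. \<phi> \<omega> \<le> \<psi> \<omega>"
  shows "malliavin_form \<phi> Z (soft_sup n b v) (soft_argmax n b v) \<le> malliavin_form \<psi> W (soft_sup n b v) (soft_argmax n b v)"
  unfolding malliavin_form_soft[OF \<phi>] malliavin_form_soft[OF \<psi>]
proof (rule integral_mono_AE)
  note q = square_integrable_exp_growth[OF exp_growth_soft_defect]
  show "integrable M (\<lambda>\<omega>. \<phi> \<omega> * soft_defect n b v (\<lambda>v. X v \<omega>))" "integrable M (\<lambda>\<omega>. \<psi> \<omega> * soft_defect n b v (\<lambda>v. X v \<omega>))"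
    using integrable_inner_square_integrable[OF ibp_pairD(1)[OF \<phi>] q] integrable_inner_square_integrable[OF ibp_pairD(1)[OF \<psi>] q]
    by simp_all
  show "AE \<omega> in M. \<phi> \<omega> * soft_defect n b v (\<lambda>v. X v \<omega>) \<le> \<psi> \<omega> * soft_defect n b v (\<lambda>v. X v \<omega>)"
    using le by eventually_elim (intro mult_right_mono soft_defect_nonneg)
qed

end

text \<open>The test variables for which monotonicity is available: it holds against soft maxima and
  survives simultaneous \<open>L\<^sup>2\<close> limits of values and derivatives. The number of
  points, the temperature and the points may all vary along the sequence.\<close>

definition soft_limit :: "('w \<Rightarrow> real) \<Rightarrow> ('w \<Rightarrow> 'a) \<Rightarrow> bool" where
  "soft_limit \<phi> Z \<longleftrightarrow> square_integrable M \<phi> \<and> square_integrable M Z \<and>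
    (\<exists>n b v. (\<forall>k. 0 < n k \<and> 0 < b k) \<and> l2_lim M (\<lambda>k. soft_sup (n k) (b k) (v k)) \<phi> \<and>
       l2_lim M (\<lambda>k. soft_argmax (n k) (b k) (v k)) Z)"

lemma soft_limit_malliavin_graph:
  assumes "soft_limit \<phi> Z"
  shows "malliavin_graph M X \<phi> Z"
proof -
  from assms obtain n b v where s: "square_integrable M \<phi>" "square_integrable M Z" and nb: "\<And>k. 0 < n k" "\<And>k. 0 < b k"
    and l: "l2_lim M (\<lambda>k. soft_sup (n k) (b k) (v k)) \<phi>" "l2_lim M (\<lambda>k. soft_argmax (n k) (b k) (v k)) Z"
    unfolding soft_limit_def by blast
  show ?thesis
    unfolding malliavin_graph_alt
    by (intro conjI s, rule exI[of _ "\<lambda>k. soft_sup (n k) (b k) (v k)"], rule exI[of _ "\<lambda>k. soft_argmax (n k) (b k) (v k)"])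
      (intro conjI l allI smooth_rv_deriv_soft nb)
qed

lemma soft_limit_soft:
  assumes "0 < n" "0 < b"
  shows "soft_limit (soft_sup n b v) (soft_argmax n b v)"
  unfolding soft_limit_def
proof (intro conjI soft_props(3,4)[OF assms])
  show "\<exists>m c w. (\<forall>k. 0 < m k \<and> 0 < c k) \<and> l2_lim M (\<lambda>k. soft_sup (m k) (c k) (w k)) (soft_sup n b v) \<and>
      l2_lim M (\<lambda>k. soft_argmax (m k) (c k) (w k)) (soft_argmax n b v)"
    by (rule exI[of _ "\<lambda>_. n"], rule exI[of _ "\<lambda>_. b"], rule exI[of _ "\<lambda>_. v"])
      (simp add: l2_lim_const assms)
qed

lemma malliavin_form_mono:
  assumes \<phi>: "ibp_pair \<phi> Z" and \<psi>: "ibp_pair \<psi> W" and le: "AE \<omega> in M. \<phi> \<omega> \<le> \<psi> \<omega>" and g: "soft_limit g G"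
  shows "malliavin_form \<phi> Z g G \<le> malliavin_form \<psi> W g G"
proof -
  from g obtain n b v where s: "square_integrable M g" "square_integrable M G" and nb: "\<And>k. 0 < n k" "\<And>k. 0 < b k"
    and l: "l2_lim M (\<lambda>k. soft_sup (n k) (b k) (v k)) g" "l2_lim M (\<lambda>k. soft_argmax (n k) (b k) (v k)) G"
    unfolding soft_limit_def by blast
  have lim: "(\<lambda>k. malliavin_form \<phi> Z (soft_sup (n k) (b k) (v k)) (soft_argmax (n k) (b k) (v k))) \<longlonglongrightarrow> malliavin_form \<phi> Z g G"
    if "ibp_pair \<phi> Z" for \<phi> Z
    unfolding malliavin_form_def
    using l2_lim_inner[OF ibp_pairD(1)[OF that] ibp_pairD(1)[OF that] l2_lim_const soft_props(3)[OF nb] s(1) l(1)]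
      l2_lim_inner[OF ibp_pairD(2)[OF that] ibp_pairD(2)[OF that] l2_lim_const soft_props(4)[OF nb] s(2) l(2)]
    by (intro tendsto_diff) auto
  show ?thesis
    by (rule LIMSEQ_le[OF lim[OF \<phi>] lim[OF \<psi>]]) (use malliavin_form_soft_mono[OF nb \<phi> \<psi> le] in blast)
qed

lemma malliavin_form_add_const:
  assumes \<phi>: "square_integrable M \<phi>" and g: "square_integrable M g"
  shows "malliavin_form (\<lambda>\<omega>. \<phi> \<omega> + c) Z g G = malliavin_form \<phi> Z g G + c * expectation g"
proof -
  have "integrable M (\<lambda>\<omega>. \<phi> \<omega> * g \<omega>)" using integrable_inner_square_integrable[OF \<phi> g] by simp
  moreover have "integrable M g"
    using integrable_inner_square_integrable[of M "\<lambda>_. 1 :: real", OF _ g] by (simp add: square_integrable_def)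
  ultimately show ?thesis by (simp add: malliavin_form_def distrib_right)
qed

lemma ibp_pair_add_const:
  assumes "ibp_pair \<phi> Z"
  shows "ibp_pair (\<lambda>\<omega>. \<phi> \<omega> + c) Z"
  using ibp_pair_add[OF assms ibp_pair_const, of c] by simp

end

text \<open>The limit is the supremum of \<open>a n - \<epsilon> n\<close>, which every later term
  attains up to small errors.\<close>

lemma almost_increasing_converges:
  fixes a \<epsilon> :: "nat \<Rightarrow> real"
  assumes le: "\<And>n m. n \<le> m \<Longrightarrow> a n \<le> a m + \<epsilon> n" and b: "\<And>n. a n \<le> B" and \<epsilon>: "\<epsilon> \<longlonglongrightarrow> 0" "\<And>n. 0 \<le> \<epsilon> n"
  shows "convergent a"
proof -
  define S where "S = (SUP n. a n - \<epsilon> n)"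
  have "a n - \<epsilon> n \<le> B" for n using b[of n] \<epsilon>(2)[of n] by linarith
  then have bdd: "bdd_above (range (\<lambda>n. a n - \<epsilon> n))" by (intro bdd_aboveI2)
  have up: "a n \<le> S + \<epsilon> n" for n using cSUP_upper[OF _ bdd, of n] by (simp add: S_def)
  have "a \<longlonglongrightarrow> S"
  proof (rule LIMSEQ_I)
    fix r :: real assume r: "0 < r"
    have "S - r < S" using r by simp
    then obtain N where N: "S - r < a N - \<epsilon> N" unfolding S_def using less_cSUP_iff[OF _ bdd] by auto
    obtain N' where N': "\<And>n. n \<ge> N' \<Longrightarrow> norm (\<epsilon> n - 0) < r" using LIMSEQ_D[OF \<epsilon>(1) r] by blast
    have "norm (a n - S) < r" if "n \<ge> max N N'" for n
      using N le[of N n] up[of n] N'[of n] that by (simp add: abs_less_iff)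
    then show "\<exists>no. \<forall>n\<ge>no. norm (a n - S) < r" by blast
  qed
  then show ?thesis by (rule convergentI)
qed

lemma (in finite_measure) square_integrable_of_bounded:
  fixes \<phi> :: "'a \<Rightarrow> 'b::{real_inner, second_countable_topology}"
  assumes "\<phi> \<in> borel_measurable M" "\<And>\<omega>. norm (\<phi> \<omega>) \<le> R"
  shows "square_integrable M \<phi>"
proof (rule square_integrable_bound[where \<psi>="\<lambda>_. R"])
  show "square_integrable M (\<lambda>_. R)" by (simp add: square_integrable_def)
  show "norm (\<phi> \<omega>) \<le> norm R" for \<omega> using order_trans[OF assms(2) abs_ge_self] by simp
qed (rule assms)

lemma (in finite_measure) square_integrable_one: "square_integrable M (\<lambda>_. 1 :: real)"
  by (rule square_integrable_of_bounded[of _ 1]) auto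

lemma (in finite_measure) square_integrable_integrable: "square_integrable M f \<Longrightarrow> integrable M (f :: 'a \<Rightarrow> real)"
  using integrable_inner_square_integrable[OF _ square_integrable_one, of f] by simp

text \<open>The Riesz-Fischer argument: along a fast subsequence the increments are almost surely
  summable, and the uniform bound \<open>R\<close> upgrades pointwise convergence to convergence in
  \<open>L\<^sup>2\<close> by domination.\<close>

lemma (in prob_space) l2_Cauchy_bounded_convergent:
  fixes D :: "nat \<Rightarrow> 'a \<Rightarrow> 'b::{real_inner, complete_space, second_countable_topology}"
  assumes D: "\<And>n. D n \<in> borel_measurable M" and bound: "\<And>n \<omega>. norm (D n \<omega>) \<le> R"
    and cau: "\<And>e. e > 0 \<Longrightarrow> \<exists>N. \<forall>n\<ge>N. \<forall>m\<ge>n. expectation (\<lambda>\<omega>. (norm (D n \<omega> - D m \<omega>))\<^sup>2) < e"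
  obtains r Z where "strict_mono r" "square_integrable M Z" "l2_lim M (\<lambda>k. D (r k)) Z" "\<And>\<omega>. norm (Z \<omega>) \<le> R"
proof -
  note [measurable] = D
  have R0: "0 \<le> R" using bound[of 0 undefined] norm_ge_zero order_trans by blast
  \<comment> \<open>The rate \<open>(1 / 4) ^ k\<close> for second moments gives the summable rate
    \<open>(1 / 2) ^ k\<close> for first moments.\<close>
  have "\<exists>r. \<forall>k. (\<forall>n\<ge>r k. \<forall>m\<ge>n. expectation (\<lambda>\<omega>. (norm (D n \<omega> - D m \<omega>))\<^sup>2) < (1 / 4) ^ k) \<and> r k < r (Suc k)"
  proof (intro dependent_nat_choice)
    show "\<exists>x. \<forall>n\<ge>x. \<forall>m\<ge>n. expectation (\<lambda>\<omega>. (norm (D n \<omega> - D m \<omega>))\<^sup>2) < (1 / 4) ^ 0"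
      by (rule cau) simp
    fix x k
    obtain N where N: "\<forall>n\<ge>N. \<forall>m\<ge>n. expectation (\<lambda>\<omega>. (norm (D n \<omega> - D m \<omega>))\<^sup>2) < (1 / 4) ^ Suc k"
      using cau[of "(1 / 4) ^ Suc k"] by auto
    show "\<exists>y. (\<forall>n\<ge>y. \<forall>m\<ge>n. expectation (\<lambda>\<omega>. (norm (D n \<omega> - D m \<omega>))\<^sup>2) < (1 / 4) ^ Suc k) \<and> x < y"
      by (rule exI[of _ "max N (Suc x)"]) (use N in auto)
  qed
  then obtain r where r: "\<And>k n m. n \<ge> r k \<Longrightarrow> m \<ge> n \<Longrightarrow> expectation (\<lambda>\<omega>. (norm (D n \<omega> - D m \<omega>))\<^sup>2) < (1 / 4) ^ k"
    and rS: "\<And>k. r k < r (Suc k)" by blast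
  have mono: "strict_mono r" using rS by (simp add: strict_mono_Suc_iff)
  define d where "d k \<omega> = norm (D (r k) \<omega> - D (r (Suc k)) \<omega>)" for k \<omega>
  have [measurable]: "d k \<in> borel_measurable M" for k unfolding d_def by measurable
  have db: "\<bar>d k \<omega>\<bar> \<le> 2 * R" for k \<omega>
    using norm_triangle_ineq4[of "D (r k) \<omega>" "D (r (Suc k)) \<omega>"] bound[of "r k" \<omega>] bound[of "r (Suc k)" \<omega>]
    by (simp add: d_def)
  have Ed: "(\<integral>\<^sup>+\<omega>. ennreal (d k \<omega>) \<partial>M) \<le> ennreal ((1 / 2) ^ k)" for k
  proof -
    have s: "square_integrable M (d k)" "square_integrable M (\<lambda>_. 1 :: real)"
      using square_integrable_of_bounded[of "d k" "2 * R"] db by (auto simp: square_integrable_def)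
    have "\<bar>expectation (d k)\<bar> \<le> sqrt (expectation (\<lambda>\<omega>. (d k \<omega>)\<^sup>2))"
      using Cauchy_Schwarz_expectation[OF s] by (simp add: prob_space)
    also have "\<dots> \<le> sqrt ((1 / 4) ^ k)"
      using r[of k "r k" "r (Suc k)"] rS[of k] by (simp add: d_def less_imp_le)
    also have "\<dots> = (1 / 2) ^ k" by (simp add: real_sqrt_power real_sqrt_divide)
    finally have "expectation (d k) \<le> (1 / 2) ^ k" by simp
    moreover have "integrable M (d k)" by (rule integrable_bounded[OF _ db]) simp
    ultimately show ?thesis by (subst nn_integral_eq_integral) (auto simp: d_def intro!: ennreal_leI)
  qed
  define E where "E = {\<omega> \<in> space M. (\<Sum>k. ennreal (d k \<omega>)) < \<infinity>}"
  have [measurable]: "E \<in> sets M" unfolding E_def by measurable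
  have "(\<integral>\<^sup>+\<omega>. (\<Sum>k. ennreal (d k \<omega>)) \<partial>M) = (\<Sum>k. \<integral>\<^sup>+\<omega>. ennreal (d k \<omega>) \<partial>M)"
    by (rule nn_integral_suminf) simp
  also have "\<dots> \<le> (\<Sum>k. ennreal ((1 / 2) ^ k))" by (intro suminf_le Ed) auto
  also have "\<dots> = ennreal (\<Sum>k. (1 / 2) ^ k)" by (intro suminf_ennreal2) (auto simp: summable_geometric)
  finally have "(\<integral>\<^sup>+\<omega>. (\<Sum>k. ennreal (d k \<omega>)) \<partial>M) \<noteq> \<infinity>" by (auto simp: top_unique)
  then have "AE \<omega> in M. (\<Sum>k. ennreal (d k \<omega>)) \<noteq> \<infinity>" by (intro nn_integral_PInf_AE) auto
  then have AE_E: "AE \<omega> in M. \<omega> \<in> E" by (auto simp: E_def less_top elim: AE_mp)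
  have conv: "convergent (\<lambda>k. D (r k) \<omega>)" if \<omega>: "\<omega> \<in> E" for \<omega>
  proof (rule Cauchy_convergent, rule metric_CauchyI)
    fix e :: real assume e: "e > 0"
    have "summable (\<lambda>k. d k \<omega>)"
      using \<omega> by (intro summable_suminf_not_top) (auto simp: E_def d_def)
    then obtain N where N: "\<And>m n. m \<ge> N \<Longrightarrow> norm (sum (\<lambda>k. d k \<omega>) {m..<n}) < e"
      using e unfolding summable_Cauchy by blast
    have tri: "dist (D (r m) \<omega>) (D (r n) \<omega>) \<le> sum (\<lambda>k. d k \<omega>) {m..<n}" if "m \<le> n" for m n
      using that
    proof (induction n rule: dec_induct)
      case (step n)
      have "dist (D (r m) \<omega>) (D (r (Suc n)) \<omega>) \<le> dist (D (r m) \<omega>) (D (r n) \<omega>) + d n \<omega>"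
        unfolding d_def dist_norm[symmetric] by (rule dist_triangle)
      then show ?case using step by simp
    qed simp
    have lt: "dist (D (r m) \<omega>) (D (r n) \<omega>) < e" if "m \<ge> N" "m \<le> n" for m n
      using tri[OF that(2)] N[OF that(1), of n] by simp
    show "\<exists>N. \<forall>m\<ge>N. \<forall>n\<ge>N. dist (D (r m) \<omega>) (D (r n) \<omega>) < e"
    proof (intro exI[of _ N] allI impI)
      fix m n assume "N \<le> m" "N \<le> n"
      then show "dist (D (r m) \<omega>) (D (r n) \<omega>) < e"
        using lt[of m n] lt[of n m] by (cases "m \<le> n") (auto simp: dist_commute)
    qed
  qed
  define Z where "Z \<omega> = (if \<omega> \<in> E then lim (\<lambda>k. D (r k) \<omega>) else 0)" for \<omega>
  have lim: "(\<lambda>k. D (r k) \<omega>) \<longlonglongrightarrow> Z \<omega>" if "\<omega> \<in> E" for \<omega>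
    using conv[OF that] that by (simp add: Z_def convergent_LIMSEQ_iff)
  have [measurable]: "Z \<in> borel_measurable M"
  proof (rule borel_measurable_LIMSEQ_metric)
    show "(\<lambda>\<omega>. if \<omega> \<in> E then D (r k) \<omega> else 0) \<in> borel_measurable M" for k by measurable
    show "(\<lambda>k. if \<omega> \<in> E then D (r k) \<omega> else 0) \<longlonglongrightarrow> Z \<omega>" for \<omega>
      using lim by (cases "\<omega> \<in> E") (auto simp: Z_def)
  qed
  have Zb: "norm (Z \<omega>) \<le> R" for \<omega>
  proof (cases "\<omega> \<in> E")
    case True
    show ?thesis by (rule LIMSEQ_le_const2[OF tendsto_norm[OF lim[OF True]]]) (use bound in blast)
  qed (simp add: Z_def R0)
  have sZ: "square_integrable M Z"
    by (rule square_integrable_of_bounded[OF _ Zb]) simp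
  have sD: "square_integrable M (D n)" for n
    by (rule square_integrable_of_bounded[OF D bound])
  have "(\<lambda>k. expectation (\<lambda>\<omega>. (norm (D (r k) \<omega> - Z \<omega>))\<^sup>2)) \<longlonglongrightarrow> expectation (\<lambda>_. 0)"
  proof (rule integral_dominated_convergence[where w="\<lambda>_. (2 * R)\<^sup>2"])
    show "AE \<omega> in M. (\<lambda>k. (norm (D (r k) \<omega> - Z \<omega>))\<^sup>2) \<longlonglongrightarrow> 0"
      using AE_E
    proof eventually_elim
      fix \<omega> assume "\<omega> \<in> E"
      from tendsto_power[OF tendsto_norm[OF tendsto_diff[OF lim[OF this] tendsto_const[of "Z \<omega>"]]], of 2]
      show "(\<lambda>k. (norm (D (r k) \<omega> - Z \<omega>))\<^sup>2) \<longlonglongrightarrow> 0" by simp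
    qed
    show "AE \<omega> in M. norm ((norm (D (r k) \<omega> - Z \<omega>))\<^sup>2) \<le> (2 * R)\<^sup>2" for k
    proof (rule AE_I2)
      fix \<omega>
      have "norm (D (r k) \<omega> - Z \<omega>) \<le> 2 * R"
        using norm_triangle_ineq4[of "D (r k) \<omega>" "Z \<omega>"] bound[of "r k" \<omega>] Zb[of \<omega>] by linarith
      from power_mono[OF this, of 2] show "norm ((norm (D (r k) \<omega> - Z \<omega>))\<^sup>2) \<le> (2 * R)\<^sup>2" by simp
    qed
  qed auto
  then have "l2_lim M (\<lambda>k. D (r k)) Z" using l2_lim_iff_integral[OF sD sZ] by simp
  then show thesis using that mono sZ Zb by blast
qed

section \<open>Fernique's moment bound and the soft approximations\<close>

context isonormal
begin

lemma square_integrable_X: "square_integrable M (X v)"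
  using square_integrable_exp_growth[OF exp_growth_coordinate] .

text \<open>The deterministic core of Fernique's argument. When all rotated differences are at most
  \<open>s\<close>, the values \<open>a w\<close> and \<open>b w\<close> are close at each
  \<open>w\<close>, so the rotated sum is controlled by either one: by \<open>b\<close> if its
  maximum is at most \<open>s\<close>, otherwise by the maximum of \<open>a\<close>.\<close>

lemma rotation_max_bound:
  fixes a b :: "'i \<Rightarrow> real"
  assumes F: "finite F" "F \<noteq> {}" and s: "0 \<le> s"
    and le: "Max ((\<lambda>w. \<bar>1 / sqrt 2 * a w - 1 / sqrt 2 * b w\<bar>) ` F) \<le> s"
  shows "(Max ((\<lambda>w. \<bar>1 / sqrt 2 * a w + 1 / sqrt 2 * b w\<bar>) ` F))\<^sup>2 \<le>
     6 * s\<^sup>2 + 4 * (Max ((\<lambda>w. \<bar>a w\<bar>) ` F))\<^sup>2 * indicator {s<..} (Max ((\<lambda>w. \<bar>b w\<bar>) ` F))"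
proof -
  let ?c = "1 / sqrt 2 :: real"
  let ?m = "\<lambda>f. Max (f ` F)"
  have "?m (\<lambda>w. \<bar>?c * a w + ?c * b w\<bar>) \<in> (\<lambda>w. \<bar>?c * a w + ?c * b w\<bar>) ` F"
    using F by (intro Max_in) auto
  then obtain w where w: "w \<in> F" "?m (\<lambda>w. \<bar>?c * a w + ?c * b w\<bar>) = \<bar>?c * a w + ?c * b w\<bar>" by auto
  define T where "T = \<bar>?c * a w + ?c * b w\<bar>"
  have d: "\<bar>?c * a w - ?c * b w\<bar> \<le> s"
    by (rule order_trans[OF Max_ge le]) (use F w in auto)
  have A: "\<bar>a w\<bar> \<le> ?m (\<lambda>w. \<bar>a w\<bar>)" and B: "\<bar>b w\<bar> \<le> ?m (\<lambda>w. \<bar>b w\<bar>)"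
    by (rule Max_ge; use F w in auto)+
  \<comment> \<open>The rotated sum is at most twice either rotated summand plus the rotated
    difference; then \<open>(p + q)\<^sup>2 \<le> 2 * p\<^sup>2 + 2 * q\<^sup>2\<close>.\<close>
  have T: "T\<^sup>2 \<le> 4 * x\<^sup>2 + 2 * s\<^sup>2" if x: "x = \<bar>a w\<bar> \<or> x = \<bar>b w\<bar>" for x
  proof -
    have "\<bar>?c * x\<bar> = \<bar>?c * a w\<bar> \<or> \<bar>?c * x\<bar> = \<bar>?c * b w\<bar>" using x by (auto simp: abs_mult)
    then have "T \<le> 2 * \<bar>?c * x\<bar> + s" using d unfolding T_def by linarith
    moreover have "0 \<le> T" by (simp add: T_def)
    ultimately have "T\<^sup>2 \<le> (2 * \<bar>?c * x\<bar> + s)\<^sup>2" by (rule power_mono)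
    also have "\<dots> \<le> 2 * (2 * \<bar>?c * x\<bar>)\<^sup>2 + 2 * s\<^sup>2"
      using sum_squares_bound[of "2 * \<bar>?c * x\<bar>" s] by (simp add: power2_sum)
    also have "(2 * \<bar>?c * x\<bar>)\<^sup>2 = 2 * x\<^sup>2" by (simp add: power_mult_distrib power_divide)
    finally show ?thesis by simp
  qed
  show ?thesis
  proof (cases "?m (\<lambda>w. \<bar>b w\<bar>) > s")
    case True
    have "\<bar>a w\<bar>\<^sup>2 \<le> (?m (\<lambda>w. \<bar>a w\<bar>))\<^sup>2" by (rule power_mono[OF A]) simp
    then have "T\<^sup>2 \<le> 6 * s\<^sup>2 + 4 * (?m (\<lambda>w. \<bar>a w\<bar>))\<^sup>2"
      using T[of "\<bar>a w\<bar>"] zero_le_power2[of s] by linarith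
    then show ?thesis using True unfolding w(2) T_def[symmetric] by simp
  next
    case False
    then have "\<bar>b w\<bar> \<le> s" using B by linarith
    then have "\<bar>b w\<bar>\<^sup>2 \<le> s\<^sup>2" by (rule power_mono) simp
    then show ?thesis using T[of "\<bar>b w\<bar>"] False unfolding w(2) T_def[symmetric] by (simp del: power2_abs)
  qed
qed

text \<open>Fernique's argument: \<open>(X + X') / sqrt 2\<close> and \<open>(X - X') / sqrt 2\<close> are again independent copies of \<open>X\<close>.\<close>

lemma max_second_moment_bound:
  assumes F: "finite F" "F \<noteq> {}" and s: "0 \<le> s"
    and p: "prob {\<omega> \<in> space M. s < Max ((\<lambda>w. \<bar>X w \<omega>\<bar>) ` F)} \<le> 1 / 10"
  shows "integrable M (\<lambda>\<omega>. (Max ((\<lambda>w. \<bar>X w \<omega>\<bar>) ` F))\<^sup>2)"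
    and "expectation (\<lambda>\<omega>. (Max ((\<lambda>w. \<bar>X w \<omega>\<bar>) ` F))\<^sup>2) \<le> 12 * s\<^sup>2"
proof -
  define N where "N \<omega> = Max ((\<lambda>w. \<bar>X w \<omega>\<bar>) ` F)" for \<omega>
  have [measurable]: "N \<in> borel_measurable M" unfolding N_def using F by measurable
  have N2: "(N \<omega>)\<^sup>2 \<le> (\<Sum>w\<in>F. (X w \<omega>)\<^sup>2)" for \<omega>
  proof -
    have "N \<omega> \<in> (\<lambda>w. \<bar>X w \<omega>\<bar>) ` F" unfolding N_def using F by (intro Max_in) auto
    then obtain w where w: "w \<in> F" "N \<omega> = \<bar>X w \<omega>\<bar>" by auto
    then have "(N \<omega>)\<^sup>2 = (X w \<omega>)\<^sup>2" by simp
    also have "\<dots> \<le> (\<Sum>w\<in>F. (X w \<omega>)\<^sup>2)" by (rule member_le_sum[where f="\<lambda>w. (X w \<omega>)\<^sup>2"]) (use w F in auto)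
    finally show ?thesis .
  qed
  \<comment> \<open>Finiteness of the second moment comes crudely from the finite sum over
    \<open>F\<close>; the quantitative bound below absorbs a multiple of it and needs it finite
    beforehand.\<close>
  show int: "integrable M (\<lambda>\<omega>. (Max ((\<lambda>w. \<bar>X w \<omega>\<bar>) ` F))\<^sup>2)"
    unfolding N_def[symmetric]
  proof (rule Bochner_Integration.integrable_bound[where f="\<lambda>\<omega>. \<Sum>w\<in>F. (X w \<omega>)\<^sup>2"])
    show "integrable M (\<lambda>\<omega>. \<Sum>w\<in>F. (X w \<omega>)\<^sup>2)"
      using square_integrableD(2)[OF square_integrable_X] by (intro Bochner_Integration.integrable_sum) simp
    show "AE \<omega> in M. norm ((N \<omega>)\<^sup>2) \<le> norm (\<Sum>w\<in>F. (X w \<omega>)\<^sup>2)"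
      using N2 by (intro AE_I2) (simp add: abs_of_nonneg sum_nonneg)
  qed simp
  define e where "e = expectation (\<lambda>\<omega>. (N \<omega>)\<^sup>2)"
  define q where "q = prob {\<omega> \<in> space M. s < N \<omega>}"
  have e0: "0 \<le> e" by (simp add: e_def)
  have nn_e: "(\<integral>\<^sup>+\<omega>. ennreal ((N \<omega>)\<^sup>2) \<partial>M) = ennreal e"
    unfolding e_def using int unfolding N_def[symmetric] by (intro nn_integral_eq_integral) auto
  have nn_q: "(\<integral>\<^sup>+\<omega>. indicator {s<..} (N \<omega>) \<partial>M) = ennreal q"
  proof -
    have "(\<integral>\<^sup>+\<omega>. indicator {s<..} (N \<omega>) \<partial>M) = (\<integral>\<^sup>+\<omega>. indicator {\<omega> \<in> space M. s < N \<omega>} \<omega> \<partial>M)"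
      by (intro nn_integral_cong) (simp add: indicator_def)
    also have "\<dots> = emeasure M {\<omega> \<in> space M. s < N \<omega>}" by (rule nn_integral_indicator) measurable
    finally show ?thesis by (simp add: q_def emeasure_eq_measure)
  qed
  have nn_q': "(\<integral>\<^sup>+\<omega>. indicator {..s} (N \<omega>) \<partial>M) = ennreal (1 - q)"
  proof -
    have "(\<integral>\<^sup>+\<omega>. indicator {..s} (N \<omega>) \<partial>M) = (\<integral>\<^sup>+\<omega>. indicator {\<omega> \<in> space M. N \<omega> \<le> s} \<omega> \<partial>M)"
      by (intro nn_integral_cong) (simp add: indicator_def)
    also have "\<dots> = emeasure M {\<omega> \<in> space M. N \<omega> \<le> s}" by (rule nn_integral_indicator) measurable
    also have "{\<omega> \<in> space M. N \<omega> \<le> s} = space M - {\<omega> \<in> space M. s < N \<omega>}" by auto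
    also have "emeasure M \<dots> = ennreal (1 - q)"
      unfolding emeasure_eq_measure q_def by (subst prob_compl) auto
    finally show ?thesis .
  qed
  let ?c = "1 / sqrt 2 :: real"
  let ?XX = "\<lambda>p \<omega>. X (fst p) (fst \<omega>) + X (snd p) (snd \<omega>)"
  \<comment> \<open>The Boolean selects one of two independent copies; \<alpha> lists the copies
    themselves and \<beta> their rotation by 45 degrees. Equal Gram matrices give equal joint
    laws.\<close>
  define \<alpha> :: "bool \<times> 'a \<Rightarrow> 'a \<times> 'a" where "\<alpha> i = (if fst i then (snd i, 0) else (0, snd i))" for i
  define \<beta> :: "bool \<times> 'a \<Rightarrow> 'a \<times> 'a" where
    "\<beta> i = ?c *\<^sub>R (snd i, 0) + (if fst i then ?c else - ?c) *\<^sub>R (0, snd i)" for i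
  note FF = gaussian_field_pair[OF gaussian_field gaussian_field]
  interpret P: pair_prob_space M M by unfold_locales
  have c2: "?c * ?c = 1 / 2" by simp
  have law: "distr (M \<Otimes>\<^sub>M M) (PiM UNIV (\<lambda>_. borel)) (\<lambda>\<omega> i. ?XX (\<alpha> i) \<omega>) =
      distr (M \<Otimes>\<^sub>M M) (PiM UNIV (\<lambda>_. borel)) (\<lambda>\<omega> i. ?XX (\<beta> i) \<omega>)"
  proof -
    have g: "\<alpha> i \<bullet> \<alpha> j = \<beta> i \<bullet> \<beta> j" for i j
      by (cases "fst i"; cases "fst j") (simp_all add: \<alpha>_def \<beta>_def)
    show ?thesis
      using gaussian_field_law_eq[OF FF FF, of UNIV \<alpha> \<beta>] g by (simp add: restrict_UNIV)
  qed
  define mx where "mx B x = Max ((\<lambda>w. \<bar>x (B, w)\<bar>) ` F)" for B and x :: "bool \<times> 'a \<Rightarrow> real"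
  have [measurable]: "mx B \<in> borel_measurable (PiM UNIV (\<lambda>_. borel))" for B
    unfolding mx_def using F by measurable
  \<comment> \<open>Second moment of the maximum of one copy, on the event that the maximum of the
    other is at most \<open>s\<close>. Its expectation factorises along \<alpha> and is estimated by
    \<open>rotation_max_bound\<close> along \<beta>.\<close>
  define G where "G x = ennreal ((mx True x)\<^sup>2) * indicator {..s} (mx False x)" for x :: "bool \<times> 'a \<Rightarrow> real"
  have [measurable]: "G \<in> borel_measurable (PiM UNIV (\<lambda>_. borel))" unfolding G_def by measurable
  have XXm: "(\<lambda>\<omega> i. ?XX (\<gamma> i) \<omega>) \<in> M \<Otimes>\<^sub>M M \<rightarrow>\<^sub>M PiM UNIV (\<lambda>_. borel)" for \<gamma> :: "bool \<times> 'a \<Rightarrow> 'a \<times> 'a"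
    by (rule measurable_PiM_single') auto
  have eq: "(\<integral>\<^sup>+\<omega>. G (\<lambda>i. ?XX (\<alpha> i) \<omega>) \<partial>(M \<Otimes>\<^sub>M M)) = (\<integral>\<^sup>+\<omega>. G (\<lambda>i. ?XX (\<beta> i) \<omega>) \<partial>(M \<Otimes>\<^sub>M M))"
    using arg_cong[OF law, of "\<lambda>D. \<integral>\<^sup>+x. G x \<partial>D"] XXm by (simp add: nn_integral_distr)
  have prod: "(\<integral>\<^sup>+\<omega>. f (fst \<omega>) * g (snd \<omega>) \<partial>(M \<Otimes>\<^sub>M M)) = (\<integral>\<^sup>+\<omega>. f \<omega> \<partial>M) * (\<integral>\<^sup>+\<omega>. g \<omega> \<partial>M)"
    if [measurable]: "f \<in> borel_measurable M" "g \<in> borel_measurable M" for f g :: "'w \<Rightarrow> ennreal"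
  proof -
    have "(\<integral>\<^sup>+\<omega>. f (fst \<omega>) * g (snd \<omega>) \<partial>(M \<Otimes>\<^sub>M M)) = (\<integral>\<^sup>+x. \<integral>\<^sup>+y. f x * g y \<partial>M \<partial>M)"
      by (subst nn_integral_fst[symmetric]) auto
    then show ?thesis by (simp add: nn_integral_cmult nn_integral_multc)
  qed
  have X0: "AE \<omega> in M \<Otimes>\<^sub>M M. X 0 (fst \<omega>) = 0" "AE \<omega> in M \<Otimes>\<^sub>M M. X 0 (snd \<omega>) = 0"
    using AE_pair_fst[OF prob_space_axioms gaussian_field_zero[OF gaussian_field]]
      AE_pair_snd[OF prob_space_axioms prob_space_axioms gaussian_field_zero[OF gaussian_field]] by auto
  have lhs: "(\<integral>\<^sup>+\<omega>. G (\<lambda>i. ?XX (\<alpha> i) \<omega>) \<partial>(M \<Otimes>\<^sub>M M)) = ennreal e * ennreal (1 - q)"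
  proof -
    have "(\<integral>\<^sup>+\<omega>. G (\<lambda>i. ?XX (\<alpha> i) \<omega>) \<partial>(M \<Otimes>\<^sub>M M)) =
        (\<integral>\<^sup>+\<omega>. ennreal ((N (fst \<omega>))\<^sup>2) * indicator {..s} (N (snd \<omega>)) \<partial>(M \<Otimes>\<^sub>M M))"
      using X0 by (intro nn_integral_cong_AE) (auto elim!: eventually_elim2 simp: G_def mx_def \<alpha>_def N_def)
    then show ?thesis
      using prod[of "\<lambda>\<omega>. ennreal ((N \<omega>)\<^sup>2)" "\<lambda>\<omega>. indicator {..s} (N \<omega>)"] by (simp add: nn_e nn_q')
  qed
  have lin: "AE \<omega> in M \<Otimes>\<^sub>M M. \<forall>w\<in>F. \<forall>B. ?XX (\<beta> (B, w)) \<omega> = ?c * X w (fst \<omega>) + (if B then ?c else - ?c) * X w (snd \<omega>)"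
  proof -
    have "AE \<omega> in M \<Otimes>\<^sub>M M. ?XX (\<beta> (B, w)) \<omega> = ?c * X w (fst \<omega>) + (if B then ?c else - ?c) * X w (snd \<omega>)" for w B
      using gaussian_fieldD(3)[OF FF, of ?c "(w, 0)" "if B then ?c else - ?c" "(0, w)"] X0
      by eventually_elim (simp add: \<beta>_def)
    then have "\<forall>w\<in>F. \<forall>B\<in>{True, False}. AE \<omega> in M \<Otimes>\<^sub>M M. ?XX (\<beta> (B, w)) \<omega> = ?c * X w (fst \<omega>) + (if B then ?c else - ?c) * X w (snd \<omega>)"
      by blast
    then have "AE \<omega> in M \<Otimes>\<^sub>M M. \<forall>w\<in>F. \<forall>B\<in>{True, False}. ?XX (\<beta> (B, w)) \<omega> = ?c * X w (fst \<omega>) + (if B then ?c else - ?c) * X w (snd \<omega>)"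
      using F(1) by (simp only: AE_finite_all[OF F(1)] AE_finite_all[OF finite.insertI[OF finite.insertI[OF finite.emptyI]]])
    then show ?thesis by eventually_elim auto
  qed
  have "(\<integral>\<^sup>+\<omega>. G (\<lambda>i. ?XX (\<beta> i) \<omega>) \<partial>(M \<Otimes>\<^sub>M M)) \<le>
      (\<integral>\<^sup>+\<omega>. ennreal (6 * s\<^sup>2) + 4 * (ennreal ((N (fst \<omega>))\<^sup>2) * indicator {s<..} (N (snd \<omega>))) \<partial>(M \<Otimes>\<^sub>M M))"
  proof (rule nn_integral_mono_AE)
    show "AE \<omega> in M \<Otimes>\<^sub>M M. G (\<lambda>i. ?XX (\<beta> i) \<omega>) \<le> ennreal (6 * s\<^sup>2) + 4 * (ennreal ((N (fst \<omega>))\<^sup>2) * indicator {s<..} (N (snd \<omega>)))"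
      using lin
    proof eventually_elim
      fix \<omega> assume *: "\<forall>w\<in>F. \<forall>B. ?XX (\<beta> (B, w)) \<omega> = ?c * X w (fst \<omega>) + (if B then ?c else - ?c) * X w (snd \<omega>)"
      let ?a = "\<lambda>w. X w (fst \<omega>)" and ?b = "\<lambda>w. X w (snd \<omega>)"
      have mT: "mx True (\<lambda>i. ?XX (\<beta> i) \<omega>) = Max ((\<lambda>w. \<bar>?c * ?a w + ?c * ?b w\<bar>) ` F)"
        unfolding mx_def using * by (intro arg_cong[where f=Max] image_cong) auto
      have mF: "mx False (\<lambda>i. ?XX (\<beta> i) \<omega>) = Max ((\<lambda>w. \<bar>?c * ?a w - ?c * ?b w\<bar>) ` F)"
        unfolding mx_def using * by (intro arg_cong[where f=Max] image_cong) auto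
      show "G (\<lambda>i. ?XX (\<beta> i) \<omega>) \<le> ennreal (6 * s\<^sup>2) + 4 * (ennreal ((N (fst \<omega>))\<^sup>2) * indicator {s<..} (N (snd \<omega>)))"
      proof (cases "mx False (\<lambda>i. ?XX (\<beta> i) \<omega>) \<le> s")
        case True
        then have "Max ((\<lambda>w. \<bar>?c * ?a w - ?c * ?b w\<bar>) ` F) \<le> s" unfolding mF .
        from rotation_max_bound[OF F s this]
        have "ennreal ((mx True (\<lambda>i. ?XX (\<beta> i) \<omega>))\<^sup>2) \<le> ennreal (6 * s\<^sup>2 + 4 * (N (fst \<omega>))\<^sup>2 * indicator {s<..} (N (snd \<omega>)))"
          unfolding mT N_def by (rule ennreal_leI)
        also have "\<dots> = ennreal (6 * s\<^sup>2) + 4 * (ennreal ((N (fst \<omega>))\<^sup>2) * indicator {s<..} (N (snd \<omega>)))"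
          by (subst ennreal_plus) (auto simp: ennreal_mult indicator_def)
        finally show ?thesis using True by (simp add: G_def)
      qed (simp add: G_def)
    qed
  qed
  also have "\<dots> = ennreal (6 * s\<^sup>2) + 4 * (ennreal e * ennreal q)"
    using prod[of "\<lambda>\<omega>. ennreal ((N \<omega>)\<^sup>2)" "\<lambda>\<omega>. indicator {s<..} (N \<omega>)"]
    by (subst nn_integral_add) (auto simp: nn_integral_cmult nn_e nn_q P.P.emeasure_space_1)
  finally have "ennreal e * ennreal (1 - q) \<le> ennreal (6 * s\<^sup>2) + 4 * (ennreal e * ennreal q)"
    using eq lhs by simp
  moreover have q01: "0 \<le> q" "q \<le> 1 / 10" using p by (auto simp: q_def N_def)
  ultimately have "ennreal (e * (1 - q)) \<le> ennreal (6 * s\<^sup>2 + 4 * (e * q))"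
    using e0 by (simp add: ennreal_mult ennreal_plus)
  then have 1: "e * (1 - q) \<le> 6 * s\<^sup>2 + 4 * (e * q)"
    using e0 q01 by (subst (asm) ennreal_le_iff) auto
  \<comment> \<open>With \<open>q \<le> 1 / 10\<close> the inequality
    \<open>e * (1 - 5 * q) \<le> 6 * s\<^sup>2\<close> retains at least half of \<open>e\<close>;
    hence the constant 12.\<close>
  have "e * q \<le> e * (1 / 10)" by (rule mult_left_mono[OF q01(2) e0])
  with 1 have "e \<le> 12 * s\<^sup>2" by (simp add: algebra_simps)
  then show "expectation (\<lambda>\<omega>. (Max ((\<lambda>w. \<bar>X w \<omega>\<bar>) ` F))\<^sup>2) \<le> 12 * s\<^sup>2" by (simp add: e_def N_def)
qed

text \<open>The supremum of \<open>X\<close> over the points \<open>c 0, c 1, \<dots>\<close>, where \<open>\<phi> n\<close> below is its smooth approximation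
  with \<open>n + 1\<close> points and inverse temperature \<open>(n + 1)\<^sup>2\<close>, so that the error \<open>ln (n + 1) / (n + 1)\<^sup>2\<close> vanishes.\<close>

definition approx_sup :: "(nat \<Rightarrow> 'a) \<Rightarrow> nat \<Rightarrow> 'w \<Rightarrow> real" where
  "approx_sup c n = soft_sup (Suc n) ((real (Suc n))\<^sup>2) c"

definition approx_argmax :: "(nat \<Rightarrow> 'a) \<Rightarrow> nat \<Rightarrow> 'w \<Rightarrow> 'a" where
  "approx_argmax c n = soft_argmax (Suc n) ((real (Suc n))\<^sup>2) c"

lemma ln_Suc_div_le: "ln (real (Suc n)) / (real (Suc n))\<^sup>2 \<le> 1 / real (Suc n)"
proof -
  have "ln (real (Suc n)) \<le> real (Suc n)" using ln_le_minus_one[of "real (Suc n)"] by simp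
  then have "ln (real (Suc n)) / (real (Suc n))\<^sup>2 \<le> real (Suc n) / (real (Suc n))\<^sup>2" by (intro divide_right_mono) auto
  then show ?thesis by (simp add: power2_eq_square)
qed

lemma approx_props:
  "smooth_rv_deriv X (approx_sup c n) (approx_argmax c n)"
  "ibp_pair (approx_sup c n) (approx_argmax c n)"
  "square_integrable M (approx_sup c n)" "square_integrable M (approx_argmax c n)"
  "soft_limit (approx_sup c n) (approx_argmax c n)"
  unfolding approx_sup_def approx_argmax_def
  by (rule smooth_rv_deriv_soft soft_props soft_limit_soft; simp)+

lemma norm_approx_argmax_le: "(\<And>i. norm (c i) \<le> R) \<Longrightarrow> norm (approx_argmax c n \<omega>) \<le> R"
  unfolding approx_argmax_def by (rule norm_soft_argmax_le) auto

lemma approx_sup_ge: "i \<le> n \<Longrightarrow> X (c i) \<omega> \<le> approx_sup c n \<omega>"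
  unfolding approx_sup_def soft_sup_def using soft_max_ge[of "Suc n" "(real (Suc n))\<^sup>2" i "\<lambda>i. X (c i) \<omega>"] by simp

lemma approx_sup_le:
  assumes "\<And>i. i \<le> n \<Longrightarrow> X (c i) \<omega> \<le> m"
  shows "approx_sup c n \<omega> \<le> m + 1 / real (Suc n)"
  using soft_max_le[of "Suc n" "(real (Suc n))\<^sup>2" "\<lambda>i. X (c i) \<omega>" m] assms ln_Suc_div_le[of n]
  unfolding approx_sup_def soft_sup_def by (simp add: less_Suc_eq_le)

end

section \<open>Suprema over a bounded sequence: square integrability and Malliavin
  derivative\<close>

locale gaussian_sup = isonormal M X
  for M :: "'w measure" and X :: "'a::{real_inner, complete_space, second_countable_topology} \<Rightarrow> 'w \<Rightarrow> real" +
  fixes c :: "nat \<Rightarrow> 'a" and h :: "'w \<Rightarrow> real" and R :: real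
  assumes h_measurable[measurable]: "h \<in> borel_measurable M"
    and bdd: "AE \<omega> in M. bdd_above (range (\<lambda>i. X (c i) \<omega>))"
    and h: "AE \<omega> in M. h \<omega> = (SUP i. X (c i) \<omega>)"
    and norm_c: "\<And>i. norm (c i) \<le> R"
begin

lemma h_ge: "AE \<omega> in M. \<forall>i. X (c i) \<omega> \<le> h \<omega>"
  using bdd h by eventually_elim (auto intro: cSUP_upper)

text \<open>The upper tail of the maxima is dominated by that of the finite variable
  \<open>h\<close>, made at most 1/20. The lower tail has the same probability by the symmetry
  \<open>v \<mapsto> - v\<close> of the law, and together they give the 1/10 required by
  \<open>max_second_moment_bound\<close>.\<close>

lemma prob_max_bound: "\<exists>s\<ge>0. \<forall>n. prob {\<omega> \<in> space M. s < Max ((\<lambda>w. \<bar>X w \<omega>\<bar>) ` (c ` {..n}))} \<le> 1 / 10"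
proof -
  have "(\<lambda>n. prob {\<omega> \<in> space M. real n < h \<omega>}) \<longlonglongrightarrow> prob (\<Inter>n. {\<omega> \<in> space M. real n < h \<omega>})"
    by (rule finite_Lim_measure_decseq) (auto simp: decseq_def image_subset_iff)
  moreover have "(\<Inter>n. {\<omega> \<in> space M. real n < h \<omega>}) = {}"
  proof -
    have "\<exists>n. \<not> real n < h \<omega>" for \<omega> by (metis reals_Archimedean2 order_less_not_sym)
    then show ?thesis by blast
  qed
  ultimately have "(\<lambda>n. prob {\<omega> \<in> space M. real n < h \<omega>}) \<longlonglongrightarrow> 0" by simp
  from LIMSEQ_D[OF this, of "1 / 20"] obtain N where N: "norm (prob {\<omega> \<in> space M. real N < h \<omega>} - 0) < 1 / 20"
    by auto
  define s where "s = real N"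
  have hs: "prob {\<omega> \<in> space M. s < h \<omega>} \<le> 1 / 20" using N by (simp add: s_def)
  have "prob {\<omega> \<in> space M. s < Max ((\<lambda>w. \<bar>X w \<omega>\<bar>) ` (c ` {..n}))} \<le> 1 / 10" for n
  proof -
    define A where "A = {x :: 'a \<Rightarrow> real. \<exists>i\<in>{..n}. s < x (c i)}"
    have A[measurable]: "A \<in> sets (PiM UNIV (\<lambda>_. borel))"
    proof -
      have "A = {x \<in> space (PiM UNIV (\<lambda>_. borel)). \<exists>i\<in>{..n}. s < x (c i)}" by (simp add: A_def space_PiM)
      also have "\<dots> \<in> sets (PiM UNIV (\<lambda>_. borel))" by measurable
      finally show ?thesis .
    qed
    have "distr M (PiM UNIV (\<lambda>_. borel)) (\<lambda>\<omega>. \<lambda>v\<in>UNIV. X v \<omega>) = distr M (PiM UNIV (\<lambda>_. borel)) (\<lambda>\<omega>. \<lambda>v\<in>UNIV. X (- v) \<omega>)"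
      by (rule gaussian_field_law_eq[OF gaussian_field gaussian_field]) simp
    then have "measure (distr M (PiM UNIV (\<lambda>_. borel)) (\<lambda>\<omega> v. X v \<omega>)) A = measure (distr M (PiM UNIV (\<lambda>_. borel)) (\<lambda>\<omega> v. X (- v) \<omega>)) A"
      by (simp add: restrict_UNIV)
    moreover have "(\<lambda>\<omega> v. X (- v) \<omega>) \<in> M \<rightarrow>\<^sub>M PiM UNIV (\<lambda>_. borel)" by (rule measurable_PiM_single') auto
    ultimately have sym: "prob {\<omega> \<in> space M. \<exists>i\<in>{..n}. s < X (c i) \<omega>} = prob {\<omega> \<in> space M. \<exists>i\<in>{..n}. s < X (- c i) \<omega>}"
      by (simp add: measure_distr) (simp add: A_def vimage_def Int_def conj_commute)
    have up: "prob {\<omega> \<in> space M. \<exists>i\<in>{..n}. s < X (c i) \<omega>} \<le> prob {\<omega> \<in> space M. s < h \<omega>}"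
      by (rule finite_measure_mono_AE) (use h_ge in \<open>auto elim!: eventually_mono intro: less_le_trans\<close>)
    have neg: "AE \<omega> in M. \<forall>i. X (- c i) \<omega> = - X (c i) \<omega>"
      unfolding AE_all_countable
    proof
      show "AE \<omega> in M. X (- c i) \<omega> = - X (c i) \<omega>" for i using X_linear[of "-1" "c i" 0 0] by simp
    qed
    have "prob {\<omega> \<in> space M. s < Max ((\<lambda>w. \<bar>X w \<omega>\<bar>) ` (c ` {..n}))} \<le>
       prob ({\<omega> \<in> space M. \<exists>i\<in>{..n}. s < X (c i) \<omega>} \<union> {\<omega> \<in> space M. \<exists>i\<in>{..n}. s < X (- c i) \<omega>})"
    proof (rule finite_measure_mono_AE)
      show "AE \<omega> in M. \<omega> \<in> {\<omega> \<in> space M. s < Max ((\<lambda>w. \<bar>X w \<omega>\<bar>) ` (c ` {..n}))} \<longrightarrow>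
         \<omega> \<in> {\<omega> \<in> space M. \<exists>i\<in>{..n}. s < X (c i) \<omega>} \<union> {\<omega> \<in> space M. \<exists>i\<in>{..n}. s < X (- c i) \<omega>}"
        using neg
      proof eventually_elim
        case (elim \<omega>)
        show ?case
        proof
          assume a: "\<omega> \<in> {\<omega> \<in> space M. s < Max ((\<lambda>w. \<bar>X w \<omega>\<bar>) ` (c ` {..n}))}"
          then obtain i where "i \<le> n" "s < \<bar>X (c i) \<omega>\<bar>" by (auto simp: Max_gr_iff)
          then show "\<omega> \<in> {\<omega> \<in> space M. \<exists>i\<in>{..n}. s < X (c i) \<omega>} \<union> {\<omega> \<in> space M. \<exists>i\<in>{..n}. s < X (- c i) \<omega>}"
            using a elim by (auto simp: abs_if split: if_splits)
        qed
      qed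
    qed measurable
    also have "\<dots> \<le> prob {\<omega> \<in> space M. \<exists>i\<in>{..n}. s < X (c i) \<omega>} + prob {\<omega> \<in> space M. \<exists>i\<in>{..n}. s < X (- c i) \<omega>}"
      by (rule measure_Un_le) measurable
    also have "\<dots> \<le> 1 / 10" using sym up hs by linarith
    finally show ?thesis .
  qed
  then show ?thesis by (intro exI[of _ s]) (simp add: s_def)
qed

definition partial_max :: "nat \<Rightarrow> 'w \<Rightarrow> real" where
  "partial_max n \<omega> = Max ((\<lambda>i. X (c i) \<omega>) ` {..n})"

lemma partial_max_measurable[measurable]: "partial_max n \<in> borel_measurable M"
  unfolding partial_max_def by measurable

lemma X_le_partial_max: "i \<le> n \<Longrightarrow> X (c i) \<omega> \<le> partial_max n \<omega>"
  unfolding partial_max_def by (intro Max_ge) auto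

lemma partial_max_approx: "partial_max n \<omega> \<le> approx_sup c n \<omega>" "approx_sup c n \<omega> \<le> partial_max n \<omega> + 1 / real (Suc n)"
proof -
  show "partial_max n \<omega> \<le> approx_sup c n \<omega>"
    unfolding partial_max_def by (rule Max.boundedI) (auto intro: approx_sup_ge)
  show "approx_sup c n \<omega> \<le> partial_max n \<omega> + 1 / real (Suc n)"
    by (rule approx_sup_le) (rule X_le_partial_max)
qed

lemma partial_max_tendsto: "AE \<omega> in M. (\<lambda>n. partial_max n \<omega>) \<longlonglongrightarrow> h \<omega>"
  using bdd h h_ge
proof eventually_elim
  fix \<omega> assume b: "bdd_above (range (\<lambda>i. X (c i) \<omega>))" and hw: "h \<omega> = (SUP i. X (c i) \<omega>)" and ge: "\<forall>i. X (c i) \<omega> \<le> h \<omega>"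
  show "(\<lambda>n. partial_max n \<omega>) \<longlonglongrightarrow> h \<omega>"
  proof (rule increasing_LIMSEQ)
    show "partial_max n \<omega> \<le> partial_max (Suc n) \<omega>" for n
      unfolding partial_max_def by (intro Max_mono) auto
    show "partial_max n \<omega> \<le> h \<omega>" for n
      unfolding partial_max_def using ge by (intro Max.boundedI) auto
    fix e :: real assume "0 < e"
    then have "h \<omega> - e < (SUP i. X (c i) \<omega>)" using hw by simp
    then obtain i where "h \<omega> - e < X (c i) \<omega>" using less_cSUP_iff[OF _ b] by auto
    then show "\<exists>n. h \<omega> \<le> partial_max n \<omega> + e" using X_le_partial_max[of i i \<omega>] by (intro exI[of _ i]) linarith
  qed
qed

text \<open>The level \<open>s\<close> from \<open>prob_max_bound\<close> serves all
  \<open>n\<close>, so the maxima are bounded in \<open>L\<^sup>2\<close> uniformly, and Fatou's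
  lemma passes to \<open>h\<close>.\<close>

lemma square_integrable_h: "square_integrable M h"
proof -
  obtain s where s: "0 \<le> s" "\<And>n. prob {\<omega> \<in> space M. s < Max ((\<lambda>w. \<bar>X w \<omega>\<bar>) ` (c ` {..n}))} \<le> 1 / 10"
    using prob_max_bound by blast
  have b: "(\<integral>\<^sup>+\<omega>. ennreal ((partial_max n \<omega>)\<^sup>2) \<partial>M) \<le> ennreal (12 * s\<^sup>2)" for n
  proof -
    have fin: "finite (c ` {..n})" "c ` {..n} \<noteq> {}" by auto
    note m = max_second_moment_bound[OF fin s]
    have "(partial_max n \<omega>)\<^sup>2 \<le> (Max ((\<lambda>w. \<bar>X w \<omega>\<bar>) ` (c ` {..n})))\<^sup>2" for \<omega>
    proof -
      have "partial_max n \<omega> \<in> (\<lambda>i. X (c i) \<omega>) ` {..n}" unfolding partial_max_def by (intro Max_in) auto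
      then obtain i where "i \<le> n" "partial_max n \<omega> = X (c i) \<omega>" by auto
      then have "\<bar>partial_max n \<omega>\<bar> \<le> Max ((\<lambda>w. \<bar>X w \<omega>\<bar>) ` (c ` {..n}))" by (intro Max_ge) auto
      from power_mono[OF this, of 2] show ?thesis by simp
    qed
    then have "(\<integral>\<^sup>+\<omega>. ennreal ((partial_max n \<omega>)\<^sup>2) \<partial>M) \<le> (\<integral>\<^sup>+\<omega>. ennreal ((Max ((\<lambda>w. \<bar>X w \<omega>\<bar>) ` (c ` {..n})))\<^sup>2) \<partial>M)"
      by (intro nn_integral_mono ennreal_leI)
    also have "\<dots> = ennreal (expectation (\<lambda>\<omega>. (Max ((\<lambda>w. \<bar>X w \<omega>\<bar>) ` (c ` {..n})))\<^sup>2))"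
      by (rule nn_integral_eq_integral[OF m(1)]) simp
    also have "\<dots> \<le> ennreal (12 * s\<^sup>2)" by (rule ennreal_leI[OF m(2)])
    finally show ?thesis .
  qed
  have "(\<integral>\<^sup>+\<omega>. ennreal ((h \<omega>)\<^sup>2) \<partial>M) = (\<integral>\<^sup>+\<omega>. liminf (\<lambda>n. ennreal ((partial_max n \<omega>)\<^sup>2)) \<partial>M)"
  proof (rule nn_integral_cong_AE)
    show "AE \<omega> in M. ennreal ((h \<omega>)\<^sup>2) = liminf (\<lambda>n. ennreal ((partial_max n \<omega>)\<^sup>2))"
      using partial_max_tendsto
    proof eventually_elim
      fix \<omega> assume "(\<lambda>n. partial_max n \<omega>) \<longlonglongrightarrow> h \<omega>"
      then have "(\<lambda>n. ennreal ((partial_max n \<omega>)\<^sup>2)) \<longlonglongrightarrow> ennreal ((h \<omega>)\<^sup>2)"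
        by (intro tendsto_ennrealI tendsto_power)
      then show "ennreal ((h \<omega>)\<^sup>2) = liminf (\<lambda>n. ennreal ((partial_max n \<omega>)\<^sup>2))"
        by (intro lim_imp_Liminf[symmetric]) auto
    qed
  qed
  also have "\<dots> \<le> liminf (\<lambda>n. \<integral>\<^sup>+\<omega>. ennreal ((partial_max n \<omega>)\<^sup>2) \<partial>M)" by (rule nn_integral_liminf) simp
  also have "\<dots> \<le> liminf (\<lambda>n. ennreal (12 * s\<^sup>2))" by (intro Liminf_mono always_eventually allI b)
  also have "\<dots> < \<infinity>" by (simp add: Liminf_const)
  finally have "integrable M (\<lambda>\<omega>. (h \<omega>)\<^sup>2)" by (intro integrableI_nonneg) auto
  then show ?thesis by (simp add: square_integrable_def)
qed

text \<open>The approximations are squeezed pointwise between \<open>partial_max\<close> and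
  \<open>partial_max\<close> plus a null sequence. As they lie between \<open>X (c 0)\<close> and
  \<open>h + 1\<close>, the variable \<open>h - X (c 0) + 1\<close> dominates the error.\<close>

lemma approx_sup_tendsto: "l2_lim M (approx_sup c) h"
proof -
  have [measurable]: "approx_sup c n \<in> borel_measurable M" for n using approx_props(3) by (auto simp: square_integrable_def)
  have s: "square_integrable M (\<lambda>\<omega>. (h \<omega> - X (c 0) \<omega>) + 1)"
    by (intro square_integrable_add square_integrable_diff square_integrable_h square_integrable_X) (simp add: square_integrable_def)
  have "(\<lambda>n. expectation (\<lambda>\<omega>. (norm (approx_sup c n \<omega> - h \<omega>))\<^sup>2)) \<longlonglongrightarrow> expectation (\<lambda>_. 0)"
  proof (rule integral_dominated_convergence[where w="\<lambda>\<omega>. ((h \<omega> - X (c 0) \<omega>) + 1)\<^sup>2"])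
    show "integrable M (\<lambda>\<omega>. ((h \<omega> - X (c 0) \<omega>) + 1)\<^sup>2)" using square_integrableD(2)[OF s] by simp
    show "AE \<omega> in M. (\<lambda>n. (norm (approx_sup c n \<omega> - h \<omega>))\<^sup>2) \<longlonglongrightarrow> 0"
      using partial_max_tendsto
    proof eventually_elim
      fix \<omega> assume l: "(\<lambda>n. partial_max n \<omega>) \<longlonglongrightarrow> h \<omega>"
      have "(\<lambda>n. partial_max n \<omega> + 1 / real (Suc n)) \<longlonglongrightarrow> h \<omega> + 0"
        by (intro tendsto_add l LIMSEQ_Suc[OF lim_1_over_n])
      then have "(\<lambda>n. approx_sup c n \<omega>) \<longlonglongrightarrow> h \<omega>"
        unfolding add_0_right
        by (rule tendsto_sandwich[OF always_eventually always_eventually l, rotated 2]) (rule allI, rule partial_max_approx)+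
      from tendsto_power[OF tendsto_norm[OF tendsto_diff[OF this tendsto_const[of "h \<omega>"]]], of 2]
      show "(\<lambda>n. (norm (approx_sup c n \<omega> - h \<omega>))\<^sup>2) \<longlonglongrightarrow> 0" by simp
    qed
    show "AE \<omega> in M. norm ((norm (approx_sup c n \<omega> - h \<omega>))\<^sup>2) \<le> ((h \<omega> - X (c 0) \<omega>) + 1)\<^sup>2" for n
      using h_ge
    proof eventually_elim
      fix \<omega> assume ge: "\<forall>i. X (c i) \<omega> \<le> h \<omega>"
      have "approx_sup c n \<omega> \<le> h \<omega> + 1 / real (Suc n)" using ge by (intro approx_sup_le) auto
      moreover have "1 / real (Suc n) \<le> 1" by simp
      moreover have "X (c 0) \<omega> \<le> approx_sup c n \<omega>" by (rule approx_sup_ge) simp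
      ultimately have "\<bar>approx_sup c n \<omega> - h \<omega>\<bar> \<le> (h \<omega> - X (c 0) \<omega>) + 1" using ge[rule_format, of 0] by linarith
      from power_mono[OF this, of 2] show "norm ((norm (approx_sup c n \<omega> - h \<omega>))\<^sup>2) \<le> ((h \<omega> - X (c 0) \<omega>) + 1)\<^sup>2" by simp
    qed
  qed auto
  then show ?thesis using l2_lim_iff_integral[OF approx_props(3) square_integrable_h] by simp
qed

text \<open>Monotonicity of the form makes \<open>malliavin_form (\<phi> n) (D n) (\<phi> n) (D n)\<close> almost increasing, hence
  convergent, and this forces the derivatives \<open>D n\<close> to be Cauchy in \<open>L\<^sup>2\<close>.\<close>

lemma approx_argmax_Cauchy:
  assumes e: "0 < e"
  shows "\<exists>N. \<forall>n\<ge>N. \<forall>m\<ge>n. expectation (\<lambda>\<omega>. (norm (approx_argmax c n \<omega> - approx_argmax c m \<omega>))\<^sup>2) < e"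
proof -
  let ?\<phi> = "approx_sup c" and ?D = "approx_argmax c"
  let ?B = "\<lambda>n m. malliavin_form (?\<phi> n) (?D n) (?\<phi> m) (?D m)"
  let ?\<epsilon> = "\<lambda>n. 1 / real (Suc n)"
  note s = approx_props(3,4)[of c]
  have s1: "square_integrable M (\<lambda>_. 1 :: real)" by (simp add: square_integrable_def)
  have bounded: "\<exists>C. \<forall>n. f n \<le> C" if f: "f \<longlonglongrightarrow> L" for f and L :: real
  proof -
    obtain K where "\<forall>n. norm (f n) \<le> K"
      using convergent_imp_Bseq[OF convergentI[OF f]] by (auto elim: BseqE)
    then have "f n \<le> K" for n using abs_ge_self[of "f n"] by (simp add: abs_le_iff)
    then show ?thesis by blast
  qed
  have "(\<lambda>n. expectation (\<lambda>\<omega>. ?\<phi> n \<omega> \<bullet> ?\<phi> n \<omega>)) \<longlonglongrightarrow> expectation (\<lambda>\<omega>. h \<omega> \<bullet> h \<omega>)"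
    by (rule l2_lim_inner[OF s(1) square_integrable_h approx_sup_tendsto s(1) square_integrable_h approx_sup_tendsto])
  from bounded[OF this] obtain C where C: "\<And>n. expectation (\<lambda>\<omega>. ?\<phi> n \<omega> \<bullet> ?\<phi> n \<omega>) \<le> C" by blast
  have "(\<lambda>n. expectation (\<lambda>\<omega>. ?\<phi> n \<omega> \<bullet> 1)) \<longlonglongrightarrow> expectation (\<lambda>\<omega>. h \<omega> \<bullet> 1)"
    by (rule l2_lim_inner[OF s(1) square_integrable_h approx_sup_tendsto s1 s1 l2_lim_const])
  from bounded[OF this] obtain A' where A': "\<And>n. expectation (\<lambda>\<omega>. ?\<phi> n \<omega> \<bullet> 1) \<le> A'" by blast
  define A where "A = max 0 A'"
  have A: "expectation (?\<phi> n) \<le> A" "0 \<le> A" for n using A'[of n] by (auto simp: A_def)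
  have le: "?\<phi> n \<omega> \<le> ?\<phi> m \<omega> + ?\<epsilon> n" if "n \<le> m" for n m \<omega>
    using that by (intro approx_sup_le approx_sup_ge) auto
  have form_le: "malliavin_form (?\<phi> n) (?D n) (?\<phi> k) (?D k) \<le> ?B m k + ?\<epsilon> n * A" if nm: "n \<le> m" for n m k
  proof -
    have "?B n k \<le> malliavin_form (\<lambda>\<omega>. ?\<phi> m \<omega> + ?\<epsilon> n) (?D m) (?\<phi> k) (?D k)"
      by (rule malliavin_form_mono[OF approx_props(2) ibp_pair_add_const[OF approx_props(2)] _ approx_props(5)])
        (use le[OF nm] in auto)
    also have "\<dots> = ?B m k + ?\<epsilon> n * expectation (?\<phi> k)" by (rule malliavin_form_add_const[OF s(1) s(1)])
    also have "\<dots> \<le> ?B m k + ?\<epsilon> n * A" by (intro add_left_mono mult_left_mono A) simp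
    finally show ?thesis .
  qed
  have comm: "?B n m = ?B m n" for n m by (rule malliavin_form_commute)
  have "convergent (\<lambda>n. ?B n n)"
  proof (rule almost_increasing_converges)
    \<comment> \<open>One argument is replaced at a time, with symmetry of the form in between; each
      replacement costs at most \<open>?\<epsilon> n * A\<close>.\<close>
    show "?B n n \<le> ?B m m + ?\<epsilon> n * (2 * A)" if "n \<le> m" for n m
      using form_le[OF that, of n] form_le[OF that, of m] comm[of n m] by linarith
    show "?B n n \<le> C" for n
    proof -
      have "0 \<le> expectation (\<lambda>\<omega>. ?D n \<omega> \<bullet> ?D n \<omega>)" by simp
      then show ?thesis using C[of n] unfolding malliavin_form_def inner_real_def by linarith
    qed
    show "(\<lambda>n. ?\<epsilon> n * (2 * A)) \<longlonglongrightarrow> 0" by (intro tendsto_mult_left_zero LIMSEQ_Suc[OF lim_1_over_n])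
    show "0 \<le> ?\<epsilon> n * (2 * A)" for n using A by simp
  qed
  then have "Cauchy (\<lambda>n. ?B n n)" by (rule convergent_Cauchy)
  then obtain N1 where N1: "\<And>m n. m \<ge> N1 \<Longrightarrow> n \<ge> N1 \<Longrightarrow> norm (?B m m - ?B n n) < e / 4"
    using e CauchyD[of "\<lambda>n. ?B n n" "e / 4"] by auto
  have "(\<lambda>n. expectation (\<lambda>\<omega>. (norm (?\<phi> n \<omega> - h \<omega>))\<^sup>2)) \<longlonglongrightarrow> 0"
    using approx_sup_tendsto l2_lim_iff_integral[OF s(1) square_integrable_h] by simp
  from LIMSEQ_D[OF this, of "e / 16"] e obtain N2 where N2: "\<And>n. n \<ge> N2 \<Longrightarrow> expectation (\<lambda>\<omega>. (norm (?\<phi> n \<omega> - h \<omega>))\<^sup>2) < e / 16"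
    by auto
  have "(\<lambda>n. ?\<epsilon> n * (2 * A)) \<longlonglongrightarrow> 0" by (intro tendsto_mult_left_zero LIMSEQ_Suc[OF lim_1_over_n])
  from LIMSEQ_D[OF this, of "e / 4"] have "\<exists>N. \<forall>n\<ge>N. norm (?\<epsilon> n * (2 * A) - 0) < e / 4" using e by simp
  then obtain N3 where "\<And>n. n \<ge> N3 \<Longrightarrow> norm (?\<epsilon> n * (2 * A) - 0) < e / 4" by blast
  then have N3: "?\<epsilon> n * (2 * A) < e / 4" if "n \<ge> N3" for n
    using that abs_ge_self[of "?\<epsilon> n * (2 * A)"] unfolding real_norm_def diff_0_right by fastforce
  show ?thesis
  proof (rule exI[of _ "max N1 (max N2 N3)"], intro allI impI)
    fix n m assume n: "max N1 (max N2 N3) \<le> n" and nm: "n \<le> m"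
    have sq: "(norm (x - y))\<^sup>2 = x \<bullet> x - 2 * (x \<bullet> y) + y \<bullet> y" for x y :: "'z::real_inner"
      by (simp add: power2_norm_eq_inner inner_diff_left inner_diff_right inner_commute)
    have ex: "expectation (\<lambda>\<omega>. (norm (f \<omega> - g \<omega>))\<^sup>2) = expectation (\<lambda>\<omega>. f \<omega> \<bullet> f \<omega>) - 2 * expectation (\<lambda>\<omega>. f \<omega> \<bullet> g \<omega>) + expectation (\<lambda>\<omega>. g \<omega> \<bullet> g \<omega>)"
      if "square_integrable M f" "square_integrable M g" for f g :: "'w \<Rightarrow> 'z::{real_inner, second_countable_topology}"
      unfolding sq using integrable_inner_square_integrable[OF that(1) that(1)] integrable_inner_square_integrable[OF that]
        integrable_inner_square_integrable[OF that(2) that(2)] by simp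
    \<comment> \<open>The distance of the derivatives is that of the values minus the form of the
      difference. Monotonicity enters as \<open>?B n m \<le> ?B m m + ?\<epsilon> n * A\<close>;
      three contributions of at most \<open>e / 4\<close> remain.\<close>
    have "expectation (\<lambda>\<omega>. (norm (?D n \<omega> - ?D m \<omega>))\<^sup>2) =
        expectation (\<lambda>\<omega>. (norm (?\<phi> n \<omega> - ?\<phi> m \<omega>))\<^sup>2) - (?B n n - 2 * ?B n m + ?B m m)"
      unfolding ex[OF s(2) s(2)] ex[OF s(1) s(1)] malliavin_form_def by simp
    moreover have "expectation (\<lambda>\<omega>. (norm (?\<phi> n \<omega> - ?\<phi> m \<omega>))\<^sup>2) \<le> e / 4"
    proof -
      have "(norm (x - y))\<^sup>2 \<le> 2 * (norm (x - z))\<^sup>2 + 2 * (norm (y - z))\<^sup>2" for x y z :: real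
        using zero_le_power2[of "(x - z) + (y - z)"] by (simp add: power2_eq_square algebra_simps)
      then have "expectation (\<lambda>\<omega>. (norm (?\<phi> n \<omega> - ?\<phi> m \<omega>))\<^sup>2) \<le>
         expectation (\<lambda>\<omega>. 2 * (norm (?\<phi> n \<omega> - h \<omega>))\<^sup>2 + 2 * (norm (?\<phi> m \<omega> - h \<omega>))\<^sup>2)"
        by (intro integral_mono square_integrableD(2)[OF square_integrable_diff[OF s(1) s(1)]] Bochner_Integration.integrable_add
           integrable_mult_right square_integrableD(2)[OF square_integrable_diff[OF s(1) square_integrable_h]])
      also have "\<dots> = 2 * expectation (\<lambda>\<omega>. (norm (?\<phi> n \<omega> - h \<omega>))\<^sup>2) + 2 * expectation (\<lambda>\<omega>. (norm (?\<phi> m \<omega> - h \<omega>))\<^sup>2)"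
        using square_integrableD(2)[OF square_integrable_diff[OF s(1) square_integrable_h]] by simp
      finally show ?thesis using N2[of n] N2[of m] n nm by simp
    qed
    moreover have "?B n m \<le> ?B m m + ?\<epsilon> n * A" by (rule form_le[OF nm])
    moreover have "?B m m - ?B n n < e / 4" 
    proof -
      have "norm (?B m m - ?B n n) < e / 4" by (rule N1) (use n nm in auto)
      then show ?thesis unfolding real_norm_def by linarith
    qed
    moreover have "2 * (?\<epsilon> n * A) < e / 4"
    proof -
      have "?\<epsilon> n * (2 * A) < e / 4" by (rule N3) (use n in auto)
      then show ?thesis by (simp only: mult_ac)
    qed
    ultimately show "expectation (\<lambda>\<omega>. (norm (?D n \<omega> - ?D m \<omega>))\<^sup>2) < e" using e by linarith
  qed
qed

lemma malliavin_derivative_exists: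
  obtains r Z where "strict_mono r" "square_integrable M Z" "l2_lim M (\<lambda>k. approx_sup c (r k)) h"
    "l2_lim M (\<lambda>k. approx_argmax c (r k)) Z" "soft_limit h Z"
proof -
  have m: "approx_argmax c n \<in> borel_measurable M" for n using square_integrableD(1)[OF approx_props(4)] .
  obtain r Z where r: "strict_mono r" "square_integrable M Z" "l2_lim M (\<lambda>k. approx_argmax c (r k)) Z"
    using l2_Cauchy_bounded_convergent[OF m norm_approx_argmax_le[of c R, OF norm_c] approx_argmax_Cauchy] by metis
  have l: "l2_lim M (\<lambda>k. approx_sup c (r k)) h"
    using LIMSEQ_subseq_LIMSEQ[OF approx_sup_tendsto[unfolded l2_lim_def] r(1)] by (simp add: l2_lim_def o_def)
  have "soft_limit h Z"
    unfolding soft_limit_def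
  proof (intro conjI square_integrable_h r(2))
    show "\<exists>n b v. (\<forall>k. 0 < n k \<and> 0 < b k) \<and> l2_lim M (\<lambda>k. soft_sup (n k) (b k) (v k)) h \<and>
       l2_lim M (\<lambda>k. soft_argmax (n k) (b k) (v k)) Z"
      by (rule exI[of _ "\<lambda>k. Suc (r k)"], rule exI[of _ "\<lambda>k. (real (Suc (r k)))\<^sup>2"], rule exI[of _ "\<lambda>_. c"])
        (use l r(3) in \<open>simp add: approx_sup_def approx_argmax_def\<close>)
  qed
  then show thesis using that r l by blast
qed

end

section \<open>Nearest points and Lebesgue measure on subspaces\<close>

definition nearest :: "'a::real_inner set \<Rightarrow> 'a \<Rightarrow> 'a" where
  "nearest K a = (SOME p. p \<in> K \<and> (\<forall>y\<in>K. dist a p \<le> dist a y))"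

context
  fixes K :: "'a::real_inner set"
  assumes K: "convex_body K"
begin

lemma nearest_props: "nearest K a \<in> K" "y \<in> K \<Longrightarrow> dist a (nearest K a) \<le> dist a y"
proof -
  have "\<exists>p\<in>K. \<forall>y\<in>K. dist a p \<le> dist a y"
    using K by (intro continuous_attains_inf) (auto simp: convex_body_def intro!: continuous_intros)
  then have "\<exists>p. p \<in> K \<and> (\<forall>y\<in>K. dist a p \<le> dist a y)" by blast
  from someI_ex[OF this] show "nearest K a \<in> K" "y \<in> K \<Longrightarrow> dist a (nearest K a) \<le> dist a y"
    unfolding nearest_def by blast+
qed

lemma nearest_dot: "y \<in> K \<Longrightarrow> (a - nearest K a) \<bullet> (y - nearest K a) \<le> 0"
  using any_closest_point_dot[of K "nearest K a" y a] K nearest_props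
  by (auto simp: convex_body_def compact_imp_closed)

text \<open>Adding the variational inequalities of the two candidates bounds their squared distance
  by 0.\<close>

lemma nearest_eqI:
  assumes "p \<in> K" "\<And>y. y \<in> K \<Longrightarrow> (a - p) \<bullet> (y - p) \<le> 0"
  shows "nearest K a = p"
proof -
  let ?q = "nearest K a"
  have "(a - p) \<bullet> (?q - p) \<le> 0" "(a - ?q) \<bullet> (p - ?q) \<le> 0"
    using assms nearest_props(1) nearest_dot by auto
  then have "(?q - p) \<bullet> (?q - p) \<le> 0" by (simp add: inner_diff_left inner_diff_right inner_commute)
  then show ?thesis by (metis inner_gt_zero_iff not_less eq_iff_diff_eq_0)
qed

lemma nearest_lipschitz: "dist (nearest K x) (nearest K y) \<le> dist x y"
proof -
  let ?p = "nearest K x" and ?q = "nearest K y"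
  have "(x - ?p) \<bullet> (?q - ?p) \<le> 0" "(y - ?q) \<bullet> (?p - ?q) \<le> 0"
    using nearest_props(1) nearest_dot by auto
  then have "(norm (?p - ?q))\<^sup>2 \<le> (x - y) \<bullet> (?p - ?q)"
    by (simp add: power2_norm_eq_inner inner_diff_left inner_diff_right inner_commute)
  also have "\<dots> \<le> norm (x - y) * norm (?p - ?q)" by (rule norm_cauchy_schwarz)
  finally show ?thesis
    by (cases "norm (?p - ?q) = 0") (auto simp: dist_norm power2_eq_square)
qed

lemma continuous_nearest: "continuous_on UNIV (nearest K)"
  unfolding continuous_on_iff using nearest_lipschitz order_le_less_trans by blast

lemma infdist_eq_nearest: "infdist a K = dist a (nearest K a)"
proof (rule antisym)
  show "infdist a K \<le> dist a (nearest K a)" by (rule infdist_le[OF nearest_props(1)])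
  show "dist a (nearest K a) \<le> infdist a K"
    using nearest_props K by (auto simp: infdist_def convex_body_def intro!: cINF_greatest)
qed

end

definition coords :: "nat \<Rightarrow> (nat \<Rightarrow> 'a::real_inner) \<Rightarrow> (nat \<Rightarrow> real) \<Rightarrow> 'a" where
  "coords d e x = (\<Sum>i<d. x i *\<^sub>R e i)"

lemma coords_in_span: "coords d e x \<in> span (e ` {..<d})"
  unfolding coords_def by (intro span_sum span_scale span_base) auto

context
  fixes d :: nat and e :: "nat \<Rightarrow> 'a::real_inner"
  assumes e: "orthonormal_system d e"
begin

lemma orthonormal_inner: "i < d \<Longrightarrow> j < d \<Longrightarrow> e i \<bullet> e j = (if i = j then 1 else 0)"
  using e by (simp add: orthonormal_system_def)

lemma norm_orthonormal: "i < d \<Longrightarrow> norm (e i) = 1"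
  using orthonormal_inner[of i i] by (simp add: norm_eq_1)

lemma coords_inner:
  assumes "i < d"
  shows "coords d e x \<bullet> e i = x i"
proof -
  have "coords d e x \<bullet> e i = (\<Sum>j<d. if j = i then x j else 0)"
    unfolding coords_def inner_sum_left using assms by (intro sum.cong) (auto simp: orthonormal_inner)
  then show ?thesis using assms by simp
qed

lemma norm_coords: "(norm (coords d e x))\<^sup>2 = (\<Sum>i<d. (x i)\<^sup>2)"
proof -
  have "(norm (coords d e x))\<^sup>2 = (\<Sum>i<d. x i * (coords d e x \<bullet> e i))"
    unfolding power2_norm_eq_inner by (subst (2) coords_def) (simp add: inner_sum_right)
  then show ?thesis by (simp add: coords_inner power2_eq_square)
qed

lemma orthonormal_expansion:
  assumes "x \<in> span (e ` {..<d})"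
  shows "coords d e (\<lambda>i. x \<bullet> e i) = x"
proof -
  let ?y = "x - coords d e (\<lambda>i. x \<bullet> e i)"
  have "?y \<in> span (e ` {..<d})" by (intro span_diff assms coords_in_span)
  moreover have "orthogonal ?y z" if "z \<in> e ` {..<d}" for z
    using that by (auto simp: orthogonal_def inner_diff_left coords_inner)
  ultimately have "orthogonal ?y ?y" by (metis orthogonal_to_span)
  then show ?thesis by (simp add: orthogonal_def)
qed

lemma orthonormal_independent: "independent (e ` {..<d})" "inj_on e {..<d}"
proof -
  have inj: "i = j" if "i < d" "j < d" "e i = e j" for i j
    using orthonormal_inner[of i j] orthonormal_inner[of i i] that by (auto split: if_splits)
  then show "inj_on e {..<d}" by (auto intro: inj_onI)
  show "independent (e ` {..<d})"
  proof (rule pairwise_orthogonal_independent)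
    show "pairwise orthogonal (e ` {..<d})" by (auto simp: pairwise_def orthogonal_def orthonormal_inner)
    show "0 \<notin> e ` {..<d}" using norm_orthonormal by force
  qed
qed

lemma dim_orthonormal: "dim (span (e ` {..<d})) = d"
  using orthonormal_independent by (simp add: dim_eq_card[OF refl] card_image)

end

text \<open>Gram-Schmidt, skipping vectors that are already in the span. The given vectors
  \<open>b\<close> are kept as the initial ones, which later yields bases adapted to a face.\<close>

lemma orthonormal_extend:
  fixes b :: "nat \<Rightarrow> 'a::real_inner"
  assumes b: "orthonormal_system k b" and V: "finite V"
  obtains d c where "orthonormal_system d c" "k \<le> d" "\<And>i. i < k \<Longrightarrow> c i = b i"
    "span (c ` {..<d}) = span (b ` {..<k} \<union> V)"
proof -
  have "\<exists>d c. orthonormal_system d c \<and> k \<le> d \<and> (\<forall>i<k. c i = b i) \<and> span (c ` {..<d}) = span (b ` {..<k} \<union> V)"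
    using V
  proof (induction V rule: finite_induct)
    case empty
    then show ?case using b by (intro exI[of _ k] exI[of _ b]) auto
  next
    case (insert v V)
    then obtain d c where c: "orthonormal_system d c" "k \<le> d" "\<forall>i<k. c i = b i" "span (c ` {..<d}) = span (b ` {..<k} \<union> V)"
      by blast
    have sp: "span (b ` {..<k} \<union> insert v V) = span (insert v (c ` {..<d}))"
    proof -
      have "span (b ` {..<k} \<union> insert v V) = span (insert v (b ` {..<k} \<union> V))" by simp
      also have "\<dots> = span (insert v (c ` {..<d}))" using c(4) by (simp add: span_insert)
      finally show ?thesis .
    qed
    define p where "p = coords d c (\<lambda>i. v \<bullet> c i)"
    define u where "u = v - p"
    have p: "p \<in> span (c ` {..<d})" unfolding p_def by (rule coords_in_span)
    have uc: "u \<bullet> c i = 0" if "i < d" for i using that by (simp add: u_def p_def inner_diff_left coords_inner[OF c(1)])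
    show ?case
    proof (cases "u = 0")
      case True
      then have "v \<in> span (c ` {..<d})" using p by (simp add: u_def)
      then have "span (insert v (c ` {..<d})) = span (c ` {..<d})" by (rule span_redundant)
      then show ?thesis using c sp by (intro exI[of _ d] exI[of _ c]) auto
    next
      case False
      define f where "f = c(d := (1 / norm u) *\<^sub>R u)"
      have im: "f ` {..<Suc d} = insert ((1 / norm u) *\<^sub>R u) (c ` {..<d})"
        by (auto simp: f_def lessThan_Suc image_iff)
      have "orthonormal_system (Suc d) f"
        using c(1) uc False unfolding orthonormal_system_def f_def
        by (auto simp: less_Suc_eq inner_commute power2_norm_eq_inner[symmetric] power2_eq_square)
      moreover have "span (f ` {..<Suc d}) = span (insert v (c ` {..<d}))"
      proof -
        have "span (insert ((1 / norm u) *\<^sub>R u) (c ` {..<d})) = span (insert v (c ` {..<d}))"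
        proof (rule span_eq[THEN iffD2], intro conjI)
          have v: "v \<in> span (insert v (c ` {..<d}))" and pin: "p \<in> span (insert v (c ` {..<d}))"
            using p span_mono[of "c ` {..<d}" "insert v (c ` {..<d})"] by (auto intro: span_base)
          show "insert ((1 / norm u) *\<^sub>R u) (c ` {..<d}) \<subseteq> span (insert v (c ` {..<d}))"
            using span_scale[OF span_diff[OF v pin], of "1 / norm u"] by (auto simp: u_def intro: span_base)
          have w: "(1 / norm u) *\<^sub>R u \<in> span (insert ((1 / norm u) *\<^sub>R u) (c ` {..<d}))"
            and pin': "p \<in> span (insert ((1 / norm u) *\<^sub>R u) (c ` {..<d}))"
            using p span_mono[of "c ` {..<d}" "insert ((1 / norm u) *\<^sub>R u) (c ` {..<d})"] by (auto intro: span_base)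
          have "v = norm u *\<^sub>R ((1 / norm u) *\<^sub>R u) + p" using False by (simp add: u_def)
          then have "v \<in> span (insert ((1 / norm u) *\<^sub>R u) (c ` {..<d}))"
            using span_add[OF span_scale[OF w, of "norm u"] pin'] by simp
          then show "insert v (c ` {..<d}) \<subseteq> span (insert ((1 / norm u) *\<^sub>R u) (c ` {..<d}))"
            by (auto intro: span_base)
        qed
        then show ?thesis unfolding im .
      qed
      moreover have "\<forall>i<k. f i = b i" using c(2,3) by (auto simp: f_def)
      ultimately show ?thesis using sp c(2) by (intro exI[of _ "Suc d"] exI[of _ f]) simp
    qed
  qed
  then show thesis using that by blast
qed

lemma orthonormal_dim_eq:
  assumes "orthonormal_system d e" "orthonormal_system d' e'" "span (e ` {..<d}) = span (e' ` {..<d'})"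
  shows "d = d'"
  using dim_orthonormal[OF assms(1)] dim_orthonormal[OF assms(2)] assms(3) by simp

text \<open>Lebesgue measure of the span, carried over to a Borel measure on the whole Hilbert
  space, so that sets need not be intersected with the span.\<close>

definition span_vol :: "nat \<Rightarrow> (nat \<Rightarrow> 'a::{real_inner, second_countable_topology}) \<Rightarrow> 'a measure" where
  "span_vol d e = distr (PiM {..<d} (\<lambda>_. lborel)) borel (coords d e)"

lemma measurable_lborel_component:
  "i \<in> I \<Longrightarrow> (\<lambda>x :: 'i \<Rightarrow> real. x i) \<in> borel_measurable (PiM I (\<lambda>_. lborel))"
  using measurable_component_singleton[of i I "\<lambda>_. lborel :: real measure"] by simp

lemma coords_measurable[measurable]:
  fixes e :: "nat \<Rightarrow> 'a::{real_inner, second_countable_topology}"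
  shows "coords d e \<in> borel_measurable (PiM {..<d} (\<lambda>_. lborel))"
  unfolding coords_def
  by (intro borel_measurable_sum borel_measurable_scaleR borel_measurable_const measurable_lborel_component) auto

lemma sets_span_vol[measurable_cong, simp]: "sets (span_vol d e) = sets borel" "space (span_vol d e) = UNIV"
  by (simp_all add: span_vol_def)

lemma subspace_vol_eq:
  fixes e :: "nat \<Rightarrow> 'a::{real_inner, second_countable_topology}"
  assumes A: "A \<in> sets borel"
  shows "subspace_vol d e A = measure (span_vol d e) A"
proof -
  have "{x \<in> extensional {..<d}. (\<Sum>i<d. x i *\<^sub>R e i) \<in> A} = coords d e -` A \<inter> space (PiM {..<d} (\<lambda>_. lborel))"
    by (auto simp: space_PiM PiE_def coords_def)
  then show ?thesis using A by (simp add: subspace_vol_def span_vol_def measure_distr)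
qed

lemma nn_integral_span_vol:
  fixes e :: "nat \<Rightarrow> 'a::{real_inner, second_countable_topology}"
  assumes "F \<in> borel_measurable borel"
  shows "(\<integral>\<^sup>+x. F x \<partial>span_vol d e) = (\<integral>\<^sup>+x. F (coords d e x) \<partial>PiM {..<d} (\<lambda>_. lborel))"
  unfolding span_vol_def using assms by (subst nn_integral_distr) auto

lemma emeasure_span_vol_cong:
  fixes e :: "nat \<Rightarrow> 'a::{real_inner, second_countable_topology}"
  assumes "A \<in> sets borel" "B \<in> sets borel" "A \<inter> span (e ` {..<d}) = B \<inter> span (e ` {..<d})"
  shows "emeasure (span_vol d e) A = emeasure (span_vol d e) B"
proof -
  have "coords d e -` A = coords d e -` B" using assms(3) coords_in_span[of d e] by auto
  then show ?thesis using assms by (simp add: span_vol_def emeasure_distr)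
qed

text \<open>Diagonal affine maps cover both later uses: dilation of the whole span, and stretching
  only the directions normal to a face.\<close>

lemma nn_integral_PiM_affine:
  fixes c t :: "'i \<Rightarrow> real"
  assumes "finite I" "\<And>i. i \<in> I \<Longrightarrow> c i \<noteq> 0" "f \<in> borel_measurable (PiM I (\<lambda>_. lborel))"
  shows "(\<integral>\<^sup>+x. f (\<lambda>i\<in>I. t i + c i * x i) \<partial>PiM I (\<lambda>_. lborel)) = ennreal (\<Prod>i\<in>I. 1 / \<bar>c i\<bar>) * (\<integral>\<^sup>+x. f x \<partial>PiM I (\<lambda>_. lborel))"
  using assms
proof (induction I arbitrary: f rule: finite_induct)
  case empty
  interpret product_sigma_finite "\<lambda>_ :: 'i. lborel" by standard
  have "(\<integral>\<^sup>+x. f x \<partial>PiM {} (\<lambda>_ :: 'i. lborel)) = f (\<lambda>_. undefined)"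
    by (rule nn_integral_empty) simp
  moreover have "(\<integral>\<^sup>+x. f (\<lambda>i\<in>{}. t i + c i * x i) \<partial>PiM {} (\<lambda>_ :: 'i. lborel)) = f (\<lambda>i\<in>{}. t i + c i * undefined i)"
    by (subst nn_integral_empty) (simp_all add: restrict_def)
  ultimately show ?case by (simp add: restrict_def)
next
  case (insert i I)
  interpret product_sigma_finite "\<lambda>_ :: 'i. lborel" by standard
  note [measurable] = insert.prems(2)
  let ?P = "PiM I (\<lambda>_. lborel :: real measure)"
  have ci: "c i \<noteq> 0" using insert.prems by auto
  have g: "(\<lambda>z. \<integral>\<^sup>+y. f (z(i := y)) \<partial>lborel) \<in> borel_measurable ?P" by measurable
  have meas: "(\<lambda>x. \<lambda>j\<in>insert i I. t j + c j * x j) \<in> PiM (insert i I) (\<lambda>_. lborel) \<rightarrow>\<^sub>M PiM (insert i I) (\<lambda>_. lborel)"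
    by (rule measurable_restrict) (simp, intro borel_measurable_add borel_measurable_times borel_measurable_const measurable_lborel_component, simp)
  have "(\<integral>\<^sup>+x. f (\<lambda>j\<in>insert i I. t j + c j * x j) \<partial>PiM (insert i I) (\<lambda>_. lborel)) =
      (\<integral>\<^sup>+x. \<integral>\<^sup>+y. f (\<lambda>j\<in>insert i I. t j + c j * (x(i := y)) j) \<partial>lborel \<partial>?P)"
    by (rule product_nn_integral_insert[OF insert.hyps measurable_compose[OF meas insert.prems(2)]])
  also have "\<dots> = (\<integral>\<^sup>+x. \<integral>\<^sup>+y. f ((\<lambda>j\<in>I. t j + c j * x j)(i := t i + c i * y)) \<partial>lborel \<partial>?P)"
    using insert.hyps by (intro nn_integral_cong arg_cong[where f=f]) (auto simp: restrict_def fun_eq_iff)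
  also have "\<dots> = (\<integral>\<^sup>+x. ennreal (1 / \<bar>c i\<bar>) * (\<integral>\<^sup>+y. f ((\<lambda>j\<in>I. t j + c j * x j)(i := y)) \<partial>lborel) \<partial>?P)"
  proof (rule nn_integral_cong)
    fix x assume x: "x \<in> space ?P"
    let ?z = "\<lambda>j\<in>I. t j + c j * x j"
    have z: "?z \<in> space ?P" by (auto simp: space_PiM)
    have m: "(\<lambda>y. f (?z(i := y))) \<in> borel_measurable lborel"
      by (rule measurable_compose[OF measurable_component_update[OF z insert.hyps(2)] insert.prems(2)])
    have "(\<integral>\<^sup>+y. f (?z(i := y)) \<partial>lborel) = \<bar>c i\<bar> * (\<integral>\<^sup>+y. f (?z(i := t i + c i * y)) \<partial>lborel)"
      by (rule nn_integral_real_affine) (use m ci in auto)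
    then have "ennreal (1 / \<bar>c i\<bar>) * (\<integral>\<^sup>+y. f (?z(i := y)) \<partial>lborel) =
        (ennreal (1 / \<bar>c i\<bar>) * ennreal \<bar>c i\<bar>) * (\<integral>\<^sup>+y. f (?z(i := t i + c i * y)) \<partial>lborel)"
      by (simp add: mult.assoc)
    also have "ennreal (1 / \<bar>c i\<bar>) * ennreal \<bar>c i\<bar> = 1" using ci by (simp flip: ennreal_mult)
    finally show "(\<integral>\<^sup>+y. f (?z(i := t i + c i * y)) \<partial>lborel) = ennreal (1 / \<bar>c i\<bar>) * (\<integral>\<^sup>+y. f (?z(i := y)) \<partial>lborel)"
      by (simp only: mult_1)
  qed
  also have "\<dots> = ennreal (1 / \<bar>c i\<bar>) * (\<integral>\<^sup>+x. \<integral>\<^sup>+y. f ((\<lambda>j\<in>I. t j + c j * x j)(i := y)) \<partial>lborel \<partial>?P)"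
  proof (rule nn_integral_cmult)
    have "(\<lambda>x. \<lambda>j\<in>I. t j + c j * x j) \<in> ?P \<rightarrow>\<^sub>M ?P" by (rule measurable_restrict) (simp, intro borel_measurable_add borel_measurable_times borel_measurable_const measurable_lborel_component)
    from measurable_compose[OF this g]
    show "(\<lambda>x. \<integral>\<^sup>+y. f ((\<lambda>j\<in>I. t j + c j * x j)(i := y)) \<partial>lborel) \<in> borel_measurable ?P" .
  qed
  also have "(\<integral>\<^sup>+x. \<integral>\<^sup>+y. f ((\<lambda>j\<in>I. t j + c j * x j)(i := y)) \<partial>lborel \<partial>?P) =
      ennreal (\<Prod>i\<in>I. 1 / \<bar>c i\<bar>) * (\<integral>\<^sup>+x. \<integral>\<^sup>+y. f (x(i := y)) \<partial>lborel \<partial>?P)"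
    using insert.prems by (intro insert.IH g) auto
  also have "(\<integral>\<^sup>+x. \<integral>\<^sup>+y. f (x(i := y)) \<partial>lborel \<partial>?P) = (\<integral>\<^sup>+x. f x \<partial>PiM (insert i I) (\<lambda>_. lborel))"
    by (rule product_nn_integral_insert[OF insert.hyps insert.prems(2), symmetric])
  finally have *: "(\<integral>\<^sup>+x. f (\<lambda>j\<in>insert i I. t j + c j * x j) \<partial>PiM (insert i I) (\<lambda>_. lborel)) =
      ennreal (1 / \<bar>c i\<bar>) * (ennreal (\<Prod>i\<in>I. 1 / \<bar>c i\<bar>) * (\<integral>\<^sup>+x. f x \<partial>PiM (insert i I) (\<lambda>_. lborel)))" .
  have "ennreal (\<Prod>i\<in>insert i I. 1 / \<bar>c i\<bar>) = ennreal (1 / \<bar>c i\<bar>) * ennreal (\<Prod>i\<in>I. 1 / \<bar>c i\<bar>)"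
    unfolding prod.insert[OF insert.hyps] by (rule ennreal_mult) (auto intro!: prod_nonneg)
  with * show ?case by (simp only: mult.assoc)
qed

lemma nn_integral_span_vol_affine:
  fixes e :: "nat \<Rightarrow> 'a::{real_inner, second_countable_topology}"
  assumes e: "orthonormal_system d e" and c: "\<And>i. i < d \<Longrightarrow> c i \<noteq> 0" and F: "F \<in> borel_measurable borel"
  shows "(\<integral>\<^sup>+x. F (coords d e (\<lambda>i. t i + c i * (x \<bullet> e i))) \<partial>span_vol d e) =
    ennreal (\<Prod>i<d. 1 / \<bar>c i\<bar>) * (\<integral>\<^sup>+x. F x \<partial>span_vol d e)"
proof -
  note [measurable] = F
  have m: "(\<lambda>x. F (coords d e (\<lambda>i. t i + c i * (x \<bullet> e i)))) \<in> borel_measurable borel"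
    unfolding coords_def by measurable
  have "(\<integral>\<^sup>+x. F (coords d e (\<lambda>i. t i + c i * (x \<bullet> e i))) \<partial>span_vol d e) =
     (\<integral>\<^sup>+x. F (coords d e (\<lambda>i\<in>{..<d}. t i + c i * x i)) \<partial>PiM {..<d} (\<lambda>_. lborel))"
    unfolding nn_integral_span_vol[OF m]
    by (intro nn_integral_cong arg_cong[where f=F]) (simp add: coords_def[of d e "\<lambda>i. t i + c i * _ i"] coords_def[of d e "restrict _ _"] coords_inner[OF e])
  also have "\<dots> = ennreal (\<Prod>i<d. 1 / \<bar>c i\<bar>) * (\<integral>\<^sup>+x. F (coords d e x) \<partial>PiM {..<d} (\<lambda>_. lborel))"
    by (rule nn_integral_PiM_affine) (use c in auto)
  finally show ?thesis unfolding nn_integral_span_vol[OF F] .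
qed

lemma emeasure_span_vol_cball:
  fixes e :: "nat \<Rightarrow> 'a::{real_inner, second_countable_topology}"
  assumes e: "orthonormal_system d e" and r: "0 < r"
  shows "emeasure (span_vol d e) (cball 0 r) = ennreal (unit_ball_vol (real d) * r ^ d)"
proof -
  have "norm (coords d e x) = sqrt (\<Sum>i<d. (x i)\<^sup>2)" for x
    by (metis norm_coords[OF e] norm_ge_zero real_sqrt_unique)
  then have "coords d e -` cball 0 r = {f. sqrt (\<Sum>i<d. (f i)\<^sup>2) \<le> r}" by auto
  then show ?thesis
    using emeasure_cball_aux[of "{..<d}" r] r by (simp add: span_vol_def emeasure_distr)
qed

lemma integral_PiM_std_normal_cos:
  assumes "finite I"
  shows "(LINT x|PiM I (\<lambda>_. std_normal). cos ((\<Sum>i\<in>I. a i * x i) + c)) = exp (- (\<Sum>i\<in>I. (a i)\<^sup>2) / 2) * cos c"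
  using assms
proof (induction I arbitrary: c rule: finite_induct)
  case empty
  interpret product_prob_space "\<lambda>_. std_normal" by (rule product_prob_spaceI) (rule prob_space_std_normal)
  show ?case by (simp add: prob_space.prob_space[OF prob_space_PiM[OF prob_space_std_normal]])
next
  case (insert i I)
  interpret product_prob_space "\<lambda>_ :: 'a. std_normal" by (rule product_prob_spaceI) (rule prob_space_std_normal)
  interpret PP: prob_space "PiM (insert i I) (\<lambda>_. std_normal)" by (rule prob_space_PiM[OF prob_space_std_normal])
  have comp: "(\<lambda>x. x j) \<in> borel_measurable (PiM (insert i I) (\<lambda>_. std_normal))" if "j \<in> insert i I" for j
    using measurable_component_singleton[of j "insert i I" "\<lambda>_. std_normal"] that by simp
  have m: "(\<lambda>x. cos ((\<Sum>j\<in>insert i I. a j * x j) + c)) \<in> borel_measurable (PiM (insert i I) (\<lambda>_. std_normal))"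
    by (rule measurable_compose[OF _ borel_measurable_continuous_onI[OF continuous_on_cos[OF continuous_on_id]]])
      (intro borel_measurable_add borel_measurable_sum borel_measurable_times borel_measurable_const comp)
  have "integrable (PiM (insert i I) (\<lambda>_. std_normal)) (\<lambda>x. cos ((\<Sum>j\<in>insert i I. a j * x j) + c))"
    by (rule PP.integrable_bounded[OF m, of 1]) simp
  from product_integral_insert[OF insert.hyps this]
  have "(LINT x|PiM (insert i I) (\<lambda>_. std_normal). cos ((\<Sum>j\<in>insert i I. a j * x j) + c)) =
     (LINT x|PiM I (\<lambda>_. std_normal). LINT y|std_normal. cos ((\<Sum>j\<in>insert i I. a j * (x(i := y)) j) + c))" .
  also have "\<dots> = (LINT x|PiM I (\<lambda>_. std_normal). LINT y|std_normal. cos (a i * y + ((\<Sum>j\<in>I. a j * x j) + c)))"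
  proof -
    have "(\<Sum>j\<in>insert i I. a j * (x(i := y)) j) = a i * y + (\<Sum>j\<in>I. a j * x j)" for x y
      using insert.hyps by (simp add: sum.insert) (intro sum.cong, auto)
    then show ?thesis by (simp add: add.assoc)
  qed
  also have "\<dots> = (LINT x|PiM I (\<lambda>_. std_normal). exp (- (a i)\<^sup>2 / 2) * cos ((\<Sum>j\<in>I. a j * x j) + c))"
    by (simp only: integral_std_normal_cos)
  also have "\<dots> = exp (- (a i)\<^sup>2 / 2) * (exp (- (\<Sum>j\<in>I. (a j)\<^sup>2) / 2) * cos c)"
    by (simp only: integral_mult_right_zero insert.IH)
  also have "\<dots> = exp (- (\<Sum>j\<in>insert i I. (a j)\<^sup>2) / 2) * cos c"
  proof -
    have "(\<Sum>j\<in>insert i I. (a j)\<^sup>2) = (a i)\<^sup>2 + (\<Sum>j\<in>I. (a j)\<^sup>2)" using insert.hyps by simp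
    then have "- (\<Sum>j\<in>insert i I. (a j)\<^sup>2) / 2 = - (a i)\<^sup>2 / 2 + - (\<Sum>j\<in>I. (a j)\<^sup>2) / 2"
      by (simp only:) (simp add: field_simps)
    then show ?thesis by (simp only: exp_add mult.assoc)
  qed
  finally show ?case .
qed

lemma PiM_std_normal_density:
  assumes "finite I"
  shows "PiM I (\<lambda>_. std_normal) = density (PiM I (\<lambda>_. lborel)) (\<lambda>x. ennreal (\<Prod>i\<in>I. std_normal_density (x i)))"
proof -
  interpret L: product_sigma_finite "\<lambda>_ :: 'a. lborel :: real measure" by standard
  interpret product_prob_space "\<lambda>_ :: 'a. std_normal" by (rule product_prob_spaceI) (rule prob_space_std_normal)
  have sets_eq: "sets (PiM I (\<lambda>_. std_normal)) = sets (PiM I (\<lambda>_. lborel))" by (intro sets_PiM_cong) auto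
  have dens: "(\<lambda>x. ennreal (\<Prod>i\<in>I. std_normal_density (x i))) \<in> borel_measurable (PiM I (\<lambda>_. lborel))"
    by (intro measurable_compose[OF _ measurable_ennreal] borel_measurable_prod
        measurable_compose[OF measurable_lborel_component borel_measurable_normal_density])
  show ?thesis
  proof (rule PiM_eqI[OF assms, symmetric])
    show "sets (density (PiM I (\<lambda>_. lborel)) (\<lambda>x. ennreal (\<Prod>i\<in>I. std_normal_density (x i)))) = sets (PiM I (\<lambda>_. std_normal))"
      using sets_eq by simp
    fix A assume A: "\<And>i. i \<in> I \<Longrightarrow> A i \<in> sets std_normal"
    have A': "A i \<in> sets borel" if "i \<in> I" for i using A[OF that] by simp
    have B: "PiE I A \<in> sets (PiM I (\<lambda>_. lborel))" using A' by (intro sets_PiM_I_finite assms) auto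
    have "emeasure (density (PiM I (\<lambda>_. lborel)) (\<lambda>x. ennreal (\<Prod>i\<in>I. std_normal_density (x i)))) (PiE I A) =
        (\<integral>\<^sup>+x. ennreal (\<Prod>i\<in>I. std_normal_density (x i)) * indicator (PiE I A) x \<partial>PiM I (\<lambda>_. lborel))"
      by (rule emeasure_density[OF dens B])
    also have "\<dots> = (\<integral>\<^sup>+x. (\<Prod>i\<in>I. ennreal (std_normal_density (x i)) * indicator (A i) (x i)) \<partial>PiM I (\<lambda>_. lborel))"
    proof (rule nn_integral_cong)
      fix x :: "'a \<Rightarrow> real" assume x: "x \<in> space (PiM I (\<lambda>_. lborel))"
      have "indicator (PiE I A) x = (\<Prod>i\<in>I. indicator (A i) (x i) :: ennreal)"
        using x assms by (auto simp: indicator_def space_PiM PiE_iff prod_zero_iff)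
      then show "ennreal (\<Prod>i\<in>I. std_normal_density (x i)) * indicator (PiE I A) x =
          (\<Prod>i\<in>I. ennreal (std_normal_density (x i)) * indicator (A i) (x i))"
        by (simp add: prod.distrib prod_ennreal)
    qed
    also have "\<dots> = (\<Prod>i\<in>I. \<integral>\<^sup>+y. ennreal (std_normal_density y) * indicator (A i) y \<partial>lborel)"
      using A' by (intro L.product_nn_integral_prod assms) (auto intro!: borel_measurable_times borel_measurable_indicator)
    also have "\<dots> = (\<Prod>i\<in>I. emeasure std_normal (A i))"
      using A' by (intro prod.cong) (auto simp: emeasure_density)
    finally show "emeasure (density (PiM I (\<lambda>_. lborel)) (\<lambda>x. ennreal (\<Prod>i\<in>I. std_normal_density (x i)))) (PiE I A) = (\<Prod>i\<in>I. emeasure std_normal (A i))" .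
  qed
qed

definition gauss_density :: "nat \<Rightarrow> 'a::real_normed_vector \<Rightarrow> real" where
  "gauss_density d x = (1 / sqrt (2 * pi)) ^ d * exp (- (norm x)\<^sup>2 / 2)"

lemma gauss_density_pos: "0 < gauss_density d x"
  by (simp add: gauss_density_def)

lemma gauss_density_measurable[measurable]: "gauss_density d \<in> borel_measurable borel"
  unfolding gauss_density_def by measurable

section \<open>Gaussian marginals, layer cake formula and invariance of the volume\<close>

context isonormal
begin

text \<open>The standard Gaussian vector \<xi> of the span, an honest vector for each outcome; its
  inner product with \<open>v\<close> in the span is \<open>X v\<close> almost surely.\<close>

definition marginal :: "nat \<Rightarrow> (nat \<Rightarrow> 'a) \<Rightarrow> 'w \<Rightarrow> 'a" where
  "marginal d e \<omega> = coords d e (\<lambda>i. X (e i) \<omega>)"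

lemma marginal_measurable[measurable]: "marginal d e \<in> borel_measurable M"
  unfolding marginal_def coords_def by measurable

context
  fixes d :: nat and e :: "nat \<Rightarrow> 'a"
  assumes e: "orthonormal_system d e"
begin

lemma law_coordinates: "distr M (PiM {..<d} (\<lambda>_. borel)) (\<lambda>\<omega>. \<lambda>i\<in>{..<d}. X (e i) \<omega>) = PiM {..<d} (\<lambda>_. std_normal)"
proof -
  let ?P = "PiM {..<d} (\<lambda>_. std_normal)"
  interpret P: prob_space ?P by (rule prob_space_PiM[OF prob_space_std_normal])
  \<comment> \<open>Extension by 0 beyond \<open>d\<close>, because the uniqueness lemma asks for
    measurable coordinates at every index.\<close>
  define Y where "Y i x = (if i < d then x i else 0)" for i and x :: "nat \<Rightarrow> real"
  have Ym: "Y i \<in> borel_measurable ?P" for i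
    using measurable_component_singleton[of i "{..<d}" "\<lambda>_. std_normal"] by (cases "i < d") (simp_all add: Y_def[abs_def])
  have s: "sets ?P = sets (PiM {..<d} (\<lambda>_. borel))" by (intro sets_PiM_cong) auto
  have "distr M (PiM {..<d} (\<lambda>_. borel)) (\<lambda>\<omega>. \<lambda>i\<in>{..<d}. X (e i) \<omega>) = distr ?P (PiM {..<d} (\<lambda>_. borel)) (\<lambda>x. \<lambda>i\<in>{..<d}. Y i x)"
  proof (rule distr_PiM_eqI_cos)
    show "finite_measure M" "finite_measure ?P" by unfold_locales
    fix J a c assume J: "finite J" "J \<subseteq> {..<d}"
    define b where "b i = (if i \<in> J then a i else 0 :: real)" for i
    have sumJ: "(\<Sum>i\<in>J. a i * f i) = (\<Sum>i<d. b i * f i)" for f :: "nat \<Rightarrow> real"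
      by (rule sum.mono_neutral_cong_left) (use J in \<open>auto simp: b_def\<close>)
    have "expectation (\<lambda>\<omega>. cos ((\<Sum>i\<in>J. a i * X (e i) \<omega>) + c)) = expectation (\<lambda>\<omega>. cos (X (\<Sum>i<d. b i *\<^sub>R e i) \<omega> + c))"
      unfolding sumJ
      by (rule integral_cong_AE) (use gaussian_field_sum[OF gaussian_field, of "{..<d}" b e] in \<open>auto elim!: eventually_mono\<close>)
    also have "\<dots> = exp (- (norm (coords d e b))\<^sup>2 / 2) * cos c"
      unfolding coords_def by (rule gaussian_fieldD(4)[OF gaussian_field])
    also have "\<dots> = (LINT x|?P. cos ((\<Sum>i<d. b i * x i) + c))"
      unfolding norm_coords[OF e] by (rule integral_PiM_std_normal_cos[symmetric]) simp
    also have "\<dots> = (LINT x|?P. cos ((\<Sum>i\<in>J. a i * Y i x) + c))"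
      unfolding sumJ by (intro Bochner_Integration.integral_cong refl arg_cong[where f=cos] arg_cong2[where f="(+)"] sum.cong) (auto simp: Y_def)
    finally show "expectation (\<lambda>\<omega>. cos ((\<Sum>i\<in>J. a i * X (e i) \<omega>) + c)) = (LINT x|?P. cos ((\<Sum>i\<in>J. a i * Y i x) + c))" .
  qed (simp, rule Ym)
  also have "distr ?P (PiM {..<d} (\<lambda>_. borel)) (\<lambda>x. \<lambda>i\<in>{..<d}. Y i x) = distr ?P ?P (\<lambda>x. x)"
  proof (rule distr_cong)
    fix x assume "x \<in> space ?P"
    then show "(\<lambda>i\<in>{..<d}. Y i x) = x" by (auto simp: space_PiM Y_def fun_eq_iff restrict_def PiE_iff extensional_def)
  qed (use s in auto)
  finally show ?thesis by (simp add: distr_id2)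
qed

lemma distr_marginal: "distr M borel (marginal d e) = density (span_vol d e) (\<lambda>x. ennreal (gauss_density d x))"
proof -
  let ?L = "PiM {..<d} (\<lambda>_. lborel :: real measure)"
  have cm: "coords d e \<in> PiM {..<d} (\<lambda>_. borel) \<rightarrow>\<^sub>M borel"
  proof -
    have "PiM {..<d} (\<lambda>_. borel) \<rightarrow>\<^sub>M borel = ?L \<rightarrow>\<^sub>M borel" by (intro measurable_cong_sets sets_PiM_cong) auto
    then show ?thesis using coords_measurable[of d e] by simp
  qed
  have rm: "(\<lambda>\<omega>. \<lambda>i\<in>{..<d}. X (e i) \<omega>) \<in> M \<rightarrow>\<^sub>M PiM {..<d} (\<lambda>_. borel)" by measurable
  have "distr M borel (marginal d e) = distr M borel (coords d e \<circ> (\<lambda>\<omega>. \<lambda>i\<in>{..<d}. X (e i) \<omega>))"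
    by (rule distr_cong) (auto simp: marginal_def coords_def)
  also have "\<dots> = distr (distr M (PiM {..<d} (\<lambda>_. borel)) (\<lambda>\<omega>. \<lambda>i\<in>{..<d}. X (e i) \<omega>)) borel (coords d e)"
    by (rule distr_distr[OF cm rm, symmetric])
  also have "\<dots> = distr (density ?L (\<lambda>x. ennreal (\<Prod>i<d. std_normal_density (x i)))) borel (coords d e)"
    unfolding law_coordinates PiM_std_normal_density[OF finite_lessThan] ..
  also have "(\<lambda>x. ennreal (\<Prod>i<d. std_normal_density (x i))) = (\<lambda>x. ennreal (gauss_density d (coords d e x)))"
  proof
    fix x :: "nat \<Rightarrow> real"
    have "(\<Prod>i<d. std_normal_density (x i)) = (1 / sqrt (2 * pi)) ^ d * (\<Prod>i<d. exp (- (x i)\<^sup>2 / 2))"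
      unfolding std_normal_density_def prod.distrib by simp
    also have "(\<Prod>i<d. exp (- (x i)\<^sup>2 / 2)) = exp (- (\<Sum>i<d. (x i)\<^sup>2) / 2)"
      by (simp add: exp_sum[symmetric] sum_negf sum_divide_distrib)
    finally show "ennreal (\<Prod>i<d. std_normal_density (x i)) = ennreal (gauss_density d (coords d e x))"
      by (simp add: gauss_density_def norm_coords[OF e])
  qed
  also have "distr (density ?L (\<lambda>x. ennreal (gauss_density d (coords d e x)))) borel (coords d e) =
      density (span_vol d e) (\<lambda>x. ennreal (gauss_density d x))"
    unfolding span_vol_def by (rule density_distr[symmetric]) auto
  finally show ?thesis .
qed

lemma nn_expectation_marginal:
  assumes [measurable]: "F \<in> borel_measurable borel"
  shows "(\<integral>\<^sup>+\<omega>. F (marginal d e \<omega>) \<partial>M) = (\<integral>\<^sup>+x. ennreal (gauss_density d x) * F x \<partial>span_vol d e)"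
proof -
  have "(\<integral>\<^sup>+\<omega>. F (marginal d e \<omega>) \<partial>M) = (\<integral>\<^sup>+x. F x \<partial>distr M borel (marginal d e))"
    by (subst nn_integral_distr) auto
  then show ?thesis unfolding distr_marginal by (simp add: nn_integral_density measurable_cong_sets[OF sets_span_vol(1) refl])
qed

lemma marginal_inner:
  assumes "v \<in> span (e ` {..<d})"
  shows "AE \<omega> in M. marginal d e \<omega> \<bullet> v = X v \<omega>"
proof -
  have "v = (\<Sum>i<d. (v \<bullet> e i) *\<^sub>R e i)" using orthonormal_expansion[OF e assms] by (simp add: coords_def)
  with gaussian_field_sum[OF gaussian_field, of "{..<d}" "\<lambda>i. v \<bullet> e i" e]
  have "AE \<omega> in M. X v \<omega> = (\<Sum>i<d. (v \<bullet> e i) * X (e i) \<omega>)" by simp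
  then show ?thesis
    by eventually_elim (simp add: marginal_def coords_def inner_sum_left, simp add: inner_commute mult.commute)
qed

text \<open>The Gaussian factor at distance \<rho> is the integral over
  \<open>r \<ge> \<rho>\<close> of its negative derivative; exchanging the integrals leaves the
  volumes of parallel bodies.\<close>

lemma layer_cake:
  assumes K: "K \<noteq> {}" and t: "0 < t"
  shows "(\<integral>\<^sup>+x. ennreal (exp (- (t\<^sup>2 * (infdist x K)\<^sup>2) / 2)) \<partial>span_vol d e) =
    (\<integral>\<^sup>+r. ennreal (t\<^sup>2 * r * exp (- (t\<^sup>2 * r\<^sup>2) / 2)) * emeasure (span_vol d e) {x. infdist x K \<le> r} \<partial>lborel)"
proof -
  let ?L = "PiM {..<d} (\<lambda>_. lborel :: real measure)"
  interpret L: product_sigma_finite "\<lambda>_ :: nat. lborel :: real measure" by standard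
  interpret LL: sigma_finite_measure ?L by (rule L.sigma_finite) simp
  interpret P: pair_sigma_finite ?L lborel by unfold_locales
  let ?g = "\<lambda>r. t\<^sup>2 * r * exp (- (t\<^sup>2 * r\<^sup>2) / 2)"
  have inf_m[measurable]: "(\<lambda>x. infdist x K) \<in> borel_measurable borel"
    by (intro borel_measurable_continuous_onI continuous_intros)
  have ftc: "(\<integral>\<^sup>+r. ennreal (?g r) * indicator {\<rho>..} r \<partial>lborel) = ennreal (exp (- (t\<^sup>2 * \<rho>\<^sup>2) / 2))" if \<rho>: "0 \<le> \<rho>" for \<rho>
  proof -
    have "(\<integral>\<^sup>+r. ennreal (?g r) * indicator {\<rho>..} r \<partial>lborel) = ennreal (0 - (- exp (- (t\<^sup>2 * \<rho>\<^sup>2) / 2)))"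
    proof (rule nn_integral_FTC_atLeast)
      show "((\<lambda>r. - exp (- (t\<^sup>2 * r\<^sup>2) / 2)) has_real_derivative ?g r) (at r)" for r
        by (auto intro!: derivative_eq_intros simp: field_simps)
      have "LIM r at_top. t\<^sup>2 / 2 * r\<^sup>2 :> at_top"
        using t by (intro filterlim_tendsto_pos_mult_at_top[OF tendsto_const] filterlim_pow_at_top filterlim_ident) auto
      then have "((\<lambda>r. exp (- (t\<^sup>2 / 2 * r\<^sup>2))) \<longlongrightarrow> 0) at_top"
        by (intro filterlim_compose[OF exp_at_bot]) (rule filterlim_uminus_at_top[THEN iffD1])
      then show "((\<lambda>r. - exp (- (t\<^sup>2 * r\<^sup>2) / 2)) \<longlongrightarrow> 0) at_top"
        using tendsto_minus by fastforce
    qed (use \<rho> in auto)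
    then show ?thesis by simp
  qed
  have "(\<integral>\<^sup>+x. ennreal (exp (- (t\<^sup>2 * (infdist x K)\<^sup>2) / 2)) \<partial>span_vol d e) =
      (\<integral>\<^sup>+x. \<integral>\<^sup>+r. ennreal (?g r) * indicator {infdist (coords d e x) K..} r \<partial>lborel \<partial>?L)"
    unfolding ftc[OF infdist_nonneg] by (rule nn_integral_span_vol) measurable
  also have "\<dots> = (\<integral>\<^sup>+r. \<integral>\<^sup>+x. ennreal (?g r) * indicator {infdist (coords d e x) K..} r \<partial>?L \<partial>lborel)"
  proof (rule P.Fubini'[symmetric])
    have [measurable]: "(\<lambda>p. infdist (coords d e (fst p)) K) \<in> borel_measurable (?L \<Otimes>\<^sub>M lborel)"
      by (rule measurable_compose[OF _ inf_m]) (rule measurable_compose[OF measurable_fst coords_measurable])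
    have "(\<lambda>p. ennreal (?g (snd p)) * indicator {p. infdist (coords d e (fst p)) K \<le> snd p} p) \<in> borel_measurable (?L \<Otimes>\<^sub>M lborel)"
      by measurable
    then show "(\<lambda>(x, r). ennreal (?g r) * indicator {infdist (coords d e x) K..} r) \<in> borel_measurable (?L \<Otimes>\<^sub>M lborel)"
      by (simp add: split_def indicator_def)
  qed
  also have "\<dots> = (\<integral>\<^sup>+r. ennreal (?g r) * emeasure (span_vol d e) {x. infdist x K \<le> r} \<partial>lborel)"
  proof (rule nn_integral_cong)
    fix r
    have B: "{x. infdist x K \<le> r} \<in> sets borel" by measurable
    have "(\<integral>\<^sup>+x. ennreal (?g r) * indicator {infdist (coords d e x) K..} r \<partial>?L) =
        (\<integral>\<^sup>+x. ennreal (?g r) * indicator {x. infdist x K \<le> r} (coords d e x) \<partial>?L)"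
      by (intro nn_integral_cong) (simp add: indicator_def)
    also have "\<dots> = (\<integral>\<^sup>+x. ennreal (?g r) * indicator {x. infdist x K \<le> r} x \<partial>span_vol d e)"
      by (rule nn_integral_span_vol[symmetric]) (use B in auto)
    also have "\<dots> = ennreal (?g r) * emeasure (span_vol d e) {x. infdist x K \<le> r}"
      using B by (subst nn_integral_cmult_indicator) auto
    finally show "(\<integral>\<^sup>+x. ennreal (?g r) * indicator {infdist (coords d e x) K..} r \<partial>?L) =
       ennreal (?g r) * emeasure (span_vol d e) {x. infdist x K \<le> r}" .
  qed
  finally show ?thesis .
qed

text \<open>The case \<open>K = {0}\<close> of the layer cake formula evaluates the radial Gaussian integrals without the Gamma function.\<close>

lemma radial_gauss_integral:
  "(\<integral>\<^sup>+r. ennreal (r * exp (- r\<^sup>2 / 2)) * (ennreal (unit_ball_vol d * r ^ d) * indicator {0<..} r) \<partial>lborel) = ennreal (sqrt (2 * pi) ^ d)"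
proof -
  have pos: "0 < sqrt (2 * pi) ^ d" by simp
  have "(\<integral>\<^sup>+r. ennreal (r * exp (- r\<^sup>2 / 2)) * (ennreal (unit_ball_vol d * r ^ d) * indicator {0<..} r) \<partial>lborel) =
     (\<integral>\<^sup>+r. ennreal (1\<^sup>2 * r * exp (- (1\<^sup>2 * r\<^sup>2) / 2)) * emeasure (span_vol d e) {x. infdist x {0} \<le> r} \<partial>lborel)"
  proof (rule nn_integral_cong)
    fix r :: real
    have s: "{x. infdist x {0} \<le> r} = cball (0::'a) r" by (auto simp: dist_norm)
    show "ennreal (r * exp (- r\<^sup>2 / 2)) * (ennreal (unit_ball_vol d * r ^ d) * indicator {0<..} r) =
       ennreal (1\<^sup>2 * r * exp (- (1\<^sup>2 * r\<^sup>2) / 2)) * emeasure (span_vol d e) {x. infdist x {0} \<le> r}"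
    proof (cases "0 < r")
      case True
      then show ?thesis unfolding s emeasure_span_vol_cball[OF e True] by simp
    next
      case False
      then have "r * exp (- r\<^sup>2 / 2) \<le> 0" by (simp add: mult_le_0_iff)
      then show ?thesis using False by (simp add: ennreal_neg)
    qed
  qed
  also have "\<dots> = (\<integral>\<^sup>+x. ennreal (exp (- (norm x)\<^sup>2 / 2)) \<partial>span_vol d e)"
    by (subst layer_cake[symmetric]) simp_all
  also have "\<dots> = (\<integral>\<^sup>+x. ennreal (sqrt (2 * pi) ^ d) * (ennreal (gauss_density d x) * 1) \<partial>span_vol d e)"
  proof (rule nn_integral_cong)
    fix x :: 'a
    have "exp (- (norm x)\<^sup>2 / 2) = sqrt (2 * pi) ^ d * gauss_density d x"
      using pos by (simp add: gauss_density_def power_one_over)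
    then show "ennreal (exp (- (norm x)\<^sup>2 / 2)) = ennreal (sqrt (2 * pi) ^ d) * (ennreal (gauss_density d x) * 1)"
      by (simp add: ennreal_mult gauss_density_pos less_imp_le)
  qed
  also have "\<dots> = ennreal (sqrt (2 * pi) ^ d) * (\<integral>\<^sup>+\<omega>. 1 \<partial>M)"
    unfolding nn_expectation_marginal[of "\<lambda>_. 1", OF borel_measurable_const]
    by (rule nn_integral_cmult) (simp add: measurable_cong_sets[OF sets_span_vol(1) refl])
  finally show ?thesis by (simp add: emeasure_space_1)
qed

end

text \<open>Rotation invariance, proved through the process: the Gaussian vectors of the two bases
  agree almost surely, and their densities with respect to the two volumes are the same positive
  function of the norm. Dividing by it identifies the volumes.\<close>

lemma span_vol_basis_change:
  fixes e b :: "nat \<Rightarrow> 'a"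
  assumes e: "orthonormal_system d e" and b: "orthonormal_system d b" and eq: "span (e ` {..<d}) = span (b ` {..<d})"
  shows "span_vol d e = span_vol d b"
proof -
  have "AE \<omega> in M. \<forall>i\<in>{..<d}. marginal d e \<omega> \<bullet> b i = X (b i) \<omega>"
    unfolding AE_finite_all[OF finite_lessThan]
    using marginal_inner[OF e] eq by (auto intro: span_base)
  then have "AE \<omega> in M. marginal d e \<omega> = marginal d b \<omega>"
  proof eventually_elim
    case (elim \<omega>)
    have "marginal d e \<omega> \<in> span (b ` {..<d})" unfolding eq[symmetric] marginal_def by (rule coords_in_span)
    from orthonormal_expansion[OF b this] show ?case
      using elim by (simp add: marginal_def[of d b] coords_def)
  qed
  then have "distr M borel (marginal d e) = distr M borel (marginal d b)"
    by (intro distr_cong_AE) auto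
  then have eq: "density (span_vol d e) (\<lambda>x. ennreal (gauss_density d x)) = density (span_vol d b) (\<lambda>x. ennreal (gauss_density d x))"
    unfolding distr_marginal[OF e] distr_marginal[OF b] .
  have inv: "span_vol d f = density (density (span_vol d f) (\<lambda>x. ennreal (gauss_density d x))) (\<lambda>x. ennreal (1 / gauss_density d x))" for f :: "nat \<Rightarrow> 'a"
  proof -
    have "ennreal (gauss_density d x) * ennreal (1 / gauss_density d x) = 1" for x :: 'a
      using gauss_density_pos[of d x] by (simp flip: ennreal_mult)
    then show ?thesis by (subst density_density_eq) (auto simp: density_1 measurable_cong_sets[OF sets_span_vol(1) refl])
  qed
  show ?thesis using inv[of e] inv[of b] eq by simp
qed

end

lemma orthonormal_mono: "orthonormal_system d e \<Longrightarrow> m \<le> d \<Longrightarrow> orthonormal_system m e"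
  by (simp add: orthonormal_system_def)

lemma closed_span_orthonormal:
  assumes e: "orthonormal_system d e"
  shows "closed (span (e ` {..<d}))"
proof -
  have "span (e ` {..<d}) = {x. coords d e (\<lambda>i. x \<bullet> e i) = x}"
    using orthonormal_expansion[OF e] coords_in_span[of d e] by (auto intro: sym) (metis coords_in_span)
  also have "closed \<dots>" unfolding coords_def by (intro closed_Collect_eq continuous_intros)
  finally show ?thesis .
qed

context
  fixes K :: "'a::{real_inner, second_countable_topology} set" and d :: nat and e :: "nat \<Rightarrow> 'a"
  assumes K: "convex_body K" and e: "orthonormal_system d e" and sub: "K \<subseteq> span (e ` {..<d})"
begin

lemma parallel_body_eq:
  assumes r: "0 < r"
  shows "K + (\<lambda>x. r *\<^sub>R x) ` (cball 0 1 \<inter> span (e ` {..<d})) = {x. infdist x K \<le> r} \<inter> span (e ` {..<d})"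
proof (intro equalityI subsetI)
  fix x assume "x \<in> K + (\<lambda>x. r *\<^sub>R x) ` (cball 0 1 \<inter> span (e ` {..<d}))"
  then obtain k b where kb: "k \<in> K" "norm b \<le> 1" "b \<in> span (e ` {..<d})" "x = k + r *\<^sub>R b"
    by (auto elim!: set_plus_elim)
  have "infdist x K \<le> dist x k" by (rule infdist_le[OF kb(1)])
  also have "\<dots> \<le> r" using r kb(2) by (simp add: kb(4) dist_norm mult_left_le)
  finally show "x \<in> {x. infdist x K \<le> r} \<inter> span (e ` {..<d})"
    using kb sub by (auto intro!: span_add span_scale)
next
  fix x assume x: "x \<in> {x. infdist x K \<le> r} \<inter> span (e ` {..<d})"
  let ?p = "nearest K x"
  have "?p \<in> K" "dist x ?p \<le> r" using nearest_props(1)[OF K] x infdist_eq_nearest[OF K, of x] by auto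
  moreover from this have "norm ((1 / r) *\<^sub>R (x - ?p)) \<le> 1" using r by (simp add: dist_norm)
  moreover have "(1 / r) *\<^sub>R (x - ?p) \<in> span (e ` {..<d})"
    using \<open>?p \<in> K\<close> x sub by (auto intro!: span_scale span_diff)
  moreover have "x = ?p + r *\<^sub>R ((1 / r) *\<^sub>R (x - ?p))" using r by simp
  ultimately show "x \<in> K + (\<lambda>x. r *\<^sub>R x) ` (cball 0 1 \<inter> span (e ` {..<d}))"
    by (metis (no_types, lifting) Int_iff image_eqI mem_cball_0 set_plus_intro)
qed

lemma parallel_body_measurable: "{x. infdist x K \<le> r} \<in> sets borel"
  by (intro borel_closed closed_Collect_le continuous_intros)

lemma emeasure_parallel_body_finite: "emeasure (span_vol d e) {x. infdist x K \<le> r} < \<infinity>"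
proof -
  have ne: "K \<noteq> {}" and "bounded K" using K compact_imp_bounded by (auto simp: convex_body_def)
  then obtain R where R: "\<And>x. x \<in> K \<Longrightarrow> norm x \<le> R" by (auto simp: bounded_iff)
  have "{x. infdist x K \<le> r} \<subseteq> cball 0 (max 1 (R + r))"
  proof
    fix x assume x: "x \<in> {x. infdist x K \<le> r}"
    have "norm x \<le> norm (nearest K x) + dist x (nearest K x)" by (metis dist_norm norm_triangle_sub add.commute)
    also have "\<dots> \<le> R + r" using R[OF nearest_props(1)[OF K]] x infdist_eq_nearest[OF K, of x] by (intro add_mono) auto
    finally show "x \<in> cball 0 (max 1 (R + r))" by simp
  qed
  then have "emeasure (span_vol d e) {x. infdist x K \<le> r} \<le> emeasure (span_vol d e) (cball 0 (max 1 (R + r)))"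
    by (rule emeasure_mono) simp
  also have "\<dots> < \<infinity>" by (subst emeasure_span_vol_cball[OF e]) auto
  finally show ?thesis .
qed

lemma subspace_vol_parallel_body:
  assumes r: "0 < r"
  shows "subspace_vol d e (K + (\<lambda>x. r *\<^sub>R x) ` (cball 0 1 \<inter> span (e ` {..<d}))) = measure (span_vol d e) {x. infdist x K \<le> r}"
proof -
  have B: "{x. infdist x K \<le> r} \<inter> span (e ` {..<d}) \<in> sets borel"
    by (intro sets.Int parallel_body_measurable borel_closed closed_span_orthonormal[OF e])
  have "emeasure (span_vol d e) ({x. infdist x K \<le> r} \<inter> span (e ` {..<d})) = emeasure (span_vol d e) {x. infdist x K \<le> r}"
    by (rule emeasure_span_vol_cong[OF B parallel_body_measurable]) auto
  then show ?thesis unfolding parallel_body_eq[OF r] subspace_vol_eq[OF B] by (simp add: measure_def)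
qed

lemma emeasure_parallel_body:
  assumes W: "steiner_coeffs d e K W" and r: "0 < r"
  shows "emeasure (span_vol d e) {x. infdist x K \<le> r} = ennreal (\<Sum>k\<le>d. r ^ (d - k) * unit_ball_vol (real (d - k)) * W k)"
    "0 \<le> (\<Sum>k\<le>d. r ^ (d - k) * unit_ball_vol (real (d - k)) * W k)"
proof -
  have eq: "measure (span_vol d e) {x. infdist x K \<le> r} = (\<Sum>k\<le>d. r ^ (d - k) * unit_ball_vol (real (d - k)) * W k)"
    using W r unfolding steiner_coeffs_def subspace_vol_parallel_body[OF r, symmetric] by simp
  show "0 \<le> (\<Sum>k\<le>d. r ^ (d - k) * unit_ball_vol (real (d - k)) * W k)" unfolding eq[symmetric] by simp
  show "emeasure (span_vol d e) {x. infdist x K \<le> r} = ennreal (\<Sum>k\<le>d. r ^ (d - k) * unit_ball_vol (real (d - k)) * W k)"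
    unfolding eq[symmetric] using emeasure_parallel_body_finite[of r] by (simp add: emeasure_eq_ennreal_measure)
qed

end

section \<open>The Wills functional and the smoothed support function\<close>

lemma (in isonormal) radial_gauss_has_bochner_integral:
  fixes e :: "nat \<Rightarrow> 'a"
  assumes e: "orthonormal_system m e" and t: "0 < t"
  shows "has_bochner_integral lborel (\<lambda>r. t\<^sup>2 * r * exp (- (t\<^sup>2 * r\<^sup>2) / 2) * (unit_ball_vol m * r ^ m) * indicator {0<..} r) ((sqrt (2 * pi) / t) ^ m)"
proof -
  let ?f = "\<lambda>r. r * exp (- r\<^sup>2 / 2) * (unit_ball_vol m * r ^ m) * indicator {0<..} r :: real"
  have "has_bochner_integral lborel ?f (sqrt (2 * pi) ^ m)"
  proof (rule has_bochner_integral_nn_integral)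
    show "?f \<in> borel_measurable lborel"
      by (intro borel_measurable_times borel_measurable_indicator borel_measurable_const borel_measurable_power
          borel_measurable_exp borel_measurable_divide borel_measurable_uminus) auto
    show "AE r in lborel. 0 \<le> ?f r" by (intro AE_I2) (auto simp: indicator_def)
    have "(\<integral>\<^sup>+r. ennreal (?f r) \<partial>lborel) = (\<integral>\<^sup>+r. ennreal (r * exp (- r\<^sup>2 / 2)) * (ennreal (unit_ball_vol m * r ^ m) * indicator {0<..} r) \<partial>lborel)"
    proof (rule nn_integral_cong)
      fix r :: real
      show "ennreal (?f r) = ennreal (r * exp (- r\<^sup>2 / 2)) * (ennreal (unit_ball_vol m * r ^ m) * indicator {0<..} r)"
        by (cases "0 < r") (simp_all flip: ennreal_mult)
    qed
    then show "(\<integral>\<^sup>+r. ennreal (?f r) \<partial>lborel) = ennreal (sqrt (2 * pi) ^ m)"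
      unfolding radial_gauss_integral[OF e] .
  qed simp
  then have "has_bochner_integral lborel (\<lambda>r. ?f (0 + t * r)) (sqrt (2 * pi) ^ m /\<^sub>R \<bar>t\<bar>)"
    using lborel_has_bochner_integral_real_affine_iff[of t ?f _ 0] t by simp
  \<comment> \<open>The substitution \<open>r \<mapsto> t * r\<close> produces \<open>t ^ m\<close>
    from the volume term and only one factor \<open>t\<close> instead of two;
    \<open>t / t ^ m\<close> corrects both.\<close>
  then have "has_bochner_integral lborel (\<lambda>r. t / t ^ m * ?f (0 + t * r)) (t / t ^ m * (sqrt (2 * pi) ^ m /\<^sub>R \<bar>t\<bar>))"
    by (rule has_bochner_integral_mult_right)
  moreover have "t / t ^ m * (sqrt (2 * pi) ^ m /\<^sub>R \<bar>t\<bar>) = (sqrt (2 * pi) / t) ^ m"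
    using t by (simp add: power_divide)
  moreover have "t / t ^ m * ?f (0 + t * r) = t\<^sup>2 * r * exp (- (t\<^sup>2 * r\<^sup>2) / 2) * (unit_ball_vol m * r ^ m) * indicator {0<..} r" for r
    using t by (cases "0 < r") (simp_all add: power_mult_distrib power2_eq_square zero_less_mult_iff)
  ultimately show ?thesis by simp
qed

text \<open>The Moreau envelope of the support function with parameter \<open>t\<close>: the maximum
  over \<open>q\<close> in \<open>K\<close> of
  \<open>x \<bullet> q - t * (norm q)\<^sup>2 / 2\<close>, written at its maximiser.\<close>

definition smoothed_support :: "'a::real_inner set \<Rightarrow> real \<Rightarrow> 'a \<Rightarrow> real" where
  "smoothed_support K t x = x \<bullet> nearest K (x /\<^sub>R t) - t * (norm (nearest K (x /\<^sub>R t)))\<^sup>2 / 2"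

lemma smoothed_support_eq_infdist:
  assumes K: "convex_body K" and t: "0 < t"
  shows "t * smoothed_support K t x = (norm x)\<^sup>2 / 2 - t\<^sup>2 * (infdist (x /\<^sub>R t) K)\<^sup>2 / 2"
proof -
  let ?p = "nearest K (x /\<^sub>R t)"
  have "(infdist (x /\<^sub>R t) K)\<^sup>2 = (norm (x /\<^sub>R t))\<^sup>2 - 2 * ((x /\<^sub>R t) \<bullet> ?p) + (norm ?p)\<^sup>2"
    unfolding infdist_eq_nearest[OF K] dist_norm power2_norm_eq_inner by (simp add: algebra_simps inner_commute)
  then have "t\<^sup>2 * (infdist (x /\<^sub>R t) K)\<^sup>2 = (norm x)\<^sup>2 - 2 * t * (x \<bullet> ?p) + t\<^sup>2 * (norm ?p)\<^sup>2"
    using t by (simp add: power_divide power2_eq_square field_simps)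
  then show ?thesis by (simp add: smoothed_support_def power2_eq_square field_simps)
qed

text \<open>The Gaussian density cancels the factor \<open>exp ((norm x)\<^sup>2 / 2)\<close>,
  leaving the integrand of \<open>layer_cake\<close> dilated by \<open>t\<close>. Inserting the
  Steiner polynomial reduces it to radial Gaussian integrals. Bochner integrals are used since the
  coefficients \<open>W k\<close> carry no sign information.\<close>

lemma (in isonormal) wills_formula:
  fixes K :: "'a set" and e :: "nat \<Rightarrow> 'a"
  assumes K: "convex_body K" and e: "orthonormal_system d e" and sub: "K \<subseteq> span (e ` {..<d})"
    and W: "steiner_coeffs d e K W" and t: "0 < t"
  shows "has_bochner_integral M (\<lambda>\<omega>. exp (t * smoothed_support K t (marginal d e \<omega>))) (\<Sum>k\<le>d. t ^ k * (W k / sqrt (2 * pi) ^ k))"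
proof -
  let ?S = "\<lambda>r. \<Sum>k\<le>d. r ^ (d - k) * unit_ball_vol (real (d - k)) * W k"
  let ?g = "\<lambda>r. t\<^sup>2 * r * exp (- (t\<^sup>2 * r\<^sup>2) / 2)"
  have ne: "K \<noteq> {}" using K by (simp add: convex_body_def)
  have hbi: "has_bochner_integral lborel (\<lambda>r. \<Sum>k\<le>d. W k * (?g r * (unit_ball_vol (real (d - k)) * r ^ (d - k)) * indicator {0<..} r)) (\<Sum>k\<le>d. W k * (sqrt (2 * pi) / t) ^ (d - k))"
    by (intro has_bochner_integral_sum has_bochner_integral_mult_right radial_gauss_has_bochner_integral[OF orthonormal_mono[OF e]] t) simp
  have fs: "(\<Sum>k\<le>d. W k * (?g r * (unit_ball_vol (real (d - k)) * r ^ (d - k)) * indicator {0<..} r)) = ?g r * ?S r * indicator {0<..} r" for r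
    by (simp add: sum_distrib_left sum_distrib_right mult_ac)
  let ?c = "\<Sum>k\<le>d. W k * (sqrt (2 * pi) / t) ^ (d - k)"
  have nn: "0 \<le> ?g r * ?S r * indicator {0<..} r" for r
    using emeasure_parallel_body(2)[OF K e sub W, of r] by (cases "0 < r") (auto intro!: mult_nonneg_nonneg)
  have "0 \<le> ?c"
    using hbi Bochner_Integration.integral_nonneg[of lborel "\<lambda>r. ?g r * ?S r * indicator {0<..} r"] nn
    unfolding fs by (simp add: has_bochner_integral_iff)
  \<comment> \<open>For \<open>r \<le> 0\<close> the Steiner polynomial says nothing, but the weight
    is then nonpositive and \<open>ennreal\<close> sends it to 0.\<close>
  have "(\<integral>\<^sup>+r. ennreal (?g r) * emeasure (span_vol d e) {x. infdist x K \<le> r} \<partial>lborel) = (\<integral>\<^sup>+r. ennreal (?g r * ?S r * indicator {0<..} r) \<partial>lborel)"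
  proof (rule nn_integral_cong)
    fix r :: real
    show "ennreal (?g r) * emeasure (span_vol d e) {x. infdist x K \<le> r} = ennreal (?g r * ?S r * indicator {0<..} r)"
    proof (cases "0 < r")
      case True
      then show ?thesis unfolding emeasure_parallel_body(1)[OF K e sub W True]
        using emeasure_parallel_body(2)[OF K e sub W True] by (simp add: ennreal_mult)
    next
      case False
      then have "?g r \<le> 0" by (simp add: mult_le_0_iff)
      then show ?thesis using False by (simp add: ennreal_neg)
    qed
  qed
  also have "\<dots> = ennreal ?c"
    using hbi nn unfolding fs by (simp add: nn_integral_eq_integral has_bochner_integral_iff)
  finally have lc: "(\<integral>\<^sup>+x. ennreal (exp (- (t\<^sup>2 * (infdist x K)\<^sup>2) / 2)) \<partial>span_vol d e) = ennreal ?c"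
    unfolding layer_cake[OF e ne t] .
  let ?F = "\<lambda>x. ennreal (exp (- (t\<^sup>2 * (infdist (x /\<^sub>R t) K)\<^sup>2) / 2))"
  have inf_m[measurable]: "(\<lambda>x. infdist x K) \<in> borel_measurable borel"
    by (intro borel_measurable_continuous_onI continuous_intros)
  have Fm[measurable]: "?F \<in> borel_measurable borel" by measurable
  \<comment> \<open>Prepares the substitution \<open>x \<mapsto> t * x\<close>, written in
    coordinates; it contributes the factor \<open>t ^ d\<close>.\<close>
  have "(\<integral>\<^sup>+x. ennreal (exp (- (t\<^sup>2 * (infdist x K)\<^sup>2) / 2)) \<partial>span_vol d e) = (\<integral>\<^sup>+x. ?F (coords d e (\<lambda>i. 0 + t * (x \<bullet> e i))) \<partial>span_vol d e)"
  proof -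
    have "(\<lambda>x. coords d e (\<lambda>i. 0 + t * (x \<bullet> e i))) \<in> borel_measurable borel" unfolding coords_def by measurable
    from nn_integral_span_vol[OF measurable_compose[OF this Fm]]
    have *: "(\<integral>\<^sup>+x. ?F (coords d e (\<lambda>i. 0 + t * (x \<bullet> e i))) \<partial>span_vol d e) =
      (\<integral>\<^sup>+x. ?F (coords d e (\<lambda>i. 0 + t * (coords d e x \<bullet> e i))) \<partial>PiM {..<d} (\<lambda>_. lborel))" .
    have cc: "coords d e (\<lambda>i. 0 + t * (coords d e x \<bullet> e i)) = t *\<^sub>R coords d e x" for x
      unfolding coords_def[of d e "\<lambda>i. 0 + t * (coords d e x \<bullet> e i)"]
      using coords_inner[OF e, of _ x] by (simp add: coords_def scaleR_sum_right)
    show ?thesis unfolding * cc using t by (subst nn_integral_span_vol) simp_all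
  qed
  also have "\<dots> = ennreal (\<Prod>i<d. 1 / \<bar>t\<bar>) * (\<integral>\<^sup>+x. ?F x \<partial>span_vol d e)"
    using t by (intro nn_integral_span_vol_affine[OF e _ Fm]) simp
  finally have sc: "ennreal ?c = ennreal ((1 / t) ^ d) * (\<integral>\<^sup>+x. ?F x \<partial>span_vol d e)"
    unfolding lc using t by simp
  have Fint: "(\<integral>\<^sup>+x. ?F x \<partial>span_vol d e) = ennreal (t ^ d * ?c)"
  proof -
    have "ennreal (t ^ d) * ennreal ?c = ennreal (t ^ d * (1 / t) ^ d) * (\<integral>\<^sup>+x. ?F x \<partial>span_vol d e)"
      using t unfolding sc by (simp add: ennreal_mult mult.assoc)
    also have "t ^ d * (1 / t) ^ d = 1" using t by (simp add: power_mult_distrib[symmetric])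
    finally show ?thesis using t \<open>0 \<le> ?c\<close> by (simp add: ennreal_mult)
  qed
  have cont: "continuous_on UNIV (smoothed_support K t)"
    unfolding smoothed_support_def[abs_def]
    by (intro continuous_intros continuous_on_compose2[OF continuous_nearest[OF K]]) auto
  have sm[measurable]: "smoothed_support K t \<in> borel_measurable borel" by (rule borel_measurable_continuous_onI[OF cont])
  \<comment> \<open>All powers belonging to the ambient dimension \<open>d\<close> cancel, and
    exactly \<open>(t / sqrt (2 * pi)) ^ k\<close> remains.\<close>
  have val: "(1 / sqrt (2 * pi)) ^ d * (t ^ d * ?c) = (\<Sum>k\<le>d. t ^ k * (W k / sqrt (2 * pi) ^ k))"
  proof -
    have "(1 / sqrt (2 * pi)) ^ d * (t ^ d * (W k * (sqrt (2 * pi) / t) ^ (d - k))) = t ^ k * (W k / sqrt (2 * pi) ^ k)" if "k \<le> d" for k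
    proof -
      have "t ^ d = t ^ k * t ^ (d - k)" "sqrt (2 * pi) ^ d = sqrt (2 * pi) ^ k * sqrt (2 * pi) ^ (d - k)"
        using that by (simp_all flip: power_add)
      then show ?thesis using t by (simp add: power_divide field_simps)
    qed
    then show ?thesis by (simp add: sum_distrib_left)
  qed
  show ?thesis
  proof (rule has_bochner_integral_nn_integral)
    show "(\<lambda>\<omega>. exp (t * smoothed_support K t (marginal d e \<omega>))) \<in> borel_measurable M" by measurable
    show "0 \<le> (\<Sum>k\<le>d. t ^ k * (W k / sqrt (2 * pi) ^ k))"
      unfolding val[symmetric] using t \<open>0 \<le> ?c\<close> by (intro mult_nonneg_nonneg) auto
    have "(\<integral>\<^sup>+\<omega>. ennreal (exp (t * smoothed_support K t (marginal d e \<omega>))) \<partial>M) =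
      (\<integral>\<^sup>+x. ennreal (gauss_density d x) * ennreal (exp (t * smoothed_support K t x)) \<partial>span_vol d e)"
      by (rule nn_expectation_marginal[OF e]) measurable
    also have "\<dots> = (\<integral>\<^sup>+x. ennreal ((1 / sqrt (2 * pi)) ^ d) * ?F x \<partial>span_vol d e)"
    proof (rule nn_integral_cong)
      fix x
      have "exp (t * smoothed_support K t x) = exp ((norm x)\<^sup>2 / 2) * exp (- (t\<^sup>2 * (infdist (x /\<^sub>R t) K)\<^sup>2) / 2)"
        unfolding smoothed_support_eq_infdist[OF K t] by (simp flip: exp_add)
      then have "gauss_density d x * exp (t * smoothed_support K t x) = (1 / sqrt (2 * pi)) ^ d * exp (- (t\<^sup>2 * (infdist (x /\<^sub>R t) K)\<^sup>2) / 2)"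
        by (simp add: gauss_density_def exp_minus field_simps)
      then show "ennreal (gauss_density d x) * ennreal (exp (t * smoothed_support K t x)) = ennreal ((1 / sqrt (2 * pi)) ^ d) * ?F x"
        by (simp flip: ennreal_mult add: gauss_density_pos less_imp_le)
    qed
    also have "\<dots> = ennreal ((1 / sqrt (2 * pi)) ^ d) * (\<integral>\<^sup>+x. ?F x \<partial>span_vol d e)"
      by (rule nn_integral_cmult) (simp add: measurable_cong_sets[OF sets_span_vol(1) refl])
    also have "\<dots> = ennreal (\<Sum>k\<le>d. t ^ k * (W k / sqrt (2 * pi) ^ k))"
      unfolding Fint val[symmetric] by (rule ennreal_mult'[symmetric]) simp
    finally show "(\<integral>\<^sup>+\<omega>. ennreal (exp (t * smoothed_support K t (marginal d e \<omega>))) \<partial>M) = ennreal (\<Sum>k\<le>d. t ^ k * (W k / sqrt (2 * pi) ^ k))" .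
  qed auto
qed

text \<open>By induction the lower coefficients vanish; dividing by \<open>t ^ k\<close> leaves a
  polynomial bounded by \<open>C * t\<close>, and \<open>t\<close> tends to 0 from the
  right.\<close>

lemma low_coefficients_zero:
  fixes a :: "nat \<Rightarrow> real"
  assumes b: "\<And>t. 0 < t \<Longrightarrow> t \<le> 1 \<Longrightarrow> \<bar>\<Sum>k\<le>N. a k * t ^ k\<bar> \<le> C * t ^ m" and "k < m" "k \<le> N"
  shows "a k = 0"
  using assms(2,3)
proof (induction k rule: less_induct)
  case (less k)
  let ?q = "\<lambda>t. \<Sum>j\<in>{k..N}. a j * t ^ (j - k)"
  have C: "0 \<le> C" using b[of 1] by simp
  have eq: "(\<Sum>j\<le>N. a j * t ^ j) = t ^ k * ?q t" for t
  proof -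
    have "(\<Sum>j\<le>N. a j * t ^ j) = (\<Sum>j\<in>{k..N}. a j * t ^ j)"
      by (rule sum.mono_neutral_right) (use less in auto)
    also have "\<dots> = t ^ k * ?q t" unfolding sum_distrib_left
      by (intro sum.cong refl) (auto simp: mult.left_commute simp flip: power_add)
    finally show ?thesis .
  qed
  have bound: "\<bar>?q t\<bar> \<le> C * t" if t: "0 < t" "t \<le> 1" for t
  proof -
    have "t ^ k * \<bar>?q t\<bar> \<le> C * t ^ m" using b[OF t] t unfolding eq by (simp add: abs_mult)
    also have "C * t ^ m \<le> C * t ^ Suc k" using t less.prems C by (intro mult_left_mono power_decreasing) auto
    also have "\<dots> = t ^ k * (C * t)" by simp
    finally show ?thesis using t by simp
  qed
  have "(?q \<longlongrightarrow> ?q 0) (at_right 0)" by (intro tendsto_intros)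
  moreover have "(?q \<longlongrightarrow> 0) (at_right 0)"
  proof (rule Lim_null_comparison)
    have "((\<lambda>t. C * t) \<longlongrightarrow> C * 0) (at_right 0)" by (intro tendsto_intros)
    then show "((\<lambda>t. C * t) \<longlongrightarrow> 0) (at_right 0)" by simp
    have "\<forall>\<^sub>F t in at_right 0. 0 < t \<and> t \<le> (1 :: real)"
      using eventually_at_right_field[of "\<lambda>t. 0 < t \<and> t \<le> 1" "0 :: real"] by (auto intro!: exI[of _ 1])
    then show "\<forall>\<^sub>F t in at_right 0. norm (?q t) \<le> C * t" by eventually_elim (use bound in auto)
  qed
  ultimately have "?q 0 = 0" by (rule tendsto_unique[rotated]) simp
  moreover have "?q 0 = a k"
  proof -
    have "?q 0 = (\<Sum>j\<in>{k..N}. if j = k then a k else 0)" by (intro sum.cong) (auto simp: power_0_left)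
    then show ?thesis using less.prems by simp
  qed
  ultimately show ?case by simp
qed

lemma exp_taylor_cubic: "\<bar>exp y - (1 + y + y\<^sup>2 / 2)\<bar> \<le> \<bar>y\<bar> ^ 3 * exp \<bar>y\<bar>" for y :: real
proof -
  obtain s where s: "\<bar>s\<bar> \<le> \<bar>y\<bar>" "exp y = (\<Sum>m<3. y ^ m / fact m) + exp s / fact 3 * y ^ 3"
    using Maclaurin_exp_le[of y 3] by blast
  then have "exp y - (1 + y + y\<^sup>2 / 2) = exp s / 6 * y ^ 3"
    by (simp add: numeral_3_eq_3 lessThan_Suc fact_numeral power2_eq_square)
  then have "\<bar>exp y - (1 + y + y\<^sup>2 / 2)\<bar> = exp s / 6 * \<bar>y\<bar> ^ 3" by (simp only: abs_mult power_abs) simp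
  also have "\<dots> \<le> exp \<bar>y\<bar> * \<bar>y\<bar> ^ 3"
  proof (rule mult_right_mono)
    have "exp s \<le> exp \<bar>y\<bar>" using s(1) by simp
    then show "exp s / 6 \<le> exp \<bar>y\<bar>" using exp_ge_zero[of "\<bar>y\<bar>"] by linarith
  qed simp
  finally show ?thesis by (simp add: mult.commute)
qed

lemma has_real_derivative_quadratic_bound:
  fixes f :: "real \<Rightarrow> real"
  assumes "\<And>s. \<bar>f s - f 0 - s * D\<bar> \<le> C * s\<^sup>2"
  shows "(f has_real_derivative D) (at 0)"
  unfolding DERIV_def
proof (rule LIM_zero_cancel, rule Lim_null_comparison)
  have "((\<lambda>s. C * \<bar>s\<bar>) \<longlongrightarrow> C * \<bar>0\<bar>) (at 0)" by (intro tendsto_intros)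
  then show "((\<lambda>s. C * \<bar>s\<bar>) \<longlongrightarrow> 0) (at (0::real))" by simp
  show "\<forall>\<^sub>F s in at 0. norm ((f (0 + s) - f 0) / s - D) \<le> C * \<bar>s\<bar>"
    unfolding eventually_at_filter
  proof (intro always_eventually allI impI)
    fix s :: real assume s: "s \<noteq> 0"
    have "norm ((f (0 + s) - f 0) / s - D) = \<bar>f s - f 0 - s * D\<bar> / \<bar>s\<bar>"
      using s by (simp add: diff_divide_distrib abs_divide[symmetric])
    also have "\<dots> \<le> C * s\<^sup>2 / \<bar>s\<bar>" by (intro divide_right_mono assms) simp
    also have "\<dots> = C * \<bar>s\<bar>" using s by (simp add: power2_eq_square abs_if)
    finally show "norm ((f (0 + s) - f 0) / s - D) \<le> C * \<bar>s\<bar>" .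
  qed
qed

context
  fixes K :: "'a::real_inner set" and t :: real
  assumes K: "convex_body K" and t: "0 < t"
begin

text \<open>Completing the square shows that maximising
  \<open>x \<bullet> q - t * (norm q)\<^sup>2 / 2\<close> over \<open>K\<close> is minimising the
  distance of \<open>q\<close> to \<open>x /\<^sub>R t\<close>.\<close>

lemma smoothed_support_ge:
  assumes q: "q \<in> K"
  shows "x \<bullet> q - t * (norm q)\<^sup>2 / 2 \<le> smoothed_support K t x"
proof -
  let ?p = "nearest K (x /\<^sub>R t)"
  have sq: "t\<^sup>2 * (dist (x /\<^sub>R t) y)\<^sup>2 = (norm x)\<^sup>2 - 2 * t * (x \<bullet> y - t * (norm y)\<^sup>2 / 2)" for y
  proof -
    have "(dist (x /\<^sub>R t) y)\<^sup>2 = (norm (x /\<^sub>R t))\<^sup>2 - 2 * ((x /\<^sub>R t) \<bullet> y) + (norm y)\<^sup>2"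
      unfolding dist_norm power2_norm_eq_inner by (simp add: algebra_simps inner_commute)
    then show ?thesis using t by (simp add: power_divide power2_eq_square field_simps)
  qed
  have "t\<^sup>2 * (dist (x /\<^sub>R t) ?p)\<^sup>2 \<le> t\<^sup>2 * (dist (x /\<^sub>R t) q)\<^sup>2"
    using nearest_props(2)[OF K q] by (intro mult_left_mono power_mono) auto
  then have "t * (x \<bullet> q - t * (norm q)\<^sup>2 / 2) \<le> t * (x \<bullet> ?p - t * (norm ?p)\<^sup>2 / 2)"
    unfolding sq by linarith
  then show ?thesis unfolding smoothed_support_def using t by simp
qed

lemma continuous_smoothed_support: "continuous_on UNIV (smoothed_support K t)"
  unfolding smoothed_support_def[abs_def]
  by (intro continuous_intros continuous_on_compose2[OF continuous_nearest[OF K]]) auto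

text \<open>The envelope theorem: testing each maximiser at the other point traps the first-order
  error between 0 and the displacement of the maximiser paired with \<open>s *\<^sub>R w\<close>,
  which is quadratic in \<open>s\<close> because \<open>nearest\<close> is non-expansive.\<close>

lemma smoothed_support_deriv:
  "((\<lambda>s. smoothed_support K t (y + s *\<^sub>R w)) has_real_derivative nearest K (y /\<^sub>R t) \<bullet> w) (at 0)"
proof (rule has_real_derivative_quadratic_bound)
  fix s
  let ?F = "smoothed_support K t" and ?p = "\<lambda>y. nearest K (y /\<^sub>R t)"
  let ?z = "y + s *\<^sub>R w"
  have 1: "?z \<bullet> ?p y - t * (norm (?p y))\<^sup>2 / 2 \<le> ?F ?z" "y \<bullet> ?p ?z - t * (norm (?p ?z))\<^sup>2 / 2 \<le> ?F y"
    by (intro smoothed_support_ge nearest_props(1)[OF K])+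
  then have lo: "0 \<le> ?F ?z - ?F y - s * (?p y \<bullet> w)" and hi: "?F ?z - ?F y - s * (?p y \<bullet> w) \<le> (?p ?z - ?p y) \<bullet> (s *\<^sub>R w)"
    by (simp_all add: smoothed_support_def algebra_simps inner_commute)
  have "(?p ?z - ?p y) \<bullet> (s *\<^sub>R w) \<le> norm (?p ?z - ?p y) * norm (s *\<^sub>R w)" by (rule norm_cauchy_schwarz)
  also have "\<dots> \<le> norm (?z /\<^sub>R t - y /\<^sub>R t) * norm (s *\<^sub>R w)"
    using nearest_lipschitz[OF K, of "?z /\<^sub>R t" "y /\<^sub>R t"] by (intro mult_right_mono) (auto simp: dist_norm)
  also have "\<dots> = (norm w)\<^sup>2 / t * s\<^sup>2"
    using t by (simp add: power2_eq_square scaleR_right_distrib divide_inverse abs_mult)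
  finally show "\<bar>?F (y + s *\<^sub>R w) - ?F (y + 0 *\<^sub>R w) - s * (?p y \<bullet> w)\<bar> \<le> (norm w)\<^sup>2 / t * s\<^sup>2"
    using lo hi by simp
qed

end

lemma norm_coords_le:
  assumes "orthonormal_system d e"
  shows "norm (coords d e x) \<le> (\<Sum>i<d. \<bar>x i\<bar>)"
proof -
  have "norm (coords d e x) \<le> (\<Sum>i<d. norm (x i *\<^sub>R e i))" unfolding coords_def by (rule norm_sum)
  also have "\<dots> = (\<Sum>i<d. \<bar>x i\<bar>)" by (rule sum.cong) (simp_all add: norm_orthonormal[OF assms])
  finally show ?thesis .
qed

lemma abs_smoothed_support_le:
  assumes K: "convex_body K" and R: "\<And>x. x \<in> K \<Longrightarrow> norm x \<le> R" and t: "0 < t"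
  shows "\<bar>smoothed_support K t x\<bar> \<le> R * norm x + t * R\<^sup>2 / 2"
proof -
  let ?p = "nearest K (x /\<^sub>R t)"
  have p: "norm ?p \<le> R" by (rule R[OF nearest_props(1)[OF K]])
  have "\<bar>x \<bullet> ?p\<bar> \<le> norm x * norm ?p" by (rule Cauchy_Schwarz_ineq2)
  also have "\<dots> \<le> norm x * R" by (rule mult_left_mono[OF p]) simp
  finally have 1: "\<bar>x \<bullet> ?p\<bar> \<le> R * norm x" by (simp add: mult.commute)
  have "(norm ?p)\<^sup>2 \<le> R\<^sup>2" using p by (intro power_mono) auto
  then have "t * (norm ?p)\<^sup>2 / 2 \<le> t * R\<^sup>2 / 2" using t by simp
  moreover have "0 \<le> t * (norm ?p)\<^sup>2 / 2" using t by simp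
  ultimately show ?thesis unfolding smoothed_support_def using 1 by linarith
qed

section \<open>Second order expansion in finite dimension\<close>

context gaussian_sup
begin

context
  fixes K :: "'a set" and d :: nat and e :: "nat \<Rightarrow> 'a"
  assumes K: "convex_body K" and e: "orthonormal_system d e" and sub: "K \<subseteq> span (e ` {..<d})"
    and norm_K: "\<And>x. x \<in> K \<Longrightarrow> norm x \<le> R"
    and dense: "range c \<subseteq> K" "K \<subseteq> closure (range c)"
begin

lemma R_nonneg: "0 \<le> R" using norm_c[of 0] norm_ge_zero[of "c 0"] by linarith

lemma nearest_measurable[measurable]: "nearest K \<in> borel_measurable borel"
  by (rule borel_measurable_continuous_onI[OF continuous_nearest[OF K]])

lemma smoothed_support_ibp_pair:
  assumes t: "0 < t"
  shows "ibp_pair (\<lambda>\<omega>. smoothed_support K t (marginal d e \<omega>)) (\<lambda>\<omega>. nearest K (marginal d e \<omega> /\<^sub>R t))"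
proof -
  let ?F = "\<lambda>x :: 'a \<Rightarrow> real. nearest K (coords d e (\<lambda>i. x (e i)) /\<^sub>R t)"
  let ?\<Phi> = "\<lambda>x :: 'a \<Rightarrow> real. smoothed_support K t (coords d e (\<lambda>i. x (e i)))"
  have cc: "continuous_on UNIV (coords d e)"
    unfolding coords_def[abs_def] by (intro continuous_intros continuous_on_product_coordinates)
  have D: "path_deriv u ?\<Phi> (\<lambda>x. ?F x \<bullet> u)" for u
    unfolding path_deriv_def
  proof (intro conjI allI)
    show "exp_growth ?\<Phi>"
    proof (rule exp_growth_pullback'[of "\<lambda>z. smoothed_support K t (coords d e z)" d])
      show "continuous_on UNIV (\<lambda>z. smoothed_support K t (coords d e z))"
        by (rule continuous_on_compose2[OF continuous_smoothed_support[OF K t] cc]) simp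
      show "exp_bound d (\<lambda>z. smoothed_support K t (coords d e z))"
      proof (rule exp_boundI_poly)
        fix x :: "nat \<Rightarrow> real"
        let ?S = "\<Sum>i<d. \<bar>x i\<bar>"
        have "\<bar>smoothed_support K t (coords d e x)\<bar> \<le> R * ?S + t * R\<^sup>2 / 2"
          using abs_smoothed_support_le[OF K norm_K t, of "coords d e x"] mult_left_mono[OF norm_coords_le[OF e, of x] R_nonneg] by linarith
        also have "\<dots> \<le> (R + t * R\<^sup>2 / 2) * (1 + ?S) ^ 1"
        proof -
          have "0 \<le> t * R\<^sup>2 / 2 * ?S" using t by (intro mult_nonneg_nonneg sum_nonneg) auto
          then show ?thesis using R_nonneg unfolding power_one_right by (simp only: ring_distribs mult_1_right)
        qed
        finally show "\<bar>smoothed_support K t (coords d e x)\<bar> \<le> (R + t * R\<^sup>2 / 2) * (1 + ?S) ^ 1" .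
      qed
    qed
    show "exp_growth (\<lambda>x. ?F x \<bullet> u)"
    proof (rule exp_growth_pullback'[of "\<lambda>z. nearest K (coords d e z /\<^sub>R t) \<bullet> u" d])
      show "continuous_on UNIV (\<lambda>z. nearest K (coords d e z /\<^sub>R t) \<bullet> u)"
        by (intro continuous_intros continuous_on_compose2[OF continuous_nearest[OF K]] cc) simp
      show "exp_bound d (\<lambda>z. nearest K (coords d e z /\<^sub>R t) \<bullet> u)"
      proof (rule exp_boundI_bounded)
        fix z
        have "\<bar>nearest K (coords d e z /\<^sub>R t) \<bullet> u\<bar> \<le> norm (nearest K (coords d e z /\<^sub>R t)) * norm u" by (rule Cauchy_Schwarz_ineq2)
        also have "\<dots> \<le> R * norm u" by (intro mult_right_mono norm_K nearest_props(1)[OF K]) simp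
        finally show "\<bar>nearest K (coords d e z /\<^sub>R t) \<bullet> u\<bar> \<le> R * norm u" .
      qed
    qed
    fix x :: "'a \<Rightarrow> real"
    \<comment> \<open>The projection of \<open>u\<close> to the span. Only this part of a shift
      moves the Gaussian vector, and points of \<open>K\<close> have the same inner product with
      \<open>w\<close> as with \<open>u\<close>.\<close>
    define w where "w = coords d e (\<lambda>i. e i \<bullet> u)"
    define y where "y = coords d e (\<lambda>i. x (e i))"
    have line: "coords d e (\<lambda>i. x (e i) + s * (e i \<bullet> u)) = y + s *\<^sub>R w" for s
      by (simp add: y_def w_def coords_def scaleR_left_distrib sum.distrib scaleR_sum_right)
    have pw: "p \<bullet> w = p \<bullet> u" if "p \<in> K" for p
    proof -
      have "coords d e (\<lambda>i. p \<bullet> e i) = p" using orthonormal_expansion[OF e] that sub by (metis subsetD)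
      then have "p \<bullet> u = coords d e (\<lambda>i. p \<bullet> e i) \<bullet> u" by simp
      also have "\<dots> = (\<Sum>i<d. (p \<bullet> e i) * (e i \<bullet> u))" by (simp add: coords_def inner_sum_left)
      finally have "p \<bullet> u = (\<Sum>i<d. (p \<bullet> e i) * (e i \<bullet> u))" .
      then show ?thesis by (simp add: w_def coords_def inner_sum_right mult.commute)
    qed
    show "((\<lambda>s. ?\<Phi> (\<lambda>v. x v + s * (v \<bullet> u))) has_real_derivative ?F x \<bullet> u) (at 0)"
      unfolding line y_def[symmetric] pw[OF nearest_props(1)[OF K], symmetric] by (rule smoothed_support_deriv[OF K t])
    show "continuous_on UNIV (\<lambda>s. ?F (\<lambda>v. x v + s * (v \<bullet> u)) \<bullet> u)"
      unfolding line by (intro continuous_intros continuous_on_compose2[OF continuous_nearest[OF K]]) simp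
  qed
  have "square_integrable M (\<lambda>\<omega>. nearest K (marginal d e \<omega> /\<^sub>R t))"
    by (rule square_integrable_of_bounded[of _ R]) (auto intro: norm_K nearest_props(1)[OF K])
  then show ?thesis using ibp_pair_path[of ?\<Phi> ?F, OF D] unfolding marginal_def by simp
qed

text \<open>Inner products with \<open>marginal\<close> agree with \<open>X\<close> almost surely at
  the countably many \<open>c i\<close>. For a fixed outcome they are continuous in the point, so
  the upper bound extends to all of \<open>K\<close> outside one null set.\<close>

lemma marginal_le_h: "AE \<omega> in M. (\<forall>p\<in>K. marginal d e \<omega> \<bullet> p \<le> h \<omega>) \<and> h \<omega> = (SUP i. marginal d e \<omega> \<bullet> c i)"
proof -
  have "AE \<omega> in M. \<forall>i. marginal d e \<omega> \<bullet> c i = X (c i) \<omega>"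
    unfolding AE_all_countable using marginal_inner[OF e] dense(1) sub by blast
  with h_ge h show ?thesis
  proof eventually_elim
    case (elim \<omega>)
    have "closed {p. marginal d e \<omega> \<bullet> p \<le> h \<omega>}" by (intro closed_Collect_le continuous_intros)
    then have "closure (range c) \<subseteq> {p. marginal d e \<omega> \<bullet> p \<le> h \<omega>}" using elim by (intro closure_minimal) auto
    then show ?case using dense(2) elim by auto
  qed
qed

text \<open>The penalty in the maximisation lies between 0 and \<open>t * R\<^sup>2 / 2\<close>. For
  the lower estimate, the penalty at the maximiser is added back, leaving the inner product with a
  point of \<open>K\<close>.\<close>

lemma smoothed_support_bounds:
  assumes t: "0 < t"
  shows "AE \<omega> in M. smoothed_support K t (marginal d e \<omega>) + t * (norm (nearest K (marginal d e \<omega> /\<^sub>R t)))\<^sup>2 / 2 \<le> h \<omega> \<and>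
    h \<omega> \<le> smoothed_support K t (marginal d e \<omega>) + t * R\<^sup>2 / 2"
  using marginal_le_h
proof eventually_elim
  case (elim \<omega>)
  have "marginal d e \<omega> \<bullet> c i \<le> smoothed_support K t (marginal d e \<omega>) + t * R\<^sup>2 / 2" for i
  proof -
    have "(norm (c i))\<^sup>2 \<le> R\<^sup>2" using norm_c[of i] by (intro power_mono) auto
    then have "t * (norm (c i))\<^sup>2 / 2 \<le> t * R\<^sup>2 / 2" using t by simp
    then show ?thesis using smoothed_support_ge[OF K t, of "c i" "marginal d e \<omega>"] dense(1) by fastforce
  qed
  then have "h \<omega> \<le> smoothed_support K t (marginal d e \<omega>) + t * R\<^sup>2 / 2"
    using elim by (auto intro!: cSUP_least)
  moreover have "marginal d e \<omega> \<bullet> nearest K (marginal d e \<omega> /\<^sub>R t) \<le> h \<omega>" using elim nearest_props(1)[OF K] by blast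
  ultimately show ?case by (simp add: smoothed_support_def)
qed

context
  fixes r :: "nat \<Rightarrow> nat" and Z :: "'w \<Rightarrow> 'a"
  assumes r: "strict_mono r" and Z: "square_integrable M Z"
    and lim_h: "l2_lim M (\<lambda>k. approx_sup c (r k)) h" and lim_Z: "l2_lim M (\<lambda>k. approx_argmax c (r k)) Z"
    and soft: "soft_limit h Z"
begin

lemma approx_argmax_in: "approx_argmax c n \<omega> \<in> K"
proof -
  have p: "0 < Suc n" "0 < (real (Suc n))\<^sup>2" by simp_all
  show ?thesis unfolding approx_argmax_def soft_argmax_def
    using K dense(1) sum_soft_wt[OF p] less_imp_le[OF soft_wt_pos[OF p]]
    by (intro convex_sum) (auto simp: convex_body_def)
qed

text \<open>The soft argmax is a convex combination of points of \<open>K\<close>, hence a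
  competitor in the maximisation; by the entropy bound its inner product with the Gaussian vector is
  almost \<open>approx_sup\<close>.\<close>

lemma smoothed_support_ge_approx:
  assumes t: "0 < t"
  shows "AE \<omega> in M. approx_sup c n \<omega> - 1 / real (Suc n) - t * (norm (approx_argmax c n \<omega>))\<^sup>2 / 2 \<le> smoothed_support K t (marginal d e \<omega>)"
proof -
  have p: "0 < Suc n" "0 < (real (Suc n))\<^sup>2" by simp_all
  have "AE \<omega> in M. \<forall>i. marginal d e \<omega> \<bullet> c i = X (c i) \<omega>"
    unfolding AE_all_countable using marginal_inner[OF e] dense(1) sub by blast
  then show ?thesis
  proof eventually_elim
    case (elim \<omega>)
    have "marginal d e \<omega> \<bullet> approx_argmax c n \<omega> = (\<Sum>i<Suc n. soft_wt (Suc n) ((real (Suc n))\<^sup>2) i (\<lambda>k. X (c k) \<omega>) * X (c i) \<omega>)"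
      using elim by (simp only: approx_argmax_def soft_argmax_def inner_sum_right inner_scaleR_right)
    moreover have "approx_sup c n \<omega> - (\<Sum>i<Suc n. soft_wt (Suc n) ((real (Suc n))\<^sup>2) i (\<lambda>k. X (c k) \<omega>) * X (c i) \<omega>) \<le> 1 / real (Suc n)"
      unfolding approx_sup_def soft_sup_def using soft_max_entropy(2)[OF p, of "\<lambda>k. X (c k) \<omega>"] ln_Suc_div_le[of n] by linarith
    ultimately show ?case
      using smoothed_support_ge[OF K t approx_argmax_in, of "marginal d e \<omega>" n \<omega>] by linarith
  qed
qed

text \<open>The first estimate is the limit of \<open>smoothed_support_ge_approx\<close>. For the
  second, let \<open>P\<close> be the nearest point and \<open>H\<close> the smoothed support. Then
  \<open>h - H \<ge> t / 2 * (P \<bullet> P)\<close> and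
  \<open>P \<bullet> P \<ge> 2 * (P \<bullet> Z) - Z \<bullet> Z\<close>, so a lower bound for the
  expectation of \<open>P \<bullet> Z\<close> is enough. Monotonicity of the form provides
  it.\<close>

lemma smoothed_support_expectation:
  assumes t: "0 < t"
  shows "expectation (\<lambda>\<omega>. h \<omega> - smoothed_support K t (marginal d e \<omega>)) \<le> t / 2 * expectation (\<lambda>\<omega>. (norm (Z \<omega>))\<^sup>2)"
    "t / 2 * (expectation (\<lambda>\<omega>. (norm (Z \<omega>))\<^sup>2) - t * R\<^sup>2 * expectation (\<lambda>\<omega>. \<bar>h \<omega>\<bar>)) \<le> expectation (\<lambda>\<omega>. h \<omega> - smoothed_support K t (marginal d e \<omega>))"
proof -
  let ?H = "\<lambda>\<omega>. smoothed_support K t (marginal d e \<omega>)" and ?P = "\<lambda>\<omega>. nearest K (marginal d e \<omega> /\<^sub>R t)"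
  note ibp = smoothed_support_ibp_pair[OF t]
  note sq = ibp_pairD(1,2)[OF ibp] square_integrable_h Z
  note ih = square_integrable_integrable[OF sq(1)] square_integrable_integrable[OF sq(3)]
  have "expectation h - 0 - t * expectation (\<lambda>\<omega>. Z \<omega> \<bullet> Z \<omega>) / 2 \<le> expectation ?H"
  proof (rule LIMSEQ_le_const2)
    have "(\<lambda>k. expectation (\<lambda>\<omega>. approx_sup c (r k) \<omega> \<bullet> 1)) \<longlonglongrightarrow> expectation (\<lambda>\<omega>. h \<omega> \<bullet> 1)"
      by (rule l2_lim_inner[OF approx_props(3) sq(3) lim_h square_integrable_one square_integrable_one l2_lim_const])
    moreover have "(\<lambda>k. expectation (\<lambda>\<omega>. approx_argmax c (r k) \<omega> \<bullet> approx_argmax c (r k) \<omega>)) \<longlonglongrightarrow> expectation (\<lambda>\<omega>. Z \<omega> \<bullet> Z \<omega>)"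
      by (rule l2_lim_inner[OF approx_props(4) Z lim_Z approx_props(4) Z lim_Z])
    moreover have "(\<lambda>k. 1 / real (Suc (r k))) \<longlonglongrightarrow> 0"
      using LIMSEQ_subseq_LIMSEQ[OF LIMSEQ_inverse_real_of_nat r] by (simp add: o_def inverse_eq_divide)
    ultimately show "(\<lambda>k. expectation (approx_sup c (r k)) - 1 / real (Suc (r k)) - t * expectation (\<lambda>\<omega>. approx_argmax c (r k) \<omega> \<bullet> approx_argmax c (r k) \<omega>) / 2)
      \<longlonglongrightarrow> expectation h - 0 - t * expectation (\<lambda>\<omega>. Z \<omega> \<bullet> Z \<omega>) / 2"
      by (intro tendsto_intros) simp_all
    have "expectation (approx_sup c n) - 1 / real (Suc n) - t * expectation (\<lambda>\<omega>. approx_argmax c n \<omega> \<bullet> approx_argmax c n \<omega>) / 2 \<le> expectation ?H" for n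
    proof -
      have i: "integrable M (approx_sup c n)" "integrable M (\<lambda>\<omega>. approx_argmax c n \<omega> \<bullet> approx_argmax c n \<omega>)"
        by (rule square_integrable_integrable[OF approx_props(3)], rule integrable_inner_square_integrable[OF approx_props(4) approx_props(4)])
      have "expectation (\<lambda>\<omega>. approx_sup c n \<omega> - 1 / real (Suc n) - t * (approx_argmax c n \<omega> \<bullet> approx_argmax c n \<omega>) / 2) \<le> expectation ?H"
        by (rule integral_mono_AE) (use i ih smoothed_support_ge_approx[OF t, of n] in \<open>auto simp: power2_norm_eq_inner\<close>)
      then show ?thesis using i by (simp add: prob_space)
    qed
    then show "\<exists>N. \<forall>k\<ge>N. expectation (approx_sup c (r k)) - 1 / real (Suc (r k)) - t * expectation (\<lambda>\<omega>. approx_argmax c (r k) \<omega> \<bullet> approx_argmax c (r k) \<omega>) / 2 \<le> expectation ?H"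
      by blast
  qed
  then show "expectation (\<lambda>\<omega>. h \<omega> - ?H \<omega>) \<le> t / 2 * expectation (\<lambda>\<omega>. (norm (Z \<omega>))\<^sup>2)"
    using ih by (simp add: power2_norm_eq_inner)
  have le: "AE \<omega> in M. ?H \<omega> \<le> h \<omega>"
    using smoothed_support_bounds[OF t] by eventually_elim (smt (verit) t divide_nonneg_nonneg mult_nonneg_nonneg zero_le_power2)
  note ibp_h = malliavin_graphD(1)[OF soft_limit_malliavin_graph[OF soft]]
  \<comment> \<open>Applying \<open>H \<le> h\<close> inside the form with test variable
    \<open>h\<close> compares the derivatives: the expectation of \<open>P \<bullet> Z\<close> falls
    short of that of \<open>Z \<bullet> Z\<close> by at most the expectation of
    \<open>(h - H) * h\<close>, which is of order \<open>t\<close>.\<close>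
  have "malliavin_form ?H ?P h Z \<le> malliavin_form h Z h Z"
    by (rule malliavin_form_mono[OF ibp ibp_h le soft])
  then have PZ: "expectation (\<lambda>\<omega>. Z \<omega> \<bullet> Z \<omega>) - (expectation (\<lambda>\<omega>. h \<omega> * h \<omega>) - expectation (\<lambda>\<omega>. ?H \<omega> * h \<omega>)) \<le> expectation (\<lambda>\<omega>. ?P \<omega> \<bullet> Z \<omega>)"
    unfolding malliavin_form_def by linarith
  have ihh: "integrable M (\<lambda>\<omega>. h \<omega> * h \<omega>)" "integrable M (\<lambda>\<omega>. ?H \<omega> * h \<omega>)"
    using integrable_inner_square_integrable[OF sq(3) sq(3)] integrable_inner_square_integrable[OF sq(1) sq(3)] by simp_all
  have "expectation (\<lambda>\<omega>. h \<omega> * h \<omega> - ?H \<omega> * h \<omega>) \<le> expectation (\<lambda>\<omega>. t * R\<^sup>2 / 2 * \<bar>h \<omega>\<bar>)"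
  proof (rule integral_mono_AE)
    show "AE \<omega> in M. h \<omega> * h \<omega> - ?H \<omega> * h \<omega> \<le> t * R\<^sup>2 / 2 * \<bar>h \<omega>\<bar>"
      using le smoothed_support_bounds[OF t]
    proof eventually_elim
      case (elim \<omega>)
      have "(h \<omega> - ?H \<omega>) * h \<omega> \<le> (h \<omega> - ?H \<omega>) * \<bar>h \<omega>\<bar>" using elim by (intro mult_left_mono) auto
      also have "\<dots> \<le> t * R\<^sup>2 / 2 * \<bar>h \<omega>\<bar>" using elim by (intro mult_right_mono) auto
      finally show ?case by (simp add: left_diff_distrib)
    qed
  qed (use ihh ih in auto)
  then have hh: "expectation (\<lambda>\<omega>. h \<omega> * h \<omega>) - expectation (\<lambda>\<omega>. ?H \<omega> * h \<omega>) \<le> t * R\<^sup>2 / 2 * expectation (\<lambda>\<omega>. \<bar>h \<omega>\<bar>)"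
    using ihh ih by simp
  have ip: "integrable M (\<lambda>\<omega>. ?P \<omega> \<bullet> ?P \<omega>)" "integrable M (\<lambda>\<omega>. ?P \<omega> \<bullet> Z \<omega>)" "integrable M (\<lambda>\<omega>. Z \<omega> \<bullet> Z \<omega>)"
    using integrable_inner_square_integrable[OF sq(2) sq(2)] integrable_inner_square_integrable[OF sq(2) Z]
      integrable_inner_square_integrable[OF Z Z] by simp_all
  have "0 \<le> expectation (\<lambda>\<omega>. ?P \<omega> \<bullet> ?P \<omega> - 2 * (?P \<omega> \<bullet> Z \<omega>) + Z \<omega> \<bullet> Z \<omega>)"
  proof (rule Bochner_Integration.integral_nonneg)
    fix \<omega>
    have "0 \<le> (?P \<omega> - Z \<omega>) \<bullet> (?P \<omega> - Z \<omega>)" by (rule inner_ge_zero)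
    then show "0 \<le> ?P \<omega> \<bullet> ?P \<omega> - 2 * (?P \<omega> \<bullet> Z \<omega>) + Z \<omega> \<bullet> Z \<omega>" by (simp add: algebra_simps inner_commute)
  qed
  then have PP: "2 * expectation (\<lambda>\<omega>. ?P \<omega> \<bullet> Z \<omega>) - expectation (\<lambda>\<omega>. Z \<omega> \<bullet> Z \<omega>) \<le> expectation (\<lambda>\<omega>. ?P \<omega> \<bullet> ?P \<omega>)"
    using ip by simp
  have "expectation (\<lambda>\<omega>. t / 2 * (?P \<omega> \<bullet> ?P \<omega>)) \<le> expectation (\<lambda>\<omega>. h \<omega> - ?H \<omega>)"
  proof (rule integral_mono_AE)
    show "AE \<omega> in M. t / 2 * (?P \<omega> \<bullet> ?P \<omega>) \<le> h \<omega> - ?H \<omega>"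
      using smoothed_support_bounds[OF t] by eventually_elim (simp add: power2_norm_eq_inner)
  qed (use ip ih in auto)
  then have "t / 2 * expectation (\<lambda>\<omega>. ?P \<omega> \<bullet> ?P \<omega>) \<le> expectation (\<lambda>\<omega>. h \<omega> - ?H \<omega>)" by simp
  moreover have "t / 2 * (expectation (\<lambda>\<omega>. Z \<omega> \<bullet> Z \<omega>) - t * R\<^sup>2 * expectation (\<lambda>\<omega>. \<bar>h \<omega>\<bar>)) \<le> t / 2 * expectation (\<lambda>\<omega>. ?P \<omega> \<bullet> ?P \<omega>)"
    using PP PZ hh t by (intro mult_left_mono) auto
  ultimately show "t / 2 * (expectation (\<lambda>\<omega>. (norm (Z \<omega>))\<^sup>2) - t * R\<^sup>2 * expectation (\<lambda>\<omega>. \<bar>h \<omega>\<bar>)) \<le> expectation (\<lambda>\<omega>. h \<omega> - ?H \<omega>)"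
    by (simp add: power2_norm_eq_inner)
qed

lemma integrable_exp_norm_marginal: "integrable M (\<lambda>\<omega>. exp (a * norm (marginal d e \<omega>)))"
proof (rule Bochner_Integration.integrable_bound)
  show "integrable M (\<lambda>\<omega>. exp (\<bar>a\<bar> * (\<Sum>v\<in>e ` {..<d}. \<bar>X v \<omega>\<bar>)))" by (rule integrable_exp_sum_abs_X) simp
  show "AE \<omega> in M. norm (exp (a * norm (marginal d e \<omega>))) \<le> norm (exp (\<bar>a\<bar> * (\<Sum>v\<in>e ` {..<d}. \<bar>X v \<omega>\<bar>)))"
  proof (rule AE_I2)
    fix \<omega>
    have "a * norm (marginal d e \<omega>) \<le> \<bar>a\<bar> * norm (marginal d e \<omega>)" by (intro mult_right_mono) auto
    also have "\<dots> \<le> \<bar>a\<bar> * (\<Sum>i<d. \<bar>X (e i) \<omega>\<bar>)" unfolding marginal_def by (intro mult_left_mono norm_coords_le[OF e]) simp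
    also have "(\<Sum>i<d. \<bar>X (e i) \<omega>\<bar>) = (\<Sum>v\<in>e ` {..<d}. \<bar>X v \<omega>\<bar>)"
      using orthonormal_independent(2)[OF e] by (simp add: sum.reindex)
    finally show "norm (exp (a * norm (marginal d e \<omega>))) \<le> norm (exp (\<bar>a\<bar> * (\<Sum>v\<in>e ` {..<d}. \<bar>X v \<omega>\<bar>)))" by simp
  qed
qed measurable

text \<open>With \<open>H\<close> the smoothed support, the Wills functional is
  \<open>1 + t * E H + t\<^sup>2 * E H\<^sup>2 / 2\<close> up to order \<open>t ^ 3\<close>.
  Inserting \<open>E H = m - t * z / 2\<close> and \<open>E H\<^sup>2 = q\<close> up to errors of
  order \<open>t\<^sup>2\<close> and \<open>t\<close> gives the coefficient
  \<open>(q - z) / 2\<close> of \<open>t\<^sup>2\<close>, to be compared with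
  \<open>W 2 / (2 * pi)\<close>.\<close>

lemma steiner_coeff_2:
  assumes W: "steiner_coeffs d e K W"
  shows "W 2 = pi * malliavin_form h Z h Z"
proof -
  define A where "A \<omega> = R * norm (marginal d e \<omega>) + R\<^sup>2 / 2" for \<omega>
  define m where "m = expectation h"
  define q where "q = expectation (\<lambda>\<omega>. (h \<omega>)\<^sup>2)"
  define z where "z = expectation (\<lambda>\<omega>. (norm (Z \<omega>))\<^sup>2)"
  define g where "g = expectation (\<lambda>\<omega>. \<bar>h \<omega>\<bar>)"
  \<comment> \<open>\<open>A\<close> dominates the smoothed support for all
    \<open>t \<le> 1\<close>; the Taylor remainder involves \<open>A ^ 3 * exp A\<close>, which is
    below \<open>exp (4 * A)\<close>.\<close>
  define D where "D = expectation (\<lambda>\<omega>. exp (4 * A \<omega>))"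
  \<comment> \<open>Three sources of error of order \<open>t ^ 3\<close>: the Taylor remainder, the
    mean and the second moment of the smoothed support.\<close>
  define C where "C = D + R\<^sup>2 * g / 2 + R\<^sup>2 * (2 * g + R\<^sup>2 / 2) / 4"
  have iD: "integrable M (\<lambda>\<omega>. exp (4 * A \<omega>))"
  proof -
    have "exp (4 * A \<omega>) = exp (2 * R\<^sup>2) * exp ((4 * R) * norm (marginal d e \<omega>))" for \<omega>
      by (simp add: A_def algebra_simps flip: exp_add)
    then show ?thesis using integrable_exp_norm_marginal[of "4 * R"] by simp
  qed
  have A0: "0 \<le> A \<omega>" for \<omega> using R_nonneg by (simp add: A_def)
  note sh = square_integrable_h and ih = square_integrable_integrable[OF square_integrable_h]
  have ihh: "integrable M (\<lambda>\<omega>. (h \<omega>)\<^sup>2)" using square_integrableD(2)[OF sh] by simp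
  have key: "\<bar>(\<Sum>k\<le>d. t ^ k * (W k / sqrt (2 * pi) ^ k)) - 1 - m * t - (q - z) / 2 * t\<^sup>2\<bar> \<le> C * t ^ 3" if t: "0 < t" "t \<le> 1" for t
  proof -
    let ?H = "\<lambda>\<omega>. smoothed_support K t (marginal d e \<omega>)"
    note sH = ibp_pairD(1)[OF smoothed_support_ibp_pair[OF t(1)]]
    note iH = square_integrable_integrable[OF sH]
    have iHH: "integrable M (\<lambda>\<omega>. (?H \<omega>)\<^sup>2)" using square_integrableD(2)[OF sH] by simp
    have G: "integrable M (\<lambda>\<omega>. exp (t * ?H \<omega>))" "expectation (\<lambda>\<omega>. exp (t * ?H \<omega>)) = (\<Sum>k\<le>d. t ^ k * (W k / sqrt (2 * pi) ^ k))"
      using wills_formula[OF K e sub W t(1)] by (simp_all add: has_bochner_integral_iff)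
    have HA: "\<bar>?H \<omega>\<bar> \<le> A \<omega>" for \<omega>
    proof -
      have "t * R\<^sup>2 / 2 \<le> R\<^sup>2 / 2" using t by (simp add: mult_left_le_one_le)
      then show ?thesis using abs_smoothed_support_le[OF K norm_K t(1), of "marginal d e \<omega>"] unfolding A_def by linarith
    qed
    let ?rem = "\<lambda>\<omega>. exp (t * ?H \<omega>) - (1 + t * ?H \<omega> + (t * ?H \<omega>)\<^sup>2 / 2)"
    have irem: "integrable M ?rem" using G(1) iH iHH by (auto simp: power_mult_distrib)
    have "\<bar>expectation ?rem\<bar> \<le> expectation (\<lambda>\<omega>. \<bar>?rem \<omega>\<bar>)" by (rule integral_abs_bound)
    also have "\<dots> \<le> expectation (\<lambda>\<omega>. t ^ 3 * exp (4 * A \<omega>))"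
    proof (rule integral_mono)
      fix \<omega>
      have y: "\<bar>t * ?H \<omega>\<bar> \<le> t * A \<omega>" "t * A \<omega> \<le> A \<omega>" using t HA[of \<omega>] A0[of \<omega>] by (auto simp: abs_mult mult_left_le_one_le)
      have "\<bar>?rem \<omega>\<bar> \<le> \<bar>t * ?H \<omega>\<bar> ^ 3 * exp \<bar>t * ?H \<omega>\<bar>" by (rule exp_taylor_cubic)
      also have "\<dots> \<le> (t * A \<omega>) ^ 3 * exp (A \<omega>)"
        using y t A0 by (intro mult_mono power_mono) auto
      also have "\<dots> = t ^ 3 * (A \<omega> ^ 3 * exp (A \<omega>))" by (simp add: power_mult_distrib)
      also have "\<dots> \<le> t ^ 3 * (exp (A \<omega>) ^ 3 * exp (A \<omega>))"
      proof -
        have "A \<omega> \<le> exp (A \<omega>)" using exp_ge_add_one_self[of "A \<omega>"] by linarith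
        then show ?thesis using A0[of \<omega>] t by (intro mult_left_mono mult_right_mono power_mono) auto
      qed
      also have "exp (A \<omega>) ^ 3 * exp (A \<omega>) = exp (4 * A \<omega>)" by (simp flip: exp_of_nat_mult exp_add)
      finally show "\<bar>?rem \<omega>\<bar> \<le> t ^ 3 * exp (4 * A \<omega>)" .
    qed (use irem iD in auto)
    finally have rem: "\<bar>expectation ?rem\<bar> \<le> D * t ^ 3" by (simp add: D_def mult.commute)
    have rem_eq: "expectation ?rem = (\<Sum>k\<le>d. t ^ k * (W k / sqrt (2 * pi) ^ k)) - (1 + t * expectation ?H + t\<^sup>2 * expectation (\<lambda>\<omega>. (?H \<omega>)\<^sup>2) / 2)"
      using G iH iHH by (simp add: power_mult_distrib prob_space)
    have "\<bar>expectation (\<lambda>\<omega>. (h \<omega>)\<^sup>2 - (?H \<omega>)\<^sup>2)\<bar> \<le> expectation (\<lambda>\<omega>. \<bar>(h \<omega>)\<^sup>2 - (?H \<omega>)\<^sup>2\<bar>)" by (rule integral_abs_bound)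
    also have "\<dots> \<le> expectation (\<lambda>\<omega>. t * R\<^sup>2 / 2 * (2 * \<bar>h \<omega>\<bar> + R\<^sup>2 / 2))"
    proof (rule integral_mono_AE)
      show "AE \<omega> in M. \<bar>(h \<omega>)\<^sup>2 - (?H \<omega>)\<^sup>2\<bar> \<le> t * R\<^sup>2 / 2 * (2 * \<bar>h \<omega>\<bar> + R\<^sup>2 / 2)"
        using smoothed_support_bounds[OF t(1)]
      proof eventually_elim
        case (elim \<omega>)
        have "0 \<le> t * (norm (nearest K (marginal d e \<omega> /\<^sub>R t)))\<^sup>2 / 2" using t by simp
        then have 1: "\<bar>h \<omega> - ?H \<omega>\<bar> \<le> t * R\<^sup>2 / 2" using elim by linarith
        moreover have "t * R\<^sup>2 / 2 \<le> R\<^sup>2 / 2" using t by (simp add: mult_left_le_one_le)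
        ultimately have "\<bar>h \<omega> + ?H \<omega>\<bar> \<le> 2 * \<bar>h \<omega>\<bar> + R\<^sup>2 / 2" by linarith
        with 1 have "\<bar>h \<omega> - ?H \<omega>\<bar> * \<bar>h \<omega> + ?H \<omega>\<bar> \<le> t * R\<^sup>2 / 2 * (2 * \<bar>h \<omega>\<bar> + R\<^sup>2 / 2)"
          by (rule mult_mono) (use t in auto)
        then show ?case by (simp add: power2_eq_square square_diff_square_factored abs_mult mult.commute)
      qed
    qed (use ihh iHH ih in auto)
    also have "\<dots> = t * R\<^sup>2 / 2 * (2 * g + R\<^sup>2 / 2)"
      unfolding g_def using ih by (simp add: prob_space)
    finally have sqd: "\<bar>q - expectation (\<lambda>\<omega>. (?H \<omega>)\<^sup>2)\<bar> \<le> t * R\<^sup>2 / 2 * (2 * g + R\<^sup>2 / 2)"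
      unfolding q_def using ihh iHH by simp
    have "\<bar>m - expectation ?H - t / 2 * z\<bar> \<le> t\<^sup>2 * R\<^sup>2 * g / 2"
    proof -
      have "expectation (\<lambda>\<omega>. h \<omega> - ?H \<omega>) = m - expectation ?H" unfolding m_def using ih iH by simp
      then have "m - expectation ?H \<le> t / 2 * z" "t / 2 * (z - t * R\<^sup>2 * g) \<le> m - expectation ?H"
        using smoothed_support_expectation[OF t(1)] unfolding z_def g_def by simp_all
      moreover have "t / 2 * (z - t * R\<^sup>2 * g) = t / 2 * z - t\<^sup>2 * R\<^sup>2 * g / 2" by (simp add: power2_eq_square algebra_simps)
      ultimately show ?thesis by linarith
    qed
    then have "t * \<bar>m - expectation ?H - t / 2 * z\<bar> \<le> t * (t\<^sup>2 * R\<^sup>2 * g / 2)" using t by (intro mult_left_mono) auto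
    then have md: "\<bar>t * m - t * expectation ?H - t\<^sup>2 * z / 2\<bar> \<le> R\<^sup>2 * g / 2 * t ^ 3"
    proof -
      have "t * \<bar>m - expectation ?H - t / 2 * z\<bar> = \<bar>t * (m - expectation ?H - t / 2 * z)\<bar>" using t by (simp add: abs_mult)
      also have "t * (m - expectation ?H - t / 2 * z) = t * m - t * expectation ?H - t\<^sup>2 * z / 2"
        by (simp add: algebra_simps power2_eq_square)
      finally show ?thesis
        using \<open>t * \<bar>m - expectation ?H - t / 2 * z\<bar> \<le> _\<close> by (simp add: power2_eq_square power3_eq_cube mult_ac)
    qed
    have "t\<^sup>2 / 2 * \<bar>q - expectation (\<lambda>\<omega>. (?H \<omega>)\<^sup>2)\<bar> \<le> t\<^sup>2 / 2 * (t * R\<^sup>2 / 2 * (2 * g + R\<^sup>2 / 2))"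
      using sqd by (rule mult_left_mono) simp
    also have "\<dots> = R\<^sup>2 * (2 * g + R\<^sup>2 / 2) / 4 * t ^ 3" by (simp add: power2_eq_square power3_eq_cube)
    finally have "t\<^sup>2 / 2 * \<bar>q - expectation (\<lambda>\<omega>. (?H \<omega>)\<^sup>2)\<bar> \<le> R\<^sup>2 * (2 * g + R\<^sup>2 / 2) / 4 * t ^ 3" .
    then have sd: "\<bar>t\<^sup>2 * q / 2 - t\<^sup>2 * expectation (\<lambda>\<omega>. (?H \<omega>)\<^sup>2) / 2\<bar> \<le> R\<^sup>2 * (2 * g + R\<^sup>2 / 2) / 4 * t ^ 3"
    proof -
      have "t\<^sup>2 / 2 * \<bar>q - expectation (\<lambda>\<omega>. (?H \<omega>)\<^sup>2)\<bar> = \<bar>t\<^sup>2 / 2 * (q - expectation (\<lambda>\<omega>. (?H \<omega>)\<^sup>2))\<bar>" by (simp add: abs_mult)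
      moreover have "t\<^sup>2 / 2 * (q - expectation (\<lambda>\<omega>. (?H \<omega>)\<^sup>2)) = t\<^sup>2 * q / 2 - t\<^sup>2 * expectation (\<lambda>\<omega>. (?H \<omega>)\<^sup>2) / 2"
        by (simp add: algebra_simps)
      ultimately show ?thesis
        using \<open>t\<^sup>2 / 2 * \<bar>q - expectation (\<lambda>\<omega>. (?H \<omega>)\<^sup>2)\<bar> \<le> R\<^sup>2 * (2 * g + R\<^sup>2 / 2) / 4 * t ^ 3\<close> by linarith
    qed
    have "(\<Sum>k\<le>d. t ^ k * (W k / sqrt (2 * pi) ^ k)) - 1 - m * t - (q - z) / 2 * t\<^sup>2 =
      expectation ?rem - (t * m - t * expectation ?H - t\<^sup>2 * z / 2) - (t\<^sup>2 * q / 2 - t\<^sup>2 * expectation (\<lambda>\<omega>. (?H \<omega>)\<^sup>2) / 2)"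
      unfolding rem_eq by (simp add: field_simps)
    moreover have "C * t ^ 3 = D * t ^ 3 + R\<^sup>2 * g / 2 * t ^ 3 + R\<^sup>2 * (2 * g + R\<^sup>2 / 2) / 4 * t ^ 3"
      unfolding C_def by (simp only: ring_distribs)
    ultimately show ?thesis using rem md sd by linarith
  qed
  define a where "a k = W k / sqrt (2 * pi) ^ k - (if k = 0 then 1 else 0) - (if k = 1 then m else 0) - (if k = 2 then (q - z) / 2 else 0)" for k
  have "a 2 = 0"
  \<comment> \<open>The sum runs to \<open>d + 2\<close> so that the index 2 occurs even when
    \<open>d < 2\<close>; the additional \<open>W k\<close> are 0 by definition of
    \<open>steiner_coeffs\<close>.\<close>
  proof (rule low_coefficients_zero[where N = "d + 2" and C = C and m = 3])
    fix t :: real assume t: "0 < t" "t \<le> 1"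
    have "(\<Sum>k\<le>d + 2. t ^ k * (W k / sqrt (2 * pi) ^ k)) = (\<Sum>k\<le>d. t ^ k * (W k / sqrt (2 * pi) ^ k))"
      by (rule sum.mono_neutral_right) (use W in \<open>auto simp: steiner_coeffs_def\<close>)
    moreover have "(\<Sum>k\<le>d + 2. a k * t ^ k) = (\<Sum>k\<le>d + 2. t ^ k * (W k / sqrt (2 * pi) ^ k)) - 1 - m * t - (q - z) / 2 * t\<^sup>2"
    proof -
      have "a k * t ^ k = t ^ k * (W k / sqrt (2 * pi) ^ k) - (if k = 0 then 1 else 0) - (if k = 1 then m * t else 0) - (if k = 2 then (q - z) / 2 * t\<^sup>2 else 0)" for k
        by (simp add: a_def algebra_simps)
      then show ?thesis by (simp add: sum_subtractf)
    qed
    ultimately show "\<bar>\<Sum>k\<le>d + 2. a k * t ^ k\<bar> \<le> C * t ^ 3" using key[OF t] by simp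
  qed auto
  then have "W 2 = pi * (q - z)" by (simp add: a_def field_simps)
  then show ?thesis unfolding malliavin_form_def q_def z_def power2_norm_eq_inner by (simp add: power2_eq_square)
qed

end

end

end

section \<open>The Steiner formula\<close>

text \<open>Induction on the degree by synthetic division at a point \<open>x\<close> of
  \<open>S\<close>: the quotients have smaller degree and converge on the rest of \<open>S\<close>,
  and their limit rebuilds \<open>q\<close>.\<close>

lemma pointwise_limit_poly:
  fixes p :: "nat \<Rightarrow> real poly"
  assumes "\<And>n. degree (p n) \<le> d" "infinite S" "\<And>r. r \<in> S \<Longrightarrow> (\<lambda>n. poly (p n) r) \<longlonglongrightarrow> q r"
  shows "\<exists>P. degree P \<le> d \<and> (\<forall>r\<in>S. q r = poly P r)"
  using assms
proof (induction d arbitrary: p q S)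
  case 0
  obtain x where x: "x \<in> S" using 0(2) by (metis finite.emptyI ex_in_conv)
  have "poly (p n) r = poly (p n) x" for n r using 0(1)[of n] by (auto elim: degree_eq_zeroE)
  then have eq: "(\<lambda>n. poly (p n) r) = (\<lambda>n. poly (p n) x)" for r by blast
  have "q r = q x" if "r \<in> S" for r using 0(3)[OF that] unfolding eq[of r] by (rule LIMSEQ_unique[OF _ 0(3)[OF x]])
  then show ?case by (intro exI[of _ "[:q x:]"]) auto
next
  case (Suc d)
  obtain x where x: "x \<in> S" using Suc.prems(2) by (metis finite.emptyI ex_in_conv)
  let ?p = "\<lambda>n. synthetic_div (p n) x"
  have pe: "poly (p n) r = (r - x) * poly (?p n) r + poly (p n) x" for n r
    using arg_cong[OF synthetic_div_correct'[of x "p n"], of "\<lambda>u. poly u r"] by (simp add: algebra_simps)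
  have "\<exists>P. degree P \<le> d \<and> (\<forall>r\<in>S - {x}. (q r - q x) / (r - x) = poly P r)"
  proof (rule Suc.IH)
    show "degree (?p n) \<le> d" for n using Suc.prems(1)[of n] by (simp add: degree_synthetic_div)
    show "infinite (S - {x})" using Suc.prems(2) by simp
    fix r assume r: "r \<in> S - {x}"
    have "(\<lambda>n. (poly (p n) r - poly (p n) x) / (r - x)) \<longlonglongrightarrow> (q r - q x) / (r - x)"
      by (intro tendsto_intros Suc.prems(3)) (use r x in auto)
    moreover have "(poly (p n) r - poly (p n) x) / (r - x) = poly (?p n) r" for n using r pe[of n r] by simp
    ultimately show "(\<lambda>n. poly (?p n) r) \<longlonglongrightarrow> (q r - q x) / (r - x)" by simp
  qed
  then obtain P where P: "degree P \<le> d" "\<And>r. r \<in> S - {x} \<Longrightarrow> (q r - q x) / (r - x) = poly P r" by blast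
  show ?case
  proof (intro exI[of _ "[:- x, 1:] * P + [:q x:]"] conjI ballI)
    have "degree ([:- x, 1:] * P) \<le> Suc d" using degree_mult_le[of "[:- x, 1:]" P] P(1) by simp
    then show "degree ([:- x, 1:] * P + [:q x:]) \<le> Suc d" by (intro degree_add_le) auto
    fix r assume r: "r \<in> S"
    show "q r = poly ([:- x, 1:] * P + [:q x:]) r"
    proof (cases "r = x")
      case False
      then show ?thesis using P(2)[of r] r by (simp add: field_simps)
    qed simp
  qed
qed

lemma poly_eq_sum_atMost:
  fixes p :: "'a::comm_semiring_1 poly"
  assumes "degree p \<le> d"
  shows "poly p x = (\<Sum>j\<le>d. coeff p j * x ^ j)"
  unfolding poly_altdef by (rule sum.mono_neutral_left) (use assms in \<open>auto simp: coeff_eq_0\<close>)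

context isonormal
begin

context
  fixes d :: nat and e :: "nat \<Rightarrow> 'a"
  assumes e: "orthonormal_system d e"
begin

context
  fixes V :: "'a set"
  assumes V: "finite V" "V \<noteq> {}" "V \<subseteq> span (e ` {..<d})"
begin

lemma polytope: "convex_body (convex hull V)" "convex hull V \<subseteq> span (e ` {..<d})"
  using V finite_imp_compact_convex_hull[of V] hull_minimal[of V "span (e ` {..<d})" convex]
  by (auto simp: convex_body_def subspace_imp_convex)

text \<open>The vertices on the supporting hyperplane of the hull at the point nearest to \<open>x\<close>.\<close>

definition nearest_face :: "'a \<Rightarrow> 'a set" where
  "nearest_face x = {v \<in> V. (x - nearest (convex hull V) x) \<bullet> (v - nearest (convex hull V) x) = 0}"

text \<open>In a convex representation of the nearest point, vertices off the supporting hyperplane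
  contribute strictly negative terms to a sum that is 0, so their weights vanish.\<close>

lemma nearest_face_span:
  assumes "a \<in> nearest_face x"
  shows "nearest (convex hull V) x - a \<in> span ((\<lambda>v. v - a) ` nearest_face x)"
proof -
  let ?p = "nearest (convex hull V) x"
  obtain u where u: "\<And>v. v \<in> V \<Longrightarrow> 0 \<le> u v" "sum u V = 1" "(\<Sum>v\<in>V. u v *\<^sub>R v) = ?p"
    using nearest_props(1)[OF polytope(1), of x] unfolding convex_hull_finite[OF V(1)] by auto
  have "(\<Sum>v\<in>V. - (u v * ((x - ?p) \<bullet> (v - ?p)))) = - ((x - ?p) \<bullet> (\<Sum>v\<in>V. u v *\<^sub>R (v - ?p)))"
    by (simp add: inner_sum_right sum_negf)
  also have "(\<Sum>v\<in>V. u v *\<^sub>R (v - ?p)) = 0"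
    using u(2,3) by (simp add: scaleR_diff_right sum_subtractf flip: scaleR_sum_left)
  finally have "(\<Sum>v\<in>V. - (u v * ((x - ?p) \<bullet> (v - ?p)))) = 0" by simp
  moreover have "0 \<le> - (u v * ((x - ?p) \<bullet> (v - ?p)))" if "v \<in> V" for v
    using u(1)[OF that] nearest_dot[OF polytope(1), of v x] that hull_subset[of V convex]
    by (auto simp: mult_nonneg_nonpos)
  ultimately have "\<forall>v\<in>V. - (u v * ((x - ?p) \<bullet> (v - ?p))) = 0" using V(1) by (simp add: sum_nonneg_eq_0_iff)
  then have u0: "u v = 0" if "v \<in> V" "v \<notin> nearest_face x" for v using that by (auto simp: nearest_face_def)
  have "?p - a = (\<Sum>v\<in>V. u v *\<^sub>R (v - a))"
    using u(2,3) by (simp add: scaleR_diff_right sum_subtractf flip: scaleR_sum_left)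
  also have "\<dots> \<in> span ((\<lambda>v. v - a) ` nearest_face x)"
  proof (rule span_sum)
    fix v assume "v \<in> V"
    then show "u v *\<^sub>R (v - a) \<in> span ((\<lambda>v. v - a) ` nearest_face x)"
      using u0[of v] by (cases "v \<in> nearest_face x") (auto intro: span_scale span_base span_zero)
  qed
  finally show ?thesis .
qed

text \<open>Otherwise all vertices, hence the hull, would lie in an open half-space whose boundary
  contains the nearest point.\<close>

lemma nearest_face_nonempty: "nearest_face x \<noteq> {}"
proof
  assume empty: "nearest_face x = {}"
  let ?p = "nearest (convex hull V) x"
  have "convex {v. (x - ?p) \<bullet> (v - ?p) < 0}"
    using convex_halfspace_lt[of "x - ?p" "(x - ?p) \<bullet> ?p"] by (simp add: inner_diff_right)
  moreover have "V \<subseteq> {v. (x - ?p) \<bullet> (v - ?p) < 0}"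
    using empty nearest_dot[OF polytope(1), of _ x] hull_subset[of V convex] by (force simp: nearest_face_def)
  ultimately have "convex hull V \<subseteq> {v. (x - ?p) \<bullet> (v - ?p) < 0}" by (rule hull_minimal[rotated])
  then show False using nearest_props(1)[OF polytope(1), of x] by auto
qed

lemma nearest_face_measurable: "{x. nearest_face x = A \<and> infdist x (convex hull V) \<le> s} \<in> sets borel"
proof (cases "A \<subseteq> V")
  case True
  have [measurable]: "nearest (convex hull V) \<in> borel_measurable borel"
    by (rule borel_measurable_continuous_onI[OF continuous_nearest[OF polytope(1)]])
  have inf_m[measurable]: "(\<lambda>x. infdist x (convex hull V)) \<in> borel_measurable borel"
    by (intro borel_measurable_continuous_onI continuous_intros)
  have "{x. nearest_face x = A \<and> infdist x (convex hull V) \<le> s} =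
    {x. (\<forall>v\<in>V. ((x - nearest (convex hull V) x) \<bullet> (v - nearest (convex hull V) x) = 0) = (v \<in> A)) \<and> infdist x (convex hull V) \<le> s}"
    using True by (auto simp: nearest_face_def)
  also have "\<dots> \<in> sets borel" using V(1) by measurable
  finally show ?thesis .
next
  case False
  then have "{x. nearest_face x = A \<and> infdist x (convex hull V) \<le> s} = {}" by (auto simp: nearest_face_def)
  then show ?thesis by (simp only: sets.empty_sets)
qed

text \<open>The variational inequality at \<open>p\<close> is homogeneous in \<open>x - p\<close>,
  so moving along the outer normal ray keeps both the foot and the supporting hyperplane.\<close>

lemma dilation:
  assumes s: "0 < s" and p: "p = nearest (convex hull V) x" and y: "y = p + s *\<^sub>R (x - p)"
  shows "nearest (convex hull V) y = p" "nearest_face y = nearest_face x"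
    "infdist y (convex hull V) = s * infdist x (convex hull V)"
proof -
  show n: "nearest (convex hull V) y = p"
  proof (rule nearest_eqI[OF polytope(1)])
    show "p \<in> convex hull V" unfolding p by (rule nearest_props(1)[OF polytope(1)])
    fix z assume "z \<in> convex hull V"
    from nearest_dot[OF polytope(1) this, of x] show "(y - p) \<bullet> (z - p) \<le> 0"
      using s by (simp add: y p mult_le_0_iff)
  qed
  show "nearest_face y = nearest_face x" unfolding nearest_face_def n p[symmetric] using s by (simp add: y)
  show "infdist y (convex hull V) = s * infdist x (convex hull V)"
    unfolding infdist_eq_nearest[OF polytope(1)] n p[symmetric] dist_norm using s by (simp add: y)
qed

text \<open>In an orthonormal basis adapted to the face, moving away from the nearest point is affine in each coordinate.\<close>

lemma nearest_face_piece_volume: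
  obtains m where "m \<le> d" "\<And>s. 0 < s \<Longrightarrow> measure (span_vol d e) {x. nearest_face x = A \<and> infdist x (convex hull V) \<le> s} =
    s ^ m * measure (span_vol d e) {x. nearest_face x = A \<and> infdist x (convex hull V) \<le> 1}"
proof (cases "A \<noteq> {} \<and> A \<subseteq> V")
  case False
  then have empty: "{x. nearest_face x = A \<and> infdist x (convex hull V) \<le> s} = {}" for s
    using nearest_face_nonempty by (auto simp: nearest_face_def)
  show ?thesis by (rule that[of 0]) (simp_all only: empty, simp_all)
next
  case True
  then obtain a where a: "a \<in> A" by blast
  let ?L = "(\<lambda>v. v - a) ` A" and ?E = "span (e ` {..<d})" and ?K = "convex hull V"
  have L: "finite ?L" "?L \<subseteq> ?E" using True V a by (auto intro: finite_subset span_diff)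
  \<comment> \<open>An orthonormal basis of the directions within the face, completed next to a
    basis \<open>c\<close> of the whole span: the first \<open>k\<close> directions are tangential,
    the others normal.\<close>
  obtain k b where b: "orthonormal_system k b" "span (b ` {..<k}) = span ?L"
    using orthonormal_extend[of 0 e ?L] L(1) by (auto simp: orthonormal_system_def)
  obtain d' c where c: "orthonormal_system d' c" "k \<le> d'" "\<And>i. i < k \<Longrightarrow> c i = b i"
    "span (c ` {..<d'}) = span (b ` {..<k} \<union> e ` {..<d})"
    using orthonormal_extend[OF b(1), of "e ` {..<d}"] by auto
  have "b ` {..<k} \<subseteq> span ?L" unfolding b(2)[symmetric] by (rule span_superset)
  also have "span ?L \<subseteq> ?E" by (rule span_minimal[OF L(2) subspace_span])
  finally have "span (b ` {..<k} \<union> e ` {..<d}) = ?E"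
    unfolding span_eq using span_superset[of "e ` {..<d}"] span_superset[of "b ` {..<k} \<union> e ` {..<d}"] by auto
  with c(4) have sc: "span (c ` {..<d'}) = ?E" by simp
  have dd: "d' = d" by (rule orthonormal_dim_eq[OF c(1) e sc])
  note c = c[unfolded dd] and sc = sc[unfolded dd]
  have ck: "span (c ` {..<k}) = span ?L" using c(3) b(2) by (metis (no_types, lifting) image_cong lessThan_iff)
  \<comment> \<open>Tangential coordinates stay fixed. A normal coordinate is scaled by
    \<open>s\<close> about \<open>a \<bullet> c i\<close>, the common normal coordinate of the face
    and thus of every foot; so \<open>U s\<close> is one affine map that acts as the dilation on the
    whole piece.\<close>
  define \<tau> where "\<tau> s i = (if i < k then 0 else (1 - s) * (a \<bullet> c i))" for s i
  define \<gamma> where "\<gamma> s i = (if i < k then 1 else s)" for s :: real and i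
  define U where "U s x = coords d c (\<lambda>i. \<tau> s i + \<gamma> s i * (x \<bullet> c i))" for s x
  have U_span: "U s x \<in> ?E" for s x unfolding U_def sc[symmetric] by (rule coords_in_span)
  have U_inner: "U s x \<bullet> c i = \<tau> s i + \<gamma> s i * (x \<bullet> c i)" if "i < d" for s x i
    unfolding U_def by (rule coords_inner[OF c(1) that])
  have U_eq: "U s x = p + s *\<^sub>R (x - p)" if x: "x \<in> ?E" "nearest_face x = A" and p: "p = nearest ?K x" for s x p
  proof -
    have pK: "p \<in> ?E" using nearest_props(1)[OF polytope(1), of x] polytope(2) p by auto
    have F1: "(x - p) \<bullet> c i = 0" if "i < k" for i
    proof -
      have "?L \<subseteq> {y. (x - p) \<bullet> y = 0}"
      proof clarify
        fix v assume "v \<in> A"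
        then have "(x - p) \<bullet> (v - p) = 0" "(x - p) \<bullet> (a - p) = 0" using x(2) a p by (auto simp: nearest_face_def)
        then show "(x - p) \<bullet> (v - a) = 0" by (simp add: inner_diff_right)
      qed
      then have "span ?L \<subseteq> {y. (x - p) \<bullet> y = 0}" by (rule span_minimal[OF _ subspace_hyperplane])
      moreover have "c i \<in> span ?L" unfolding ck[symmetric] using that by (auto intro: span_base)
      ultimately show ?thesis by blast
    qed
    have F2: "(p - a) \<bullet> c i = 0" if "k \<le> i" "i < d" for i
    proof -
      have "c ` {..<k} \<subseteq> {y. c i \<bullet> y = 0}" using that orthonormal_inner[OF c(1), of i] by auto
      then have "span ?L \<subseteq> {y. c i \<bullet> y = 0}" unfolding ck[symmetric] by (rule span_minimal[OF _ subspace_hyperplane])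
      moreover have "p - a \<in> span ?L" using nearest_face_span[of a x] a x(2) p by simp
      ultimately show ?thesis by (auto simp: inner_commute)
    qed
    have "p + s *\<^sub>R (x - p) \<in> span (c ` {..<d})" unfolding sc using x(1) pK by (intro span_add span_scale span_diff)
    from orthonormal_expansion[OF c(1) this]
    have "p + s *\<^sub>R (x - p) = coords d c (\<lambda>i. (p + s *\<^sub>R (x - p)) \<bullet> c i)" by simp
    also have "\<dots> = U s x"
      unfolding U_def coords_def
    proof (rule sum.cong)
      fix i assume "i \<in> {..<d}"
      have "(p + s *\<^sub>R (x - p)) \<bullet> c i = \<tau> s i + \<gamma> s i * (x \<bullet> c i)"
      proof (cases "i < k")
        case True
        then show ?thesis using F1[OF True] by (simp add: \<tau>_def \<gamma>_def inner_add_left inner_diff_left)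
      next
        case False
        then have "p \<bullet> c i = a \<bullet> c i" using F2[of i] \<open>i \<in> {..<d}\<close> by (simp add: inner_diff_left)
        then show ?thesis using False by (simp add: \<tau>_def \<gamma>_def inner_add_left inner_diff_left algebra_simps)
      qed
      then show "((p + s *\<^sub>R (x - p)) \<bullet> c i) *\<^sub>R c i = (\<tau> s i + \<gamma> s i * (x \<bullet> c i)) *\<^sub>R c i" by simp
    qed simp
    finally show ?thesis by simp
  qed
  define E where "E s = {x. nearest_face x = A \<and> infdist x ?K \<le> s}" for s
  have Em[measurable]: "E s \<in> sets borel" for s unfolding E_def by (rule nearest_face_measurable)
  have forward: "U s x \<in> E (s * \<rho>)" if "x \<in> ?E" "x \<in> E \<rho>" "0 < s" for s \<rho> x
  proof -
    have x: "nearest_face x = A" "infdist x ?K \<le> \<rho>" using that(2) by (auto simp: E_def)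
    show ?thesis using dilation[OF that(3) refl U_eq[OF that(1) x(1) refl]] x that(3) by (simp add: E_def)
  qed
  have U_inverse: "U (1 / s) (U s x) = x" if x: "x \<in> ?E" and s: "0 < s" for s x
  proof -
    have "x \<in> span (c ` {..<d})" using x sc by simp
    from orthonormal_expansion[OF c(1) this] have "x = coords d c (\<lambda>i. x \<bullet> c i)" by simp
    also have "\<dots> = U (1 / s) (U s x)"
      unfolding U_def[of "1 / s"] coords_def
      by (intro sum.cong refl arg_cong2[where f = "(*\<^sub>R)"])
        (use s in \<open>auto simp: U_inner \<tau>_def \<gamma>_def field_simps\<close>)
    finally show ?thesis by simp
  qed
  \<comment> \<open>\<open>U (1 / s)\<close> inverts \<open>U s\<close> on the span and is itself a
    dilation of the piece, which yields the converse inclusion.\<close>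
  have iff: "U s x \<in> E s \<longleftrightarrow> x \<in> E 1" if "x \<in> ?E" "0 < s" for s x
    using forward[OF that(1) _ that(2), of 1] forward[OF U_span, of s x s "1 / s"] U_inverse[OF that] that(2) by auto
  have vol: "span_vol d e = span_vol d c" by (rule span_vol_basis_change[OF e c(1) sc[symmetric]])
  show ?thesis
  \<comment> \<open>The exponent is the number of normal directions.\<close>
  proof (rule that[of "d - k"])
    fix s :: real assume s: "0 < s"
    have cm: "(\<lambda>x. U s x) \<in> borel_measurable borel" unfolding U_def coords_def by measurable
    have Fm: "(\<lambda>x. indicator (E s) x :: ennreal) \<in> borel_measurable borel" by measurable
    have "emeasure (span_vol d c) (E 1) = (\<integral>\<^sup>+x. indicator (E 1) x \<partial>span_vol d c)" by simp
    also have "\<dots> = (\<integral>\<^sup>+x. indicator (E 1) (coords d c x) \<partial>PiM {..<d} (\<lambda>_. lborel))" by (rule nn_integral_span_vol) measurable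
    also have "\<dots> = (\<integral>\<^sup>+x. indicator (E s) (U s (coords d c x)) \<partial>PiM {..<d} (\<lambda>_. lborel))"
      by (rule nn_integral_cong) (use iff[OF _ s] coords_in_span[of d c] sc in \<open>auto simp: indicator_def\<close>)
    also have "\<dots> = (\<integral>\<^sup>+x. indicator (E s) (U s x) \<partial>span_vol d c)"
      by (rule nn_integral_span_vol[symmetric]) (rule measurable_compose[OF cm Fm])
    also have "\<dots> = ennreal (\<Prod>i<d. 1 / \<bar>\<gamma> s i\<bar>) * (\<integral>\<^sup>+x. indicator (E s) x \<partial>span_vol d c)"
      unfolding U_def by (rule nn_integral_span_vol_affine[OF c(1) _ Fm]) (use s in \<open>simp add: \<gamma>_def\<close>)
    also have "(\<Prod>i<d. 1 / \<bar>\<gamma> s i\<bar>) = (1 / s) ^ (d - k)"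
    proof -
      have "(\<Prod>i<d. 1 / \<bar>\<gamma> s i\<bar>) = (\<Prod>i\<in>{k..<d}. 1 / s)"
        by (rule prod.mono_neutral_cong_right) (use s in \<open>auto simp: \<gamma>_def\<close>)
      then show ?thesis by simp
    qed
    finally have "emeasure (span_vol d c) (E 1) = ennreal ((1 / s) ^ (d - k)) * emeasure (span_vol d c) (E s)" by simp
    then have "measure (span_vol d c) (E 1) = (1 / s) ^ (d - k) * measure (span_vol d c) (E s)"
      using s by (simp add: measure_def enn2real_mult)
    then show "measure (span_vol d e) {x. nearest_face x = A \<and> infdist x ?K \<le> s} =
      s ^ (d - k) * measure (span_vol d e) {x. nearest_face x = A \<and> infdist x ?K \<le> 1}"
      unfolding E_def[symmetric] vol using s by (simp add: power_divide)
  qed simp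
qed

text \<open>The sets belonging to the subsets \<open>A\<close> of \<open>V\<close> partition the
  parallel body, and each contributes a monomial of degree at most \<open>d\<close> in the
  radius.\<close>

lemma polytope_parallel_volume:
  obtains P where "degree P \<le> d" "\<And>s. 0 < s \<Longrightarrow> measure (span_vol d e) {x. infdist x (convex hull V) \<le> s} = poly P s"
proof -
  let ?E = "\<lambda>A s. {x. nearest_face x = A \<and> infdist x (convex hull V) \<le> s}"
  have "\<exists>k\<le>d. \<forall>s>0. measure (span_vol d e) (?E A s) = s ^ k * measure (span_vol d e) (?E A 1)" for A
    by (rule nearest_face_piece_volume[of A]) blast
  then have "\<exists>m. \<forall>A. m A \<le> d \<and> (\<forall>s>0. measure (span_vol d e) (?E A s) = s ^ m A * measure (span_vol d e) (?E A 1))"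
    by (intro choice allI)
  then obtain m where m: "\<And>A. m A \<le> d" "\<And>A s. 0 < s \<Longrightarrow> measure (span_vol d e) (?E A s) = s ^ m A * measure (span_vol d e) (?E A 1)"
    by blast
  define P where "P = (\<Sum>A\<in>Pow V. monom (measure (span_vol d e) (?E A 1)) (m A))"
  show ?thesis
  proof (rule that)
    show "degree P \<le> d" unfolding P_def
      by (intro degree_sum_le) (use V(1) m(1) in \<open>auto intro: order_trans[OF degree_monom_le]\<close>)
    fix s :: real assume s: "0 < s"
    have fin: "emeasure (span_vol d e) (?E A s) \<noteq> \<infinity>" for A
    proof -
      have "emeasure (span_vol d e) (?E A s) \<le> emeasure (span_vol d e) {x. infdist x (convex hull V) \<le> s}"
        by (rule emeasure_mono) (auto intro: parallel_body_measurable[OF polytope(1) e polytope(2)])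
      then show ?thesis using emeasure_parallel_body_finite[OF polytope(1) e polytope(2), of s] by (simp add: top_unique)
    qed
    have "{x. infdist x (convex hull V) \<le> s} = (\<Union>A\<in>Pow V. ?E A s)" by (auto simp: nearest_face_def)
    then have "measure (span_vol d e) {x. infdist x (convex hull V) \<le> s} = measure (span_vol d e) (\<Union>A\<in>Pow V. ?E A s)" by simp
    also have "\<dots> = (\<Sum>A\<in>Pow V. measure (span_vol d e) (?E A s))"
      by (rule measure_finite_Union) (use V(1) nearest_face_measurable fin in \<open>auto simp: disjoint_family_on_def\<close>)
    also have "\<dots> = poly P s" unfolding P_def poly_sum poly_monom by (intro sum.cong refl) (simp add: m(2)[OF s] mult.commute)
    finally show "measure (span_vol d e) {x. infdist x (convex hull V) \<le> s} = poly P s" .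
  qed
qed

end

text \<open>Hulls of the first points of a dense sequence increase to a dense part of
  \<open>K\<close>; their volume polynomials converge to a polynomial. The union of their parallel
  bodies may miss boundary points of that of \<open>K\<close>, so volumes are compared at slightly
  different radii and continuity of the limit closes the gap.\<close>

lemma parallel_volume_polynomial:
  assumes K: "convex_body K" and sub: "K \<subseteq> span (e ` {..<d})"
  obtains P where "degree P \<le> d" "\<And>s. 0 < s \<Longrightarrow> measure (span_vol d e) {x. infdist x K \<le> s} = poly P s"
proof -
  have ne: "K \<noteq> {}" and conv: "convex K" using K by (auto simp: convex_body_def)
  obtain T where T: "countable T" "T \<subseteq> K" "K \<subseteq> closure T" by (rule separable)
  have Tne: "T \<noteq> {}" using T(3) ne by auto
  define c where "c = from_nat_into T"
  have rc: "range c = T" unfolding c_def by (rule range_from_nat_into[OF Tne T(1)])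
  define Q where "Q n = convex hull (c ` {..n})" for n
  have cV: "finite (c ` {..n})" "c ` {..n} \<noteq> {}" "c ` {..n} \<subseteq> span (e ` {..<d})" for n
    using rc T(2) sub by auto
  have Qne: "Q n \<noteq> {}" for n unfolding Q_def using cV(2)[of n] by simp
  have QK: "Q n \<subseteq> K" for n unfolding Q_def using rc T(2) conv by (intro hull_minimal) auto
  have Qmono: "Q n \<subseteq> Q k" if "n \<le> k" for n k unfolding Q_def using that by (intro hull_mono) auto
  let ?R = "\<lambda>n s. {x. infdist x (Q n) \<le> s}" and ?f = "\<lambda>s. measure (span_vol d e) {x. infdist x K \<le> s}"
  have Rm: "?R n s \<in> sets borel" for n s by (intro borel_closed closed_Collect_le continuous_intros)
  have Km: "{x. infdist x K \<le> s} \<in> sets borel" for s by (rule parallel_body_measurable[OF K e sub])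
  have RK: "?R n s \<subseteq> {x. infdist x K \<le> s}" for n s
    using infdist_mono[OF QK Qne] by (auto intro: order_trans)
  have Kfin: "emeasure (span_vol d e) {x. infdist x K \<le> s} < \<infinity>" for s by (rule emeasure_parallel_body_finite[OF K e sub])
  have Ufin: "emeasure (span_vol d e) (\<Union>n. ?R n s) \<noteq> \<infinity>" for s
  proof -
    have "emeasure (span_vol d e) (\<Union>n. ?R n s) \<le> emeasure (span_vol d e) {x. infdist x K \<le> s}"
      using RK Km by (intro emeasure_mono) auto
    then show ?thesis using Kfin[of s] by (simp add: top_unique)
  qed
  have "\<exists>P. degree P \<le> d \<and> (\<forall>s>0. measure (span_vol d e) (?R n s) = poly P s)" for n
    using polytope_parallel_volume[OF cV[of n]] unfolding Q_def by metis
  then obtain p where p: "\<And>n. degree (p n) \<le> d" "\<And>n s. 0 < s \<Longrightarrow> measure (span_vol d e) (?R n s) = poly (p n) s"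
    by metis
  define q where "q s = measure (span_vol d e) (\<Union>n. ?R n s)" for s
  have lim: "(\<lambda>n. poly (p n) s) \<longlonglongrightarrow> q s" if s: "s \<in> {0<..}" for s
  proof -
    have "(\<lambda>n. measure (span_vol d e) (?R n s)) \<longlonglongrightarrow> q s"
      unfolding q_def
    proof (rule Lim_measure_incseq[OF _ _ Ufin])
      show "incseq (\<lambda>n. ?R n s)"
        unfolding incseq_def using infdist_mono[OF Qmono Qne] by (auto intro: order_trans)
    qed (use Rm in auto)
    then show ?thesis using p(2) s by simp
  qed
  obtain P where P: "degree P \<le> d" "\<And>s. 0 < s \<Longrightarrow> q s = poly P s"
    using pointwise_limit_poly[OF p(1) _ lim] infinite_Ioi by (metis greaterThan_iff)
  have qf: "q s \<le> ?f s" for s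
    unfolding q_def using RK Km Kfin by (intro measure_mono_fmeasurable) (auto simp: fmeasurable_def Rm intro!: sets.countable_UN)
  \<comment> \<open>A surplus of \<open>t - s\<close> in the radius pays for replacing the nearest
    point of \<open>K\<close> by a point of the dense sequence.\<close>
  have fq: "?f s \<le> q t" if st: "s < t" for s t
    unfolding q_def
  proof (rule measure_mono_fmeasurable)
    show "(\<Union>n. ?R n t) \<in> fmeasurable (span_vol d e)" using Ufin[of t] Rm by (auto simp: fmeasurable_def top.not_eq_extremum)
    show "{x. infdist x K \<le> s} \<subseteq> (\<Union>n. ?R n t)"
    proof
      fix x assume x: "x \<in> {x. infdist x K \<le> s}"
      have "nearest K x \<in> closure T" using nearest_props(1)[OF K] T(3) by auto
      then obtain y where y: "y \<in> T" "dist y (nearest K x) < t - s"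
        unfolding closure_approachable using st by (metis diff_gt_0_iff_gt)
      then obtain n where n: "y = c n" using rc by auto
      have "infdist x (Q n) \<le> dist x y" unfolding Q_def n by (rule infdist_le) (simp add: hull_inc)
      also have "\<dots> \<le> dist x (nearest K x) + dist y (nearest K x)" by (rule dist_triangle2)
      also have "\<dots> \<le> t" using x y(2) infdist_eq_nearest[OF K, of x] by simp
      finally show "x \<in> (\<Union>n. ?R n t)" by blast
    qed
  qed (use Km in simp)
  show ?thesis
  proof (rule that[OF P(1)])
    fix s :: real assume s: "0 < s"
    have "?f s \<le> poly P s"
    proof (rule tendsto_lowerbound)
      show "(poly P \<longlongrightarrow> poly P s) (at_right s)" by (intro tendsto_intros)
      show "\<forall>\<^sub>F t in at_right s. ?f s \<le> poly P t"
        unfolding eventually_at_filter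
      proof (intro always_eventually allI impI)
        fix t assume "t \<in> {s<..}"
        then show "?f s \<le> poly P t" using fq[of s t] P(2)[of t] s by simp
      qed
    qed simp
    then show "?f s = poly P s" using qf[of s] P(2)[OF s] by simp
  qed
qed

text \<open>Provides the witness for the definite description in
  \<open>fin_dim_intrinsic_volume\<close>; the coefficients of the volume polynomial are divided by
  the positive unit ball volumes.\<close>

theorem steiner_coeffs_exist:
  assumes K: "convex_body K" and sub: "K \<subseteq> span (e ` {..<d})"
  obtains W where "steiner_coeffs d e K W"
proof -
  obtain P where P: "degree P \<le> d" "\<And>s. 0 < s \<Longrightarrow> measure (span_vol d e) {x. infdist x K \<le> s} = poly P s"
    using parallel_volume_polynomial[OF K sub] by blast
  define W where "W k = (if k \<le> d then coeff P (d - k) / unit_ball_vol (real (d - k)) else 0)" for k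
  have "steiner_coeffs d e K W"
    unfolding steiner_coeffs_def
  proof (intro conjI allI impI)
    fix r :: real assume r: "0 < r"
    have "poly P r = (\<Sum>j\<le>d. coeff P j * r ^ j)" by (rule poly_eq_sum_atMost[OF P(1)])
    also have "\<dots> = (\<Sum>k\<le>d. coeff P (d - k) * r ^ (d - k))" by (rule sum.reindex_bij_witness[of _ "\<lambda>k. d - k" "\<lambda>k. d - k"]) auto
    also have "\<dots> = (\<Sum>k\<le>d. r ^ (d - k) * unit_ball_vol (real (d - k)) * W k)"
      by (intro sum.cong refl) (simp add: W_def less_imp_neq[OF unit_ball_vol_pos, symmetric])
    finally show "subspace_vol d e (K + (\<lambda>x. r *\<^sub>R x) ` (cball 0 1 \<inter> span (e ` {..<d}))) =
      (\<Sum>k\<le>d. r ^ (d - k) * unit_ball_vol (real (d - k)) * W k)"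
      unfolding subspace_vol_parallel_body[OF K e sub r] P(2)[OF r] .
  qed (simp add: W_def)
  then show ?thesis by (rule that)
qed

end

end

section \<open>Passage to infinite dimension and polarisation\<close>

context isonormal
begin

lemma X_diff_second_moment:
  "integrable M (\<lambda>\<omega>. (X v \<omega> - X w \<omega>)\<^sup>2)" "expectation (\<lambda>\<omega>. (X v \<omega> - X w \<omega>)\<^sup>2) = (norm (v - w))\<^sup>2"
proof -
  have i: "integrable M (\<lambda>\<omega>. X a \<omega> * X b \<omega>)" for a b
    using integrable_inner_square_integrable[OF square_integrable_X square_integrable_X, of a b] by simp
  have eq: "(X v \<omega> - X w \<omega>)\<^sup>2 = X v \<omega> * X v \<omega> - 2 * (X v \<omega> * X w \<omega>) + X w \<omega> * X w \<omega>" for \<omega>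
    by (simp add: power2_eq_square algebra_simps)
  show "integrable M (\<lambda>\<omega>. (X v \<omega> - X w \<omega>)\<^sup>2)" unfolding eq using i by simp
  have "expectation (\<lambda>\<omega>. (X v \<omega> - X w \<omega>)\<^sup>2) = v \<bullet> v - 2 * (v \<bullet> w) + w \<bullet> w"
    unfolding eq using i by (simp add: X_cov)
  then show "expectation (\<lambda>\<omega>. (X v \<omega> - X w \<omega>)\<^sup>2) = (norm (v - w))\<^sup>2"
    by (simp add: power2_norm_eq_inner algebra_simps inner_commute)
qed

text \<open>\<open>X\<close> is an isometry into \<open>L\<^sup>2\<close>. For \<open>c\<close> in
  \<open>C\<close> the squared positive part of \<open>X v - h\<close> is dominated by the square of
  \<open>X v - X c\<close>, whose expectation becomes arbitrarily small.\<close>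

lemma X_le_of_closure:
  assumes h[measurable]: "h \<in> borel_measurable M" and le: "\<And>c. c \<in> C \<Longrightarrow> AE \<omega> in M. X c \<omega> \<le> h \<omega>" and v: "v \<in> closure C"
  shows "AE \<omega> in M. X v \<omega> \<le> h \<omega>"
proof -
  let ?f = "\<lambda>\<omega>. (max 0 (X v \<omega> - h \<omega>))\<^sup>2"
  have dom: "AE \<omega> in M. ?f \<omega> \<le> (X v \<omega> - X c \<omega>)\<^sup>2" if "c \<in> C" for c
    using le[OF that]
  proof eventually_elim
    case (elim \<omega>)
    have "max 0 (X v \<omega> - h \<omega>) \<le> \<bar>X v \<omega> - X c \<omega>\<bar>" using elim by auto
    then show ?case by (metis abs_ge_zero max.cobounded1 power2_abs power_mono)
  qed
  obtain c0 where c0: "c0 \<in> C" using v by (metis closure_empty empty_iff ex_in_conv)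
  have i: "integrable M ?f"
  proof (rule Bochner_Integration.integrable_bound[OF X_diff_second_moment(1)])
    show "AE \<omega> in M. norm (?f \<omega>) \<le> norm ((X v \<omega> - X c0 \<omega>)\<^sup>2)" using dom[OF c0] by eventually_elim simp
  qed measurable
  have small: "expectation ?f \<le> \<epsilon>" if "0 < \<epsilon>" for \<epsilon>
  proof -
    obtain c where c: "c \<in> C" "dist c v < sqrt \<epsilon>" using v \<open>0 < \<epsilon>\<close> by (metis closure_approachable real_sqrt_gt_zero)
    have "expectation ?f \<le> expectation (\<lambda>\<omega>. (X v \<omega> - X c \<omega>)\<^sup>2)"
      by (rule integral_mono_AE[OF i X_diff_second_moment(1) dom[OF c(1)]])
    also have "\<dots> = (norm (v - c))\<^sup>2" by (rule X_diff_second_moment(2))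
    also have "\<dots> \<le> (sqrt \<epsilon>)\<^sup>2" using c(2) by (intro power_mono) (auto simp: dist_norm norm_minus_commute)
    finally show ?thesis using \<open>0 < \<epsilon>\<close> by simp
  qed
  have "expectation ?f \<le> 0" by (rule dense_ge) (rule small)
  moreover have "0 \<le> expectation ?f" by (rule Bochner_Integration.integral_nonneg) simp
  ultimately have "AE \<omega> in M. ?f \<omega> = 0" using integral_nonneg_eq_0_iff_AE[OF i] by simp
  then show ?thesis by eventually_elim (auto simp: max_def split: if_splits)
qed

lemma support_rv_exists:
  assumes K: "GB_convex_body M X K"
  obtains h where "is_support_rv M X K h"
proof -
  obtain C where C: "countable C" "C \<subseteq> K" "K \<subseteq> closure C" by (rule separable)
  \<comment> \<open>The supremum is formed in \<open>ereal\<close>, where countable suprema are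
    measurable even on the null set of unbounded outcomes.\<close>
  define h where "h \<omega> = real_of_ereal (SUP v\<in>C. ereal (X v \<omega>))" for \<omega>
  have ne: "C \<noteq> {}" using C(3) K by (auto simp: GB_convex_body_def convex_body_def)
  have [measurable]: "h \<in> borel_measurable M"
    unfolding h_def by (intro borel_measurable_real_of_ereal borel_measurable_SUP C(1)) simp
  have "AE \<omega> in M. bdd_above ((\<lambda>v. X v \<omega>) ` C)" using K C by (auto simp: GB_convex_body_def)
  then have "AE \<omega> in M. h \<omega> = (SUP v\<in>C. X v \<omega>)"
  proof eventually_elim
    case (elim \<omega>)
    obtain B where B: "\<And>v. v \<in> C \<Longrightarrow> X v \<omega> \<le> B" using elim by (auto simp: bdd_above_def)
    obtain w where w: "w \<in> C" using ne by blast
    have "(SUP v\<in>C. ereal (X v \<omega>)) \<le> ereal B" using B by (auto intro!: SUP_least)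
    moreover have "ereal (X w \<omega>) \<le> (SUP v\<in>C. ereal (X v \<omega>))" by (rule SUP_upper[OF w])
    ultimately have "\<bar>SUP v\<in>C. ereal (X v \<omega>)\<bar> \<noteq> \<infinity>" by (cases "SUP v\<in>C. ereal (X v \<omega>)") auto
    from ereal_SUP[OF this] show ?case by (simp add: h_def flip: \<open>ereal (SUP v\<in>C. X v \<omega>) = _\<close>)
  qed
  then show ?thesis using that[of h] C unfolding is_support_rv_def by auto
qed

lemma support_sequence:
  assumes K: "GB_convex_body M X K" and h: "is_support_rv M X K h"
  obtains c R where "gaussian_sup M X c h R" "range c \<subseteq> K" "K \<subseteq> closure (range c)" "\<And>x. x \<in> K \<Longrightarrow> norm x \<le> R"
proof -
  obtain C where hm: "h \<in> borel_measurable M" and C: "countable C" "C \<subseteq> K" "K \<subseteq> closure C"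
    and sup: "AE \<omega> in M. h \<omega> = (SUP v\<in>C. X v \<omega>)"
    using h unfolding is_support_rv_def by blast
  have ne: "C \<noteq> {}" and cb: "convex_body K" using C(3) K by (auto simp: GB_convex_body_def convex_body_def)
  have "bounded K" using cb by (simp add: convex_body_def compact_imp_bounded)
  then obtain R where R: "\<And>x. x \<in> K \<Longrightarrow> norm x \<le> R" by (auto simp: bounded_iff)
  define c where "c = from_nat_into C"
  have rc: "range c = C" unfolding c_def by (rule range_from_nat_into[OF ne C(1)])
  have im: "range (\<lambda>i. X (c i) \<omega>) = (\<lambda>v. X v \<omega>) ` C" for \<omega> unfolding rc[symmetric] by auto
  have "gaussian_sup M X c h R"
  proof (intro gaussian_sup.intro isonormal_axioms gaussian_sup_axioms.intro hm)
    show "AE \<omega> in M. bdd_above (range (\<lambda>i. X (c i) \<omega>))" unfolding im using K C by (auto simp: GB_convex_body_def)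
    show "AE \<omega> in M. h \<omega> = (SUP i. X (c i) \<omega>)" unfolding im by (rule sup)
    show "norm (c i) \<le> R" for i using R rc C(2) by auto
  qed
  then show ?thesis using that R rc C by metis
qed

text \<open>\<open>steiner_coeff_2\<close> holds for every orthonormal system whose span contains
  \<open>K\<close>, with a right-hand side that does not mention the system; this makes the definite
  description unique across ambient spaces.\<close>

lemma fin_dim_intrinsic_volume_2:
  assumes c: "gaussian_sup M X c h R" and K: "convex_body K" "range c \<subseteq> K" "K \<subseteq> closure (range c)" "\<And>x. x \<in> K \<Longrightarrow> norm x \<le> R"
    and fd: "finite_dimensional K"
    and Z: "strict_mono r" "square_integrable M Z" "l2_lim M (\<lambda>k. approx_sup c (r k)) h"
      "l2_lim M (\<lambda>k. approx_argmax c (r k)) Z" "soft_limit h Z"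
  shows "fin_dim_intrinsic_volume 2 K = pi * malliavin_form h Z h Z"
proof -
  interpret G: gaussian_sup M X c h R by (rule c)
  obtain B where B: "finite B" "K \<subseteq> span B" using fd by (auto simp: finite_dimensional_def)
  obtain d e where e: "orthonormal_system d e" "span (e ` {..<d}) = span B"
    using orthonormal_extend[of 0 "\<lambda>_. 0" B] B(1) by (auto simp: orthonormal_system_def)
  obtain W where W: "steiner_coeffs d e K W" by (rule steiner_coeffs_exist[OF e(1) K(1)]) (use B(2) e(2) in auto)
  have u: "W' 2 = pi * malliavin_form h Z h Z"
    if "orthonormal_system d' e'" "K \<subseteq> span (e' ` {..<d'})" "steiner_coeffs d' e' K W'" for d' e' W'
    using G.steiner_coeff_2[OF K(1) that(1,2) K(4) K(2,3) Z that(3)] .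
  show ?thesis
    unfolding fin_dim_intrinsic_volume_def
  proof (rule the_equality)
    show "\<exists>d e W. orthonormal_system d e \<and> K \<subseteq> span (e ` {..<d}) \<and> steiner_coeffs d e K W \<and> pi * malliavin_form h Z h Z = W 2"
      using e B(2) W u[OF e(1) _ W] by (intro exI[of _ d] exI[of _ e] exI[of _ W]) auto
  qed (use u in auto)
qed

lemma GB_convex_body_subset: "GB_convex_body M X K \<Longrightarrow> convex_body C \<Longrightarrow> C \<subseteq> K \<Longrightarrow> GB_convex_body M X C"
  unfolding GB_convex_body_def by (meson subset_trans)

text \<open>Frees the support variable from the particular dense set in its definition; the null set
  depends on \<open>v\<close>.\<close>

lemma X_le_support_rv:
  assumes "GB_convex_body M X K" "is_support_rv M X K h" "v \<in> K"
  shows "AE \<omega> in M. X v \<omega> \<le> h \<omega>"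
proof -
  obtain c R where c: "gaussian_sup M X c h R" "K \<subseteq> closure (range c)"
    by (rule support_sequence[OF assms(1,2)]) blast
  interpret G: gaussian_sup M X c h R by (rule c)
  have "AE \<omega> in M. X w \<omega> \<le> h \<omega>" if "w \<in> range c" for w
    using G.h_ge that by (auto elim!: eventually_mono)
  then show ?thesis by (rule X_le_of_closure[OF G.h_measurable]) (use assms(3) c(2) in auto)
qed

lemma support_rv_le:
  assumes K: "GB_convex_body M X K" "is_support_rv M X K h" and C: "is_support_rv M X C g" "C \<noteq> {}" "C \<subseteq> K"
  shows "AE \<omega> in M. g \<omega> \<le> h \<omega>"
proof -
  obtain T where T: "countable T" "T \<subseteq> C" "C \<subseteq> closure T" "AE \<omega> in M. g \<omega> = (SUP v\<in>T. X v \<omega>)"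
    using C(1) unfolding is_support_rv_def by blast
  have "T \<noteq> {}" using T(3) C(2) by auto
  have "AE \<omega> in M. \<forall>v\<in>T. X v \<omega> \<le> h \<omega>"
    unfolding AE_ball_countable[OF T(1)] using X_le_support_rv[OF K] T(2) C(3) by blast
  with T(4) show ?thesis by eventually_elim (use \<open>T \<noteq> {}\<close> in \<open>auto intro: cSUP_least\<close>)
qed

lemma malliavin_form_mono_both:
  assumes "soft_limit \<phi> Z" "soft_limit \<psi> W" "AE \<omega> in M. \<phi> \<omega> \<le> \<psi> \<omega>"
  shows "malliavin_form \<phi> Z \<phi> Z \<le> malliavin_form \<psi> W \<psi> W"
proof -
  note i = assms(1,2)[THEN soft_limit_malliavin_graph, THEN malliavin_graphD(1)]
  have "malliavin_form \<phi> Z \<phi> Z \<le> malliavin_form \<psi> W \<phi> Z" by (rule malliavin_form_mono[OF i assms(3,1)])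
  also have "\<dots> = malliavin_form \<phi> Z \<psi> W" by (rule malliavin_form_commute)
  also have "\<dots> \<le> malliavin_form \<psi> W \<psi> W" by (rule malliavin_form_mono[OF i assms(3,2)])
  finally show ?thesis .
qed

lemma malliavin_form_mono_add_const:
  assumes "soft_limit \<phi> Z" "soft_limit \<psi> W" "AE \<omega> in M. \<phi> \<omega> \<le> \<psi> \<omega> + \<epsilon>"
  shows "malliavin_form \<phi> Z \<phi> Z \<le> malliavin_form \<psi> W \<psi> W + \<epsilon> * expectation \<phi> + \<epsilon> * expectation \<psi>"
proof -
  note i = assms(1,2)[THEN soft_limit_malliavin_graph, THEN malliavin_graphD(1)]
  note s = assms(1,2)[THEN soft_limit_malliavin_graph, THEN malliavin_graphD(3)]
  have "malliavin_form \<phi> Z \<phi> Z \<le> malliavin_form (\<lambda>\<omega>. \<psi> \<omega> + \<epsilon>) W \<phi> Z"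
    by (rule malliavin_form_mono[OF i(1) ibp_pair_add_const[OF i(2)] assms(3,1)])
  also have "\<dots> = malliavin_form \<phi> Z \<psi> W + \<epsilon> * expectation \<phi>"
    by (simp only: malliavin_form_add_const[OF s(2,1)] malliavin_form_commute[of \<phi>])
  also have "malliavin_form \<phi> Z \<psi> W \<le> malliavin_form (\<lambda>\<omega>. \<psi> \<omega> + \<epsilon>) W \<psi> W"
    by (rule malliavin_form_mono[OF i(1) ibp_pair_add_const[OF i(2)] assms(3,2)])
  also have "\<dots> = malliavin_form \<psi> W \<psi> W + \<epsilon> * expectation \<psi>" by (rule malliavin_form_add_const[OF s(2,2)])
  finally show ?thesis by simp
qed

lemma intrinsic_volume_2_finite_dimensional:
  assumes K: "GB_convex_body M X K" and h: "is_support_rv M X K h" and fd: "finite_dimensional K"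
  obtains Z where "soft_limit h Z" "fin_dim_intrinsic_volume 2 K = pi * malliavin_form h Z h Z"
proof -
  obtain c R where c: "gaussian_sup M X c h R" "range c \<subseteq> K" "K \<subseteq> closure (range c)" "\<And>x. x \<in> K \<Longrightarrow> norm x \<le> R"
    using support_sequence[OF K h] by metis
  interpret G: gaussian_sup M X c h R by (rule c(1))
  obtain r Z where Z: "strict_mono r" "square_integrable M Z" "l2_lim M (\<lambda>k. approx_sup c (r k)) h"
    "l2_lim M (\<lambda>k. approx_argmax c (r k)) Z" "soft_limit h Z"
    using G.malliavin_derivative_exists by metis
  have "convex_body K" using K by (simp add: GB_convex_body_def)
  from that[OF Z(5) fin_dim_intrinsic_volume_2[OF c(1) this c(2-4) fd Z]] show thesis .
qed

lemma expectation_mono_square_integrable: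
  fixes f g :: "'w \<Rightarrow> real"
  assumes "square_integrable M f" "square_integrable M g" "AE \<omega> in M. f \<omega> \<le> g \<omega>"
  shows "expectation f \<le> expectation g"
  using assms by (intro integral_mono_AE square_integrable_integrable)

text \<open>A finite-dimensional body inside \<open>K\<close> has a smaller support variable, so
  monotonicity of the form bounds its \<open>V_2\<close> from above. Conversely, hulls of finitely
  many points of the dense sequence already dominate the soft approximations up to a null sequence,
  and the form of these converges to that of \<open>h\<close>.\<close>

lemma intrinsic_volume_2:
  assumes K: "GB_convex_body M X K" and h: "is_support_rv M X K h"
  obtains Z where "soft_limit h Z" "intrinsic_volume 2 K = ereal (pi * malliavin_form h Z h Z)"
proof (cases "finite_dimensional K")
  case True
  obtain Z where "soft_limit h Z" "fin_dim_intrinsic_volume 2 K = pi * malliavin_form h Z h Z"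
    by (rule intrinsic_volume_2_finite_dimensional[OF K h True])
  then show ?thesis using that True by (simp add: intrinsic_volume_def)
next
  case False
  obtain c R where c: "gaussian_sup M X c h R" "range c \<subseteq> K" "K \<subseteq> closure (range c)" "\<And>x. x \<in> K \<Longrightarrow> norm x \<le> R"
    using support_sequence[OF K h] by metis
  interpret G: gaussian_sup M X c h R by (rule c(1))
  obtain r Z where Z: "strict_mono r" "square_integrable M Z" "l2_lim M (\<lambda>k. approx_sup c (r k)) h"
    "l2_lim M (\<lambda>k. approx_argmax c (r k)) Z" "soft_limit h Z"
    using G.malliavin_derivative_exists by metis
  note sh = G.square_integrable_h
  let ?\<C> = "{C. convex_body C \<and> finite_dimensional C \<and> C \<subseteq> K}"
  have upper: "fin_dim_intrinsic_volume 2 C \<le> pi * malliavin_form h Z h Z" if "C \<in> ?\<C>" for C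
  proof -
    have C: "convex_body C" "finite_dimensional C" "C \<subseteq> K" using that by auto
    note GB = GB_convex_body_subset[OF K C(1,3)]
    obtain g where g: "is_support_rv M X C g" by (rule support_rv_exists[OF GB])
    obtain W where W: "soft_limit g W" "fin_dim_intrinsic_volume 2 C = pi * malliavin_form g W g W"
      by (rule intrinsic_volume_2_finite_dimensional[OF GB g C(2)])
    have "AE \<omega> in M. g \<omega> \<le> h \<omega>" by (rule support_rv_le[OF K h g]) (use C in \<open>auto simp: convex_body_def\<close>)
    from malliavin_form_mono_both[OF W(1) Z(5) this] show ?thesis unfolding W(2) by simp
  qed
  let ?\<phi> = "approx_sup c" and ?D = "approx_argmax c"
  \<comment> \<open>The form of the n-th soft approximation minus the price of the additive error
    \<open>1 / (n + 1)\<close>, paid once in each argument.\<close>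
  let ?low = "\<lambda>n. pi * (malliavin_form (?\<phi> n) (?D n) (?\<phi> n) (?D n) - 1 / real (Suc n) * expectation (?\<phi> n) - 1 / real (Suc n) * expectation h)"
  have lower: "ereal (?low n) \<le> (SUP C\<in>?\<C>. ereal (fin_dim_intrinsic_volume 2 C))" for n
  proof -
    define C where "C = convex hull (c ` {..n})"
    have "c ` {..n} \<subseteq> K" using c(2) by auto
    then have CK: "C \<subseteq> K" unfolding C_def using K by (intro hull_minimal) (auto simp: GB_convex_body_def convex_body_def)
    have cb: "convex_body C" unfolding C_def by (auto simp: convex_body_def finite_imp_compact_convex_hull)
    have fd: "finite_dimensional C"
      unfolding finite_dimensional_def C_def by (intro exI[of _ "c ` {..n}"] conjI convex_hull_subset_span) simp
    note GB = GB_convex_body_subset[OF K cb CK]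
    obtain g where g: "is_support_rv M X C g" by (rule support_rv_exists[OF GB])
    obtain W where W: "soft_limit g W" "fin_dim_intrinsic_volume 2 C = pi * malliavin_form g W g W"
      by (rule intrinsic_volume_2_finite_dimensional[OF GB g fd])
    note sg = malliavin_graphD(3)[OF soft_limit_malliavin_graph[OF W(1)]]
    have "AE \<omega> in M. \<forall>i\<in>{..n}. X (c i) \<omega> \<le> g \<omega>"
      unfolding AE_finite_all[OF finite_atMost] by (intro ballI X_le_support_rv[OF GB g]) (simp add: C_def hull_inc)
    then have "AE \<omega> in M. ?\<phi> n \<omega> \<le> g \<omega> + 1 / real (Suc n)" by eventually_elim (intro approx_sup_le, simp)
    from malliavin_form_mono_add_const[OF approx_props(5) W(1) this]
    have 1: "malliavin_form (?\<phi> n) (?D n) (?\<phi> n) (?D n) \<le> malliavin_form g W g W + 1 / real (Suc n) * expectation (?\<phi> n) + 1 / real (Suc n) * expectation g" .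
    have "expectation g \<le> expectation h"
      by (rule expectation_mono_square_integrable[OF sg sh support_rv_le[OF K h g]]) (use CK cb in \<open>auto simp: convex_body_def\<close>)
    then have "1 / real (Suc n) * expectation g \<le> 1 / real (Suc n) * expectation h" by (intro mult_left_mono) auto
    with 1 have "?low n \<le> pi * malliavin_form g W g W" by (intro mult_left_mono) auto
    then have "ereal (?low n) \<le> ereal (fin_dim_intrinsic_volume 2 C)" unfolding W(2) by simp
    also have "\<dots> \<le> (SUP C\<in>?\<C>. ereal (fin_dim_intrinsic_volume 2 C))" by (rule SUP_upper) (use cb fd CK in simp)
    finally show ?thesis .
  qed
  have "(\<lambda>k. ?low (r k)) \<longlonglongrightarrow> pi * (malliavin_form h Z h Z - 0 * expectation h - 0 * expectation h)"
  proof -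
    have "(\<lambda>k. expectation (\<lambda>\<omega>. ?\<phi> (r k) \<omega> \<bullet> 1)) \<longlonglongrightarrow> expectation (\<lambda>\<omega>. h \<omega> \<bullet> 1)"
      by (rule l2_lim_inner[OF approx_props(3) sh Z(3) square_integrable_one square_integrable_one l2_lim_const])
    then have 1: "(\<lambda>k. expectation (?\<phi> (r k))) \<longlonglongrightarrow> expectation h" by simp
    have 2: "(\<lambda>k. malliavin_form (?\<phi> (r k)) (?D (r k)) (?\<phi> (r k)) (?D (r k))) \<longlonglongrightarrow> malliavin_form h Z h Z"
      using tendsto_diff[OF l2_lim_inner[OF approx_props(3) sh Z(3) approx_props(3) sh Z(3)] l2_lim_inner[OF approx_props(4) Z(2,4) approx_props(4) Z(2,4)]]
      unfolding malliavin_form_def by simp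
    have 3: "(\<lambda>k. 1 / real (Suc (r k))) \<longlonglongrightarrow> 0"
      using LIMSEQ_subseq_LIMSEQ[OF LIMSEQ_inverse_real_of_nat Z(1)] by (simp add: o_def inverse_eq_divide)
    show ?thesis by (intro tendsto_intros 1 2 3)
  qed
  then have "(\<lambda>k. ereal (?low (r k))) \<longlonglongrightarrow> ereal (pi * malliavin_form h Z h Z)" by simp
  then have "ereal (pi * malliavin_form h Z h Z) \<le> (SUP C\<in>?\<C>. ereal (fin_dim_intrinsic_volume 2 C))"
    by (rule LIMSEQ_le_const2) (use lower in blast)
  moreover have "(SUP C\<in>?\<C>. ereal (fin_dim_intrinsic_volume 2 C)) \<le> ereal (pi * malliavin_form h Z h Z)"
    by (rule SUP_least) (use upper in simp)
  ultimately have "intrinsic_volume 2 K = ereal (pi * malliavin_form h Z h Z)"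
    unfolding intrinsic_volume_def using False by simp
  from that[OF Z(5) this] show ?thesis .
qed

text \<open>The sum of the two dense sets is dense in \<open>K + K'\<close> and countable, so
  additivity of \<open>X\<close> holds on it outside a single null set, and the supremum of sums
  splits. The bound by \<open>h + h'\<close> gives the GB property.\<close>

lemma
  assumes K: "GB_convex_body M X K" and h: "is_support_rv M X K h"
    and K': "GB_convex_body M X K'" and h': "is_support_rv M X K' h'"
  shows GB_convex_body_plus: "GB_convex_body M X (K + K')"
    and is_support_rv_plus: "is_support_rv M X (K + K') (\<lambda>\<omega>. h \<omega> + h' \<omega>)"
proof -
  have cb: "K \<noteq> {}" "compact K" "convex K" "K' \<noteq> {}" "compact K'" "convex K'"
    using K K' by (auto simp: GB_convex_body_def convex_body_def)
  have "K + K' = {x + y |x y. x \<in> K \<and> y \<in> K'}" by (auto simp: set_plus_def)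
  then have cbp: "convex_body (K + K')"
    using compact_sums[OF cb(2,5)] convex_set_plus[OF cb(3,6)] cb(1,4) by (auto simp: convex_body_def set_plus_def)
  have X_add: "AE \<omega> in M. X (a + b) \<omega> = X a \<omega> + X b \<omega>" for a b using X_linear[of 1 a 1 b] by simp
  have le: "AE \<omega> in M. X v \<omega> \<le> h \<omega> + h' \<omega>" if v: "v \<in> K + K'" for v
  proof -
    obtain a b where ab: "v = a + b" "a \<in> K" "b \<in> K'" using v by (rule set_plus_elim)
    show ?thesis unfolding ab(1)
      using X_add[of a b] X_le_support_rv[OF K h ab(2)] X_le_support_rv[OF K' h' ab(3)] by eventually_elim simp
  qed
  have le_all: "AE \<omega> in M. \<forall>v\<in>C. X v \<omega> \<le> h \<omega> + h' \<omega>" if "countable C" "C \<subseteq> K + K'" for C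
    unfolding AE_ball_countable[OF that(1)] using le that(2) by blast
  show "GB_convex_body M X (K + K')"
    unfolding GB_convex_body_def
  proof (intro conjI cbp allI impI)
    fix C assume "C \<subseteq> K + K'" "countable C"
    from le_all[OF this(2,1)] show "AE \<omega> in M. bdd_above ((\<lambda>v. X v \<omega>) ` C)"
      by eventually_elim (rule bdd_aboveI2, blast)
  qed
  obtain C where [measurable]: "h \<in> borel_measurable M" and C: "countable C" "C \<subseteq> K" "K \<subseteq> closure C"
    and sup: "AE \<omega> in M. h \<omega> = (SUP v\<in>C. X v \<omega>)"
    using h unfolding is_support_rv_def by blast
  obtain C' where [measurable]: "h' \<in> borel_measurable M" and C': "countable C'" "C' \<subseteq> K'" "K' \<subseteq> closure C'"
    and sup': "AE \<omega> in M. h' \<omega> = (SUP v\<in>C'. X v \<omega>)"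
    using h' unfolding is_support_rv_def by blast
  have ne: "C \<noteq> {}" "C' \<noteq> {}" using cb C(3) C'(3) by auto
  have cP: "countable (C + C')"
    unfolding set_plus_image using C(1) C'(1) by (intro countable_image countable_SIGMA)
  have sP: "C + C' \<subseteq> K + K'" by (rule set_plus_mono2[OF C(2) C'(2)])
  have "K + K' \<subseteq> closure C + closure C'" by (rule set_plus_mono2[OF C(3) C'(3)])
  also have "\<dots> \<subseteq> closure (C + C')" by (rule closure_sum)
  finally have dP: "K + K' \<subseteq> closure (C + C')" .
  have "AE \<omega> in M. \<forall>a\<in>C. \<forall>b\<in>C'. X (a + b) \<omega> = X a \<omega> + X b \<omega>"
    unfolding AE_ball_countable[OF C(1)] AE_ball_countable[OF C'(1)] using X_add by blast
  with sup sup' le_all[OF cP sP] have "AE \<omega> in M. h \<omega> + h' \<omega> = (SUP v\<in>C + C'. X v \<omega>)"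
  proof eventually_elim
    case (elim \<omega>)
    let ?S = "SUP v\<in>C + C'. X v \<omega>"
    have bdd: "bdd_above ((\<lambda>v. X v \<omega>) ` (C + C'))" using elim(3) by (intro bdd_aboveI2) blast
    have "X a \<omega> + X b \<omega> \<le> ?S" if "a \<in> C" "b \<in> C'" for a b
      using cSUP_upper[OF _ bdd, of "a + b"] that elim(4) by (auto simp: set_plus_intro)
    then have "X a \<omega> \<le> ?S - X b \<omega>" if "a \<in> C" "b \<in> C'" for a b using that by (simp add: le_diff_eq)
    then have "h \<omega> \<le> ?S - X b \<omega>" if "b \<in> C'" for b unfolding elim(1) using that ne by (intro cSUP_least)
    then have "X b \<omega> \<le> ?S - h \<omega>" if "b \<in> C'" for b using that by (simp add: le_diff_eq add.commute)
    then have "h' \<omega> \<le> ?S - h \<omega>" unfolding elim(2) using ne by (intro cSUP_least)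
    moreover have "?S \<le> h \<omega> + h' \<omega>"
      using ne elim(3) by (intro cSUP_least) (auto simp: set_plus_def)
    ultimately show ?case by simp
  qed
  then show "is_support_rv M X (K + K') (\<lambda>\<omega>. h \<omega> + h' \<omega>)"
    unfolding is_support_rv_def using cP sP dP by (intro conjI exI[of _ "C + C'"]) auto
qed

lemma malliavin_form_add:
  assumes \<phi>: "square_integrable M \<phi>" "square_integrable M Z" and \<psi>: "square_integrable M \<psi>" "square_integrable M W"
  shows "malliavin_form (\<lambda>\<omega>. \<phi> \<omega> + \<psi> \<omega>) (\<lambda>\<omega>. Z \<omega> + W \<omega>) (\<lambda>\<omega>. \<phi> \<omega> + \<psi> \<omega>) (\<lambda>\<omega>. Z \<omega> + W \<omega>) =
    malliavin_form \<phi> Z \<phi> Z + 2 * malliavin_form \<phi> Z \<psi> W + malliavin_form \<psi> W \<psi> W"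
proof -
  note i = integrable_inner_square_integrable[OF \<phi>(1) \<phi>(1)] integrable_inner_square_integrable[OF \<phi>(1) \<psi>(1)]
    integrable_inner_square_integrable[OF \<psi>(1) \<psi>(1)]
  note j = integrable_inner_square_integrable[OF \<phi>(2) \<phi>(2)] integrable_inner_square_integrable[OF \<phi>(2) \<psi>(2)]
    integrable_inner_square_integrable[OF \<psi>(2) \<psi>(2)]
  have 1: "(\<phi> \<omega> + \<psi> \<omega>) * (\<phi> \<omega> + \<psi> \<omega>) = \<phi> \<omega> \<bullet> \<phi> \<omega> + 2 * (\<phi> \<omega> \<bullet> \<psi> \<omega>) + \<psi> \<omega> \<bullet> \<psi> \<omega>" for \<omega> by (simp add: algebra_simps)
  have 2: "(Z \<omega> + W \<omega>) \<bullet> (Z \<omega> + W \<omega>) = Z \<omega> \<bullet> Z \<omega> + 2 * (Z \<omega> \<bullet> W \<omega>) + W \<omega> \<bullet> W \<omega>" for \<omega>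
    by (simp add: algebra_simps inner_commute)
  show ?thesis unfolding malliavin_form_def 1 2 using i j by simp
qed

lemma malliavin_form_cong_AE:
  assumes "Z \<in> borel_measurable M" "Z' \<in> borel_measurable M" "W \<in> borel_measurable M" "W' \<in> borel_measurable M"
    and "AE \<omega> in M. Z \<omega> = Z' \<omega>" "AE \<omega> in M. W \<omega> = W' \<omega>"
  shows "malliavin_form \<phi> Z \<psi> W = malliavin_form \<phi> Z' \<psi> W'"
proof -
  note [measurable] = assms(1-4)
  have "AE \<omega> in M. Z \<omega> \<bullet> W \<omega> = Z' \<omega> \<bullet> W' \<omega>" using assms(5,6) by eventually_elim simp
  then have "expectation (\<lambda>\<omega>. Z \<omega> \<bullet> W \<omega>) = expectation (\<lambda>\<omega>. Z' \<omega> \<bullet> W' \<omega>)" by (intro integral_cong_AE) auto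
  then show ?thesis by (simp add: malliavin_form_def)
qed

lemma malliavin_form_malliavin_deriv:
  assumes "soft_limit \<phi> Z" "soft_limit \<psi> W"
  shows "malliavin_form \<phi> Z \<psi> W = (LINT \<omega>|M. \<phi> \<omega> * \<psi> \<omega> - malliavin_deriv M X \<phi> \<omega> \<bullet> malliavin_deriv M X \<psi> \<omega>)"
proof -
  note g = assms[THEN soft_limit_malliavin_graph]
  note s = g[THEN malliavin_graphD(4)] and s' = g[THEN malliavin_deriv_eq(2), THEN malliavin_graphD(4)]
    and q = g[THEN malliavin_graphD(3)]
  have "malliavin_form \<phi> Z \<psi> W = malliavin_form \<phi> (malliavin_deriv M X \<phi>) \<psi> (malliavin_deriv M X \<psi>)"
    by (rule malliavin_form_cong_AE[OF s(1)[THEN square_integrableD(1)] s'(1)[THEN square_integrableD(1)]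
        s(2)[THEN square_integrableD(1)] s'(2)[THEN square_integrableD(1)]])
      (use g[THEN malliavin_deriv_eq(1)] in \<open>auto elim: eventually_mono\<close>)
  then show ?thesis
    unfolding malliavin_form_def
    using integrable_inner_square_integrable[OF q] integrable_inner_square_integrable[OF s'] by simp
qed

text \<open>\<open>intrinsic_volume_2\<close> delivers some derivative \<open>Y\<close> for the sum
  of the support variables; uniqueness identifies it with \<open>Z + Z'\<close>, after which
  bilinearity isolates the mixed term. All three volumes are finite, so the \<open>ereal\<close>
  subtraction is the real one.\<close>

lemma mixed_V2_malliavin_form:
  assumes K: "GB_convex_body M X K" and h: "is_support_rv M X K h" and Z: "soft_limit h Z" "intrinsic_volume 2 K = ereal (pi * malliavin_form h Z h Z)"
    and K': "GB_convex_body M X K'" and h': "is_support_rv M X K' h'" and Z': "soft_limit h' Z'" "intrinsic_volume 2 K' = ereal (pi * malliavin_form h' Z' h' Z')"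
  shows "mixed_V2 K K' = ereal (pi * malliavin_form h Z h' Z')"
proof -
  obtain Y where Y: "soft_limit (\<lambda>\<omega>. h \<omega> + h' \<omega>) Y"
    "intrinsic_volume 2 (K + K') = ereal (pi * malliavin_form (\<lambda>\<omega>. h \<omega> + h' \<omega>) Y (\<lambda>\<omega>. h \<omega> + h' \<omega>) Y)"
    by (rule intrinsic_volume_2[OF GB_convex_body_plus[OF K h K' h'] is_support_rv_plus[OF K h K' h']])
  note gZ = malliavin_graphD[OF soft_limit_malliavin_graph[OF Z(1)]]
    and gZ' = malliavin_graphD[OF soft_limit_malliavin_graph[OF Z'(1)]]
    and gY = malliavin_graphD[OF soft_limit_malliavin_graph[OF Y(1)]]
  have "AE \<omega> in M. Y \<omega> = Z \<omega> + Z' \<omega>"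
    by (rule ibp_pair_unique[OF gY(1,2) ibp_pair_add[OF gZ(1) gZ'(1)] path_generated_add[OF gZ(2) gZ'(2) gZ(4) gZ'(4)]])
  moreover have m: "Y \<in> borel_measurable M" "(\<lambda>\<omega>. Z \<omega> + Z' \<omega>) \<in> borel_measurable M"
    using square_integrableD(1)[OF gY(4)] square_integrableD(1)[OF square_integrable_add[OF gZ(4) gZ'(4)]] by auto
  ultimately have "malliavin_form (\<lambda>\<omega>. h \<omega> + h' \<omega>) Y (\<lambda>\<omega>. h \<omega> + h' \<omega>) Y =
    malliavin_form h Z h Z + 2 * malliavin_form h Z h' Z' + malliavin_form h' Z' h' Z'"
    unfolding malliavin_form_add[OF gZ(3,4) gZ'(3,4), symmetric] by (intro malliavin_form_cong_AE)
  then show ?thesis unfolding mixed_V2_def Y(2) Z(2) Z'(2) by (simp add: field_simps)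
qed

end

theorem theorem1p2:
  fixes M :: "'w measure"
    and X :: "'a::{real_inner, complete_space, second_countable_topology} \<Rightarrow> 'w \<Rightarrow> real"
    and K K' :: "'a set"
    and h h' :: "'w \<Rightarrow> real"
  assumes "\<not> finite_dimensional (UNIV :: 'a set)"
    and "isonormal_process M X"
    and "GB_convex_body M X K"
    and "GB_convex_body M X K'"
    and "is_support_rv M X K h"
    and "is_support_rv M X K' h'"
  shows "intrinsic_volume 2 K =
           ereal (pi * (LINT \<omega>|M. \<bar>h \<omega>\<bar>\<^sup>2 - (norm (malliavin_deriv M X h \<omega>))\<^sup>2)) \<and>
         mixed_V2 K K' =
           ereal (pi * (LINT \<omega>|M. h \<omega> * h' \<omega> -
             malliavin_deriv M X h \<omega> \<bullet> malliavin_deriv M X h' \<omega>))"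
proof -
  interpret isonormal M X by (rule isonormal.intro) fact
  obtain Z where Z: "soft_limit h Z" "intrinsic_volume 2 K = ereal (pi * malliavin_form h Z h Z)"
    by (rule intrinsic_volume_2[OF assms(3,5)])
  obtain Z' where Z': "soft_limit h' Z'" "intrinsic_volume 2 K' = ereal (pi * malliavin_form h' Z' h' Z')"
    by (rule intrinsic_volume_2[OF assms(4,6)])
  have "malliavin_form h Z h Z = (LINT \<omega>|M. \<bar>h \<omega>\<bar>\<^sup>2 - (norm (malliavin_deriv M X h \<omega>))\<^sup>2)"
    unfolding malliavin_form_malliavin_deriv[OF Z(1) Z(1)] power2_norm_eq_inner by (simp add: power2_eq_square)
  with Z(2) mixed_V2_malliavin_form[OF assms(3,5) Z assms(4,6) Z'] malliavin_form_malliavin_deriv[OF Z(1) Z'(1)]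
  show ?thesis by simp
qed

end
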